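(* Let $f,g$ satisfy $(H_1)$, $(H_2)$, $(H_3)$, let $K$ be a kernel as in the context, and suppose that, for some $L>0$, $|g(s_1)-g(s_2)|\le L|s_1-s_2|$ for all $s_1,s_2\ge 0$; let $\chi_L$ be defined with this $L$. Let $\phi$ be a semi-wavefront solution with speed $c'$ of $$y''(t)-cy'(t)-f(y(t))+\int_0^\infty\int_{\mathbb{R}}K(s,w)g(y(t-cs-w))\,dw\,ds=0,\quad t\in\mathbb{R}, \tag{E}$$ (i.e. with $c=c'$). If there exists $m\in(0,\gamma_K(c'))$ such that $\chi_L(m,c')\le0$, then $\phi$ is the unique (modulo translation) semi-wavefront solution of (E) with speed $c'$. Moreover, the uniqueness (modulo translation) also holds for each semi-wavefront solution of (E) with speed $c>c'$.
   Context: Kernel: $K\in L^1(\mathbb{R}_+\times\mathbb{R})$, $K\ge0$, $\int_0^\infty\int_{\mathbb{R}}K(s,w)\,dw\,ds=1$ ($K$ may be asymmetric in $w$). Hypotheses: $(H_1)$ $g\in C(\mathbb{R}_+,\mathbb{R}_+)$, $g(0)=0$, $g(s)>0$ for all $s>0$, $g$ is differentiable at $0$ with $g'(0)>0$. $(H_2)$ $f\in C^1(\mathbb{R}_+,\mathbb{R}_+)$, $f(0)=0$, $f$ is strictly increasing, and $f'(0)<g'(0)$. $(H_3)$ $f,g\in C^{1,\alpha}$ in some neighborhood of $0$ (in $\mathbb{R}_+$), for some $\alpha\in(0,1)$. A semi-wavefront solution of (E) with speed $c$ is a positive, bounded, non-constant solution $\phi:\mathbb{R}\to(0,\infty)$ of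 (E) with $\phi(-\infty)=0$. Uniqueness modulo translation means that any two such solutions with the same $c$ satisfy $\phi_1(t)=\phi_2(t+t_0)$ for all $t$, for some $t_0\in\mathbb{R}$. $$\chi_L(z,c)=z^2-cz-\inf_{s\ge0}f'(s)+L\int_0^\infty\int_{\mathbb{R}}K(s,w)e^{-z(cs+w)}\,dw\,ds,\qquad L\ge g'(0).$$ The number $\gamma_K(c)$: fix $\beta>f'(0)$, let $\nu(c)<0<\mu(c)$ be the roots of $z^2-cz-\beta=0$, $\sigma(c)=\sqrt{c^2+4\beta}$, $k_1(s)=\sigma(c)^{-1}e^{\nu(c)s}$ for $s\ge0$ and $k_1(s)=\sigma(c)^{-1}e^{\mu(c)s}$ for $s<0$, and $k_2(r)=\int_0^\infty K(s,r-cs)\,ds$. Then $\gamma_K(c)\in(0,+\infty]$ is the maximal number such that the bilateral Laplace transform $$g'(0)\int_{\mathbb{R}}(k_1*k_2)(s)e^{-sz}\,ds+(\beta-f'(0))\int_{\mathbb{R}}k_1(s)e^{-sz}\,ds$$ converges if $\Re z\in[0,\gamma_K(c))$ and diverges if $\Re z>\gamma_K(c)$. Such a positive number exists whenever a semi-wavefront with speed $c$ exists. *)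

theory Defs
  imports "HOL-Analysis.Analysis"
begin

text \<open>The kernel and the nonlinearities live on the half-line \<open>[0,\<infinity>)\<close>; they are encoded as total
  functions whose values at negative arguments are never used.  A kernel in \<open>L\<^sup>1\<close> is given by a
  Borel representative that is nonnegative everywhere.\<close>

definition is_kernel :: "(real \<Rightarrow> real \<Rightarrow> real) \<Rightarrow> bool" where
  "is_kernel K \<longleftrightarrow>
     set_integrable lborel ({0..} \<times> UNIV) (\<lambda>(s, w). K s w) \<and>
     (\<forall>s\<ge>0. \<forall>w. K s w \<ge> 0) \<and>
     (LINT s:{0..}|lborel. (LINT w|lborel. K s w)) = 1"

text \<open>Derivative of a function on \<open>[0,\<infinity>)\<close>: two-sided at \<open>s > 0\<close>, one-sided at \<open>s = 0\<close>.\<close>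

definition hderiv :: "(real \<Rightarrow> real) \<Rightarrow> real \<Rightarrow> real" where
  "hderiv h s = vector_derivative h (at s within {0..})"

definition H1 :: "(real \<Rightarrow> real) \<Rightarrow> bool" where
  "H1 g \<longleftrightarrow>
     continuous_on {0..} g \<and> (\<forall>s\<ge>0. g s \<ge> 0) \<and> g 0 = 0 \<and> (\<forall>s>0. g s > 0) \<and>
     g differentiable (at 0 within {0..}) \<and> hderiv g 0 > 0"

definition H2 :: "(real \<Rightarrow> real) \<Rightarrow> (real \<Rightarrow> real) \<Rightarrow> bool" where
  "H2 f g \<longleftrightarrow>
     (\<forall>s\<ge>0. f differentiable (at s within {0..})) \<and> continuous_on {0..} (hderiv f) \<and>
     (\<forall>s\<ge>0. f s \<ge> 0) \<and> f 0 = 0 \<and> strict_mono_on {0..} f \<and> hderiv f 0 < hderiv g 0"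

definition C1_Hoelder_near_0 :: "real \<Rightarrow> (real \<Rightarrow> real) \<Rightarrow> bool" where
  "C1_Hoelder_near_0 \<alpha> h \<longleftrightarrow>
     (\<exists>\<delta>>0. (\<forall>s\<in>{0..<\<delta>}. h differentiable (at s within {0..})) \<and>
        (\<exists>C. \<forall>s\<in>{0..<\<delta>}. \<forall>t\<in>{0..<\<delta>}. \<bar>hderiv h s - hderiv h t\<bar> \<le> C * \<bar>s - t\<bar> powr \<alpha>))"

definition H3 :: "(real \<Rightarrow> real) \<Rightarrow> (real \<Rightarrow> real) \<Rightarrow> bool" where
  "H3 f g \<longleftrightarrow> (\<exists>\<alpha>. 0 < \<alpha> \<and> \<alpha> < 1 \<and> C1_Hoelder_near_0 \<alpha> f \<and> C1_Hoelder_near_0 \<alpha> g)"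

definition solves_E ::
  "(real \<Rightarrow> real) \<Rightarrow> (real \<Rightarrow> real) \<Rightarrow> (real \<Rightarrow> real \<Rightarrow> real) \<Rightarrow> real \<Rightarrow> (real \<Rightarrow> real) \<Rightarrow> bool" where
  "solves_E f g K c y \<longleftrightarrow>
     (\<forall>t. y differentiable (at t)) \<and> (\<forall>t. deriv y differentiable (at t)) \<and>
     (\<forall>t. deriv (deriv y) t - c * deriv y t - f (y t)
        + (LINT s:{0..}|lborel. (LINT w|lborel. K s w * g (y (t - c * s - w)))) = 0)"

definition semi_wavefront ::
  "(real \<Rightarrow> real) \<Rightarrow> (real \<Rightarrow> real) \<Rightarrow> (real \<Rightarrow> real \<Rightarrow> real) \<Rightarrow> real \<Rightarrow> (real \<Rightarrow> real) \<Rightarrow> bool" where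
  "semi_wavefront f g K c \<phi> \<longleftrightarrow>
     solves_E f g K c \<phi> \<and> (\<forall>t. \<phi> t > 0) \<and> bounded (range \<phi>) \<and> \<not> \<phi> constant_on UNIV \<and>
     (\<phi> \<longlongrightarrow> 0) at_bot"

definition unique_mod_translation ::
  "(real \<Rightarrow> real) \<Rightarrow> (real \<Rightarrow> real) \<Rightarrow> (real \<Rightarrow> real \<Rightarrow> real) \<Rightarrow> real \<Rightarrow> bool" where
  "unique_mod_translation f g K c \<longleftrightarrow>
     (\<forall>\<phi>1 \<phi>2. semi_wavefront f g K c \<phi>1 \<longrightarrow> semi_wavefront f g K c \<phi>2 \<longrightarrow>
        (\<exists>t0. \<forall>t. \<phi>1 t = \<phi>2 (t + t0)))"

text \<open>The integral has a nonnegative integrand and may diverge, so \<open>\<chi>\<^sub>L\<close> takes the value \<open>\<infinity>\<close>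
  there (for \<open>L > 0\<close>) instead of the default value of a divergent Bochner integral.\<close>

definition chi ::
  "(real \<Rightarrow> real) \<Rightarrow> (real \<Rightarrow> real \<Rightarrow> real) \<Rightarrow> real \<Rightarrow> real \<Rightarrow> real \<Rightarrow> ereal" where
  "chi f K L z c =
     ereal (z\<^sup>2 - c * z - (INF s\<in>{0..}. hderiv f s))
     + ereal L * enn2ereal
         (\<integral>\<^sup>+s\<in>{0..}. (\<integral>\<^sup>+w. ennreal (K s w * exp (- z * (c * s + w))) \<partial>lborel) \<partial>lborel)"

definition sigma :: "real \<Rightarrow> real \<Rightarrow> real" where
  "sigma \<beta> c = sqrt (c\<^sup>2 + 4 * \<beta>)"

definition nu :: "real \<Rightarrow> real \<Rightarrow> real" where
  "nu \<beta> c = (c - sigma \<beta> c) / 2"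

definition mu :: "real \<Rightarrow> real \<Rightarrow> real" where
  "mu \<beta> c = (c + sigma \<beta> c) / 2"

lemma nu_mu_roots:
  assumes "\<beta> > 0"
  shows "nu \<beta> c < 0" and "0 < mu \<beta> c"
    and "z\<^sup>2 - c * z - \<beta> = 0 \<longleftrightarrow> z = nu \<beta> c \<or> z = mu \<beta> c"
proof -
  have sq: "(sigma \<beta> c)\<^sup>2 = c\<^sup>2 + 4 * \<beta>"
    using assms by (simp add: sigma_def)
  have "\<bar>c\<bar> < sigma \<beta> c"
    unfolding sigma_def by (rule real_less_rsqrt) (use assms in simp)
  then show "nu \<beta> c < 0" and "0 < mu \<beta> c"
    by (auto simp: nu_def mu_def)
  have "z\<^sup>2 - c * z - \<beta> = (z - nu \<beta> c) * (z - mu \<beta> c)"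
    using sq by (simp add: nu_def mu_def field_simps power2_eq_square)
  then show "z\<^sup>2 - c * z - \<beta> = 0 \<longleftrightarrow> z = nu \<beta> c \<or> z = mu \<beta> c"
    by simp
qed

definition k1 :: "real \<Rightarrow> real \<Rightarrow> real \<Rightarrow> real" where
  "k1 \<beta> c s = (if s \<ge> 0 then exp (nu \<beta> c * s) else exp (mu \<beta> c * s)) / sigma \<beta> c"

definition k2 :: "(real \<Rightarrow> real \<Rightarrow> real) \<Rightarrow> real \<Rightarrow> real \<Rightarrow> real" where
  "k2 K c r = (LINT s:{0..}|lborel. K s (r - c * s))"

definition conv :: "(real \<Rightarrow> real) \<Rightarrow> (real \<Rightarrow> real) \<Rightarrow> real \<Rightarrow> real" where
  "conv u v x = (LINT r|lborel. u (x - r) * v r)"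

definition laplace_converges :: "(real \<Rightarrow> real) \<Rightarrow> complex \<Rightarrow> bool" where
  "laplace_converges u z \<longleftrightarrow>
     integrable lborel (\<lambda>s. complex_of_real (u s) * exp (- (complex_of_real s * z)))"

text \<open>The weights \<open>g'(0)\<close> and \<open>\<beta> - f'(0)\<close> are positive and both transformed functions are
  nonnegative, so the weighted sum of transforms converges iff the transform of the weighted sum
  of functions does.\<close>

definition is_gammaK ::
  "(real \<Rightarrow> real) \<Rightarrow> (real \<Rightarrow> real) \<Rightarrow> (real \<Rightarrow> real \<Rightarrow> real) \<Rightarrow> real \<Rightarrow> real \<Rightarrow> ereal \<Rightarrow> bool" where
  "is_gammaK f g K \<beta> c \<gamma> \<longleftrightarrow>
     (let u = (\<lambda>s. hderiv g 0 * conv (k1 \<beta> c) (k2 K c) s + (\<beta> - hderiv f 0) * k1 \<beta> c s) in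
      0 < \<gamma> \<and>
      (\<forall>z. 0 \<le> Re z \<and> ereal (Re z) < \<gamma> \<longrightarrow> laplace_converges u z) \<and>
      (\<forall>z. \<gamma> < ereal (Re z) \<longrightarrow> \<not> laplace_converges u z))"

text \<open>At most one number satisfies \<open>is_gammaK\<close> (a complex number with real part strictly between
  two of them would give both convergence and divergence), so the supremum below is that number
  whenever it exists; otherwise it is \<open>-\<infinity>\<close>.\<close>

definition gammaK ::
  "(real \<Rightarrow> real) \<Rightarrow> (real \<Rightarrow> real) \<Rightarrow> (real \<Rightarrow> real \<Rightarrow> real) \<Rightarrow> real \<Rightarrow> real \<Rightarrow> ereal" where
  "gammaK f g K \<beta> c = Sup {\<gamma>. is_gammaK f g K \<beta> c \<gamma>}"

end

theory Submission
  imports Defs "HOL-Real_Asymp.Real_Asymp" "HOL-Probability.Probability_Measure"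
begin

text \<open>Let \<open>M\<close> be the law of \<open>c s + w\<close> under \<open>K\<close>; the equation becomes
  \<open>y'' - c y' - f(y) + \<integral> g(y(t - r)) dM(r) = 0\<close>. The condition at \<open>m\<close> persists when \<open>c\<close> grows, so every
  speed \<open>c \<ge> c'\<close> is treated alike. Let \<open>\<lambda> \<le> m\<close> be the first positive zero of the characteristic
  function \<open>\<chi>\<close> of the linearization at \<open>0\<close>. Solutions decay at \<open>-\<infinity>\<close> like \<open>e\<^bsup>\<rho>t\<^esup>\<close> for every
  \<open>\<rho> < \<lambda>\<close>, so with \<open>h\<close> the nonlinear remainder the charge \<open>I(\<phi>) = \<integral> e\<^bsup>-\<lambda>t\<^esup> h(t) dt\<close>
  converges. It is nonnegative, since \<open>\<integral> e\<^bsup>-\<rho>t\<^esup> h = \<chi>(\<rho>) \<integral> e\<^bsup>-\<rho>t\<^esup> \<phi> \<ge> 0\<close> for \<open>\<rho> < \<lambda>\<close>, and it is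
  multiplied by an exponential under translation. If \<open>I(\<phi>) = 0\<close>, the argument below, comparing with
  the solution \<open>0\<close>, shows \<open>\<phi> = 0\<close>; otherwise a translation matches the charges of two solutions.

  Let \<open>v\<close> be the difference of two solutions of equal charge and \<open>w = e\<^bsup>-\<lambda>t\<^esup> v\<close>. Integrating the
  equation of \<open>w\<close> once costs no boundary term precisely because the charges agree, and
  energy estimates with the weight \<open>1 / cosh(\<epsilon>t)\<close>, \<open>\<epsilon> \<rightarrow> 0\<close>, show that \<open>w\<close> vanishes at \<open>-\<infinity>\<close>. If
  \<open>\<chi> < 0\<close> somewhere in \<open>(\<lambda>, m]\<close>, a barrier then improves the decay of \<open>v\<close> past an exponent where
  \<open>\<chi>\<^sub>L \<le> 0\<close>, and there the energy estimate for \<open>\<bar>v\<bar>\<close>, with the Lipschitz constant in place of \<open>g'(0)\<close>,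
  forces \<open>v = 0\<close>. Otherwise \<open>\<lambda> = m\<close> is a double zero of \<open>\<chi> = \<chi>\<^sub>L\<close>; the first-order term of the
  energy estimate disappears, and a second integration gives \<open>w' = 0\<close>.\<close>

text \<open>Where the charge comes from: the transform of a solution is that of the remainder
  divided by \<chi>, so the charge is the numerator at the first pole \<lambda>. Equal charges
  cancel the leading behaviour at minus infinity without the asymptotics of either solution being
  known, and this works alike for a simple and for a double zero. Two obstacles shape the proof. The
  law \<open>M\<close> may charge both half-lines and solutions need not be monotone, so two
  solutions need not be ordered; energy replaces comparison. To leading order it loses nothing:
  Young's inequality for the convolution followed by transposition reproduces \<chi> at the exponent
  of the weight, with errors \<epsilon> times its derivative and the square of \<epsilon>. At a
  double zero the second error alone remains, and it beats the factor \<open>1 / \<epsilon>\<close>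
  that a bounded function costs under the weight. Secondly, the linearization governs differences
  only near minus infinity, while the Lipschitz bound holds everywhere but is favourable only from
  \<lambda> on; the barrier bridges this gap. The condition on \<open>gammaK\<close> gives
  \<open>M\<close> a moment beyond \<open>m\<close>, and this room pays for powers of
  \<open>r\<close> and shifts of the weight.\<close>

section \<open>Calculus and integration on the line\<close>

lemma integrable_exp_abs:
  fixes b :: real assumes "b > 0"
  shows "integrable lborel (\<lambda>t::real. exp (- b * \<bar>t\<bar>))"
    and "(\<integral>t. exp (- b * \<bar>t\<bar>) \<partial>lborel) = 2 / b"
proof -
  have lim: "((\<lambda>x. - exp (- b * x) / b) \<longlongrightarrow> 0) at_top"
    using assms by real_asymp
  have pos: "(\<integral>\<^sup>+x. ennreal (exp (- b * x)) * indicator {0..} x \<partial>lborel) = ennreal (1 / b)"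
    by (subst nn_integral_FTC_atLeast[OF _ _ _ lim])
       (use assms in \<open>auto intro!: derivative_eq_intros\<close>)
  have neg: "(\<integral>\<^sup>+x. ennreal (exp (b * x)) * indicator {..0} x \<partial>lborel) = ennreal (1 / b)"
  proof -
    have "indicator {..0} (- x) = (indicator {0..} x :: ennreal)" for x :: real
      by (auto simp: indicator_def)
    then have "(\<integral>\<^sup>+x. ennreal (exp (b * x)) * indicator {..0} x \<partial>lborel)
        = (\<integral>\<^sup>+x. ennreal (exp (- b * x)) * indicator {0..} x \<partial>lborel)"
      by (subst nn_integral_real_affine[where c = "-1" and t = 0]) auto
    then show ?thesis using pos by (rule trans)
  qed
  have "(\<integral>\<^sup>+t. ennreal (exp (- b * \<bar>t\<bar>)) \<partial>lborel)
      = (\<integral>\<^sup>+t. ennreal (exp (- b * t)) * indicator {0..} t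
            + ennreal (exp (b * t)) * indicator {..0} t \<partial>lborel)"
    by (rule nn_integral_cong_AE, rule AE_mp[OF AE_lborel_singleton[of 0]])
       (auto simp: indicator_def)
  also have "\<dots> = ennreal (1 / b) + ennreal (1 / b)"
    by (subst nn_integral_add) (simp_all only: pos neg, auto)
  also have "\<dots> = ennreal (2 / b)"
    using assms by (subst ennreal_plus[symmetric]) auto
  finally have *: "(\<integral>\<^sup>+t. ennreal (exp (- b * \<bar>t\<bar>)) \<partial>lborel) = ennreal (2 / b)" .
  show "integrable lborel (\<lambda>t::real. exp (- b * \<bar>t\<bar>))"
    using * by (intro integrableI_nonneg) auto
  show "(\<integral>t. exp (- b * \<bar>t\<bar>) \<partial>lborel) = 2 / b"
    using * assms by (subst integral_eq_nn_integral) auto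
qed

lemma integrable_exp_bound:
  fixes u :: "real \<Rightarrow> real"
  assumes "b > 0" "u \<in> borel_measurable borel" "\<And>t. \<bar>u t\<bar> \<le> C * exp (- b * \<bar>t\<bar>)"
  shows "integrable lborel u"
  by (rule Bochner_Integration.integrable_bound[where f = "\<lambda>t. C * exp (- b * \<bar>t\<bar>)"])
     (use assms integrable_exp_abs(1)[OF assms(1)] in \<open>auto intro: order_trans[OF _ abs_ge_self]\<close>)

lemma integral_deriv_eq_0:
  fixes P p :: "real \<Rightarrow> real"
  assumes "\<And>t. (P has_real_derivative p t) (at t)" "\<And>t. isCont p t" "integrable lborel p"
    and "(P \<longlongrightarrow> 0) at_top" "(P \<longlongrightarrow> 0) at_bot"
  shows "(\<integral>t. p t \<partial>lborel) = 0"
proof -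
  have "(LBINT x=-\<infinity>..\<infinity>. p x) = 0 - 0"
    by (rule interval_integral_FTC_integrable[where F = P])
       (use assms in \<open>auto simp: set_integrable_def ereal_tendsto_simps
          has_real_derivative_iff_has_vector_derivative\<close>)
  then show ?thesis
    by (simp add: interval_lebesgue_integral_def set_lebesgue_integral_def)
qed

text \<open>The primitive of \<open>- u\<close> that vanishes at plus infinity. Integrating an
  equation in this way leaves boundary terms at plus infinity alone, where the exponential weight
  makes everything small.\<close>

definition tail_int :: "(real \<Rightarrow> real) \<Rightarrow> real \<Rightarrow> real" where
  "tail_int u t = (LINT s:{t<..}|lborel. u s)"

lemma set_integrable_exp_tail:
  fixes u :: "real \<Rightarrow> real"
  assumes "b > 0" "u \<in> borel_measurable borel" "\<And>s. s > t \<Longrightarrow> \<bar>u s\<bar> \<le> C * exp (- b * s)"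
  shows "set_integrable lborel {t<..} u" "\<bar>tail_int u t\<bar> \<le> C / b * exp (- b * t)"
proof -
  have lim: "((\<lambda>x. - exp (- b * x) / b) \<longlongrightarrow> 0) at_top"
    using assms by real_asymp
  have "(\<integral>\<^sup>+x. ennreal (exp (- b * x)) * indicator {t..} x \<partial>lborel) = ennreal (exp (- b * t) / b)"
    by (subst nn_integral_FTC_atLeast[OF _ _ _ lim])
       (use assms in \<open>auto intro!: derivative_eq_intros\<close>)
  then have 1: "(\<integral>\<^sup>+x. ennreal (indicator {t<..} x * exp (- b * x)) \<partial>lborel) = ennreal (exp (- b * t) / b)"
    by (subst (asm) nn_integral_cong_AE[where v = "\<lambda>x. ennreal (indicator {t<..} x * exp (- b * x))"])
       (rule AE_mp[OF AE_lborel_singleton[of t]], auto simp: indicator_def)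
  have 2: "integrable lborel (\<lambda>x. indicator {t<..} x * exp (- b * x))"
    using 1 by (intro integrableI_nonneg) auto
  have 3: "(\<integral>x. indicator {t<..} x * exp (- b * x) \<partial>lborel) = exp (- b * t) / b"
    using 1 assms by (subst integral_eq_nn_integral) auto
  show 4: "set_integrable lborel {t<..} u"
    unfolding set_integrable_def
    by (rule Bochner_Integration.integrable_bound[OF integrable_mult_right[OF 2, of C]])
       (use assms in \<open>auto simp: indicator_def intro: order_trans[OF _ abs_ge_self]\<close>)
  have "\<bar>tail_int u t\<bar> \<le> (\<integral>x. C * (indicator {t<..} x * exp (- b * x)) \<partial>lborel)"
    unfolding tail_int_def set_lebesgue_integral_def
    by (rule order_trans[OF integral_norm_bound[where 'a = real, unfolded real_norm_def]],
        rule integral_mono)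
       (use 4 2 assms in \<open>auto simp: set_integrable_def indicator_def\<close>)
  then show "\<bar>tail_int u t\<bar> \<le> C / b * exp (- b * t)"
    using 3 by simp
qed

lemma tail_int_deriv:
  fixes u :: "real \<Rightarrow> real"
  assumes "b > 0" and cont: "\<And>x. isCont u x" and bd: "\<And>s. \<bar>u s\<bar> \<le> C * exp (- b * s)"
  shows "(tail_int u has_real_derivative - u t) (at t)"
proof -
  have m: "u \<in> borel_measurable borel"
    using cont by (intro borel_measurable_continuous_onI) (auto simp: continuous_on_eq_continuous_at)
  have si: "set_integrable lborel {x<..} u" for x
    by (rule set_integrable_exp_tail[OF assms(1) m bd])
  \<comment> \<open>Near \<open>t\<close> the tail varies through an integral over a bounded
    interval, to which the fundamental theorem on compact intervals applies.\<close>
  have eq: "tail_int u x = tail_int u (t - 1) - integral {t - 1..x} u" if "x \<ge> t - 1" for x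
  proof -
    have "tail_int u (t - 1) = (LINT s:{t-1<..x} \<union> {x<..}|lborel. u s)"
      unfolding tail_int_def using that by (intro arg_cong2[where f = "\<lambda>A. set_lebesgue_integral lborel A"]) auto
    also have "\<dots> = (LINT s:{t-1<..x}|lborel. u s) + tail_int u x"
      unfolding tail_int_def
      by (intro set_integral_Un set_integrable_subset[OF si[of "t - 1"]]) (use that in auto)
    also have "(LINT s:{t-1<..x}|lborel. u s) = (LINT s:{t-1..x}|lborel. u s)"
    proof (rule set_integral_cong_set)
      show "AE y in lborel. (y \<in> {t-1..x}) = (y \<in> {t-1<..x})"
        using AE_lborel_singleton[of "t - 1"] by eventually_elim auto
    qed (use m in \<open>simp_all add: set_borel_measurable_def\<close>)
    also have "\<dots> = integral {t-1..x} u"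
      by (rule set_borel_integral_eq_integral, rule borel_integrable_atLeastAtMost')
         (use cont in \<open>auto intro!: continuous_at_imp_continuous_on\<close>)
    finally show ?thesis by simp
  qed
  have "((\<lambda>x. integral {t - 1..x} u) has_real_derivative u t) (at t within {t - 1..t + 1})"
    by (rule integral_has_real_derivative) (use cont in \<open>auto intro!: continuous_at_imp_continuous_on\<close>)
  then have "((\<lambda>x. integral {t - 1..x} u) has_real_derivative u t) (at t)"
    by (simp add: at_within_Icc_at)
  then have "((\<lambda>x. tail_int u (t - 1) - integral {t - 1..x} u) has_real_derivative - u t) (at t)"
    by (auto intro!: derivative_eq_intros)
  then show ?thesis
    by (rule has_field_derivative_transform_within_open[where S = "{t-1<..}"])
       (auto intro: eq[symmetric])
qed

lemma tail_int_FTC: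
  fixes u F :: "real \<Rightarrow> real"
  assumes "\<And>x. (F has_real_derivative u x) (at x)" "\<And>x. isCont u x"
    and "set_integrable lborel {t<..} u" "(F \<longlongrightarrow> 0) at_top"
  shows "tail_int u t = - F t"
proof -
  have "isCont F t" using assms(1) DERIV_isCont by blast
  then have "(F \<longlongrightarrow> F t) (at_right t)"
    using isCont_def filterlim_at_split by blast
  then have "(LBINT x=t..\<infinity>. u x) = 0 - F t"
    by (intro interval_integral_FTC_integrable[where F = F])
       (use assms in \<open>auto simp: ereal_tendsto_simps
          has_real_derivative_iff_has_vector_derivative\<close>)
  then show ?thesis
    by (simp add: interval_lebesgue_integral_def tail_int_def)
qed

text \<open>Taylor's formula with the second derivative compared with a free constant
  \<open>q\<close>: for \<open>q = 0\<close> this is a quadratic bound, for \<open>q\<close> the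
  value of \<open>u2\<close> at \<open>s\<close> it is a second-order expansion whose error is the
  oscillation of \<open>u2\<close>.\<close>

lemma second_order_bound:
  fixes u u1 u2 :: "real \<Rightarrow> real"
  assumes "\<And>x. (u has_real_derivative u1 x) (at x)" "\<And>x. (u1 has_real_derivative u2 x) (at x)"
    and "\<And>x. \<bar>x - s\<bar> \<le> \<bar>r\<bar> \<Longrightarrow> \<bar>u2 x - q\<bar> \<le> B"
  shows "\<bar>u (s + r) - u s - r * u1 s - r\<^sup>2 / 2 * q\<bar> \<le> B * r\<^sup>2 / 2"
proof (cases "r = 0")
  case False
  define d where "d = (\<lambda>m::nat. if m = 0 then u else if m = 1 then u1 else u2)"
  have "\<exists>t. (if s + r < s then s + r < t \<and> t < s else s < t \<and> t < s + r) \<and>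
    u (s + r) = (\<Sum>m<2. (d m s / fact m) * (s + r - s)^m) + (d 2 t / fact 2) * (s + r - s)^2"
    by (rule Taylor[where a = "s - \<bar>r\<bar>" and b = "s + \<bar>r\<bar>"])
       (use assms False in \<open>auto simp: d_def less_2_cases_iff\<close>)
  then obtain t where t0: "if s + r < s then s + r < t \<and> t < s else s < t \<and> t < s + r"
      "u (s + r) = (\<Sum>m<2. (d m s / fact m) * (s + r - s)^m) + (d 2 t / fact 2) * (s + r - s)^2"
    by blast
  have t: "\<bar>t - s\<bar> \<le> \<bar>r\<bar>" "u (s + r) = u s + r * u1 s + u2 t / 2 * r\<^sup>2"
    using t0(1) by (auto split: if_splits)
      (subst t0(2), simp add: d_def eval_nat_numeral lessThan_Suc)+
  have "\<bar>u (s + r) - u s - r * u1 s - r\<^sup>2 / 2 * q\<bar> = \<bar>u2 t - q\<bar> * (r\<^sup>2 / 2)"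
    unfolding t(2) by (subst abs_of_nonneg[of "r\<^sup>2 / 2", symmetric], simp, subst abs_mult[symmetric])
      (simp add: field_simps)
  also have "\<dots> \<le> B * (r\<^sup>2 / 2)"
    using assms(3)[OF t(1)] by (intro mult_right_mono) auto
  finally show ?thesis by simp
qed simp

text \<open>By the mean value theorem some point of the unit interval has
  \<open>\<bar>v1\<bar> \<le> 2 * A\<close>; from there back to \<open>t\<close> the quantity
  \<open>v1 - c * v\<close>, whose derivative is the controlled expression, changes by at most
  \<open>B\<close>.\<close>

lemma interior_estimate:
  fixes v v1 v2 :: "real \<Rightarrow> real"
  assumes "\<And>x. (v has_real_derivative v1 x) (at x)" "\<And>x. (v1 has_real_derivative v2 x) (at x)"
    and "\<And>x. t \<le> x \<Longrightarrow> x \<le> t + 1 \<Longrightarrow> \<bar>v x\<bar> \<le> A"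
    and "\<And>x. t \<le> x \<Longrightarrow> x \<le> t + 1 \<Longrightarrow> \<bar>v2 x - c * v1 x\<bar> \<le> B"
  shows "\<bar>v1 t\<bar> \<le> (2 + 2 * \<bar>c\<bar>) * A + B"
proof -
  obtain z where z: "t < z" "z < t + 1" "v (t + 1) - v t = (t + 1 - t) * v1 z"
    using MVT2[of t "t + 1" v v1] assms(1) by auto
  have A: "\<bar>v t\<bar> \<le> A" "\<bar>v (t + 1)\<bar> \<le> A" "\<bar>v z\<bar> \<le> A" using assms(3) z by auto
  have B: "B \<ge> 0" using assms(4)[of t] by auto
  have "((\<lambda>x. v1 x - c * v x) has_real_derivative v2 x - c * v1 x) (at x)" for x
    using assms(1,2) by (auto intro!: derivative_eq_intros)
  from MVT2[OF z(1) this] obtain y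
    where y: "t < y" "y < z" "(v1 z - c * v z) - (v1 t - c * v t) = (z - t) * (v2 y - c * v1 y)"
    by auto
  have "\<bar>(z - t) * (v2 y - c * v1 y)\<bar> \<le> 1 * B"
    unfolding abs_mult using y z assms(4)[of y] by (intro mult_mono) auto
  moreover have "\<bar>c * v z\<bar> \<le> \<bar>c\<bar> * A" "\<bar>c * v t\<bar> \<le> \<bar>c\<bar> * A"
    unfolding abs_mult using A by (auto intro!: mult_left_mono)
  moreover have "\<bar>v1 z\<bar> \<le> 2 * A" using z(3) A by auto
  moreover have "\<bar>v1 t\<bar> \<le> \<bar>v1 z\<bar> + \<bar>c * v z\<bar> + \<bar>c * v t\<bar> + \<bar>(z - t) * (v2 y - c * v1 y)\<bar>"
    using y(3) by linarith
  moreover have "(2 + 2 * \<bar>c\<bar>) * A + B = 2 * A + 2 * (\<bar>c\<bar> * A) + B" by (simp add: algebra_simps)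
  ultimately show ?thesis by linarith
qed

text \<open>One-dimensional Sobolev embedding on \<open>{t..t+1}\<close>: the minimum of the square
  of \<open>w\<close> is at most its mean, and the increase from the minimum to \<open>t\<close> is
  bounded by the integral of \<open>2 * \<bar>w * w1\<bar>\<close>. The resulting bound is a tail of
  a convergent integral.\<close>

lemma tendsto_0_at_bot_of_square_integrable:
  fixes w w1 :: "real \<Rightarrow> real"
  assumes w: "\<And>t. (w has_real_derivative w1 t) (at t)" "\<And>t. isCont w1 t"
    and i: "integrable lborel (\<lambda>t. (w t)\<^sup>2)" "integrable lborel (\<lambda>t. (w1 t)\<^sup>2)"
  shows "(w \<longlongrightarrow> 0) at_bot"
proof -
  define U where "U t = (w t)\<^sup>2 + (w1 t)\<^sup>2" for t
  have iU: "integrable lborel U" unfolding U_def using i by simp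
  have mU: "U \<in> borel_measurable borel" using iU by simp
  have cw: "isCont w t" for t using w(1) DERIV_isCont by blast
  have cU: "continuous_on A U" for A unfolding U_def
    using cw w(2) by (auto intro!: continuous_intros continuous_at_imp_continuous_on)
  have key: "(w t)\<^sup>2 \<le> 2 * (\<integral>x. indicator {..t+1} x * U x \<partial>lborel)" for t
  proof -
    have U0: "U x \<ge> 0" for x by (simp add: U_def)
    have "continuous_on {t..t+1} (\<lambda>x. w x ^ 2)"
      using cw by (auto intro!: continuous_intros continuous_at_imp_continuous_on)
    from continuous_attains_inf[OF _ _ this] obtain z
      where z: "z \<in> {t..t+1}" "\<And>x. x \<in> {t..t+1} \<Longrightarrow> w z ^ 2 \<le> w x ^ 2"
      by (metis atLeastatMost_empty_iff compact_Icc less_add_one not_less_iff_gr_or_eq order.strict_implies_order)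
    have I: "integral {t..t+1} U \<le> (\<integral>x. indicator {..t+1} x * U x \<partial>lborel)"
    proof -
      have "integral {t..t+1} U = (LINT x:{t..t+1}|lborel. U x)"
        by (rule set_borel_integral_eq_integral(2)[symmetric], rule borel_integrable_atLeastAtMost'[OF cU])
      also have "\<dots> \<le> (\<integral>x. indicator {..t+1} x * U x \<partial>lborel)"
        unfolding set_lebesgue_integral_def
      proof (rule integral_mono)
        show "integrable lborel (\<lambda>x. indicator {t..t+1} x *\<^sub>R U x)"
          by (rule integrable_mult_indicator[OF _ iU]) simp
        show "integrable lborel (\<lambda>x. indicator {..t+1} x * U x)"
          using integrable_mult_indicator[OF _ iU, of "{..t+1}"] by simp
      qed (use U0 in \<open>auto simp: indicator_def\<close>)
      finally show ?thesis .
    qed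
    have "w z ^ 2 = integral {t..t+1} (\<lambda>x. w z ^ 2)" by simp
    also have "\<dots> \<le> integral {t..t+1} U"
      by (intro integral_le integrable_continuous_interval cU continuous_intros)
         (use z in \<open>auto simp: U_def add_increasing2\<close>)
    finally have 1: "w z ^ 2 \<le> integral {t..t+1} U" .
    have ftc: "((\<lambda>x. 2 * w x * w1 x) has_integral (w z ^ 2 - w t ^ 2)) {t..z}"
      by (rule fundamental_theorem_of_calculus)
         (use z w(1) in \<open>auto intro!: derivative_eq_intros has_field_derivative_at_within[OF w(1)]
            simp: has_real_derivative_iff_has_vector_derivative[symmetric]\<close>)
    have "w t ^ 2 - w z ^ 2 = integral {t..z} (\<lambda>x. - (2 * w x * w1 x))"
      using integral_unique[OF ftc] by simp
    also have "\<dots> \<le> integral {t..z} U"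
    proof (intro integral_le)
      show "(\<lambda>x. - (2 * w x * w1 x)) integrable_on {t..z}"
        using ftc by (auto intro: integrable_neg)
      show "U integrable_on {t..z}" by (rule integrable_continuous_interval[OF cU])
      show "- (2 * w x * w1 x) \<le> U x" for x
        using zero_le_power2[of "w x + w1 x"] by (simp add: U_def power2_sum)
    qed
    also have "\<dots> \<le> integral {t..t+1} U"
      by (rule integral_subset_le) (use z U0 in \<open>auto intro!: integrable_continuous_interval cU\<close>)
    finally show ?thesis using 1 I by linarith
  qed
  have "((\<lambda>t. \<integral>x. indicator {..- t+1} x * U x \<partial>lborel) \<longlongrightarrow> integral\<^sup>L lborel (\<lambda>x::real. 0)) at_top"
  proof (rule integral_dominated_convergence_at_top
      [where s = "\<lambda>t x. indicator {..- t+1} x * U x" and w = U])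
    show "AE x in lborel. ((\<lambda>i. indicator {..- i+1} x * U x) \<longlongrightarrow> 0) at_top"
    proof (rule AE_I2, rule tendsto_eventually)
      fix x :: real
      show "\<forall>\<^sub>F i in at_top. indicator {..- i+1} x * U x = 0"
        using eventually_gt_at_top[of "1 - x"] by eventually_elim (auto simp: indicator_def)
    qed
  next
    have "U x \<ge> 0" for x by (simp add: U_def)
    then show "\<forall>\<^sub>F i in at_top. AE x in lborel. norm (indicator {..- i+1} x * U x) \<le> U x"
      by (auto simp: indicator_def)
  qed (use iU mU in auto)
  then have "((\<lambda>t. 2 * (\<integral>x. indicator {..t+1} x * U x \<partial>lborel)) \<longlongrightarrow> 0) at_bot"
    by (intro tendsto_mult_right_zero) (simp add: at_bot_mirror filterlim_filtermap)
  then have "((\<lambda>t. (w t)\<^sup>2) \<longlongrightarrow> 0) at_bot"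
    by (rule tendsto_sandwich[OF _ _ tendsto_const, rotated 2]) (auto simp: key)
  then show ?thesis
    using tendsto_real_sqrt[of "\<lambda>t. (w t)\<^sup>2" 0 at_bot] by (simp add: tendsto_rabs_zero_iff)
qed

text \<open>Tonelli followed by the translation \<open>t = s + r\<close>. This transposes a
  convolution, and in \<open>ennreal\<close> no integrability has to be known beforehand; weights
  and test functions are moved onto the kernel in this way.\<close>

lemma nn_integral_convolution_swap:
  fixes a b k :: "real \<Rightarrow> ennreal"
  assumes "sigma_finite_measure M" and sets[measurable_cong, simp]: "sets M = sets borel"
    and [measurable]: "a \<in> borel_measurable borel" "b \<in> borel_measurable borel" "k \<in> borel_measurable borel"
  shows "(\<integral>\<^sup>+t. a t * (\<integral>\<^sup>+r. k r * b (t - r) \<partial>M) \<partial>lborel)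
       = (\<integral>\<^sup>+s. b s * (\<integral>\<^sup>+r. k r * a (s + r) \<partial>M) \<partial>lborel)"
proof -
  interpret M: sigma_finite_measure M by fact
  interpret pair_sigma_finite lborel M ..
  have "(\<integral>\<^sup>+t. a t * (\<integral>\<^sup>+r. k r * b (t - r) \<partial>M) \<partial>lborel)
      = (\<integral>\<^sup>+t. (\<integral>\<^sup>+r. a t * (k r * b (t - r)) \<partial>M) \<partial>lborel)"
    by (simp add: nn_integral_cmult)
  also have "\<dots> = (\<integral>\<^sup>+r. (\<integral>\<^sup>+t. a t * (k r * b (t - r)) \<partial>lborel) \<partial>M)"
    by (rule Fubini'[symmetric]) simp
  also have "\<dots> = (\<integral>\<^sup>+r. (\<integral>\<^sup>+s. a (s + r) * (k r * b s) \<partial>lborel) \<partial>M)"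
  proof (rule nn_integral_cong)
    fix r
    show "(\<integral>\<^sup>+t. a t * (k r * b (t - r)) \<partial>lborel) = (\<integral>\<^sup>+s. a (s + r) * (k r * b s) \<partial>lborel)"
      by (subst nn_integral_real_affine[where c = 1 and t = r]) (auto simp: add.commute)
  qed
  also have "\<dots> = (\<integral>\<^sup>+s. (\<integral>\<^sup>+r. a (s + r) * (k r * b s) \<partial>M) \<partial>lborel)"
    by (rule Fubini') simp
  also have "\<dots> = (\<integral>\<^sup>+s. (\<integral>\<^sup>+r. b s * (k r * a (s + r)) \<partial>M) \<partial>lborel)"
    by (intro nn_integral_cong) (simp add: mult.assoc mult.left_commute mult.commute)
  also have "\<dots> = (\<integral>\<^sup>+s. b s * (\<integral>\<^sup>+r. k r * a (s + r) \<partial>M) \<partial>lborel)"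
    by (simp add: nn_integral_cmult)
  finally show ?thesis .
qed

subsection \<open>Probability measures with an exponential moment\<close>

text \<open>Abstracts the law of \<open>c * s + w\<close> under the kernel. The exponent
  \<open>m2\<close> will lie strictly above \<open>m\<close>, so that at every positive exponent up
  to \<open>m\<close> moments of all orders are finite.\<close>

locale exp_moment_measure = prob_space M for M :: "real measure" +
  fixes m2 :: real
  assumes sets_M [measurable_cong, simp]: "sets M = sets borel"
    and m2_pos: "0 < m2" and exp_int: "integrable M (\<lambda>r. exp (- m2 * r))"
begin

lemma space_M [simp]: "space M = UNIV"
  using sets_eq_imp_space_eq[OF sets_M] by simp

lemma prob_UNIV [simp]: "prob UNIV = 1"
  using prob_space by simp

definition kap :: "real \<Rightarrow> real" where "kap z = (\<integral>r. exp (- z * r) \<partial>M)"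

text \<open>Minus the derivative of \<open>kap\<close>. This enters through convexity and
  second-order bounds of the exponential, not through differentiation under the integral.\<close>

definition kap1 :: "real \<Rightarrow> real" where "kap1 z = (\<integral>r. r * exp (- z * r) \<partial>M)"

text \<open>With \<open>A = a0\<close>, \<open>B = b0\<close> this is the characteristic function of
  the linearization at 0; with \<open>A = ia\<close>, \<open>B = L\<close> it is the finite-valued
  form of \<open>chi\<close>. The derivative is \<open>dchf\<close>.\<close>

definition chf :: "real \<Rightarrow> real \<Rightarrow> real \<Rightarrow> real \<Rightarrow> real" where
  "chf c A B z = z\<^sup>2 - c * z - A + B * kap z"

definition dchf :: "real \<Rightarrow> real \<Rightarrow> real \<Rightarrow> real" where
  "dchf c B z = 2 * z - c - B * kap1 z"

lemma exp_le:
  assumes "0 \<le> z" "z \<le> m2" shows "exp (- z * r) \<le> 1 + exp (- m2 * r)"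
proof (cases "r \<ge> 0")
  case True
  then have "exp (- z * r) \<le> exp 0" using assms by (subst exp_le_cancel_iff) (simp add: mult_nonneg_nonneg)
  then show ?thesis by (smt (verit) exp_ge_zero exp_zero)
next
  case False
  then have "exp (- z * r) \<le> exp (- m2 * r)" using assms by (auto intro: mult_right_mono_neg)
  then show ?thesis by linarith
qed

text \<open>On the two half-lines the exponent is \<open>z - b\<close> and \<open>z + b\<close>,
  both inside \<open>{0..m2}\<close>; hence the constant 1 dominates on the right and
  \<open>exp (- m2 * r)\<close> on the left.\<close>

lemma integrable_bound_exp:
  assumes [measurable]: "u \<in> borel_measurable borel"
    and "0 \<le> z - b" "z + b \<le> m2" "\<And>r. \<bar>u r\<bar> \<le> C * (exp (- z * r) * exp (b * \<bar>r\<bar>))"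
  shows "integrable M (u :: real \<Rightarrow> real)"
proof (rule Bochner_Integration.integrable_bound)
  show "integrable M (\<lambda>r. \<bar>C\<bar> * (1 + exp (- m2 * r)))" using exp_int by simp
  show "AE r in M. norm (u r) \<le> norm (\<bar>C\<bar> * (1 + exp (- m2 * r)))"
  proof (rule AE_I2)
    fix r
    have "exp (- z * r) * exp (b * \<bar>r\<bar>) \<le> 1 + exp (- m2 * r)"
    proof (cases "r \<ge> 0")
      case True
      then have "exp (- z * r) * exp (b * \<bar>r\<bar>) = exp (- (z - b) * r)"
        by (simp add: algebra_simps flip: exp_add)
      also have "\<dots> \<le> exp 0"
        using mult_nonneg_nonneg[of "z - b" r] assms True by (subst exp_le_cancel_iff) linarith
      finally show ?thesis by (smt (verit) exp_ge_zero exp_zero)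
    next
      case False
      then have "exp (- z * r) * exp (b * \<bar>r\<bar>) = exp (- (z + b) * r)"
        by (simp add: algebra_simps flip: exp_add)
      also have "\<dots> \<le> exp (- m2 * r)"
        using mult_nonneg_nonneg[of "m2 - (z + b)" "- r"] assms False
        by (subst exp_le_cancel_iff) (auto simp: algebra_simps)
      finally show ?thesis by (smt (verit) exp_ge_zero exp_zero)
    qed
    then have "\<bar>C\<bar> * (exp (- z * r) * exp (b * \<bar>r\<bar>)) \<le> \<bar>C\<bar> * (1 + exp (- m2 * r))"
      by (rule mult_left_mono) simp
    moreover have "C * (exp (- z * r) * exp (b * \<bar>r\<bar>)) \<le> \<bar>C\<bar> * (exp (- z * r) * exp (b * \<bar>r\<bar>))"
      by (rule mult_right_mono) auto
    ultimately have "\<bar>u r\<bar> \<le> \<bar>C\<bar> * (1 + exp (- m2 * r))"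
      using assms(4)[of r] by linarith
    then show "norm (u r) \<le> norm (\<bar>C\<bar> * (1 + exp (- m2 * r)))"
      by simp
  qed
qed simp

lemma integrable_exp: "0 \<le> z \<Longrightarrow> z \<le> m2 \<Longrightarrow> integrable M (\<lambda>r. exp (- z * r))"
  by (rule integrable_bound_exp[where b = 0 and C = 1]) auto

lemma abs_power_le_exp:
  fixes r b :: real assumes "b > 0" shows "\<bar>r\<bar> ^ n \<le> fact n / b ^ n * exp (b * \<bar>r\<bar>)"
proof -
  have "(b * \<bar>r\<bar>) ^ n / fact n \<le> exp (b * \<bar>r\<bar>)"
    using sum_le_suminf[OF summable_exp_generic[of "b * \<bar>r\<bar>"], of "{n}"] assms
    by (simp add: exp_def divide_inverse mult.commute)
  then show ?thesis using assms by (simp add: field_simps power_mult_distrib)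
qed

text \<open>The distance of \<open>z - b\<close> and \<open>z + b\<close> from the ends of the
  interval from 0 to \<open>m2\<close> leaves room for a slightly larger exponential, which absorbs
  the power.\<close>

lemma integrable_power_exp:
  assumes "0 < z - b" "z + b < m2" "0 \<le> b"
  shows "integrable M (\<lambda>r. \<bar>r\<bar> ^ n * (exp (- z * r) * exp (b * \<bar>r\<bar>)))"
proof -
  define e where "e = min (z - b) (m2 - (z + b))"
  have e: "e > 0" using assms by (simp add: e_def)
  show ?thesis
  proof (rule integrable_bound_exp[where z = z and b = "b + e" and C = "fact n / e ^ n"])
    fix r
    have "\<bar>r\<bar> ^ n * (exp (- z * r) * exp (b * \<bar>r\<bar>))
        \<le> (fact n / e ^ n * exp (e * \<bar>r\<bar>)) * (exp (- z * r) * exp (b * \<bar>r\<bar>))"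
      by (rule mult_right_mono[OF abs_power_le_exp[OF e]]) auto
    also have "\<dots> = fact n / e ^ n * (exp (- z * r) * exp ((b + e) * \<bar>r\<bar>))"
      by (simp add: distrib_right exp_add)
    finally show "\<bar>\<bar>r\<bar> ^ n * (exp (- z * r) * exp (b * \<bar>r\<bar>))\<bar> \<le> fact n / e ^ n * (exp (- z * r) * exp ((b + e) * \<bar>r\<bar>))"
      by (simp add: abs_mult)
  qed (auto simp: e_def)
qed

lemma integrable_id_exp: "0 < z \<Longrightarrow> z < m2 \<Longrightarrow> integrable M (\<lambda>r. r * exp (- z * r))"
  by (rule Bochner_Integration.integrable_bound[OF integrable_power_exp[where b = 0 and n = 1]])
     (auto simp: abs_mult)

lemma integrable_sq_exp: "0 < z \<Longrightarrow> z < m2 \<Longrightarrow> integrable M (\<lambda>r. r\<^sup>2 * exp (- z * r))"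
  using integrable_power_exp[where b = 0 and n = 2 and z = z] by simp

lemma kap_pos: "0 \<le> z \<Longrightarrow> z \<le> m2 \<Longrightarrow> 0 < kap z"
proof -
  assume "0 \<le> z" "z \<le> m2"
  then have "kap z \<noteq> 0"
    unfolding kap_def using integral_nonneg_eq_0_iff_AE[OF integrable_exp, of z] by auto
  moreover have "kap z \<ge> 0" unfolding kap_def by simp
  ultimately show ?thesis by simp
qed

lemma kap_0 [simp]: "kap 0 = 1" by (simp add: kap_def)

text \<open>Convexity of \<open>kap\<close>, read off under the integral from
  \<open>1 + x \<le> exp x\<close>.\<close>

lemma kap_tangent:
  assumes "0 < y" "y < m2" "0 \<le> z" "z \<le> m2"
  shows "kap y - (z - y) * kap1 y \<le> kap z"
proof -
  have "kap y - (z - y) * kap1 y = (\<integral>r. exp (- y * r) - (z - y) * (r * exp (- y * r)) \<partial>M)"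
    unfolding kap_def kap1_def using assms integrable_exp[of y] integrable_id_exp[of y]
    by (subst Bochner_Integration.integral_diff) auto
  also have "\<dots> \<le> kap z"
    unfolding kap_def
  proof (rule integral_mono)
    fix r
    have "exp (- y * r) - (z - y) * (r * exp (- y * r)) = exp (- y * r) * (1 + (- (z - y) * r))"
      by (simp add: algebra_simps)
    also have "\<dots> \<le> exp (- y * r) * exp (- (z - y) * r)"
      by (rule mult_left_mono[OF exp_ge_add_one_self]) auto
    also have "\<dots> = exp (- z * r)" by (simp add: algebra_simps flip: exp_add)
    finally show "exp (- y * r) - (z - y) * (r * exp (- y * r)) \<le> exp (- z * r)" .
  qed (use assms integrable_exp[of y] integrable_exp[of z] integrable_id_exp[of y] in auto)
  finally show ?thesis .
qed

text \<open>The summand \<open>z\<^sup>2\<close> makes \<open>chf\<close> strongly convex, which is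
  the source of the extra square. The sign of \<open>chf\<close> on either side of its zeros is
  later read off from this inequality.\<close>

lemma chf_tangent:
  assumes "0 < y" "y < m2" "0 \<le> z" "z \<le> m2" "0 \<le> B"
  shows "chf c A B y + dchf c B y * (z - y) + (z - y)\<^sup>2 \<le> chf c A B z"
proof -
  have "B * (kap y - (z - y) * kap1 y) \<le> B * kap z"
    using kap_tangent[OF assms(1-4)] assms(5) by (rule mult_left_mono)
  then show ?thesis by (simp add: chf_def dchf_def power2_eq_square algebra_simps)
qed

lemma kap_continuous: "continuous_on {0..m2} kap"
  unfolding kap_def continuous_on_sequentially comp_def
proof (intro allI ballI impI, elim conjE)
  fix x :: "nat \<Rightarrow> real" and a assume x: "a \<in> {0..m2}" "\<forall>n. x n \<in> {0..m2}" "x \<longlonglongrightarrow> a"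
  show "(\<lambda>n. \<integral>r. exp (- x n * r) \<partial>M) \<longlonglongrightarrow> (\<integral>r. exp (- a * r) \<partial>M)"
  proof (rule integral_dominated_convergence[where w = "\<lambda>r. 1 + exp (- m2 * r)"])
    show "AE r in M. (\<lambda>n. exp (- x n * r)) \<longlonglongrightarrow> exp (- a * r)"
      using x by (intro AE_I2 tendsto_intros)
    show "AE r in M. norm (exp (- x n * r)) \<le> 1 + exp (- m2 * r)" for n
      using exp_le[of "x n"] x by auto
  qed (use exp_int in auto)
qed

lemma chf_continuous: "continuous_on {0..m2} (chf c A B)"
  unfolding chf_def by (intro continuous_intros kap_continuous)

lemma second_order_exp:
  fixes x :: real shows "exp x \<le> 1 + x + x\<^sup>2 / 2 * exp \<bar>x\<bar>"
proof -
  have "\<bar>exp (0 + x) - exp 0 - x * exp 0 - x\<^sup>2 / 2 * 0\<bar> \<le> exp \<bar>x\<bar> * x\<^sup>2 / 2"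
    by (rule second_order_bound) (auto intro: DERIV_exp)
  then show ?thesis by (simp add: abs_le_iff field_simps)
qed

text \<open>A zero with nonzero slope is a sign change. An upper bound by a parabola, obtained by
  expanding the exponential under the integral, stands in for differentiability of
  \<open>kap\<close>.\<close>

lemma chf_negative_nearby:
  assumes y: "0 < y" "y < m2" and B: "0 \<le> B" and "chf c A B y = 0" "dchf c B y \<noteq> 0"
  obtains z where "0 < z" "z < m2" "chf c A B z < 0"
proof -
  define b where "b = min y (m2 - y) / 2"
  have b: "b > 0" "0 < y - b" "y + b < m2" using y by (auto simp: b_def min_def field_simps)
  define D where "D = 1 + B * (\<integral>r. \<bar>r\<bar> ^ 2 * (exp (- y * r) * exp (b * \<bar>r\<bar>)) \<partial>M) / 2"
  have int2: "integrable M (\<lambda>r. \<bar>r\<bar> ^ 2 * (exp (- y * r) * exp (b * \<bar>r\<bar>)))"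
    by (rule integrable_power_exp) (use b in auto)
  have D: "D > 0" unfolding D_def using B by (intro add_pos_nonneg divide_nonneg_nonneg mult_nonneg_nonneg) auto
  have le: "chf c A B (y + e) \<le> e * dchf c B y + D * e\<^sup>2" if e: "\<bar>e\<bar> \<le> b" for e
  proof -
    have "kap (y + e) \<le> (\<integral>r. exp (- y * r) - e * (r * exp (- y * r))
            + e\<^sup>2 / 2 * (\<bar>r\<bar> ^ 2 * (exp (- y * r) * exp (b * \<bar>r\<bar>))) \<partial>M)"
      unfolding kap_def
    proof (rule integral_mono)
      fix r
      have "exp (- (y + e) * r) = exp (- y * r) * exp (- e * r)" by (simp add: algebra_simps flip: exp_add)
      also have "\<dots> \<le> exp (- y * r) * (1 + (- e * r) + (- e * r)\<^sup>2 / 2 * exp \<bar>- e * r\<bar>)"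
        by (rule mult_left_mono[OF second_order_exp]) auto
      also have "\<dots> \<le> exp (- y * r) * (1 + (- e * r) + (- e * r)\<^sup>2 / 2 * exp (b * \<bar>r\<bar>))"
        using e by (intro mult_left_mono add_left_mono) (auto simp: abs_mult intro: mult_right_mono)
      also have "\<dots> = exp (- y * r) - e * (r * exp (- y * r))
            + e\<^sup>2 / 2 * (\<bar>r\<bar> ^ 2 * (exp (- y * r) * exp (b * \<bar>r\<bar>)))"
        by (simp add: algebra_simps power2_eq_square)
      finally show "exp (- (y + e) * r) \<le> \<dots>" .
    next
      show "integrable M (\<lambda>r. exp (- (y + e) * r))"
        by (rule integrable_exp) (use e b in auto)
    qed (use int2 y integrable_exp[of y] integrable_id_exp[of y] in auto)
    also have "\<dots> = kap y - e * kap1 y + e\<^sup>2 / 2 * (\<integral>r. \<bar>r\<bar> ^ 2 * (exp (- y * r) * exp (b * \<bar>r\<bar>)) \<partial>M)"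
      unfolding kap_def kap1_def using int2 y integrable_exp[of y] integrable_id_exp[of y] by simp
    finally have "B * kap (y + e) \<le> B * (kap y - e * kap1 y + e\<^sup>2 / 2 * (\<integral>r. \<bar>r\<bar> ^ 2 * (exp (- y * r) * exp (b * \<bar>r\<bar>)) \<partial>M))"
      using B by (rule mult_left_mono)
    then have "chf c A B (y + e) \<le> chf c A B y + e * dchf c B y + D * e\<^sup>2"
      unfolding chf_def dchf_def D_def by (simp add: power2_eq_square algebra_simps)
    then show ?thesis using assms by simp
  qed
  \<comment> \<open>The step is so short that the quadratic term takes at most half of the linear
    gain; the bound by \<open>b\<close> keeps the new point between 0 and \<open>m2\<close>.\<close>
  define q where "q = min b (\<bar>dchf c B y\<bar> / (2 * D))"
  have q: "q > 0" "q \<le> b" "D * q \<le> \<bar>dchf c B y\<bar> / 2" using b D assms by (auto simp: q_def min_def field_simps)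
  define e where "e = - sgn (dchf c B y) * q"
  have "\<bar>e\<bar> = q" using q assms by (simp add: e_def abs_mult abs_sgn_eq)
  moreover have "e * dchf c B y = - (\<bar>dchf c B y\<bar> * q)" by (simp add: e_def abs_sgn)
  moreover have "D * e\<^sup>2 = (D * q) * q" using \<open>\<bar>e\<bar> = q\<close> by (metis power2_abs power2_eq_square mult.assoc)
  moreover have "(D * q) * q \<le> \<bar>dchf c B y\<bar> / 2 * q" using q by (intro mult_right_mono) auto
  moreover have "\<bar>dchf c B y\<bar> * q > 0" using q assms by simp
  moreover have "chf c A B (y + e) \<le> e * dchf c B y + D * e\<^sup>2" using le \<open>\<bar>e\<bar> = q\<close> q by simp
  ultimately have "chf c A B (y + e) < 0" by linarith
  moreover have "0 < y + e" "y + e < m2" using \<open>\<bar>e\<bar> = q\<close> q b by linarith+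
  ultimately show ?thesis using that by blast
qed

lemma kap_truncated_limit:
  assumes "0 \<le> z" "z \<le> m2"
  shows "((\<lambda>R. \<integral>r. indicator {-R..R} r * exp (- z * r) \<partial>M) \<longlongrightarrow> kap z) at_top"
  unfolding kap_def
proof (rule integral_dominated_convergence_at_top
    [where s = "\<lambda>R r. indicator {-R..R} r * exp (- z * r)" and w = "\<lambda>r. exp (- z * r)"])
  show "AE r in M. ((\<lambda>R. indicator {-R..R} r * exp (- z * r)) \<longlongrightarrow> exp (- z * r)) at_top"
  proof (rule AE_I2, rule tendsto_eventually)
    fix r :: real
    show "\<forall>\<^sub>F R in at_top. indicator {-R..R} r * exp (- z * r) = exp (- z * r)"
      using eventually_ge_at_top[of "\<bar>r\<bar>"] by eventually_elim (auto simp: indicator_def)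
  qed
qed (use integrable_exp[OF assms] in \<open>auto simp: indicator_def\<close>)

lemma exp_conv: "(\<integral>r. exp (z * (t - r)) \<partial>M) = exp (z * t) * kap z"
proof -
  have "(\<integral>r. exp (z * (t - r)) \<partial>M) = (\<integral>r. exp (z * t) * exp (- z * r) \<partial>M)"
    by (simp add: algebra_simps flip: exp_add)
  then show ?thesis by (simp add: kap_def)
qed

lemma integrable_exp_conv: "0 \<le> z \<Longrightarrow> z \<le> m2 \<Longrightarrow> integrable M (\<lambda>r. exp (z * (t - r)))"
proof -
  assume "0 \<le> z" "z \<le> m2"
  from integrable_mult_right[OF integrable_exp[OF this], of "exp (z * t)"]
  show ?thesis by (simp add: algebra_simps flip: exp_add)
qed

lemma measurable_shift [measurable]:
  "u \<in> borel_measurable borel \<Longrightarrow> (\<lambda>r. u (t - r)) \<in> borel_measurable M"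
  by simp

lemma bounded_conv:
  fixes u :: "real \<Rightarrow> real"
  assumes "u \<in> borel_measurable borel" "\<And>x. \<bar>u x\<bar> \<le> X"
  shows "integrable M (\<lambda>r. u (t - r))" "\<bar>\<integral>r. u (t - r) \<partial>M\<bar> \<le> X"
proof -
  show i: "integrable M (\<lambda>r. u (t - r))"
    by (rule integrable_const_bound[where B = X]) (use assms in auto)
  have "\<bar>\<integral>r. u (t - r) \<partial>M\<bar> \<le> (\<integral>r. X \<partial>M)"
    by (rule order_trans[OF integral_norm_bound[where 'a = real, unfolded real_norm_def]],
        rule integral_mono) (use i assms in auto)
  then show "\<bar>\<integral>r. u (t - r) \<partial>M\<bar> \<le> X" by simp
qed

lemma exp_bounded_conv:
  fixes u :: "real \<Rightarrow> real"
  assumes "0 \<le> z" "z \<le> m2" "u \<in> borel_measurable borel" "\<And>x. \<bar>u x\<bar> \<le> X * exp (z * x)"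
  shows "integrable M (\<lambda>r. u (t - r))" "\<bar>\<integral>r. u (t - r) \<partial>M\<bar> \<le> X * kap z * exp (z * t)"
proof -
  have iX: "integrable M (\<lambda>r. X * exp (z * (t - r)))"
    by (rule integrable_mult_right[OF integrable_exp_conv[OF assms(1,2)]])
  show i: "integrable M (\<lambda>r. u (t - r))"
    by (rule Bochner_Integration.integrable_bound[OF iX])
       (use assms in \<open>auto intro: order_trans[OF _ abs_ge_self]\<close>)
  have "\<bar>\<integral>r. u (t - r) \<partial>M\<bar> \<le> (\<integral>r. X * exp (z * (t - r)) \<partial>M)"
    by (rule order_trans[OF integral_norm_bound[where 'a = real, unfolded real_norm_def]],
        rule integral_mono) (use i iX assms in auto)
  then show "\<bar>\<integral>r. u (t - r) \<partial>M\<bar> \<le> X * kap z * exp (z * t)" by (simp add: exp_conv mult_ac)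
qed

lemma conv_isCont:
  fixes u :: "real \<Rightarrow> real"
  assumes "\<And>x. isCont u x" "\<And>x. \<bar>u x\<bar> \<le> X"
  shows "isCont (\<lambda>t. \<integral>r. u (t - r) \<partial>M) t"
  unfolding continuous_at_sequentially comp_def
proof (intro allI impI)
  fix x :: "nat \<Rightarrow> real" assume x: "x \<longlonglongrightarrow> t"
  have [measurable]: "u \<in> borel_measurable borel"
    using assms(1) by (intro borel_measurable_continuous_onI) (auto simp: continuous_on_eq_continuous_at)
  show "(\<lambda>n. \<integral>r. u (x n - r) \<partial>M) \<longlonglongrightarrow> (\<integral>r. u (t - r) \<partial>M)"
  proof (rule integral_dominated_convergence[where w = "\<lambda>_. X"])
    show "AE r in M. (\<lambda>n. u (x n - r)) \<longlonglongrightarrow> u (t - r)"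
      using x assms(1) by (intro AE_I2 isCont_tendsto_compose[of _ u] tendsto_intros) auto
  qed (use assms in auto)
qed

text \<open>Fubini applies because the weight \<open>exp (- b * r)\<close> exactly offsets the
  shift: the integrand is bounded by \<open>X * exp (- b * s)\<close> uniformly in
  \<open>r\<close>.\<close>

lemma tail_int_conv:
  fixes u :: "real \<Rightarrow> real"
  assumes b: "b > 0" and u[measurable]: "u \<in> borel_measurable borel" and bd: "\<And>x. \<bar>u x\<bar> \<le> X * exp (- b * x)"
  shows "tail_int (\<lambda>s. \<integral>r. exp (- b * r) * u (s - r) \<partial>M) t = (\<integral>r. exp (- b * r) * tail_int u (t - r) \<partial>M)"
proof -
  have X: "X \<ge> 0" using order_trans[OF abs_ge_zero bd[of 0]] by simp
  interpret pair_sigma_finite lborel M ..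
  have bd2: "\<bar>exp (- b * r) * u (s - r)\<bar> \<le> X * exp (- b * s)" for s r
  proof -
    have "\<bar>exp (- b * r) * u (s - r)\<bar> \<le> exp (- b * r) * (X * exp (- b * (s - r)))"
      unfolding abs_mult using bd[of "s - r"] by (auto intro: mult_left_mono)
    also have "\<dots> = X * exp (- b * s)" by (simp add: algebra_simps flip: exp_add)
    finally show ?thesis .
  qed
  have iM: "integrable M (\<lambda>r. exp (- b * r) * u (s - r))" for s
    by (rule integrable_const_bound[where B = "X * exp (- b * s)"]) (use bd2 in auto)
  have "integrable (lborel \<Otimes>\<^sub>M M) (case_prod (\<lambda>s r. indicator {t<..} s * (exp (- b * r) * u (s - r))))"
  proof (rule Fubini_integrable)
    show "AE s in lborel. integrable M (\<lambda>r. case (s, r) of (s, r) \<Rightarrow> indicator {t<..} s * (exp (- b * r) * u (s - r)))"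
      using iM by (intro AE_I2) simp
    have "set_integrable lborel {t<..} (\<lambda>s. \<integral>r. \<bar>exp (- b * r) * u (s - r)\<bar> \<partial>M)"
    proof (rule set_integrable_exp_tail[OF b])
      fix s show "\<bar>\<integral>r. \<bar>exp (- b * r) * u (s - r)\<bar> \<partial>M\<bar> \<le> X * exp (- b * s)"
      proof -
        have "(\<integral>r. \<bar>exp (- b * r) * u (s - r)\<bar> \<partial>M) \<le> (\<integral>r. X * exp (- b * s) \<partial>M)"
          by (rule integral_mono) (use iM bd2 in auto)
        then show ?thesis by simp
      qed
    qed simp
    then show "integrable lborel (\<lambda>s. \<integral>r. norm (case (s, r) of (s, r) \<Rightarrow> indicator {t<..} s * (exp (- b * r) * u (s - r))) \<partial>M)"
      by (simp add: set_integrable_def abs_mult)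
  qed simp
  from Fubini_integral[OF this]
  have "(\<integral>s. \<integral>r. indicator {t<..} s * (exp (- b * r) * u (s - r)) \<partial>M \<partial>lborel)
     = (\<integral>r. \<integral>s. indicator {t<..} s * (exp (- b * r) * u (s - r)) \<partial>lborel \<partial>M)" by simp
  moreover have "(\<integral>s. indicator {t<..} s * (exp (- b * r) * u (s - r)) \<partial>lborel) = exp (- b * r) * tail_int u (t - r)" for r
  proof -
    have "(\<integral>s. indicator {t<..} s * (exp (- b * r) * u (s - r)) \<partial>lborel)
        = (\<integral>s. indicator {t - r<..} s * (exp (- b * r) * u s) \<partial>lborel)"
      by (subst lborel_integral_real_affine[where c = 1 and t = r]) (auto simp: indicator_def intro!: Bochner_Integration.integral_cong)
    also have "\<dots> = (\<integral>s. exp (- b * r) * (indicator {t - r<..} s * u s) \<partial>lborel)"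
      by (simp add: mult_ac)
    finally show ?thesis by (simp add: tail_int_def set_lebesgue_integral_def)
  qed
  ultimately show ?thesis by (simp add: tail_int_def set_lebesgue_integral_def)
qed

end

subsection \<open>The weight and the weighted oscillation\<close>

text \<open>A smooth substitute for \<open>exp (- e * \<bar>t\<bar>)\<close>: the first and second
  derivatives are at most \<open>e\<close> and \<open>e\<^sup>2\<close> times the weight itself,
  which makes the errors of integration by parts small as \<open>e\<close> tends to 0.\<close>

definition psi :: "real \<Rightarrow> real \<Rightarrow> real" where "psi e t = 1 / cosh (e * t)"
definition psi1 :: "real \<Rightarrow> real \<Rightarrow> real" where "psi1 e t = - e * sinh (e * t) / (cosh (e * t))\<^sup>2"
definition psi2 :: "real \<Rightarrow> real \<Rightarrow> real" where
  "psi2 e t = e\<^sup>2 * (2 * (sinh (e * t))\<^sup>2 - (cosh (e * t))\<^sup>2) / (cosh (e * t)) ^ 3"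

lemma psi_pos: "0 < psi e t" and psi_le_1: "psi e t \<le> 1"
  using cosh_real_pos[of "e * t"] cosh_real_ge_1[of "e * t"] by (auto simp: psi_def)

lemma psi_nonneg [simp]: "0 \<le> psi e t"
  using psi_pos[of e t] by simp

lemma psi_deriv: "(psi e has_real_derivative psi1 e t) (at t)"
  unfolding psi_def[abs_def] psi1_def using cosh_real_pos[of "e * t"]
  by (auto intro!: derivative_eq_intros simp: power2_eq_square)

lemma psi1_deriv: "(psi1 e has_real_derivative psi2 e t) (at t)"
  unfolding psi1_def[abs_def] psi2_def using cosh_real_pos[of "e * t"]
  by (auto intro!: derivative_eq_intros simp: field_simps power2_eq_square power3_eq_cube)

lemma psi2_isCont: "isCont (psi2 e) t"
  unfolding psi2_def[abs_def] using cosh_real_pos[of "e * t"] by (intro continuous_intros) auto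

lemma abs_sinh_le_cosh: "\<bar>sinh x\<bar> \<le> cosh (x::real)"
  by (auto simp: abs_le_iff sinh_def cosh_def field_simps)

lemma psi1_bound: "e \<ge> 0 \<Longrightarrow> \<bar>psi1 e t\<bar> \<le> e * psi e t"
proof -
  assume e: "e \<ge> 0"
  have "e * \<bar>sinh (e * t)\<bar> / (cosh (e * t))\<^sup>2 \<le> e * cosh (e * t) / (cosh (e * t))\<^sup>2"
    using abs_sinh_le_cosh[of "e * t"] e by (intro divide_right_mono mult_left_mono) auto
  then show ?thesis using e cosh_real_pos[of "e * t"]
    by (simp add: psi1_def psi_def abs_mult power2_eq_square)
qed

lemma psi2_bound: "\<bar>psi2 e t\<bar> \<le> e\<^sup>2 * psi e t"
proof -
  have "\<bar>2 * (sinh (e * t))\<^sup>2 - (cosh (e * t))\<^sup>2\<bar> \<le> (cosh (e * t))\<^sup>2"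
    using cosh_square_eq[of "e * t"] by (auto simp: abs_le_iff)
  then have "e\<^sup>2 * \<bar>2 * (sinh (e * t))\<^sup>2 - (cosh (e * t))\<^sup>2\<bar> / (cosh (e * t)) ^ 3
      \<le> e\<^sup>2 * (cosh (e * t))\<^sup>2 / (cosh (e * t)) ^ 3"
    using cosh_real_pos[of "e * t"] by (intro divide_right_mono mult_left_mono) auto
  then show ?thesis using cosh_real_pos[of "e * t"]
    by (simp add: psi2_def psi_def abs_mult power2_eq_square power3_eq_cube)
qed

lemma psi_le_exp: "e \<ge> 0 \<Longrightarrow> psi e t \<le> 2 * exp (- e * \<bar>t\<bar>)"
proof -
  assume e: "e \<ge> 0"
  have "exp \<bar>e * t\<bar> \<le> 2 * cosh (e * t)"
    by (cases "e * t \<ge> 0") (auto simp: cosh_def)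
  then show ?thesis using cosh_real_pos[of "e * t"] e
    by (simp add: psi_def abs_mult exp_minus field_simps)
qed

lemma psi_shift: "e \<ge> 0 \<Longrightarrow> psi e (t + r) \<le> exp (e * \<bar>r\<bar>) * psi e t"
proof -
  assume e: "e \<ge> 0"
  have "cosh (e * t) = cosh (e * (t + r) - e * r)" by (simp add: algebra_simps)
  also have "\<dots> = cosh (e * (t + r)) * cosh (e * r) - sinh (e * (t + r)) * sinh (e * r)"
    by (rule cosh_diff)
  also have "\<dots> \<le> cosh (e * (t + r)) * cosh (e * r) + cosh (e * (t + r)) * \<bar>sinh (e * r)\<bar>"
    using mult_right_mono[OF abs_sinh_le_cosh[of "e * (t + r)"], of "\<bar>sinh (e * r)\<bar>"]
    by (simp flip: abs_mult)
  also have "\<dots> = cosh (e * (t + r)) * exp (e * \<bar>r\<bar>)"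
    using e by (cases "r \<ge> 0") (auto simp: cosh_plus_sinh simp flip: distrib_left,
       simp add: abs_of_nonpos mult_nonneg_nonpos cosh_minus_sinh)
  finally show ?thesis using cosh_real_pos[of "e * t"] cosh_real_pos[of "e * (t + r)"]
    by (simp add: psi_def field_simps)
qed

text \<open>The linear term is kept exactly: integrated against the kernel it produces
  \<open>kap1\<close>, which then combines with the drift. An upper bound is enough because it
  multiplies squares.\<close>

lemma psi_second_order:
  assumes "e \<ge> 0"
  shows "psi e (s + r) \<le> psi e s + r * psi1 e s + e\<^sup>2 / 2 * (r\<^sup>2 * exp (e * \<bar>r\<bar>)) * psi e s"
proof -
  have "\<bar>psi e (s + r) - psi e s - r * psi1 e s - r\<^sup>2 / 2 * 0\<bar> \<le> (e\<^sup>2 * (exp (e * \<bar>r\<bar>) * psi e s)) * r\<^sup>2 / 2"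
  proof (rule second_order_bound[OF psi_deriv psi1_deriv])
    fix x assume x: "\<bar>x - s\<bar> \<le> \<bar>r\<bar>"
    have "psi e (s + (x - s)) \<le> exp (e * \<bar>x - s\<bar>) * psi e s" by (rule psi_shift[OF assms])
    also have "\<dots> \<le> exp (e * \<bar>r\<bar>) * psi e s"
      using x assms psi_pos[of e s] by (intro mult_right_mono) (auto intro: mult_left_mono)
    finally have "e\<^sup>2 * psi e x \<le> e\<^sup>2 * (exp (e * \<bar>r\<bar>) * psi e s)" by (intro mult_left_mono) auto
    then show "\<bar>psi2 e x - 0\<bar> \<le> e\<^sup>2 * (exp (e * \<bar>r\<bar>) * psi e s)" using psi2_bound[of e x] by simp
  qed
  then have "psi e (s + r) \<le> psi e s + r * psi1 e s + (e\<^sup>2 * (exp (e * \<bar>r\<bar>) * psi e s)) * r\<^sup>2 / 2"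
    by (simp only: abs_le_iff mult_zero_right diff_zero) linarith
  then show ?thesis by (simp add: mult_ac)
qed

lemma psi_isCont: "isCont (psi e) t" and psi1_isCont: "isCont (psi1 e) t"
  using psi_deriv psi1_deriv DERIV_isCont by blast+

lemma psi_measurable [measurable]:
  "psi e \<in> borel_measurable borel" "psi1 e \<in> borel_measurable borel" "psi2 e \<in> borel_measurable borel"
  by (intro borel_measurable_continuous_onI; simp add: continuous_on_eq_continuous_at psi_isCont psi1_isCont psi2_isCont)+

lemma psi_integrable:
  fixes u :: "real \<Rightarrow> real"
  assumes "0 \<le> e" "a < e" "u \<in> borel_measurable borel" "\<And>t. \<bar>u t\<bar> \<le> C * exp (a * \<bar>t\<bar>)"
  shows "integrable lborel (\<lambda>t. psi e t * u t)"
proof (rule integrable_exp_bound[where b = "e - a" and C = "2 * C"])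
  fix t
  have "\<bar>psi e t * u t\<bar> \<le> (2 * exp (- e * \<bar>t\<bar>)) * (C * exp (a * \<bar>t\<bar>))"
    unfolding abs_mult using psi_pos[of e t] psi_le_exp[OF assms(1), of t] assms(4)[of t]
    by (intro mult_mono) auto
  also have "\<dots> = 2 * C * exp (- (e - a) * \<bar>t\<bar>)" by (simp add: algebra_simps flip: exp_add)
  finally show "\<bar>psi e t * u t\<bar> \<le> 2 * C * exp (- (e - a) * \<bar>t\<bar>)" .
qed (use assms in auto)

lemma psi_integral_le: "e > 0 \<Longrightarrow> (\<integral>t. psi e t \<partial>lborel) \<le> 4 / e"
proof -
  assume e: "e > 0"
  have "(\<integral>t. psi e t \<partial>lborel) \<le> (\<integral>t. 2 * exp (- e * \<bar>t\<bar>) \<partial>lborel)"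
    using psi_integrable[of e 0 "\<lambda>_. 1" 1] e psi_le_exp integrable_exp_abs(1)[OF e]
    by (intro integral_mono) auto
  then show ?thesis using integrable_exp_abs(2)[OF e] by simp
qed

text \<open>Fatou's lemma as \<open>e\<close> tends to 0, since the weights converge pointwise to
  1.\<close>

lemma integrable_of_psi_bound:
  fixes u :: "real \<Rightarrow> real"
  assumes [measurable]: "u \<in> borel_measurable borel" and "\<And>t. u t \<ge> 0"
    and "e0 > 0" "\<And>e. 0 < e \<Longrightarrow> e < e0 \<Longrightarrow> integrable lborel (\<lambda>t. psi e t * u t) \<and> (\<integral>t. psi e t * u t \<partial>lborel) \<le> B"
  shows "integrable lborel u" "(\<integral>t. u t \<partial>lborel) \<le> B"
proof -
  define e where "e n = e0 / (2 + real n)" for n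
  have e: "0 < e n" "e n < e0" for n
    using assms(3) by (auto simp: e_def field_simps intro: add_pos_nonneg)
  have e_lim: "e \<longlonglongrightarrow> 0" unfolding e_def using assms(3) by real_asymp
  have B: "B \<ge> 0"
  proof -
    have "0 \<le> (\<integral>t. psi (e 0) t * u t \<partial>lborel)"
      using assms(2) psi_pos[of "e 0"] by (intro integral_nonneg_AE AE_I2 mult_nonneg_nonneg) (auto intro: less_imp_le)
    then show ?thesis using assms(4)[OF e(1,2)[of 0]] by linarith
  qed
  have "(\<integral>\<^sup>+t. ennreal (u t) \<partial>lborel) = (\<integral>\<^sup>+t. liminf (\<lambda>n. ennreal (psi (e n) t * u t)) \<partial>lborel)"
  proof (rule nn_integral_cong)
    fix t
    have "(\<lambda>n. psi (e n) t * u t) \<longlonglongrightarrow> (1 / cosh (0 * t)) * u t"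
      unfolding psi_def by (intro tendsto_intros e_lim) auto
    then have "(\<lambda>n. ennreal (psi (e n) t * u t)) \<longlonglongrightarrow> ennreal (u t)" by (intro tendsto_ennrealI) simp
    then show "ennreal (u t) = liminf (\<lambda>n. ennreal (psi (e n) t * u t))"
      by (simp add: lim_imp_Liminf)
  qed
  also have "\<dots> \<le> liminf (\<lambda>n. \<integral>\<^sup>+t. ennreal (psi (e n) t * u t) \<partial>lborel)"
    by (rule nn_integral_liminf) simp
  also have "\<dots> \<le> liminf (\<lambda>n. ennreal B)"
  proof (rule Liminf_mono, rule always_eventually, rule allI)
    fix n
    have "(\<integral>\<^sup>+t. ennreal (psi (e n) t * u t) \<partial>lborel) = ennreal (\<integral>t. psi (e n) t * u t \<partial>lborel)"
      using assms(4)[OF e(1,2)[of n]] assms(2) psi_pos[of "e n"]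
      by (intro nn_integral_eq_integral AE_I2 mult_nonneg_nonneg) (auto intro: less_imp_le)
    then show "(\<integral>\<^sup>+t. ennreal (psi (e n) t * u t) \<partial>lborel) \<le> ennreal B"
      using assms(4)[OF e(1,2)[of n]] by (simp add: ennreal_leI)
  qed
  finally have *: "(\<integral>\<^sup>+t. ennreal (u t) \<partial>lborel) \<le> ennreal B" by (simp add: Liminf_const)
  then show "integrable lborel u"
    using assms(2) by (intro integrableI_nonneg) (auto simp: less_top[symmetric] top_unique)
  then show "(\<integral>t. u t \<partial>lborel) \<le> B"
    using * assms(2) B by (subst (asm) nn_integral_eq_integral) auto
qed

lemma psi_tendsto_0:
  assumes "0 < e" "a < e" "\<And>t. \<bar>u t\<bar> \<le> C * exp (a * \<bar>t\<bar>)"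
  shows "((\<lambda>t. psi e t * u t) \<longlongrightarrow> 0) at_top" "((\<lambda>t. psi e t * u t) \<longlongrightarrow> 0) at_bot"
proof -
  have le: "\<bar>psi e t * u t\<bar> \<le> 2 * C * exp (- (e - a) * \<bar>t\<bar>)" for t
  proof -
    have "\<bar>psi e t * u t\<bar> \<le> (2 * exp (- e * \<bar>t\<bar>)) * (C * exp (a * \<bar>t\<bar>))"
      unfolding abs_mult using psi_pos[of e t] psi_le_exp[of e t] assms
      by (intro mult_mono) auto
    also have "\<dots> = 2 * C * exp (- (e - a) * \<bar>t\<bar>)" by (simp add: algebra_simps flip: exp_add)
    finally show ?thesis .
  qed
  define k where "k = e - a"
  have k: "k > 0" using assms by (simp add: k_def)
  have 1: "((\<lambda>t. 2 * C * exp (- k * \<bar>t\<bar>)) \<longlongrightarrow> 0) at_top" "((\<lambda>t. 2 * C * exp (- k * \<bar>t\<bar>)) \<longlongrightarrow> 0) at_bot"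
    using k by real_asymp+
  show "((\<lambda>t. psi e t * u t) \<longlongrightarrow> 0) at_top" "((\<lambda>t. psi e t * u t) \<longlongrightarrow> 0) at_bot"
    by (rule Lim_null_comparison[OF _ 1(1)], use le k_def in simp,
        rule Lim_null_comparison[OF _ 1(2)], use le k_def in simp)
qed

text \<open>A smoothed local energy of the derivative around \<open>t\<close>. It bounds the
  increments of \<open>w\<close> from \<open>t\<close>, and its weighted integral returns the
  weighted integral of the square of \<open>w1\<close>.\<close>

definition osc :: "real \<Rightarrow> (real \<Rightarrow> real) \<Rightarrow> real \<Rightarrow> real" where
  "osc b w1 t = (\<integral>r. exp (- b * \<bar>r\<bar>) * (w1 (t - r))\<^sup>2 \<partial>lborel)"

context
  fixes w w1 :: "real \<Rightarrow> real" and a b C :: real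
  assumes w: "\<And>t. (w has_real_derivative w1 t) (at t)" and w1: "\<And>t. isCont w1 t"
    and bd: "\<And>t. \<bar>w1 t\<bar> \<le> C * exp (a * \<bar>t\<bar>)" and a: "0 \<le> a" "2 * a < b"
begin

lemma w1_meas: "w1 \<in> borel_measurable borel"
  using w1 by (intro borel_measurable_continuous_onI) (auto simp: continuous_on_eq_continuous_at)

lemma osc_integrand_bound:
  "exp (- b * \<bar>r\<bar>) * (w1 (t - r))\<^sup>2 \<le> C\<^sup>2 * exp (2 * a * \<bar>t\<bar>) * exp (- (b - 2 * a) * \<bar>r\<bar>)"
proof -
  have C: "C \<ge> 0" using order_trans[OF abs_ge_zero bd[of 0]] by simp
  have "\<bar>w1 (t - r)\<bar> \<le> C * exp (a * (\<bar>t\<bar> + \<bar>r\<bar>))"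
    by (rule order_trans[OF bd]) (use C a in \<open>auto intro!: mult_left_mono\<close>)
  then have "(w1 (t - r))\<^sup>2 \<le> (C * exp (a * (\<bar>t\<bar> + \<bar>r\<bar>)))\<^sup>2"
    by (metis abs_ge_zero power2_abs power_mono)
  then have "exp (- b * \<bar>r\<bar>) * (w1 (t - r))\<^sup>2 \<le> exp (- b * \<bar>r\<bar>) * (C * exp (a * (\<bar>t\<bar> + \<bar>r\<bar>)))\<^sup>2"
    by (rule mult_left_mono) simp
  also have "\<dots> = C\<^sup>2 * exp (2 * a * \<bar>t\<bar>) * exp (- (b - 2 * a) * \<bar>r\<bar>)"
    by (simp add: power_mult_distrib power2_eq_square algebra_simps flip: exp_add)
  finally show ?thesis .
qed

lemma osc_integrable: "integrable lborel (\<lambda>r. exp (- b * \<bar>r\<bar>) * (w1 (t - r))\<^sup>2)"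
  supply w1_meas [measurable] by (rule integrable_exp_bound[where b = "b - 2 * a"]) (use a osc_integrand_bound in auto)

lemma osc_nonneg: "0 \<le> osc b w1 t" by (simp add: osc_def)

lemma osc_measurable: "osc b w1 \<in> borel_measurable borel"
  supply w1_meas [measurable] unfolding osc_def[abs_def] by simp

lemma osc_bound: "\<bar>osc b w1 t\<bar> \<le> C\<^sup>2 * (2 / (b - 2 * a)) * exp (2 * a * \<bar>t\<bar>)"
proof -
  have "osc b w1 t \<le> (\<integral>r. C\<^sup>2 * exp (2 * a * \<bar>t\<bar>) * exp (- (b - 2 * a) * \<bar>r\<bar>) \<partial>lborel)"
    unfolding osc_def
    by (rule integral_mono[OF osc_integrable]) (use a osc_integrand_bound in \<open>auto intro!: integrable_exp_abs(1)[of "b - 2 * a", simplified]\<close>)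
  also have "\<dots> = C\<^sup>2 * exp (2 * a * \<bar>t\<bar>) * (2 / (b - 2 * a))"
    using integrable_exp_abs(2)[of "b - 2 * a"] a by simp
  finally show ?thesis using osc_nonneg by (simp add: mult_ac)
qed

lemma integral_square_le_osc:
  assumes "\<And>y. y \<in> {l..u} \<Longrightarrow> \<bar>y - t\<bar> \<le> D"
  shows "integral {l..u} (\<lambda>y. (w1 y)\<^sup>2) \<le> exp (b * D) * osc b w1 t"
proof -
  have c: "continuous_on {l..u} (\<lambda>y. (w1 y)\<^sup>2)"
    using w1 by (auto intro!: continuous_intros continuous_at_imp_continuous_on)
  have eq: "osc b w1 t = (\<integral>y. exp (- b * \<bar>y - t\<bar>) * (w1 y)\<^sup>2 \<partial>lborel)"
    unfolding osc_def by (subst lborel_integral_real_affine[where c = "-1" and t = t]) (auto simp: abs_minus_commute)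
  have i: "integrable lborel (\<lambda>y. exp (- b * \<bar>y - t\<bar>) * (w1 y)\<^sup>2)"
    using lborel_integrable_real_affine[OF osc_integrable[of t], of "-1" t] by (simp add: abs_minus_commute)
  have "integral {l..u} (\<lambda>y. (w1 y)\<^sup>2) = (LINT y:{l..u}|lborel. (w1 y)\<^sup>2)"
    by (rule set_borel_integral_eq_integral(2)[symmetric], rule borel_integrable_atLeastAtMost'[OF c])
  also have "\<dots> \<le> (\<integral>y. exp (b * D) * (exp (- b * \<bar>y - t\<bar>) * (w1 y)\<^sup>2) \<partial>lborel)"
    unfolding set_lebesgue_integral_def
  proof (rule integral_mono)
    show "integrable lborel (\<lambda>y. indicator {l..u} y *\<^sub>R (w1 y)\<^sup>2)"
      using borel_integrable_atLeastAtMost'[OF c] by (simp add: set_integrable_def)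
    show "integrable lborel (\<lambda>y. exp (b * D) * (exp (- b * \<bar>y - t\<bar>) * (w1 y)\<^sup>2))"
      using i by simp
    fix y
    show "indicator {l..u} y *\<^sub>R (w1 y)\<^sup>2 \<le> exp (b * D) * (exp (- b * \<bar>y - t\<bar>) * (w1 y)\<^sup>2)"
    proof (cases "y \<in> {l..u}")
      case True
      have "exp 0 \<le> exp (b * D + - b * \<bar>y - t\<bar>)"
        using assms[OF True] a by (subst exp_le_cancel_iff) (auto intro: mult_left_mono)
      then have "1 \<le> exp (b * D) * exp (- b * \<bar>y - t\<bar>)" by (simp only: exp_add exp_zero)
      then have "1 * (w1 y)\<^sup>2 \<le> (exp (b * D) * exp (- b * \<bar>y - t\<bar>)) * (w1 y)\<^sup>2"
        by (intro mult_right_mono) auto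
      then show ?thesis using True by (simp add: mult.assoc)
    qed auto
  qed
  also have "\<dots> = exp (b * D) * osc b w1 t" by (simp add: eq)
  finally show ?thesis .
qed

text \<open>Cauchy-Schwarz for the integral of \<open>w1\<close> between \<open>t\<close> and
  \<open>x\<close>; the length of the interval and the weight lost in \<open>osc\<close> are both
  absorbed in the exponential.\<close>

lemma increment_le_osc: "\<bar>w x - w t\<bar> \<le> sqrt (osc b w1 t / b) * exp (b * \<bar>x - t\<bar>)"
proof -
  have b: "b > 0" using a by simp
  define l u where "l = min x t" and "u = max x t"
  have lu: "l \<le> u" "\<And>y. y \<in> {l..u} \<Longrightarrow> \<bar>y - t\<bar> \<le> \<bar>x - t\<bar>" "u - l = \<bar>x - t\<bar>"
    "\<bar>w x - w t\<bar> = \<bar>w u - w l\<bar>" by (auto simp: l_def u_def min_def max_def split: if_splits)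
  \<comment> \<open>Young's inequality with a free parameter replaces Cauchy-Schwarz, so that the
    square root appears only with the choice of \<open>s\<close>.\<close>
  have *: "\<bar>w x - w t\<bar> \<le> (s / b + osc b w1 t / s) / 2 * exp (b * \<bar>x - t\<bar>)" if s: "s > 0" for s
  proof -
    have c: "continuous_on {l..u} w1"
      using w1 by (auto intro!: continuous_at_imp_continuous_on)
    have ftc: "(w1 has_integral (w u - w l)) {l..u}"
      by (rule fundamental_theorem_of_calculus)
         (use lu(1) in \<open>auto intro: has_field_derivative_at_within[OF w]
            simp: has_real_derivative_iff_has_vector_derivative[symmetric]\<close>)
    have "\<bar>w u - w l\<bar> = \<bar>integral {l..u} w1\<bar>" using integral_unique[OF ftc] by simp
    also have "\<dots> \<le> integral {l..u} (\<lambda>y. s / 2 + (w1 y)\<^sup>2 * (1 / (2 * s)))"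
    proof (rule integral_norm_bound_integral[where f = w1, unfolded real_norm_def])
      show "w1 integrable_on {l..u}" using ftc by auto
      show "(\<lambda>y. s / 2 + (w1 y)\<^sup>2 * (1 / (2 * s))) integrable_on {l..u}"
        using c by (intro integrable_continuous_interval continuous_intros)
      fix y
      have "0 \<le> (s - \<bar>w1 y\<bar>)\<^sup>2 / (2 * s)" using s by simp
      also have "\<dots> = s / 2 + (w1 y)\<^sup>2 * (1 / (2 * s)) - \<bar>w1 y\<bar>"
        using s by (simp add: power2_diff field_simps power2_eq_square)
      finally show "\<bar>w1 y\<bar> \<le> s / 2 + (w1 y)\<^sup>2 * (1 / (2 * s))" by simp
    qed
    also have "\<dots> = integral {l..u} (\<lambda>y. s / 2) + integral {l..u} (\<lambda>y. (w1 y)\<^sup>2 * (1 / (2 * s)))"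
      using c by (intro integral_add integrable_continuous_interval continuous_intros)
    also have "integral {l..u} (\<lambda>y. (w1 y)\<^sup>2 * (1 / (2 * s))) = integral {l..u} (\<lambda>y. (w1 y)\<^sup>2) * (1 / (2 * s))"
      by (rule integral_mult_left)
    also have "\<dots> \<le> (exp (b * \<bar>x - t\<bar>) * osc b w1 t) * (1 / (2 * s))"
      using s lu by (intro mult_right_mono integral_square_le_osc) auto
    also have "integral {l..u} (\<lambda>y. s / 2) = \<bar>x - t\<bar> * (s / 2)" using lu by simp
    also have "\<bar>x - t\<bar> * (s / 2) \<le> (exp (b * \<bar>x - t\<bar>) / b) * (s / 2)"
    proof (rule mult_right_mono)
      have "b * \<bar>x - t\<bar> \<le> exp (b * \<bar>x - t\<bar>)" using exp_ge_add_one_self[of "b * \<bar>x - t\<bar>"] by linarith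
      then show "\<bar>x - t\<bar> \<le> exp (b * \<bar>x - t\<bar>) / b" using b by (simp add: field_simps)
    qed (use s in auto)
    finally show ?thesis using s b lu(4) by (simp add: field_simps)
  qed
  show ?thesis
  proof (cases "osc b w1 t = 0")
    case True
    \<comment> \<open>When \<open>osc\<close> vanishes there is no optimal parameter; it is sent to
      0 instead.\<close>
    have "\<bar>w x - w t\<bar> \<le> 0 + \<epsilon>" if "\<epsilon> > 0" for \<epsilon>
      using *[of "2 * b * \<epsilon> / exp (b * \<bar>x - t\<bar>)"] that b True by simp
    then have "\<bar>w x - w t\<bar> \<le> 0" by (rule field_le_epsilon)
    then show ?thesis using True by simp
  next
    case False
    then have Z: "osc b w1 t > 0" using osc_nonneg[of t] by linarith
    define q where "q = sqrt (osc b w1 t / b)"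
    have q: "q > 0" "osc b w1 t = b * q\<^sup>2" using Z b by (auto simp: q_def)
    \<comment> \<open>The choice \<open>s = b * q\<close> makes the two summands equal.\<close>
    have eq: "(b * q / b + osc b w1 t / (b * q)) / 2 = q"
      using b q by (simp add: power2_eq_square)
    have "\<bar>w x - w t\<bar> \<le> (b * q / b + osc b w1 t / (b * q)) / 2 * exp (b * \<bar>x - t\<bar>)"
      by (rule *) (use b q(1) in simp)
    then show ?thesis unfolding eq unfolding q_def .
  qed
qed

text \<open>Transposing the convolution puts the weight under
  \<open>exp (- b * \<bar>r\<bar>)\<close>; \<open>psi_shift\<close> gives it back at the price
  \<open>exp (e * \<bar>r\<bar>)\<close>, and \<open>2 / (b - e)\<close> is the integral of what
  remains.\<close>

lemma psi_osc:
  assumes "0 < e" "2 * a < e" "e < b"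
  shows "integrable lborel (\<lambda>t. psi e t * osc b w1 t)" (is ?A)
    and "(\<integral>t. psi e t * osc b w1 t \<partial>lborel) \<le> 2 / (b - e) * (\<integral>t. psi e t * (w1 t)\<^sup>2 \<partial>lborel)" (is ?B)
proof -
  note w1_meas [measurable]
  show A: ?A
    by (rule psi_integrable[OF _ assms(2) osc_measurable osc_bound]) (use assms in auto)
  have i1: "integrable lborel (\<lambda>t. psi e t * (w1 t)\<^sup>2)"
  proof (rule psi_integrable[OF _ assms(2)])
    fix t
    have "(w1 t)\<^sup>2 \<le> (C * exp (a * \<bar>t\<bar>))\<^sup>2" using bd[of t] by (metis abs_ge_zero power2_abs power_mono)
    then show "\<bar>(w1 t)\<^sup>2\<bar> \<le> C\<^sup>2 * exp (2 * a * \<bar>t\<bar>)"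
      by (simp add: power_mult_distrib power2_eq_square algebra_simps flip: exp_add)
  qed (use assms in auto)
  have "ennreal (\<integral>t. psi e t * osc b w1 t \<partial>lborel) = (\<integral>\<^sup>+t. ennreal (psi e t * osc b w1 t) \<partial>lborel)"
    using A osc_nonneg psi_pos
    by (intro nn_integral_eq_integral[symmetric] AE_I2 mult_nonneg_nonneg) (auto intro: less_imp_le)
  also have "\<dots> = (\<integral>\<^sup>+t. ennreal (psi e t) * (\<integral>\<^sup>+r. ennreal (exp (- b * \<bar>r\<bar>)) * ennreal ((w1 (t - r))\<^sup>2) \<partial>lborel) \<partial>lborel)"
  proof (rule nn_integral_cong)
    fix t
    have "ennreal (osc b w1 t) = (\<integral>\<^sup>+r. ennreal (exp (- b * \<bar>r\<bar>) * (w1 (t - r))\<^sup>2) \<partial>lborel)"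
      unfolding osc_def using osc_integrable by (intro nn_integral_eq_integral[symmetric]) auto
    then show "ennreal (psi e t * osc b w1 t) = ennreal (psi e t) * (\<integral>\<^sup>+r. ennreal (exp (- b * \<bar>r\<bar>)) * ennreal ((w1 (t - r))\<^sup>2) \<partial>lborel)"
      using psi_pos[of e t] osc_nonneg[of t] by (simp add: ennreal_mult)
  qed
  also have "\<dots> = (\<integral>\<^sup>+s. ennreal ((w1 s)\<^sup>2) * (\<integral>\<^sup>+r. ennreal (exp (- b * \<bar>r\<bar>)) * ennreal (psi e (s + r)) \<partial>lborel) \<partial>lborel)"
    by (rule nn_integral_convolution_swap) (auto intro: sigma_finite_lborel)
  also have "\<dots> \<le> (\<integral>\<^sup>+s. ennreal ((w1 s)\<^sup>2) * (ennreal (psi e s) * ennreal (2 / (b - e))) \<partial>lborel)"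
  proof (intro nn_integral_mono mult_left_mono)
    fix s
    have "(\<integral>\<^sup>+r. ennreal (exp (- b * \<bar>r\<bar>)) * ennreal (psi e (s + r)) \<partial>lborel)
        \<le> (\<integral>\<^sup>+r. ennreal (psi e s) * ennreal (exp (- (b - e) * \<bar>r\<bar>)) \<partial>lborel)"
    proof (rule nn_integral_mono)
      fix r
      have "exp (- b * \<bar>r\<bar>) * psi e (s + r) \<le> exp (- b * \<bar>r\<bar>) * (exp (e * \<bar>r\<bar>) * psi e s)"
        by (rule mult_left_mono[OF psi_shift]) (use assms in auto)
      also have "\<dots> = psi e s * exp (- (b - e) * \<bar>r\<bar>)" by (simp add: algebra_simps flip: exp_add)
      finally show "ennreal (exp (- b * \<bar>r\<bar>)) * ennreal (psi e (s + r)) \<le> ennreal (psi e s) * ennreal (exp (- (b - e) * \<bar>r\<bar>))"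
        using psi_pos[of e s] psi_pos[of e "s + r"] by (simp flip: ennreal_mult add: ennreal_leI)
    qed
    also have "\<dots> = ennreal (psi e s) * (\<integral>\<^sup>+r. ennreal (exp (- (b - e) * \<bar>r\<bar>)) \<partial>lborel)"
      by (rule nn_integral_cmult) simp
    also have "(\<integral>\<^sup>+r. ennreal (exp (- (b - e) * \<bar>r\<bar>)) \<partial>lborel) = ennreal (2 / (b - e))"
      using integrable_exp_abs[of "b - e"] assms by (subst nn_integral_eq_integral) auto
    finally show "(\<integral>\<^sup>+r. ennreal (exp (- b * \<bar>r\<bar>)) * ennreal (psi e (s + r)) \<partial>lborel) \<le> ennreal (psi e s) * ennreal (2 / (b - e))" .
  qed simp
  also have "\<dots> = (\<integral>\<^sup>+s. ennreal (2 / (b - e)) * ennreal (psi e s * (w1 s)\<^sup>2) \<partial>lborel)"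
    using psi_pos[of e] by (intro nn_integral_cong) (simp add: ennreal_mult less_imp_le mult_ac)
  also have "\<dots> = ennreal (2 / (b - e)) * ennreal (\<integral>t. psi e t * (w1 t)\<^sup>2 \<partial>lborel)"
    using i1 psi_pos[of e]
    by (subst nn_integral_cmult, simp, subst nn_integral_eq_integral)
       auto
  also have "\<dots> = ennreal (2 / (b - e) * (\<integral>t. psi e t * (w1 t)\<^sup>2 \<partial>lborel))"
    using assms by (subst ennreal_mult) auto
  finally show ?B
    using assms by (subst (asm) ennreal_le_iff) auto
qed

end

section \<open>The weighted energy estimate\<close>

context exp_moment_measure
begin

lemma weighted_square_conv:
  fixes w :: "real \<Rightarrow> real"
  assumes [measurable]: "w \<in> borel_measurable borel" and w: "\<And>t. \<bar>w t\<bar> \<le> C * exp (a * \<bar>t\<bar>)"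
    and a: "0 \<le> a" "0 \<le> rho - 2 * a" "rho + 2 * a \<le> m2"
  shows "integrable M (\<lambda>r. exp (- rho * r) * (w (t - r))\<^sup>2)"
    and "\<bar>\<integral>r. exp (- rho * r) * (w (t - r))\<^sup>2 \<partial>M\<bar>
      \<le> C\<^sup>2 * (\<integral>r. exp (- rho * r) * exp (2 * a * \<bar>r\<bar>) \<partial>M) * exp (2 * a * \<bar>t\<bar>)"
proof -
  have C: "C \<ge> 0" using order_trans[OF abs_ge_zero w[of 0]] by simp
  have le: "exp (- rho * r) * (w (t - r))\<^sup>2 \<le> C\<^sup>2 * exp (2 * a * \<bar>t\<bar>) * (exp (- rho * r) * exp (2 * a * \<bar>r\<bar>))" for r
  proof -
    have "\<bar>w (t - r)\<bar> \<le> C * exp (a * (\<bar>t\<bar> + \<bar>r\<bar>))"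
      by (rule order_trans[OF w]) (use C a in \<open>auto intro!: mult_left_mono\<close>)
    then have "(w (t - r))\<^sup>2 \<le> (C * exp (a * (\<bar>t\<bar> + \<bar>r\<bar>)))\<^sup>2"
      by (metis abs_ge_zero power2_abs power_mono)
    then have "exp (- rho * r) * (w (t - r))\<^sup>2 \<le> exp (- rho * r) * (C * exp (a * (\<bar>t\<bar> + \<bar>r\<bar>)))\<^sup>2"
      by (rule mult_left_mono) simp
    also have "\<dots> = C\<^sup>2 * exp (2 * a * \<bar>t\<bar>) * (exp (- rho * r) * exp (2 * a * \<bar>r\<bar>))"
      by (simp add: power_mult_distrib power2_eq_square algebra_simps flip: exp_add)
    finally show ?thesis .
  qed
  have i: "integrable M (\<lambda>r. exp (- rho * r) * exp (2 * a * \<bar>r\<bar>))"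
    by (rule integrable_bound_exp[where b = "2 * a" and C = 1]) (use a in \<open>auto simp: abs_mult\<close>)
  show i2: "integrable M (\<lambda>r. exp (- rho * r) * (w (t - r))\<^sup>2)"
    by (rule integrable_bound_exp[where b = "2 * a" and z = rho and C = "C\<^sup>2 * exp (2 * a * \<bar>t\<bar>)"])
       (use a le in auto)
  have "(\<integral>r. exp (- rho * r) * (w (t - r))\<^sup>2 \<partial>M) \<le> (\<integral>r. C\<^sup>2 * exp (2 * a * \<bar>t\<bar>) * (exp (- rho * r) * exp (2 * a * \<bar>r\<bar>)) \<partial>M)"
    by (rule integral_mono[OF i2 _ le]) (use i in auto)
  also have "\<dots> = C\<^sup>2 * exp (2 * a * \<bar>t\<bar>) * (\<integral>r. exp (- rho * r) * exp (2 * a * \<bar>r\<bar>) \<partial>M)"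
    by (rule integral_mult_right_zero)
  finally show "\<bar>\<integral>r. exp (- rho * r) * (w (t - r))\<^sup>2 \<partial>M\<bar>
      \<le> C\<^sup>2 * (\<integral>r. exp (- rho * r) * exp (2 * a * \<bar>r\<bar>) \<partial>M) * exp (2 * a * \<bar>t\<bar>)"
    by (simp add: mult_ac)
qed

text \<open>After transposition the weight is expanded to second order in the shift: order 0 gives
  \<open>kap rho\<close>, order 1 gives \<open>kap1 rho\<close> with \<open>psi1\<close>, and
  \<open>M2\<close> bounds the rest.\<close>

lemma psi_weighted_square_conv:
  fixes w :: "real \<Rightarrow> real"
  assumes wm[measurable]: "w \<in> borel_measurable borel" and w: "\<And>t. \<bar>w t\<bar> \<le> C * exp (a * \<bar>t\<bar>)"
    and a: "0 \<le> a" "2 * a < e" "0 < rho - e" "rho + e < m2" and e: "0 < e"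
  defines "M2 \<equiv> (\<integral>r. \<bar>r\<bar>\<^sup>2 * (exp (- rho * r) * exp (e * \<bar>r\<bar>)) \<partial>M)"
  shows "(\<integral>t. psi e t * (\<integral>r. exp (- rho * r) * (w (t - r))\<^sup>2 \<partial>M) \<partial>lborel)
    \<le> (\<integral>s. (w s)\<^sup>2 * (psi e s * kap rho + psi1 e s * kap1 rho + e\<^sup>2 / 2 * M2 * psi e s) \<partial>lborel)"
    (is "?L \<le> (\<integral>s. ?R s \<partial>lborel)")
proof -
  note N2 = weighted_square_conv[OF wm w a(1), of rho]
  have sq: "\<bar>(w t)\<^sup>2\<bar> \<le> C\<^sup>2 * exp (2 * a * \<bar>t\<bar>)" for t
  proof -
    have "(w t)\<^sup>2 \<le> (C * exp (a * \<bar>t\<bar>))\<^sup>2" using w[of t] by (metis abs_ge_zero power2_abs power_mono)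
    then show ?thesis by (simp add: power_mult_distrib power2_eq_square algebra_simps flip: exp_add)
  qed
  have I2: "integrable lborel (\<lambda>t. psi e t * (w t)\<^sup>2)"
    by (rule psi_integrable[OF _ _ _ sq]) (use a e in auto)
  have I1: "integrable lborel (\<lambda>t. psi1 e t * (w t)\<^sup>2)"
    by (rule Bochner_Integration.integrable_bound[OF integrable_mult_right[OF I2, of e]])
       (use psi1_bound[of e] e in \<open>auto simp: abs_mult intro!: mult_right_mono simp flip: mult.assoc\<close>)
  have iM2: "integrable M (\<lambda>r. \<bar>r\<bar>\<^sup>2 * (exp (- rho * r) * exp (e * \<bar>r\<bar>)))"
    by (rule integrable_power_exp) (use a e in auto)
  have eqR: "(\<lambda>s. psi e s * (w s)\<^sup>2 * (kap rho + e\<^sup>2 / 2 * M2) + psi1 e s * (w s)\<^sup>2 * kap1 rho) = ?R"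
    by (auto simp: algebra_simps)
  have IR: "integrable lborel ?R"
    unfolding eqR[symmetric] using I1 I2 by (intro Bochner_Integration.integrable_add integrable_mult_left)
  have inner: "(\<integral>r. exp (- rho * r) * psi e (s + r) \<partial>M) \<le> psi e s * kap rho + psi1 e s * kap1 rho + e\<^sup>2 / 2 * M2 * psi e s"
    and inner_i: "integrable M (\<lambda>r. exp (- rho * r) * psi e (s + r))" for s
  proof -
    show i: "integrable M (\<lambda>r. exp (- rho * r) * psi e (s + r))"
      by (rule integrable_bound_exp[where b = 0 and z = rho and C = 1])
         (use a e psi_le_1 in \<open>auto simp: abs_mult intro: mult_left_mono\<close>)
    have i': "integrable M (\<lambda>r. exp (- rho * r))" "integrable M (\<lambda>r. r * exp (- rho * r))"
      using a e by (auto intro!: integrable_exp[of rho, simplified] integrable_id_exp[of rho, simplified])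
    have "(\<integral>r. exp (- rho * r) * psi e (s + r) \<partial>M)
       \<le> (\<integral>r. psi e s * exp (- rho * r) + psi1 e s * (r * exp (- rho * r))
           + e\<^sup>2 / 2 * psi e s * (\<bar>r\<bar>\<^sup>2 * (exp (- rho * r) * exp (e * \<bar>r\<bar>))) \<partial>M)"
    proof (rule integral_mono[OF i])
      fix r
      have "exp (- rho * r) * psi e (s + r) \<le> exp (- rho * r) *
         (psi e s + r * psi1 e s + e\<^sup>2 / 2 * (r\<^sup>2 * exp (e * \<bar>r\<bar>)) * psi e s)"
        by (rule mult_left_mono[OF psi_second_order]) (use e in auto)
      then show "exp (- rho * r) * psi e (s + r) \<le> psi e s * exp (- rho * r) + psi1 e s * (r * exp (- rho * r))
           + e\<^sup>2 / 2 * psi e s * (\<bar>r\<bar>\<^sup>2 * (exp (- rho * r) * exp (e * \<bar>r\<bar>)))"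
        by (simp add: algebra_simps)
    qed (use i' iM2 in simp)
    also have "\<dots> = psi e s * kap rho + psi1 e s * kap1 rho + e\<^sup>2 / 2 * psi e s * M2"
      unfolding kap_def kap1_def M2_def using i' iM2 by simp
    finally show "(\<integral>r. exp (- rho * r) * psi e (s + r) \<partial>M) \<le> psi e s * kap rho + psi1 e s * kap1 rho + e\<^sup>2 / 2 * M2 * psi e s"
      by (simp add: mult_ac)
  qed
  have q0: "0 \<le> psi e s * kap rho + psi1 e s * kap1 rho + e\<^sup>2 / 2 * M2 * psi e s" for s
    by (rule order_trans[OF _ inner]) simp
  have iL: "integrable lborel (\<lambda>t. psi e t * (\<integral>r. exp (- rho * r) * (w (t - r))\<^sup>2 \<partial>M))"
    by (rule psi_integrable[OF _ _ _ N2(2)]) (use a e in auto)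
  have "ennreal ?L = (\<integral>\<^sup>+t. ennreal (psi e t * (\<integral>r. exp (- rho * r) * (w (t - r))\<^sup>2 \<partial>M)) \<partial>lborel)"
    using iL by (intro nn_integral_eq_integral[symmetric]) auto
  also have "\<dots> = (\<integral>\<^sup>+t. ennreal (psi e t) * (\<integral>\<^sup>+r. ennreal (exp (- rho * r)) * ennreal ((w (t - r))\<^sup>2) \<partial>M) \<partial>lborel)"
  proof (rule nn_integral_cong)
    fix t
    have "ennreal (\<integral>r. exp (- rho * r) * (w (t - r))\<^sup>2 \<partial>M) = (\<integral>\<^sup>+r. ennreal (exp (- rho * r) * (w (t - r))\<^sup>2) \<partial>M)"
      using N2(1)[of t] a e by (intro nn_integral_eq_integral[symmetric]) auto
    then show "ennreal (psi e t * (\<integral>r. exp (- rho * r) * (w (t - r))\<^sup>2 \<partial>M)) = ennreal (psi e t) * (\<integral>\<^sup>+r. ennreal (exp (- rho * r)) * ennreal ((w (t - r))\<^sup>2) \<partial>M)"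
      by (simp add: ennreal_mult)
  qed
  also have "\<dots> = (\<integral>\<^sup>+s. ennreal ((w s)\<^sup>2) * (\<integral>\<^sup>+r. ennreal (exp (- rho * r)) * ennreal (psi e (s + r)) \<partial>M) \<partial>lborel)"
    by (rule nn_integral_convolution_swap) (auto intro: sigma_finite_measure_axioms)
  also have "\<dots> \<le> (\<integral>\<^sup>+s. ennreal (?R s) \<partial>lborel)"
  proof (rule nn_integral_mono)
    fix s
    have "(\<integral>\<^sup>+r. ennreal (exp (- rho * r)) * ennreal (psi e (s + r)) \<partial>M) = ennreal (\<integral>r. exp (- rho * r) * psi e (s + r) \<partial>M)"
      using inner_i[of s] by (subst nn_integral_eq_integral[symmetric]) (auto simp: ennreal_mult)
    also have "\<dots> \<le> ennreal (psi e s * kap rho + psi1 e s * kap1 rho + e\<^sup>2 / 2 * M2 * psi e s)"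
      by (rule ennreal_leI[OF inner])
    finally show "ennreal ((w s)\<^sup>2) * (\<integral>\<^sup>+r. ennreal (exp (- rho * r)) * ennreal (psi e (s + r)) \<partial>M) \<le> ennreal (?R s)"
      using q0[of s] by (simp add: ennreal_mult mult_left_mono)
  qed
  also have "\<dots> = ennreal (\<integral>s. ?R s \<partial>lborel)"
    using IR q0 by (intro nn_integral_eq_integral) auto
  finally show ?thesis
    using q0 by (subst (asm) ennreal_le_iff) auto
qed

text \<open>Multiply \<open>pde\<close> by the weight and integrate by parts. The zero-order
  convolution terms cancel. The drift and the first moment of the kernel join to
  \<open>d - B * kap1 rho\<close>, which is the derivative of \<open>chf\<close> at
  \<open>rho\<close> when \<open>d = 2 * rho - c\<close>; this is the only coefficient of order
  \<open>e\<close>.\<close>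

lemma energy_estimate:
  fixes w w1 w2 eta :: "real \<Rightarrow> real"
  assumes w: "\<And>t. (w has_real_derivative w1 t) (at t)" "\<And>t. (w1 has_real_derivative w2 t) (at t)"
      "\<And>t. isCont w2 t"
    and bd: "\<And>t. \<bar>w t\<bar> \<le> C * exp (a * \<bar>t\<bar>)" "\<And>t. \<bar>w1 t\<bar> \<le> C * exp (a * \<bar>t\<bar>)"
      "\<And>t. \<bar>w2 t\<bar> \<le> C * exp (a * \<bar>t\<bar>)" "\<And>t. \<bar>eta t\<bar> \<le> C * exp (a * \<bar>t\<bar>)"
    and [measurable]: "eta \<in> borel_measurable borel"
    and a: "0 \<le> a" "2 * a < e" "0 < rho - e" "rho + e < m2" and e: "0 < e" and B: "0 \<le> B"
    and pde: "\<And>t. 0 \<le> w t * w2 t + d * (w t * w1 t) - B / 2 * kap rho * (w t)\<^sup>2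
      + B / 2 * (\<integral>r. exp (- rho * r) * (w (t - r))\<^sup>2 \<partial>M) + \<bar>w t\<bar> * eta t"
  defines "M2 \<equiv> (\<integral>r. \<bar>r\<bar>\<^sup>2 * (exp (- rho * r) * exp (e * \<bar>r\<bar>)) \<partial>M)"
  shows "integrable lborel (\<lambda>t. psi e t * (w t)\<^sup>2)" "integrable lborel (\<lambda>t. psi e t * (w1 t)\<^sup>2)"
    "integrable lborel (\<lambda>t. psi e t * (\<bar>w t\<bar> * eta t))"
    and "(\<integral>t. psi e t * (w1 t)\<^sup>2 \<partial>lborel)
      \<le> (e * \<bar>d - B * kap1 rho\<bar> + e\<^sup>2 * (1 + B / 2 * M2)) / 2 * (\<integral>t. psi e t * (w t)\<^sup>2 \<partial>lborel)
        + (\<integral>t. psi e t * (\<bar>w t\<bar> * eta t) \<partial>lborel)"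
proof -
  have C: "C \<ge> 0" using order_trans[OF abs_ge_zero bd(1)[of 0]] by simp
  have cont: "isCont w t" "isCont w1 t" for t using w(1,2) DERIV_isCont by blast+
  have wm[measurable]: "w \<in> borel_measurable borel" and [measurable]: "w1 \<in> borel_measurable borel" "w2 \<in> borel_measurable borel"
    using cont w(3) by (auto intro!: borel_measurable_continuous_onI continuous_at_imp_continuous_on)
  have prod: "\<bar>x * y\<bar> \<le> C\<^sup>2 * exp (2 * a * \<bar>t\<bar>)" if "\<bar>x\<bar> \<le> C * exp (a * \<bar>t\<bar>)" "\<bar>y\<bar> \<le> C * exp (a * \<bar>t\<bar>)" for x y t
  proof -
    have "\<bar>x * y\<bar> \<le> (C * exp (a * \<bar>t\<bar>)) * (C * exp (a * \<bar>t\<bar>))"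
      unfolding abs_mult using that C by (intro mult_mono) auto
    also have "\<dots> = C\<^sup>2 * exp (2 * a * \<bar>t\<bar>)" by (simp add: power2_eq_square algebra_simps flip: exp_add)
    finally show ?thesis .
  qed
  define N2 where "N2 t = (\<integral>r. exp (- rho * r) * (w (t - r))\<^sup>2 \<partial>M)" for t
  have N2m[measurable]: "N2 \<in> borel_measurable borel" unfolding N2_def[abs_def] by simp
  have N2b: "\<bar>N2 t\<bar> \<le> C\<^sup>2 * (\<integral>r. exp (- rho * r) * exp (2 * a * \<bar>r\<bar>) \<partial>M) * exp (2 * a * \<bar>t\<bar>)" for t
    unfolding N2_def by (rule weighted_square_conv[OF wm bd(1)]) (use a e in auto)
  have int: "integrable lborel (\<lambda>t. psi e t * u t)" if "u \<in> borel_measurable borel" "\<And>t. \<bar>u t\<bar> \<le> K * exp (2 * a * \<bar>t\<bar>)" for u K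
    by (rule psi_integrable[OF _ _ _ that(2)]) (use that a e in auto)
  have Iww2: "integrable lborel (\<lambda>t. psi e t * (w t * w2 t))"
    by (rule int[OF _ prod[OF bd(1) bd(3)]]) simp
  have Iww1: "integrable lborel (\<lambda>t. psi e t * (w t * w1 t))"
    by (rule int[OF _ prod[OF bd(1) bd(2)]]) simp
  show Iw: "integrable lborel (\<lambda>t. psi e t * (w t)\<^sup>2)"
    unfolding power2_eq_square by (rule int[OF _ prod[OF bd(1) bd(1)]]) simp
  show Iw1: "integrable lborel (\<lambda>t. psi e t * (w1 t)\<^sup>2)"
    unfolding power2_eq_square by (rule int[OF _ prod[OF bd(2) bd(2)]]) simp
  have "\<bar>\<bar>w t\<bar>\<bar> \<le> C * exp (a * \<bar>t\<bar>)" for t using bd(1) by simp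
  then show Ie: "integrable lborel (\<lambda>t. psi e t * (\<bar>w t\<bar> * eta t))"
    by (intro int[OF _ prod[OF _ bd(4)]]) auto
  have IN: "integrable lborel (\<lambda>t. psi e t * N2 t)" by (rule int[OF _ N2b]) simp
  have I1: "integrable lborel (\<lambda>t. psi1 e t * (w t)\<^sup>2)"
    by (rule Bochner_Integration.integrable_bound[OF integrable_mult_right[OF Iw, of e]])
       (use psi1_bound[of e] e in \<open>auto simp: abs_mult intro!: mult_right_mono simp flip: mult.assoc\<close>)
  have I2: "integrable lborel (\<lambda>t. psi2 e t * (w t)\<^sup>2)"
    by (rule Bochner_Integration.integrable_bound[OF integrable_mult_right[OF Iw, of "e\<^sup>2"]])
       (use psi2_bound[of e] e in \<open>auto simp: abs_mult intro!: mult_right_mono simp flip: mult.assoc\<close>)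
  \<comment> \<open>\<open>P\<close> collects every boundary term of the integrations by parts; it
    vanishes at both ends, so its derivative \<open>p\<close> has integral 0.\<close>
  define P where "P t = psi e t * (w t * w1 t) - psi1 e t * (w t)\<^sup>2 / 2 + d / 2 * (psi e t * (w t)\<^sup>2)" for t
  define p where "p t = psi e t * (w t * w2 t) + d * (psi e t * (w t * w1 t)) + psi e t * (w1 t)\<^sup>2
      - psi2 e t * (w t)\<^sup>2 / 2 + d / 2 * (psi1 e t * (w t)\<^sup>2)" for t
  have P': "(P has_real_derivative p t) (at t)" for t
    unfolding P_def[abs_def] p_def
    by (auto intro!: derivative_eq_intros psi_deriv psi1_deriv w simp: field_simps power2_eq_square)
  have pc: "isCont p t" for t unfolding p_def[abs_def]
    using cont w(3) psi_isCont psi1_isCont psi2_isCont by (intro continuous_intros) auto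
  have pI: "integrable lborel p" unfolding p_def[abs_def]
    using Iww2 Iww1 Iw1 I2 I1 by simp
  have L1: "((\<lambda>t. psi e t * (w t * w1 t)) \<longlongrightarrow> 0) at_top" "((\<lambda>t. psi e t * (w t * w1 t)) \<longlongrightarrow> 0) at_bot"
    by (rule psi_tendsto_0[OF e a(2) prod[OF bd(1,2)]])+
  have L2: "((\<lambda>t. psi e t * (w t)\<^sup>2) \<longlongrightarrow> 0) at_top" "((\<lambda>t. psi e t * (w t)\<^sup>2) \<longlongrightarrow> 0) at_bot"
    unfolding power2_eq_square by (rule psi_tendsto_0[OF e a(2) prod[OF bd(1,1)]])+
  have L3: "((\<lambda>t. psi1 e t * (w t)\<^sup>2) \<longlongrightarrow> 0) F" if "((\<lambda>t. psi e t * (w t)\<^sup>2) \<longlongrightarrow> 0) F" for F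
  proof (rule Lim_null_comparison)
    show "((\<lambda>t. e * (psi e t * (w t)\<^sup>2)) \<longlongrightarrow> 0) F" using tendsto_mult_right_zero[OF that] .
    show "\<forall>\<^sub>F t in F. norm (psi1 e t * (w t)\<^sup>2) \<le> e * (psi e t * (w t)\<^sup>2)"
      using psi1_bound[of e] e
      by (intro always_eventually allI) (auto simp: abs_mult intro!: mult_right_mono simp flip: mult.assoc)
  qed
  have "(\<integral>t. p t \<partial>lborel) = 0"
  proof (rule integral_deriv_eq_0[OF P' pc pI])
    show "(P \<longlongrightarrow> 0) at_top" unfolding P_def[abs_def]
      using tendsto_add[OF tendsto_diff[OF L1(1) tendsto_divide_zero[OF L3[OF L2(1)], of 2]] tendsto_mult_right_zero[OF L2(1), of "d / 2"]] by simp
    show "(P \<longlongrightarrow> 0) at_bot" unfolding P_def[abs_def]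
      using tendsto_add[OF tendsto_diff[OF L1(2) tendsto_divide_zero[OF L3[OF L2(2)], of 2]] tendsto_mult_right_zero[OF L2(2), of "d / 2"]] by simp
  qed
  define S S1 S2 where "S = (\<integral>t. psi e t * (w t)\<^sup>2 \<partial>lborel)" and "S1 = (\<integral>t. psi1 e t * (w t)\<^sup>2 \<partial>lborel)"
    and "S2 = (\<integral>t. psi2 e t * (w t)\<^sup>2 \<partial>lborel)"
  have S1: "\<bar>S1\<bar> \<le> e * S"
  proof -
    have "\<bar>S1\<bar> \<le> (\<integral>t. e * (psi e t * (w t)\<^sup>2) \<partial>lborel)" unfolding S1_def
      by (rule order_trans[OF integral_norm_bound[where 'a = real, unfolded real_norm_def]],
          rule integral_mono[OF integrable_abs[OF I1] integrable_mult_right[OF Iw]])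
         (use psi1_bound[of e] e in \<open>auto simp: abs_mult intro!: mult_right_mono simp flip: mult.assoc\<close>)
    then show ?thesis by (simp add: S_def)
  qed
  have S2: "\<bar>S2\<bar> \<le> e\<^sup>2 * S"
  proof -
    have "\<bar>S2\<bar> \<le> (\<integral>t. e\<^sup>2 * (psi e t * (w t)\<^sup>2) \<partial>lborel)" unfolding S2_def
      by (rule order_trans[OF integral_norm_bound[where 'a = real, unfolded real_norm_def]],
          rule integral_mono[OF integrable_abs[OF I2] integrable_mult_right[OF Iw]])
         (use psi2_bound[of e] e in \<open>auto simp: abs_mult intro!: mult_right_mono simp flip: mult.assoc\<close>)
    then show ?thesis by (simp add: S_def)
  qed
  have "(\<integral>t. psi e t * N2 t \<partial>lborel) \<le> (\<integral>s. (w s)\<^sup>2 * (psi e s * kap rho + psi1 e s * kap1 rho + e\<^sup>2 / 2 * M2 * psi e s) \<partial>lborel)"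
    unfolding N2_def M2_def by (rule psi_weighted_square_conv[OF wm bd(1) a e])
  also have "\<dots> = (\<integral>s. (kap rho + e\<^sup>2 / 2 * M2) * (psi e s * (w s)\<^sup>2) + kap1 rho * (psi1 e s * (w s)\<^sup>2) \<partial>lborel)"
    by (intro Bochner_Integration.integral_cong) (auto simp: algebra_simps)
  also have "\<dots> = (kap rho + e\<^sup>2 / 2 * M2) * S + kap1 rho * S1"
    unfolding S_def S1_def using Iw I1 by simp
  finally have "B / 2 * (\<integral>t. psi e t * N2 t \<partial>lborel) \<le> B / 2 * ((kap rho + e\<^sup>2 / 2 * M2) * S + kap1 rho * S1)"
    using B by (intro mult_left_mono) auto
  moreover
  have "(\<integral>t. psi e t * (w1 t)\<^sup>2 \<partial>lborel) \<le> (\<integral>t. p t + - (B / 2 * kap rho) * (psi e t * (w t)\<^sup>2) + B / 2 * (psi e t * N2 t)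
      + psi e t * (\<bar>w t\<bar> * eta t) + 1 / 2 * (psi2 e t * (w t)\<^sup>2) + - (d / 2) * (psi1 e t * (w t)\<^sup>2) \<partial>lborel)"
  proof (rule integral_mono[OF Iw1])
    fix t
    have "0 \<le> psi e t * (w t * w2 t + d * (w t * w1 t) - B / 2 * kap rho * (w t)\<^sup>2
      + B / 2 * N2 t + \<bar>w t\<bar> * eta t)" using pde[of t] by (simp add: N2_def)
    then show "psi e t * (w1 t)\<^sup>2 \<le> p t + - (B / 2 * kap rho) * (psi e t * (w t)\<^sup>2) + B / 2 * (psi e t * N2 t)
      + psi e t * (\<bar>w t\<bar> * eta t) + 1 / 2 * (psi2 e t * (w t)\<^sup>2) + - (d / 2) * (psi1 e t * (w t)\<^sup>2)"
      unfolding p_def by (simp add: algebra_simps)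
  qed (use pI Iw IN Ie I1 I2 in simp)
  moreover have "\<dots> = (\<integral>t. p t \<partial>lborel) - B / 2 * kap rho * S + B / 2 * (\<integral>t. psi e t * N2 t \<partial>lborel)
      + (\<integral>t. psi e t * (\<bar>w t\<bar> * eta t) \<partial>lborel) + 1 / 2 * S2 - d / 2 * S1"
    unfolding S_def S1_def S2_def using pI Iw IN Ie I1 I2 by simp
  ultimately have *: "(\<integral>t. psi e t * (w1 t)\<^sup>2 \<partial>lborel) \<le> - B / 2 * kap rho * S + B / 2 * ((kap rho + e\<^sup>2 / 2 * M2) * S + kap1 rho * S1)
      + (\<integral>t. psi e t * (\<bar>w t\<bar> * eta t) \<partial>lborel) + 1 / 2 * S2 - d / 2 * S1"
    using \<open>(\<integral>t. p t \<partial>lborel) = 0\<close> by linarith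
  define E D where "E = (\<integral>t. psi e t * (\<bar>w t\<bar> * eta t) \<partial>lborel)" and "D = d - B * kap1 rho"
  have "- (D * S1) \<le> \<bar>D\<bar> * (e * S)"
    using mult_left_mono[OF S1, of "\<bar>D\<bar>"] by (simp flip: abs_mult)
  moreover have "S2 \<le> e\<^sup>2 * S" using S2 by simp
  ultimately have le: "B / 2 * (e\<^sup>2 / 2 * M2) * S + 1 / 2 * S2 + - (D * S1) / 2 + E
      \<le> B / 2 * (e\<^sup>2 / 2 * M2) * S + 1 / 2 * (e\<^sup>2 * S) + \<bar>D\<bar> * (e * S) / 2 + E"
    by (intro add_mono order_refl divide_right_mono mult_left_mono) auto
  have "(\<integral>t. psi e t * (w1 t)\<^sup>2 \<partial>lborel)
      \<le> - B / 2 * kap rho * S + B / 2 * ((kap rho + e\<^sup>2 / 2 * M2) * S + kap1 rho * S1) + E + 1 / 2 * S2 - d / 2 * S1"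
    using * unfolding E_def .
  also have "\<dots> = B / 2 * (e\<^sup>2 / 2 * M2) * S + 1 / 2 * S2 + - (D * S1) / 2 + E"
    by (simp add: D_def field_simps)
  also note le
  also have "B / 2 * (e\<^sup>2 / 2 * M2) * S + 1 / 2 * (e\<^sup>2 * S) + \<bar>D\<bar> * (e * S) / 2 + E
     = (e * \<bar>D\<bar> + e\<^sup>2 * (1 + B / 2 * M2)) / 2 * S + E"
    by (simp add: field_simps)
  finally show "(\<integral>t. psi e t * (w1 t)\<^sup>2 \<partial>lborel)
      \<le> (e * \<bar>d - B * kap1 rho\<bar> + e\<^sup>2 * (1 + B / 2 * M2)) / 2 * (\<integral>t. psi e t * (w t)\<^sup>2 \<partial>lborel)
        + (\<integral>t. psi e t * (\<bar>w t\<bar> * eta t) \<partial>lborel)"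
    unfolding S_def E_def D_def .
qed

end

subsection \<open>Solutions of the wave equation\<close>

lemma (in exp_moment_measure) weighted_conv_isCont:
  fixes u k :: "real \<Rightarrow> real"
  assumes "\<And>x. isCont u x" "\<And>x. \<bar>u x\<bar> \<le> X" and k: "integrable M k"
  shows "isCont (\<lambda>t. \<integral>r. k r * u (t - r) \<partial>M) t"
  unfolding continuous_at_sequentially comp_def
proof (intro allI impI)
  fix x :: "nat \<Rightarrow> real" assume x: "x \<longlonglongrightarrow> t"
  have [measurable]: "u \<in> borel_measurable borel"
    using assms(1) by (intro borel_measurable_continuous_onI) (auto simp: continuous_on_eq_continuous_at)
  have [measurable]: "k \<in> borel_measurable M" using k by auto
  show "(\<lambda>n. \<integral>r. k r * u (x n - r) \<partial>M) \<longlonglongrightarrow> (\<integral>r. k r * u (t - r) \<partial>M)"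
  proof (rule integral_dominated_convergence[where w = "\<lambda>r. \<bar>k r\<bar> * X"])
    show "AE r in M. (\<lambda>n. k r * u (x n - r)) \<longlonglongrightarrow> k r * u (t - r)"
      using x assms(1) by (intro AE_I2 tendsto_intros isCont_tendsto_compose[of _ u]) auto
    show "AE r in M. norm (k r * u (x n - r)) \<le> \<bar>k r\<bar> * X" for n
      using assms(2) by (intro AE_I2) (auto simp: abs_mult intro: mult_left_mono)
  qed (use k in auto)
qed

lemma integral_le_nn_integral:
  fixes u :: "'a \<Rightarrow> real"
  assumes "integrable N u" shows "ennreal (integral\<^sup>L N u) \<le> (\<integral>\<^sup>+x. ennreal (u x) \<partial>N)"
proof -
  have "integral\<^sup>L N u \<le> (\<integral>x. max 0 (u x) \<partial>N)"
    using assms by (intro integral_mono) auto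
  then have "ennreal (integral\<^sup>L N u) \<le> ennreal (\<integral>x. max 0 (u x) \<partial>N)" by (rule ennreal_leI)
  also have "\<dots> = (\<integral>\<^sup>+x. ennreal (max 0 (u x)) \<partial>N)"
    using assms by (intro nn_integral_eq_integral[symmetric]) auto
  also have "\<dots> = (\<integral>\<^sup>+x. ennreal (u x) \<partial>N)"
    by (intro nn_integral_cong) (auto simp: max_def ennreal_neg)
  finally show ?thesis .
qed

lemma exp_le_of_le_min:
  fixes z :: real
  assumes "0 \<le> z'" "z' \<le> z" "0 \<le> C" "0 \<le> x" "x \<le> C * exp (z * t)" "x \<le> X"
  shows "x \<le> max C X * exp (z' * t)"
proof (cases "t \<ge> 0")
  case True
  then have "1 \<le> exp (z' * t)" using assms by simp
  then have "X * 1 \<le> max C X * exp (z' * t)" using assms by (intro mult_mono) auto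
  then show ?thesis using assms by simp
next
  case False
  then have "exp (z * t) \<le> exp (z' * t)" using assms by (auto intro: mult_right_mono_neg)
  then have "C * exp (z * t) \<le> max C X * exp (z' * t)" using assms by (intro mult_mono) auto
  then show ?thesis using assms by simp
qed

text \<open>\<open>a0\<close> and \<open>b0\<close> stand for the slopes of \<open>f\<close> and
  \<open>g\<close> at 0, \<open>ia\<close> for the infimum of the slopes of \<open>f\<close>,
  \<open>al\<close> for the Hoelder exponent. The bounds \<open>f_near\<close> and
  \<open>g_near\<close> express superlinearity of the remainders and feed the analysis at minus
  infinity; \<open>f_lower\<close> and \<open>g_lip\<close> ask for no smallness and feed the last
  energy estimate.\<close>

locale wave_eq = exp_moment_measure M m2 for M m2 +
  fixes f g :: "real \<Rightarrow> real" and c a0 b0 ia L al :: real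
  assumes f0: "f 0 = 0" and g0: "g 0 = 0"
    and f_nonneg: "\<And>x. 0 \<le> x \<Longrightarrow> 0 \<le> f x" and g_nonneg: "\<And>x. 0 \<le> x \<Longrightarrow> 0 \<le> g x"
    and f_cont: "continuous_on {0..} f"
    and f_lower: "\<And>x y. 0 \<le> y \<Longrightarrow> y \<le> x \<Longrightarrow> ia * (x - y) \<le> f x - f y"
    and g_lip: "\<And>x y. 0 \<le> x \<Longrightarrow> 0 \<le> y \<Longrightarrow> \<bar>g x - g y\<bar> \<le> L * \<bar>x - y\<bar>"
    and al: "0 < al"
    and f_near: "\<And>X. \<exists>C\<ge>0. \<forall>x\<in>{0..X}. \<forall>y\<in>{0..X}.
      \<bar>(f x - a0 * x) - (f y - a0 * y)\<bar> \<le> C * (max x y) powr al * \<bar>x - y\<bar>"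
    and g_near: "\<And>X. \<exists>C\<ge>0. \<forall>x\<in>{0..X}. \<forall>y\<in>{0..X}.
      \<bar>(g x - b0 * x) - (g y - b0 * y)\<bar> \<le> C * (max x y) powr al * \<bar>x - y\<bar>"
    and coeffs: "0 \<le> a0" "a0 < b0" "b0 \<le> L" "ia \<le> a0"
begin

abbreviation chi0 :: "real \<Rightarrow> real" where "chi0 \<equiv> chf c a0 b0"

definition sol :: "(real \<Rightarrow> real) \<Rightarrow> bool" where
  "sol \<phi> \<longleftrightarrow> (\<forall>t. (\<phi> has_real_derivative deriv \<phi> t) (at t)) \<and>
     (\<forall>t. (deriv \<phi> has_real_derivative deriv (deriv \<phi>) t) (at t)) \<and>
     (\<forall>t. 0 \<le> \<phi> t) \<and> bounded (range \<phi>) \<and> (\<phi> \<longlongrightarrow> 0) at_bot \<and>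
     (\<forall>t. deriv (deriv \<phi>) t = c * deriv \<phi> t + f (\<phi> t) - (\<integral>r. g (\<phi> (t - r)) \<partial>M))"

lemma L_pos: "0 < L" and b0_pos: "0 < b0" using coeffs by auto

lemma g_le: "0 \<le> x \<Longrightarrow> g x \<le> L * x"
  using g_lip[of x 0] g0 by auto

lemma f_le: obtains F where "F > 0" "\<And>x. 0 \<le> x \<Longrightarrow> x \<le> X \<Longrightarrow> f x \<le> F * x"
proof -
  obtain C where C: "C \<ge> 0" "\<And>x y. x \<in> {0..X} \<Longrightarrow> y \<in> {0..X} \<Longrightarrow>
      \<bar>(f x - a0 * x) - (f y - a0 * y)\<bar> \<le> C * (max x y) powr al * \<bar>x - y\<bar>"
    using f_near[of X] by blast
  show ?thesis
  proof (rule that[of "a0 + C * X powr al + 1"])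
    show "a0 + C * X powr al + 1 > 0" using coeffs C by (intro add_nonneg_pos add_nonneg_nonneg mult_nonneg_nonneg) auto
    fix x assume x: "0 \<le> x" "x \<le> X"
    have "f x - a0 * x \<le> C * x powr al * x" using C(2)[of x 0] x f0 by auto
    also have "\<dots> \<le> C * X powr al * x" using x C al by (intro mult_right_mono mult_left_mono powr_mono2) auto
    finally show "f x \<le> (a0 + C * X powr al + 1) * x" using x by (simp add: algebra_simps)
  qed
qed

lemma g_continuous: "continuous_on {0..} g"
proof (rule continuous_on_compose2[where g = "\<lambda>x. x"])
  show "continuous_on {0..} g"
    unfolding continuous_on_iff
  proof (intro ballI allI impI)
    fix x e :: real assume "x \<in> {0..}" "e > 0"
    then show "\<exists>d>0. \<forall>x'\<in>{0..}. dist x' x < d \<longrightarrow> dist (g x') (g x) < e"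
      using g_lip[of _ x] L_pos
      by (intro exI[of _ "e / L"]) (auto simp: dist_real_def field_simps intro: order.strict_trans1)
  qed
qed auto

context
  fixes \<phi> assumes s: "sol \<phi>"
begin

lemma sol_deriv: "(\<phi> has_real_derivative deriv \<phi> t) (at t)"
  "(deriv \<phi> has_real_derivative deriv (deriv \<phi>) t) (at t)"
  and sol_nonneg: "0 \<le> \<phi> t" and sol_at_bot: "(\<phi> \<longlongrightarrow> 0) at_bot"
  and sol_eq: "deriv (deriv \<phi>) t = c * deriv \<phi> t + f (\<phi> t) - (\<integral>r. g (\<phi> (t - r)) \<partial>M)"
  using s unfolding sol_def by auto

lemma sol_bounded: obtains X where "X > 0" "\<And>t. \<phi> t \<le> X"
proof -
  obtain B where B: "\<forall>x\<in>range \<phi>. norm x \<le> B"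
    using s unfolding sol_def bounded_iff by blast
  have "\<phi> t \<le> \<bar>B\<bar> + 1" for t using bspec[OF B, of "\<phi> t"] by auto
  then show ?thesis by (intro that[of "\<bar>B\<bar> + 1"]) auto
qed

lemma sol_isCont: "isCont \<phi> t" "isCont (deriv \<phi>) t"
  using sol_deriv DERIV_isCont by blast+

lemma sol_measurable: "\<phi> \<in> borel_measurable borel" "deriv \<phi> \<in> borel_measurable borel"
  using sol_isCont by (auto intro!: borel_measurable_continuous_onI continuous_at_imp_continuous_on)

lemma sol_f_isCont: "isCont (\<lambda>t. f (\<phi> t)) t"
proof -
  have "continuous_on UNIV (\<lambda>t. f (\<phi> t))"
    by (rule continuous_on_compose2[OF f_cont]) (use sol_isCont sol_nonneg in \<open>auto intro: continuous_at_imp_continuous_on\<close>)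
  then show ?thesis by (simp add: continuous_on_eq_continuous_at)
qed

lemma sol_g_isCont: "isCont (\<lambda>t. g (\<phi> t)) t"
proof -
  have "continuous_on UNIV (\<lambda>t. g (\<phi> t))"
    by (rule continuous_on_compose2[OF g_continuous]) (use sol_isCont sol_nonneg in \<open>auto intro: continuous_at_imp_continuous_on\<close>)
  then show ?thesis by (simp add: continuous_on_eq_continuous_at)
qed

lemma sol_fg_measurable:
  "(\<lambda>t. f (\<phi> t)) \<in> borel_measurable borel" "(\<lambda>t. g (\<phi> t)) \<in> borel_measurable borel"
  using sol_f_isCont sol_g_isCont by (auto intro!: borel_measurable_continuous_onI continuous_at_imp_continuous_on)

lemma sol_g_bound: assumes "\<And>t. \<phi> t \<le> C * exp (z * t)" "0 \<le> z" "z \<le> m2"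
  shows "integrable M (\<lambda>r. g (\<phi> (t - r)))" "0 \<le> (\<integral>r. g (\<phi> (t - r)) \<partial>M)"
    "(\<integral>r. g (\<phi> (t - r)) \<partial>M) \<le> L * C * kap z * exp (z * t)"
proof -
  have b: "\<bar>g (\<phi> x)\<bar> \<le> L * C * exp (z * x)" for x
    using g_le[OF sol_nonneg, of x] g_nonneg[OF sol_nonneg, of x] mult_left_mono[OF assms(1)[of x] less_imp_le[OF L_pos]]
    by (simp only: abs_of_nonneg mult.assoc)
  note e = exp_bounded_conv[OF assms(2,3) sol_fg_measurable(2) b, of t]
  show "integrable M (\<lambda>r. g (\<phi> (t - r)))" using e(1) .
  show "0 \<le> (\<integral>r. g (\<phi> (t - r)) \<partial>M)" by (intro integral_nonneg_AE AE_I2 g_nonneg sol_nonneg)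
  show "(\<integral>r. g (\<phi> (t - r)) \<partial>M) \<le> L * C * kap z * exp (z * t)" using e(2) by simp
qed

lemma sol_conv_isCont: "isCont (\<lambda>t. \<integral>r. g (\<phi> (t - r)) \<partial>M) t"
proof -
  obtain X where X: "X > 0" "\<And>t. \<phi> t \<le> X" by (rule sol_bounded) blast
  have "\<bar>g (\<phi> x)\<bar> \<le> L * X" for x
    using g_le[OF sol_nonneg, of x] g_nonneg[OF sol_nonneg, of x] mult_left_mono[OF X(2)[of x] less_imp_le[OF L_pos]]
    by (simp only: abs_of_nonneg)
  from conv_isCont[where u = "\<lambda>t. g (\<phi> t)", OF sol_g_isCont this] show ?thesis .
qed

lemma sol_deriv2_isCont: "isCont (deriv (deriv \<phi>)) t"
proof -
  have "deriv (deriv \<phi>) = (\<lambda>t. c * deriv \<phi> t + f (\<phi> t) - (\<integral>r. g (\<phi> (t - r)) \<partial>M))"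
    using sol_eq by blast
  then show ?thesis using sol_isCont sol_f_isCont sol_conv_isCont by (simp add: continuous_intros)
qed

text \<open>The equation bounds \<open>deriv (deriv \<phi>) t - c * deriv \<phi> t\<close> by the
  same exponential, and the interior estimate on a unit interval costs just a factor
  \<open>exp z\<close>.\<close>

lemma sol_deriv_bound:
  assumes C: "\<And>t. \<phi> t \<le> C * exp (z * t)" and z: "0 \<le> z" "z \<le> m2"
  obtains D where "D \<ge> C" "\<And>t. \<bar>deriv \<phi> t\<bar> \<le> D * exp (z * t)" "\<And>t. \<bar>deriv (deriv \<phi>) t\<bar> \<le> D * exp (z * t)"
proof -
  obtain X where X: "X > 0" "\<And>t. \<phi> t \<le> X" by (rule sol_bounded) blast
  obtain F where F: "F > 0" "\<And>x. 0 \<le> x \<Longrightarrow> x \<le> X \<Longrightarrow> f x \<le> F * x" by (rule f_le[of X]) blast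
  have C0: "C \<ge> 0" using order_trans[OF sol_nonneg C[of 0]] by simp
  define B where "B = F * C + L * C * kap z"
  have B: "B \<ge> 0" unfolding B_def using F C0 L_pos kap_pos[OF z] by (intro add_nonneg_nonneg mult_nonneg_nonneg) auto
  have rhs: "\<bar>deriv (deriv \<phi>) t - c * deriv \<phi> t\<bar> \<le> B * exp (z * t)" for t
  proof -
    have "f (\<phi> t) \<le> F * (C * exp (z * t))"
      by (rule order_trans[OF F(2)]) (use sol_nonneg X C F in \<open>auto intro: mult_left_mono\<close>)
    moreover have "0 \<le> f (\<phi> t)" by (rule f_nonneg[OF sol_nonneg])
    ultimately have "\<bar>f (\<phi> t) - (\<integral>r. g (\<phi> (t - r)) \<partial>M)\<bar> \<le> F * (C * exp (z * t)) + L * C * kap z * exp (z * t)"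
      using sol_g_bound(2,3)[OF C z, of t] by linarith
    then show ?thesis using sol_eq[of t] by (simp add: B_def algebra_simps)
  qed
  define D1 where "D1 = ((2 + 2 * \<bar>c\<bar>) * C + B) * exp z"
  have D1: "D1 \<ge> 0" unfolding D1_def using C0 B by (intro mult_nonneg_nonneg add_nonneg_nonneg) auto
  have d1: "\<bar>deriv \<phi> t\<bar> \<le> D1 * exp (z * t)" for t
  proof -
    have e: "exp (z * x) \<le> exp z * exp (z * t)" if "t \<le> x" "x \<le> t + 1" for x
    proof -
      have "z * x \<le> z * (t + 1)" using that z by (intro mult_left_mono) auto
      then show ?thesis by (simp flip: exp_add add: algebra_simps)
    qed
    have "\<bar>deriv \<phi> t\<bar> \<le> (2 + 2 * \<bar>c\<bar>) * (C * (exp z * exp (z * t))) + B * (exp z * exp (z * t))"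
    proof (rule interior_estimate[OF sol_deriv])
      fix x assume x: "t \<le> x" "x \<le> t + 1"
      show "\<bar>\<phi> x\<bar> \<le> C * (exp z * exp (z * t))"
        using sol_nonneg[of x] C[of x] mult_left_mono[OF e[OF x] C0] by linarith
      show "\<bar>deriv (deriv \<phi>) x - c * deriv \<phi> x\<bar> \<le> B * (exp z * exp (z * t))"
        using rhs[of x] mult_left_mono[OF e[OF x] B] by linarith
    qed
    then show ?thesis by (simp add: D1_def algebra_simps)
  qed
  show ?thesis
  proof (rule that[of "C + D1 + (\<bar>c\<bar> * D1 + B)"])
    show "C \<le> C + D1 + (\<bar>c\<bar> * D1 + B)" using D1 B by simp
    fix t
    have "D1 * exp (z * t) \<le> (C + D1 + (\<bar>c\<bar> * D1 + B)) * exp (z * t)"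
      using D1 B C0 by (intro mult_right_mono) auto
    then show "\<bar>deriv \<phi> t\<bar> \<le> (C + D1 + (\<bar>c\<bar> * D1 + B)) * exp (z * t)" using d1[of t] by linarith
    have "\<bar>c * deriv \<phi> t\<bar> \<le> \<bar>c\<bar> * (D1 * exp (z * t))"
      unfolding abs_mult by (rule mult_left_mono[OF d1]) simp
    then have "\<bar>deriv (deriv \<phi>) t\<bar> \<le> (\<bar>c\<bar> * D1 + B) * exp (z * t)"
      using rhs[of t] by (simp only: distrib_right mult.assoc)
    also have "\<dots> \<le> (C + D1 + (\<bar>c\<bar> * D1 + B)) * exp (z * t)"
      using D1 B C0 by (intro mult_right_mono) auto
    finally show "\<bar>deriv (deriv \<phi>) t\<bar> \<le> (C + D1 + (\<bar>c\<bar> * D1 + B)) * exp (z * t)" .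
  qed
qed

text \<open>A Harnack type inequality. With \<open>f x \<le> F * x\<close> on the range of \<phi>,
  the operator with zero-order coefficient \<open>- F\<close> factors through its roots
  \<open>n < 0 < u\<close>. Since the convolution is nonnegative, \<open>D\<close> is nonincreasing;
  its limit at plus infinity is 0, so it is nonnegative, and hence
  \<open>exp (- n * t) * \<phi> t\<close> is nondecreasing.\<close>

lemma sol_growth:
  obtains k where "k > 0" "\<And>t h. 0 \<le> h \<Longrightarrow> exp (- k * h) * \<phi> t \<le> \<phi> (t + h)"
proof -
  obtain X where X: "X > 0" "\<And>t. \<phi> t \<le> X" by (rule sol_bounded) blast
  obtain F where F: "F > 0" "\<And>x. 0 \<le> x \<Longrightarrow> x \<le> X \<Longrightarrow> f x \<le> F * x" by (rule f_le[of X]) blast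
  \<comment> \<open>The roots from the definition of \<open>k1\<close> are reused with
    \<open>F\<close> in the place of \<beta>.\<close>
  define n u where "n = nu F c" and "u = mu F c"
  have nu: "n < 0" "u > 0" using nu_mu_roots[of F c] F by (auto simp: n_def u_def)
  have su: "n + u = c" "n * u = - F"
  proof -
    show "n + u = c" by (simp add: n_def u_def nu_def mu_def field_simps)
    have "(sigma F c)\<^sup>2 = c\<^sup>2 + 4 * F" using F by (simp add: sigma_def)
    then show "n * u = - F" by (simp add: n_def u_def nu_def mu_def field_simps power2_eq_square)
  qed
  define D where "D t = exp (- u * t) * (deriv \<phi> t - n * \<phi> t)" for t
  have D': "(D has_real_derivative exp (- u * t) * (f (\<phi> t) - (\<integral>r. g (\<phi> (t - r)) \<partial>M) - F * \<phi> t)) (at t)" for t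
  proof -
    have "(D has_real_derivative exp (- u * t) * (deriv (deriv \<phi>) t - n * deriv \<phi> t) - u * exp (- u * t) * (deriv \<phi> t - n * \<phi> t)) (at t)"
      unfolding D_def[abs_def] by (auto intro!: derivative_eq_intros sol_deriv)
    moreover have "exp (- u * t) * (deriv (deriv \<phi>) t - n * deriv \<phi> t) - u * exp (- u * t) * (deriv \<phi> t - n * \<phi> t)
      = exp (- u * t) * (deriv (deriv \<phi>) t - (n + u) * deriv \<phi> t + (n * u) * \<phi> t)"
      by (simp add: algebra_simps)
    ultimately show ?thesis using sol_eq[of t] by (simp add: su)
  qed
  have D_mono: "D t \<ge> D t'" if "t \<le> t'" for t t'
  proof (rule DERIV_nonpos_imp_nonincreasing[OF that])
    fix x
    have "f (\<phi> x) - (\<integral>r. g (\<phi> (x - r)) \<partial>M) - F * \<phi> x \<le> 0"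
      using F(2)[OF sol_nonneg X(2), of x] sol_g_bound(2)[of X 0 x] X m2_pos by simp
    then show "\<exists>y. (D has_real_derivative y) (at x) \<and> y \<le> 0"
      using D'[of x] by (intro exI conjI) (auto intro: mult_nonneg_nonpos)
  qed
  obtain B where B: "B \<ge> X" "\<And>t. \<bar>deriv \<phi> t\<bar> \<le> B * exp (0 * t)"
    by (rule sol_deriv_bound[of X 0]) (use X m2_pos in auto)
  have "(D \<longlongrightarrow> 0) at_top"
  proof (rule Lim_null_comparison)
    show "\<forall>\<^sub>F t in at_top. norm (D t) \<le> exp (- u * t) * (B + \<bar>n\<bar> * X)"
    proof (intro always_eventually allI)
      fix t
      have "\<bar>deriv \<phi> t - n * \<phi> t\<bar> \<le> \<bar>deriv \<phi> t\<bar> + \<bar>n * \<phi> t\<bar>" by linarith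
      also have "\<dots> \<le> B + \<bar>n\<bar> * X"
        unfolding abs_mult using B(2)[of t] X(2)[of t] sol_nonneg[of t] by (intro add_mono mult_left_mono) auto
      finally show "norm (D t) \<le> exp (- u * t) * (B + \<bar>n\<bar> * X)"
        by (simp add: D_def abs_mult)
    qed
    show "((\<lambda>t. exp (- u * t) * (B + \<bar>n\<bar> * X)) \<longlongrightarrow> 0) at_top"
      using nu(2) by (intro tendsto_mult_left_zero) real_asymp
  qed
  then have D0: "D t \<ge> 0" for t
    by (rule tendsto_upperbound) (auto intro: eventually_mono[OF eventually_ge_at_top[of t]] D_mono)
  show ?thesis
  proof (rule that[of "- n"])
    fix t h :: real assume h: "0 \<le> h"
    have "exp (- n * t) * \<phi> t \<le> exp (- n * (t + h)) * \<phi> (t + h)"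
    proof (rule DERIV_nonneg_imp_nondecreasing[of t "t + h" "\<lambda>t. exp (- n * t) * \<phi> t"])
      fix x
      have "((\<lambda>t. exp (- n * t) * \<phi> t) has_real_derivative exp (- n * x) * (deriv \<phi> x - n * \<phi> x)) (at x)"
        by (auto intro!: derivative_eq_intros sol_deriv simp: algebra_simps)
      moreover have "exp (- n * x) * (deriv \<phi> x - n * \<phi> x) \<ge> 0"
        using D0[of x] by (simp add: D_def zero_le_mult_iff)
      ultimately show "\<exists>y. ((\<lambda>t. exp (- n * t) * \<phi> t) has_real_derivative y) (at x) \<and> 0 \<le> y" by blast
    qed (use h in simp)
    then have "exp (n * t) * (exp (- n * t) * \<phi> t) \<le> exp (n * t) * (exp (- n * (t + h)) * \<phi> (t + h))"
      by (rule mult_left_mono) simp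
    moreover have "exp (n * t) * exp (- n * t) = 1" "exp (n * t) * exp (- n * (t + h)) = exp (- n * h)"
      by (simp_all add: algebra_simps flip: exp_add)
    ultimately have "\<phi> t \<le> exp (- n * h) * \<phi> (t + h)"
      by (simp only: mult.assoc[symmetric] mult_1)
    then have "exp (n * h) * \<phi> t \<le> exp (n * h) * (exp (- n * h) * \<phi> (t + h))"
      by (rule mult_left_mono) simp
    then show "exp (- (- n) * h) * \<phi> t \<le> \<phi> (t + h)"
      by (simp flip: exp_add mult.assoc)
  qed (use nu in auto)
qed

end

end

section \<open>Exponential decay of solutions at minus infinity\<close>

context wave_eq
begin

text \<open>Truncation to a bounded window allows the linear bounds for \<open>f\<close> and
  \<open>g\<close>, available only near minus infinity, to be used inside the convolution.\<close>

definition tkap :: "real \<Rightarrow> real \<Rightarrow> real" where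
  "tkap R z = (\<integral>r. indicator {-R..R} r * exp (- z * r) \<partial>M)"

text \<open>Both inequalities for \<open>chi0\<close> are strict, which leaves room for cutting off
  the kernel at \<open>R\<close> and for perturbing the slopes by \<open>1 / R\<close>.\<close>

lemma truncated_characteristic:
  assumes z: "0 \<le> z1" "z1 \<le> m2" "0 \<le> z2" "z2 \<le> m2" and chi: "0 < chi0 z2" "chi0 z2 < chi0 z1"
  obtains R \<delta> where "0 < R" "0 < \<delta>" "\<delta> < b0"
    "0 \<le> z2\<^sup>2 - c * z2 - (a0 + \<delta>) + (b0 - \<delta>) * tkap R z2"
    "z2\<^sup>2 - c * z2 - (a0 + \<delta>) + (b0 - \<delta>) * tkap R z2 < z1\<^sup>2 - c * z1 - (a0 + \<delta>) + (b0 - \<delta>) * tkap R z1"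
proof -
  define T where "T R z = z\<^sup>2 - c * z - (a0 + 1 / R) + (b0 - 1 / R) * tkap R z" for R z
  have lim: "((\<lambda>R. T R z) \<longlongrightarrow> chi0 z) at_top" if "0 \<le> z" "z \<le> m2" for z
  proof -
    have "((\<lambda>R::real. 1 / R) \<longlongrightarrow> 0) at_top" by real_asymp
    then have "((\<lambda>R. T R z) \<longlongrightarrow> z\<^sup>2 - c * z - (a0 + 0) + (b0 - 0) * kap z) at_top"
      unfolding T_def tkap_def using kap_truncated_limit[OF that] by (intro tendsto_intros)
    then show ?thesis by (simp add: chf_def)
  qed
  have "((\<lambda>R. T R z1 - T R z2) \<longlongrightarrow> chi0 z1 - chi0 z2) at_top"
    by (intro tendsto_intros lim z)
  then have "\<forall>\<^sub>F R in at_top. 0 < T R z1 - T R z2"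
    by (rule order_tendstoD) (use chi in simp)
  moreover have "\<forall>\<^sub>F R in at_top. 0 < T R z2"
    using lim[OF z(3,4)] by (rule order_tendstoD) (use chi in simp)
  ultimately have "\<forall>\<^sub>F R in at_top. 0 < T R z1 - T R z2 \<and> 0 < T R z2 \<and> R > 1 / b0 \<and> R > 0"
    using eventually_gt_at_top[of "1 / b0"] eventually_gt_at_top[of 0] by eventually_elim auto
  then obtain R where R: "0 < T R z1 - T R z2" "0 < T R z2" "R > 1 / b0" "R > 0"
    by (auto simp: eventually_at_top_linorder)
  show ?thesis
    by (rule that[of R "1 / R"]) (use R b0_pos in \<open>auto simp: T_def field_simps\<close>)
qed

text \<open>Two integrations by parts on a bounded interval. The boundary term \<open>P\<close> is
  kept explicit because at this stage nothing is known about its size at the left end.\<close>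

lemma sol_integral_exp:
  assumes s: "sol \<phi>" and lu: "l \<le> u"
  defines "P \<equiv> \<lambda>z t. exp (- z * t) * (deriv \<phi> t + (z - c) * \<phi> t)"
  shows "integral {l..u} (\<lambda>t. exp (- z * t) * (deriv (deriv \<phi>) t - c * deriv \<phi> t - a * \<phi> t))
    = P z u - P z l + (z\<^sup>2 - c * z - a) * integral {l..u} (\<lambda>t. exp (- z * t) * \<phi> t)"
proof -
  note d = sol_deriv[OF s]
  have c: "continuous_on {l..u} \<phi>"
    using sol_isCont[OF s] by (auto intro: continuous_at_imp_continuous_on)
  have "(P z has_real_derivative exp (- z * t) * (deriv (deriv \<phi>) t - c * deriv \<phi> t - (z\<^sup>2 - c * z) * \<phi> t)) (at t)" for t
    unfolding P_def by (auto intro!: derivative_eq_intros d simp: algebra_simps power2_eq_square)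
  then have "((\<lambda>t. exp (- z * t) * (deriv (deriv \<phi>) t - c * deriv \<phi> t - (z\<^sup>2 - c * z) * \<phi> t)) has_integral (P z u - P z l)) {l..u}"
    by (intro fundamental_theorem_of_calculus lu)
       (simp add: has_real_derivative_iff_has_vector_derivative[symmetric] has_field_derivative_at_within)
  moreover have "((\<lambda>t. (z\<^sup>2 - c * z - a) * (exp (- z * t) * \<phi> t)) has_integral (z\<^sup>2 - c * z - a) * integral {l..u} (\<lambda>t. exp (- z * t) * \<phi> t)) {l..u}"
    using c by (intro has_integral_mult_right integrable_integral integrable_continuous_interval continuous_intros)
  ultimately have "((\<lambda>t. exp (- z * t) * (deriv (deriv \<phi>) t - c * deriv \<phi> t - (z\<^sup>2 - c * z) * \<phi> t) + (z\<^sup>2 - c * z - a) * (exp (- z * t) * \<phi> t))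
     has_integral (P z u - P z l) + (z\<^sup>2 - c * z - a) * integral {l..u} (\<lambda>t. exp (- z * t) * \<phi> t)) {l..u}"
    by (rule has_integral_add)
  moreover have "(\<lambda>t. exp (- z * t) * (deriv (deriv \<phi>) t - c * deriv \<phi> t - (z\<^sup>2 - c * z) * \<phi> t) + (z\<^sup>2 - c * z - a) * (exp (- z * t) * \<phi> t))
     = (\<lambda>t. exp (- z * t) * (deriv (deriv \<phi>) t - c * deriv \<phi> t - a * \<phi> t))"
    by (auto simp: algebra_simps)
  ultimately show ?thesis by (simp add: integral_unique)
qed

lemma sol_linear_bounds_at_bot:
  assumes s: "sol \<phi>" and d: "0 < \<delta>"
  obtains T where "\<And>t. t \<le> T \<Longrightarrow> f (\<phi> t) \<le> (a0 + \<delta>) * \<phi> t" "\<And>t. t \<le> T \<Longrightarrow> (b0 - \<delta>) * \<phi> t \<le> g (\<phi> t)"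
proof -
  obtain X where X: "X > 0" "\<And>t. \<phi> t \<le> X" by (rule sol_bounded[OF s]) blast
  obtain C where C: "C \<ge> 0" "\<And>x y. x \<in> {0..X} \<Longrightarrow> y \<in> {0..X} \<Longrightarrow>
      \<bar>(f x - a0 * x) - (f y - a0 * y)\<bar> \<le> C * (max x y) powr al * \<bar>x - y\<bar>"
    using f_near[of X] by blast
  obtain D where D: "D \<ge> 0" "\<And>x y. x \<in> {0..X} \<Longrightarrow> y \<in> {0..X} \<Longrightarrow>
      \<bar>(g x - b0 * x) - (g y - b0 * y)\<bar> \<le> D * (max x y) powr al * \<bar>x - y\<bar>"
    using g_near[of X] by blast
  have n: "0 \<le> \<phi> t" for t by (rule sol_nonneg[OF s])
  have "((\<lambda>t. (C + D) * \<phi> t powr al) \<longlongrightarrow> 0) at_bot"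
    by (intro tendsto_mult_right_zero tendsto_zero_powrI sol_at_bot[OF s] tendsto_const) (use n al in auto)
  then have "\<forall>\<^sub>F t in at_bot. (C + D) * \<phi> t powr al < \<delta>"
    by (rule order_tendstoD) (use d in simp)
  then obtain T where T: "\<And>t. t \<le> T \<Longrightarrow> (C + D) * \<phi> t powr al < \<delta>"
    by (auto simp: eventually_at_bot_linorder)
  show ?thesis
  proof (rule that[of T])
    fix t assume t: "t \<le> T"
    have "C * \<phi> t powr al * \<phi> t \<le> \<delta> * \<phi> t" "D * \<phi> t powr al * \<phi> t \<le> \<delta> * \<phi> t"
      using T[OF t] n[of t] C(1) D(1) by (auto intro!: mult_right_mono simp: distrib_right intro: order_trans[rotated])
        (smt (verit) mult_nonneg_nonneg powr_ge_zero)+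
    moreover have "\<bar>f (\<phi> t) - a0 * \<phi> t\<bar> \<le> C * \<phi> t powr al * \<phi> t" "\<bar>g (\<phi> t) - b0 * \<phi> t\<bar> \<le> D * \<phi> t powr al * \<phi> t"
      using C(2)[of "\<phi> t" 0] D(2)[of "\<phi> t" 0] n[of t] X f0 g0 by (auto simp: max_def)
    ultimately show "f (\<phi> t) \<le> (a0 + \<delta>) * \<phi> t" "(b0 - \<delta>) * \<phi> t \<le> g (\<phi> t)"
      by (auto simp: algebra_simps abs_le_iff)
  qed
qed

end

locale wave_eq_root = wave_eq +
  fixes lam :: real
  assumes lam: "0 < lam" "lam < m2" "chi0 lam = 0" and chi0_pos: "\<And>z. 0 \<le> z \<Longrightarrow> z < lam \<Longrightarrow> 0 < chi0 z"
begin

text \<open>A convex graph that is positive at \<open>z2\<close> and zero at \<open>lam\<close> has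
  negative slope at \<open>z2\<close>, and the tangent there lies below the value at
  \<open>z1\<close>.\<close>

lemma chi0_decreasing:
  assumes "0 \<le> z1" "z1 < z2" "z2 < lam" shows "chi0 z2 < chi0 z1"
proof -
  have b: "0 \<le> b0" using b0_pos by simp
  have "chi0 z2 + dchf c b0 z2 * (lam - z2) + (lam - z2)\<^sup>2 \<le> chi0 lam"
    by (rule chf_tangent) (use assms lam b in auto)
  moreover have "0 < chi0 z2" using chi0_pos[of z2] assms by simp
  ultimately have "dchf c b0 z2 * (lam - z2) < 0" using lam(3) zero_le_power2[of "lam - z2"] by linarith
  then have "dchf c b0 z2 < 0" using assms by (simp add: mult_less_0_iff)
  then have "0 < dchf c b0 z2 * (z1 - z2)" using assms by (simp add: mult_neg_neg)
  moreover have "chi0 z2 + dchf c b0 z2 * (z1 - z2) + (z1 - z2)\<^sup>2 \<le> chi0 z1"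
    by (rule chf_tangent) (use assms lam b in auto)
  ultimately show ?thesis using zero_le_power2[of "z1 - z2"] by linarith
qed

text \<open>No decay is known yet, so the transform of \<phi> is cut at \<open>- N\<close> and
  bounded uniformly in \<open>N\<close>. The test function \<open>th\<close> is a difference of two
  exponentials that vanishes at \<open>- N\<close>: the unknown derivative drops out of the boundary
  term there, and what remains has a favourable sign. The gap \<open>k0\<close> between the
  truncated characteristic function at \<open>rho\<close> and at \<open>rho2\<close> then controls
  the integral.\<close>

lemma sol_integral_bound:
  assumes s: "sol \<phi>" and rho: "0 < rho" "rho < lam"
  obtains S C where "\<And>N. - N \<le> S \<Longrightarrow> N \<ge> 0 \<Longrightarrow> integral {-N..S} (\<lambda>t. exp (- rho * t) * \<phi> t) \<le> C"
proof -
  obtain X where X: "X > 0" "\<And>t. \<phi> t \<le> X" by (rule sol_bounded[OF s]) blast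
  have n: "0 \<le> \<phi> t" for t by (rule sol_nonneg[OF s])
  have [measurable]: "\<phi> \<in> borel_measurable borel" by (rule sol_measurable[OF s])
  have cont: "isCont \<phi> t" "isCont (deriv \<phi>) t" "isCont (deriv (deriv \<phi>)) t" for t
    using sol_isCont[OF s] sol_deriv2_isCont[OF s] by auto
  \<comment> \<open>A second exponent strictly between \<open>rho\<close> and \<open>lam\<close>,
    where the characteristic function is smaller but still positive.\<close>
  define rho2 sg where "rho2 = (rho + lam) / 2" and "sg = rho2 - rho"
  have r2: "rho < rho2" "rho2 < lam" "sg > 0" using rho by (auto simp: rho2_def sg_def)
  obtain R \<delta> where R: "0 < R" "0 < \<delta>" "\<delta> < b0"
    and ch2: "0 \<le> rho2\<^sup>2 - c * rho2 - (a0 + \<delta>) + (b0 - \<delta>) * tkap R rho2"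
    and ch1: "rho2\<^sup>2 - c * rho2 - (a0 + \<delta>) + (b0 - \<delta>) * tkap R rho2 < rho\<^sup>2 - c * rho - (a0 + \<delta>) + (b0 - \<delta>) * tkap R rho"
    by (rule truncated_characteristic[of rho rho2])
       (use rho r2 lam chi0_pos[of rho2] chi0_decreasing[of rho rho2] in auto)
  define a b where "a = a0 + \<delta>" and "b = b0 - \<delta>"
  define ch where "ch z = z\<^sup>2 - c * z - a + b * tkap R z" for z
  define k0 where "k0 = ch rho - ch rho2"
  have k0: "k0 > 0" "ch rho2 \<ge> 0" using ch1 ch2 by (auto simp: k0_def ch_def a_def b_def)
  have b: "b \<ge> 0" using R by (simp add: b_def)
  obtain T0 where T0: "\<And>t. t \<le> T0 \<Longrightarrow> f (\<phi> t) \<le> a * \<phi> t" "\<And>t. t \<le> T0 \<Longrightarrow> b * \<phi> t \<le> g (\<phi> t)"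
    unfolding a_def b_def by (rule sol_linear_bounds_at_bot[OF s R(2)]) blast
  \<comment> \<open>Two windows of length \<open>R\<close>: for \<open>t \<le> T\<close> the
    truncated convolution sees only times up to \<open>T0\<close>, and a point up to
    \<open>S\<close> shifted by at most \<open>R\<close> stays to the left of
    \<open>T\<close>.\<close>
  define T S where "T = T0 - R" and "S = T - R"
  have TS: "S \<le> T" "T \<le> T0" using R by (auto simp: T_def S_def)
  define ind :: "real \<Rightarrow> real" where "ind = indicator {-R..R}"
  have [measurable]: "ind \<in> borel_measurable borel" by (simp add: ind_def)
  then have [simp, measurable]: "ind \<in> borel_measurable M" by (simp add: measurable_cong_sets[OF sets_M refl])
  have ind: "0 \<le> ind r" "ind r \<le> 1" "ind r \<noteq> 0 \<Longrightarrow> \<bar>r\<bar> \<le> R" for r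
    by (auto simp: ind_def indicator_def split: if_splits)
  have iind: "integrable M ind" by (rule integrable_const_bound[where B = 1]) (use ind in auto)
  define J where "J t = (\<integral>r. ind r * \<phi> (t - r) \<partial>M)" for t
  have Jc: "isCont J t" for t unfolding J_def[abs_def]
    by (rule weighted_conv_isCont[OF cont(1) _ iind, where X = X]) (use X n in auto)
  have iJ: "integrable M (\<lambda>r. ind r * \<phi> (t - r))" for t
  proof (rule integrable_const_bound[where B = X])
    have "ind r * \<phi> (t - r) \<le> 1 * X" for r using ind[of r] X n[of "t - r"] by (intro mult_mono) auto
    then show "AE r in M. norm (ind r * \<phi> (t - r)) \<le> X"
      using ind n by (auto simp: abs_mult)
  qed measurable
  have super: "deriv (deriv \<phi>) t - c * deriv \<phi> t - a * \<phi> t + b * J t \<le> 0" if t: "t \<le> T" for t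
  proof -
    have "b * J t = (\<integral>r. b * (ind r * \<phi> (t - r)) \<partial>M)" by (simp add: J_def)
    also have "\<dots> \<le> (\<integral>r. g (\<phi> (t - r)) \<partial>M)"
    proof (rule integral_mono)
      show "integrable M (\<lambda>r. g (\<phi> (t - r)))"
        by (rule sol_g_bound(1)[OF s, of X 0]) (use X m2_pos in auto)
      fix r
      show "b * (ind r * \<phi> (t - r)) \<le> g (\<phi> (t - r))"
      proof (cases "\<bar>r\<bar> \<le> R")
        case True
        then have "b * \<phi> (t - r) \<le> g (\<phi> (t - r))" using t by (intro T0) (auto simp: T_def)
        then show ?thesis using True by (simp add: ind_def indicator_def abs_le_iff)
      next
        case False
        then show ?thesis using g_nonneg[OF n] by (auto simp: ind_def indicator_def abs_le_iff)
      qed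
    qed (use iJ in simp)
    finally show ?thesis using sol_eq[OF s, of t] T0(1)[of t] t TS by simp
  qed
  define P where "P z t = exp (- z * t) * (deriv \<phi> t + (z - c) * \<phi> t)" for z t
  define A where "A z = z\<^sup>2 - c * z - a" for z
  define In where "In z l u = integral {l..u} (\<lambda>t. exp (- z * t) * \<phi> t)" for z l u
  have main: "k0 * In rho (- N) S \<le> \<bar>P rho T\<bar> + \<bar>P rho2 T\<bar> + \<bar>A rho * In rho S T\<bar> + \<bar>A rho2 * In rho2 S T\<bar>"
    if N: "- N \<le> S" "N \<ge> 0" for N
  proof -
    \<comment> \<open>This factor makes the two exponentials equal at \<open>- N\<close>, so
      \<open>th\<close> is nonnegative to the right of \<open>- N\<close> and nonpositive to the
      left.\<close>
    define E where "E = exp (- sg * N)"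
    have E: "0 \<le> E" "E \<le> 1" using N r2 by (auto simp: E_def)
    define th where "th t = exp (- rho * t) - E * exp (- rho2 * t)" for t
    have Eexp: "E * exp (- rho2 * t) = exp (- rho * t) * exp (- sg * (N + t))" for t
      by (simp add: E_def sg_def algebra_simps flip: exp_add)
    have th0: "th t \<ge> 0" if "t \<ge> - N" for t
    proof -
      have "exp (- sg * (N + t)) \<le> 1" using that r2 by (simp add: mult_nonneg_nonneg)
      then have "exp (- rho * t) * exp (- sg * (N + t)) \<le> exp (- rho * t) * 1" by (intro mult_left_mono) auto
      then show ?thesis by (simp only: th_def Eexp mult_1_right diff_ge_0_iff_ge diff_le_0_iff_le)
    qed
    have th1: "th t \<le> 0" if "t < - N" for t
    proof -
      have "1 \<le> exp (- sg * (N + t))" using that r2 by (simp add: mult_le_0_iff)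
      then have "exp (- rho * t) * 1 \<le> exp (- rho * t) * exp (- sg * (N + t))" by (intro mult_left_mono) auto
      then show ?thesis by (simp only: th_def Eexp mult_1_right diff_ge_0_iff_ge diff_le_0_iff_le)
    qed
    have thc: "isCont th t" for t unfolding th_def[abs_def] by (intro continuous_intros)
    have [measurable]: "th \<in> borel_measurable borel" unfolding th_def[abs_def] by measurable
    have co: "continuous_on B u" if "\<And>t. isCont u t" for B and u :: "real \<Rightarrow> real"
      using that by (auto intro: continuous_at_imp_continuous_on)
    have NT: "- N \<le> T" using N TS by simp
    define q where "q s = exp (- rho * s) * tkap R rho - E * exp (- rho2 * s) * tkap R rho2" for s
    \<comment> \<open>Cutting the transposed convolution at \<open>- N\<close> discards nonpositive
      values of \<open>th\<close>, and letting \<open>s\<close> run over the whole line adds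
      nonnegative ones; both errors have the right sign.\<close>
    have nonlocal: "integral {-N..S} (\<lambda>s. \<phi> s * q s) \<le> integral {-N..T} (\<lambda>t. th t * J t)"
    proof -
      have JN: "0 \<le> J t" for t unfolding J_def using ind n by simp
      have q_eq: "q s = (\<integral>r. ind r * th (s + r) \<partial>M)" and q_i: "integrable M (\<lambda>r. ind r * th (s + r))" for s
      proof -
        have iz: "integrable M (\<lambda>r. ind r * exp (- z * r))" if "0 \<le> z" "z \<le> m2" for z
          using integrable_exp[OF that] ind by (intro Bochner_Integration.integrable_bound[OF integrable_exp[OF that]]) (auto simp: abs_mult mult_le_cancel_right1)
        have eq: "ind r * th (s + r) = exp (- rho * s) * (ind r * exp (- rho * r)) - E * exp (- rho2 * s) * (ind r * exp (- rho2 * r))" for r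
          by (simp add: th_def algebra_simps flip: exp_add)
        show "integrable M (\<lambda>r. ind r * th (s + r))" unfolding eq
          using iz[of rho] iz[of rho2] rho r2 lam by simp
        show "q s = (\<integral>r. ind r * th (s + r) \<partial>M)" unfolding eq
          using iz[of rho] iz[of rho2] rho r2 lam by (simp add: q_def tkap_def ind_def)
      qed
      have qc: "isCont q s" for s unfolding q_def[abs_def] by (intro continuous_intros)
      have si1: "set_integrable lborel {-N..S} (\<lambda>s. \<phi> s * q s)"
        using cont qc by (intro borel_integrable_atLeastAtMost' co continuous_mult)
      have si2: "set_integrable lborel {-N..T} (\<lambda>t. th t * J t)"
        using thc Jc by (intro borel_integrable_atLeastAtMost' co continuous_mult)
      have "ennreal (integral {-N..S} (\<lambda>s. \<phi> s * q s)) = ennreal (\<integral>s. indicator {-N..S} s *\<^sub>R (\<phi> s * q s) \<partial>lborel)"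
        using set_borel_integral_eq_integral(2)[OF si1] by (simp add: set_lebesgue_integral_def)
      also have "\<dots> \<le> (\<integral>\<^sup>+s. ennreal (indicator {-N..S} s *\<^sub>R (\<phi> s * q s)) \<partial>lborel)"
        by (rule integral_le_nn_integral) (use si1 in \<open>simp add: set_integrable_def\<close>)
      also have "\<dots> \<le> (\<integral>\<^sup>+s. ennreal (\<phi> s) * (\<integral>\<^sup>+r. ennreal (ind r) * ennreal (indicator {-N..T} (s + r) * th (s + r)) \<partial>M) \<partial>lborel)"
      proof (rule nn_integral_mono)
        fix s
        show "ennreal (indicator {-N..S} s *\<^sub>R (\<phi> s * q s)) \<le> ennreal (\<phi> s) * (\<integral>\<^sup>+r. ennreal (ind r) * ennreal (indicator {-N..T} (s + r) * th (s + r)) \<partial>M)"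
        proof (cases "s \<in> {-N..S}")
          case True
          have "ennreal (q s) \<le> (\<integral>\<^sup>+r. ennreal (ind r * th (s + r)) \<partial>M)"
            unfolding q_eq by (rule integral_le_nn_integral[OF q_i])
          also have "\<dots> \<le> (\<integral>\<^sup>+r. ennreal (ind r) * ennreal (indicator {-N..T} (s + r) * th (s + r)) \<partial>M)"
          proof (rule nn_integral_mono)
            fix r
            have "ind r * th (s + r) \<le> ind r * (indicator {-N..T} (s + r) * th (s + r))"
            proof (cases "ind r = 0")
              case False
              then have "s + r \<le> T" using ind(3)[of r] True by (auto simp: S_def)
              then show ?thesis using th1[of "s + r"] ind(1)[of r] by (cases "s + r < - N") (auto simp: mult_nonneg_nonpos)
            qed simp
            then show "ennreal (ind r * th (s + r)) \<le> ennreal (ind r) * ennreal (indicator {-N..T} (s + r) * th (s + r))"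
              using ind(1)[of r] th0[of "s + r"] by (subst ennreal_mult[symmetric]) (auto simp: indicator_def intro: ennreal_leI)
          qed
          finally show ?thesis using True n[of s]
            by (auto simp: ennreal_mult' intro: mult_left_mono)
        qed auto
      qed
      also have "\<dots> = (\<integral>\<^sup>+t. ennreal (indicator {-N..T} t * th t) * (\<integral>\<^sup>+r. ennreal (ind r) * ennreal (\<phi> (t - r)) \<partial>M) \<partial>lborel)"
        by (rule nn_integral_convolution_swap[symmetric]) (auto intro: sigma_finite_measure_axioms)
      also have "\<dots> = (\<integral>\<^sup>+t. ennreal (indicator {-N..T} t *\<^sub>R (th t * J t)) \<partial>lborel)"
      proof (rule nn_integral_cong)
        fix t
        have "(\<integral>\<^sup>+r. ennreal (ind r) * ennreal (\<phi> (t - r)) \<partial>M) = ennreal (J t)"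
          unfolding J_def using iJ[of t] ind(1) n by (subst nn_integral_eq_integral[symmetric]) (auto simp: ennreal_mult)
        then show "ennreal (indicator {-N..T} t * th t) * (\<integral>\<^sup>+r. ennreal (ind r) * ennreal (\<phi> (t - r)) \<partial>M) = ennreal (indicator {-N..T} t *\<^sub>R (th t * J t))"
          using JN[of t] th0[of t] by (auto simp: indicator_def ennreal_mult)
      qed
      also have "\<dots> = ennreal (\<integral>t. indicator {-N..T} t *\<^sub>R (th t * J t) \<partial>lborel)"
        using si2 JN th0 by (intro nn_integral_eq_integral) (auto simp: set_integrable_def indicator_def)
      also have "\<dots> = ennreal (integral {-N..T} (\<lambda>t. th t * J t))"
        using set_borel_integral_eq_integral(2)[OF si2] by (simp add: set_lebesgue_integral_def)
      finally show ?thesis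
        using JN th0 by (subst (asm) ennreal_le_iff) (auto intro!: integral_nonneg integrable_continuous_interval co continuous_mult thc Jc)
    qed
    define Lz where "Lz z = integral {-N..T} (\<lambda>t. exp (- z * t) * (deriv (deriv \<phi>) t - c * deriv \<phi> t - a * \<phi> t))" for z
    have Lz: "Lz z = P z T - P z (- N) + A z * In z (- N) T" for z
      unfolding Lz_def P_def A_def In_def by (rule sol_integral_exp[OF s NT])
    have "integral {-N..T} (\<lambda>t. th t * (deriv (deriv \<phi>) t - c * deriv \<phi> t - a * \<phi> t + b * J t)) \<le> integral {-N..T} (\<lambda>t. 0)"
      using super th0 cont thc Jc
      by (intro integral_le integrable_continuous_interval co) (auto intro!: continuous_intros mult_nonneg_nonpos)
    moreover have "integral {-N..T} (\<lambda>t. th t * (deriv (deriv \<phi>) t - c * deriv \<phi> t - a * \<phi> t + b * J t))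
       = integral {-N..T} (\<lambda>t. exp (- rho * t) * (deriv (deriv \<phi>) t - c * deriv \<phi> t - a * \<phi> t)
           - E * (exp (- rho2 * t) * (deriv (deriv \<phi>) t - c * deriv \<phi> t - a * \<phi> t)) + b * (th t * J t))"
      by (intro integral_cong) (simp add: th_def algebra_simps)
    moreover have "\<dots> = Lz rho - E * Lz rho2 + b * integral {-N..T} (\<lambda>t. th t * J t)"
    proof -
      have iU: "(\<lambda>t. exp (- z * t) * (deriv (deriv \<phi>) t - c * deriv \<phi> t - a * \<phi> t)) integrable_on {-N..T}" for z
        using cont by (intro integrable_continuous_interval co continuous_intros)
      have iV: "(\<lambda>t. th t * J t) integrable_on {-N..T}"
        using thc Jc by (intro integrable_continuous_interval co continuous_intros)
      show ?thesis
        unfolding Lz_def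
        by (intro integral_unique has_integral_add has_integral_diff has_integral_mult_right integrable_integral iU iV)
    qed
    ultimately have "Lz rho - E * Lz rho2 + b * integral {-N..T} (\<lambda>t. th t * J t) \<le> 0" by simp
    then have 1: "Lz rho - E * Lz rho2 + b * integral {-N..S} (\<lambda>s. \<phi> s * q s) \<le> 0"
      using mult_left_mono[OF nonlocal b] by linarith
    have split: "In z (- N) T = In z (- N) S + In z S T" for z
      unfolding In_def using N TS cont
      by (intro Henstock_Kurzweil_Integration.integral_combine[symmetric] integrable_continuous_interval co continuous_intros) auto
    have qI: "integral {-N..S} (\<lambda>s. \<phi> s * q s) = tkap R rho * In rho (- N) S - E * (tkap R rho2 * In rho2 (- N) S)"
    proof -
      have "integral {-N..S} (\<lambda>s. \<phi> s * q s) = integral {-N..S} (\<lambda>s. tkap R rho * (exp (- rho * s) * \<phi> s) - (E * tkap R rho2) * (exp (- rho2 * s) * \<phi> s))"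
        by (intro integral_cong) (simp add: q_def algebra_simps)
      also have "\<dots> = tkap R rho * In rho (- N) S - (E * tkap R rho2) * In rho2 (- N) S"
        unfolding In_def using cont
        by (intro integral_unique has_integral_diff has_integral_mult_right integrable_integral
            integrable_continuous_interval co continuous_intros)
      finally show ?thesis by simp
    qed
    \<comment> \<open>Nonnegativity of \<open>th\<close> compares the two transforms pointwise, so
      the one at \<open>rho2\<close> can be traded for the one at \<open>rho\<close>, which survives
      with the factor \<open>k0\<close>.\<close>
    have cmp: "E * In rho2 (- N) S \<le> In rho (- N) S"
    proof -
      have "E * In rho2 (- N) S = integral {-N..S} (\<lambda>s. E * (exp (- rho2 * s) * \<phi> s))"
        unfolding In_def by simp
      also have "\<dots> \<le> In rho (- N) S" unfolding In_def
      proof (intro integral_le integrable_continuous_interval co)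
        fix s assume "s \<in> {-N..S}"
        then have "E * exp (- rho2 * s) \<le> exp (- rho * s)" using th0[of s] by (simp add: th_def)
        then show "E * (exp (- rho2 * s) * \<phi> s) \<le> exp (- rho * s) * \<phi> s"
          using n[of s] by (simp flip: mult.assoc add: mult_right_mono)
      qed (use cont in \<open>auto intro!: continuous_intros\<close>)
      finally show ?thesis .
    qed
    \<comment> \<open>The two contributions of the derivative cancel at \<open>- N\<close>, and
      \<open>rho - rho2\<close> is negative.\<close>
    have bd: "P rho (- N) - E * P rho2 (- N) \<le> 0"
    proof -
      have "E * exp (- rho2 * - N) = exp (- rho * - N)" using Eexp[of "- N"] by simp
      then have "P rho (- N) - E * P rho2 (- N) = exp (- rho * - N) * ((rho - rho2) * \<phi> (- N))"
        unfolding P_def by (simp flip: mult.assoc) (simp add: algebra_simps)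
      then show ?thesis using r2 n by (simp add: mult_nonneg_nonpos mult_nonpos_nonneg)
    qed
    have abs: "- x + E * y \<le> \<bar>x\<bar> + \<bar>y\<bar>" for x y
    proof -
      have "E * y \<le> 1 * \<bar>y\<bar>" by (rule order_trans[OF mult_left_mono[OF abs_ge_self E(1)] mult_right_mono[OF E(2)]]) simp
      then show ?thesis by simp
    qed
    have "ch rho * In rho (- N) S - ch rho2 * (E * In rho2 (- N) S)
       \<le> (- P rho T + E * P rho2 T) + (P rho (- N) - E * P rho2 (- N)) + (- (A rho * In rho S T) + E * (A rho2 * In rho2 S T))"
      using 1 unfolding Lz qI split ch_def A_def by (simp add: algebra_simps)
    also have "\<dots> \<le> (\<bar>P rho T\<bar> + \<bar>P rho2 T\<bar>) + 0 + (\<bar>A rho * In rho S T\<bar> + \<bar>A rho2 * In rho2 S T\<bar>)"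
      by (intro add_mono abs bd)
    finally have "ch rho * In rho (- N) S - ch rho2 * (E * In rho2 (- N) S) \<le> \<dots>" .
    moreover have "ch rho2 * (E * In rho2 (- N) S) \<le> ch rho2 * In rho (- N) S"
      by (rule mult_left_mono[OF cmp k0(2)])
    ultimately show ?thesis by (simp add: k0_def algebra_simps)
  qed
  show ?thesis
  proof (rule that[of S "(\<bar>P rho T\<bar> + \<bar>P rho2 T\<bar> + \<bar>A rho * In rho S T\<bar> + \<bar>A rho2 * In rho2 S T\<bar>) / k0"])
    fix N :: real assume "- N \<le> S" "N \<ge> 0"
    then show "integral {-N..S} (\<lambda>t. exp (- rho * t) * \<phi> t) \<le> (\<bar>P rho T\<bar> + \<bar>P rho2 T\<bar> + \<bar>A rho * In rho S T\<bar> + \<bar>A rho2 * In rho2 S T\<bar>) / k0"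
      using main[of N] k0(1) by (simp add: In_def field_simps)
  qed
qed

text \<open>By the growth inequality the solution stays above \<open>exp (- k) * \<phi> t\<close> on
  the unit interval to the right of \<open>t\<close>, so the integral bound becomes
  pointwise.\<close>

lemma sol_decay:
  assumes s: "sol \<phi>" and rho: "0 < rho" "rho < lam"
  obtains C where "\<And>t. \<phi> t \<le> C * exp (rho * t)"
proof -
  obtain X where X: "X > 0" "\<And>t. \<phi> t \<le> X" by (rule sol_bounded[OF s]) blast
  have n: "0 \<le> \<phi> t" for t by (rule sol_nonneg[OF s])
  obtain k where k: "k > 0" "\<And>t h. 0 \<le> h \<Longrightarrow> exp (- k * h) * \<phi> t \<le> \<phi> (t + h)"
    by (rule sol_growth[OF s]) blast
  obtain S C where C: "\<And>N. - N \<le> S \<Longrightarrow> N \<ge> 0 \<Longrightarrow> integral {-N..S} (\<lambda>t. exp (- rho * t) * \<phi> t) \<le> C"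
    by (rule sol_integral_bound[OF s rho]) blast
  have co: "continuous_on B (\<lambda>t. exp (- rho * t) * \<phi> t)" for B
    using sol_isCont[OF s] by (auto intro!: continuous_intros continuous_at_imp_continuous_on)
  \<comment> \<open>For \<open>t\<close> up to this point the unit interval from \<open>t\<close>
    lies to the left of \<open>S\<close>, and \<open>- t\<close> is an admissible cut
    \<open>N\<close>.\<close>
  define T where "T = min S 0 - 1"
  have 1: "\<phi> t \<le> (C * exp rho * exp k) * exp (rho * t)" if t: "t \<le> T" for t
  proof -
    have t': "t + 1 \<le> S" "t \<le> S" "t \<le> 0" using t by (auto simp: T_def)
    have "exp (- rho * (t + 1)) * (exp (- k) * \<phi> t) = integral {t..t+1} (\<lambda>x. exp (- rho * (t + 1)) * (exp (- k) * \<phi> t))"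
      by simp
    also have "\<dots> \<le> integral {t..t+1} (\<lambda>t. exp (- rho * t) * \<phi> t)"
    proof (intro integral_le integrable_continuous_interval co continuous_intros)
      fix x assume x: "x \<in> {t..t+1}"
      have "exp (- k) * \<phi> t \<le> exp (- k * (x - t)) * \<phi> t"
        using x k n[of t] by (intro mult_right_mono) auto
      also have "\<dots> \<le> \<phi> x" using k(2)[of "x - t" t] x by simp
      finally have "exp (- k) * \<phi> t \<le> \<phi> x" .
      moreover have "exp (- rho * (t + 1)) \<le> exp (- rho * x)" using x rho by simp
      ultimately show "exp (- rho * (t + 1)) * (exp (- k) * \<phi> t) \<le> exp (- rho * x) * \<phi> x"
        using n[of t] by (intro mult_mono) auto
    qed
    also have "\<dots> \<le> integral {t..S} (\<lambda>t. exp (- rho * t) * \<phi> t)"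
      by (rule integral_subset_le) (use t' n in \<open>auto intro!: integrable_continuous_interval co[simplified]\<close>)
    also have "\<dots> \<le> C" using C[of "- t"] t' by simp
    finally have "exp (- rho * (t + 1)) * (exp (- k) * \<phi> t) \<le> C" .
    then have "exp (rho * (t + 1)) * exp k * (exp (- rho * (t + 1)) * (exp (- k) * \<phi> t)) \<le> exp (rho * (t + 1)) * exp k * C"
      by (rule mult_left_mono) simp
    moreover have "\<phi> t = exp (rho * (t + 1)) * exp k * (exp (- rho * (t + 1)) * (exp (- k) * \<phi> t))"
    proof -
      have "exp (rho * (t + 1)) * exp k * (exp (- rho * (t + 1)) * (exp (- k) * \<phi> t))
          = (exp (rho * (t + 1)) * exp (- rho * (t + 1))) * (exp k * exp (- k)) * \<phi> t"
        by (simp only: mult_ac)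
      also have "\<dots> = \<phi> t" by (simp flip: exp_add)
      finally show ?thesis by simp
    qed
    moreover have "exp (rho * (t + 1)) * exp k * C = (C * exp rho * exp k) * exp (rho * t)"
      by (simp add: distrib_left exp_add)
    ultimately show ?thesis by linarith
  qed
  define D where "D = max (C * exp rho * exp k) (X * exp (- rho * T))"
  show ?thesis
  proof (rule that[of D])
    fix t
    show "\<phi> t \<le> D * exp (rho * t)"
    proof (cases "t \<le> T")
      case True
      have "(C * exp rho * exp k) * exp (rho * t) \<le> D * exp (rho * t)"
        by (rule mult_right_mono) (auto simp: D_def)
      then show ?thesis using 1[OF True] by linarith
    next
      case False
      have "\<phi> t \<le> X * 1" using X by simp
      also have "\<dots> \<le> X * (exp (- rho * T) * exp (rho * t))"
        using False rho X by (intro mult_left_mono) (auto simp flip: exp_add)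
      also have "\<dots> \<le> D * exp (rho * t)"
        unfolding mult.assoc[symmetric] by (rule mult_right_mono) (auto simp: D_def)
      finally show ?thesis .
    qed
  qed
qed

end

section \<open>The nonlinear remainder and the charge\<close>

text \<open>The two bounds serve opposite half-lines: boundedness with the weight exponent
  \<open>rho \<ge> b\<close> on the right, the exponential with its surplus
  \<open>z - rho \<ge> b\<close> on the left.\<close>

lemma two_sided_exp_bound:
  fixes u :: "real \<Rightarrow> real"
  assumes "\<bar>u t\<bar> \<le> C * exp (z * t)" "\<bar>u t\<bar> \<le> X" "b \<le> rho" "rho + b \<le> z"
  shows "\<bar>exp (- rho * t) * u t\<bar> \<le> max C X * exp (- b * \<bar>t\<bar>)"
proof -
  have 0: "0 \<le> max C X" using order_trans[OF abs_ge_zero assms(2)] by (simp add: le_max_iff_disj)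
  show ?thesis
  proof (cases "t \<ge> 0")
    case True
    have "\<bar>exp (- rho * t) * u t\<bar> \<le> exp (- rho * t) * max C X"
      unfolding abs_mult using assms(2) by (simp add: max.coboundedI2)
    also have "\<dots> \<le> exp (- b * t) * max C X"
      using 0 True assms(3) by (intro mult_right_mono) (auto intro: mult_right_mono)
    finally show ?thesis using True by (simp add: mult.commute)
  next
    case False
    have "\<bar>exp (- rho * t) * u t\<bar> \<le> exp (- rho * t) * (max C X * exp (z * t))"
      unfolding abs_mult using order_trans[OF assms(1) mult_right_mono[OF max.cobounded1[of C X]]] by simp
    also have "\<dots> = max C X * exp ((z - rho) * t)" by (simp add: algebra_simps flip: exp_add)
    also have "\<dots> \<le> max C X * exp (b * t)"
      using 0 False assms(4) by (intro mult_left_mono) (auto intro: mult_right_mono_neg)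
    finally show ?thesis using False by simp
  qed
qed

lemma second_derivative_test_max:
  fixes U U1 :: "real \<Rightarrow> real"
  assumes "\<And>t. (U has_real_derivative U1 t) (at t)" "(U1 has_real_derivative u2) (at t0)"
    and "\<And>t. U t \<le> U t0"
  shows "U1 t0 = 0" "u2 \<le> 0"
proof -
  show U1: "U1 t0 = 0"
    by (rule DERIV_local_max[OF assms(1), of 1 t0]) (use assms(3) in auto)
  show "u2 \<le> 0"
  proof (rule ccontr)
    assume "\<not> u2 \<le> 0"
    then obtain d where d: "d > 0" "\<And>h. 0 < h \<Longrightarrow> h < d \<Longrightarrow> U1 t0 < U1 (t0 + h)"
      using has_real_derivative_pos_inc_right[OF assms(2)] by auto
    obtain z where z: "t0 < z" "z < t0 + d / 2" "U (t0 + d / 2) - U t0 = (t0 + d / 2 - t0) * U1 z"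
      using MVT2[of t0 "t0 + d / 2" U U1] assms(1) d(1) by auto
    have "U1 z > 0" using d(2)[of "z - t0"] z U1 by auto
    then have "(t0 + d / 2 - t0) * U1 z > 0" using d(1) by simp
    then have "U (t0 + d / 2) > U t0" using z(3) by linarith
    then show False using assms(3)[of "t0 + d / 2"] by simp
  qed
qed

context wave_eq
begin

definition nf :: "real \<Rightarrow> real" where "nf x = f x - a0 * x"
definition ng :: "real \<Rightarrow> real" where "ng x = g x - b0 * x"

text \<open>The nonlinear remainder: the linearization at 0, applied to a solution, equals this.\<close>
definition remainder :: "(real \<Rightarrow> real) \<Rightarrow> real \<Rightarrow> real" where
  "remainder \<phi> t = nf (\<phi> t) - (\<integral>r. ng (\<phi> (t - r)) \<partial>M)"

lemma sol_zero: "sol (\<lambda>t. 0)"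
  unfolding sol_def using f0 g0 by (auto simp: bounded_def)

lemma remainder_zero [simp]: "remainder (\<lambda>t. 0) = (\<lambda>t. 0)"
  by (auto simp: remainder_def nf_def ng_def f0 g0)

lemma sol_conv_integrable:
  assumes s: "sol \<phi>"
  shows "integrable M (\<lambda>r. \<phi> (t - r))" "integrable M (\<lambda>r. g (\<phi> (t - r)))" "integrable M (\<lambda>r. ng (\<phi> (t - r)))"
proof -
  obtain X where X: "X > 0" "\<And>t. \<phi> t \<le> X" by (rule sol_bounded[OF s]) blast
  show 1: "integrable M (\<lambda>r. \<phi> (t - r))"
    by (rule bounded_conv(1)[where X = X, OF sol_measurable(1)[OF s]]) (use X sol_nonneg[OF s] in auto)
  show 2: "integrable M (\<lambda>r. g (\<phi> (t - r)))"
    by (rule sol_g_bound(1)[OF s, of X 0]) (use X m2_pos in auto)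
  show "integrable M (\<lambda>r. ng (\<phi> (t - r)))" unfolding ng_def using 1 2 by simp
qed

lemma remainder_eq:
  assumes s: "sol \<phi>"
  shows "remainder \<phi> t = deriv (deriv \<phi>) t - c * deriv \<phi> t - a0 * \<phi> t + b0 * (\<integral>r. \<phi> (t - r) \<partial>M)"
  unfolding remainder_def nf_def ng_def using sol_conv_integrable[OF s, of t] sol_eq[OF s, of t] by simp

lemma sol_isCont_conv: "sol \<phi> \<Longrightarrow> isCont (\<lambda>t. \<integral>r. \<phi> (t - r) \<partial>M) t"
proof -
  assume s: "sol \<phi>"
  obtain X where X: "X > 0" "\<And>t. \<phi> t \<le> X" by (rule sol_bounded[OF s]) blast
  show ?thesis by (rule conv_isCont[where X = X]) (use X sol_nonneg[OF s] sol_isCont[OF s] in auto)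
qed

lemma remainder_isCont: "sol \<phi> \<Longrightarrow> isCont (remainder \<phi>) t"
proof -
  assume s: "sol \<phi>"
  have "remainder \<phi> = (\<lambda>t. deriv (deriv \<phi>) t - c * deriv \<phi> t - a0 * \<phi> t + b0 * (\<integral>r. \<phi> (t - r) \<partial>M))"
    using remainder_eq[OF s] by blast
  then show ?thesis
    using sol_isCont[OF s] sol_deriv2_isCont[OF s] sol_isCont_conv[OF s] by (simp add: continuous_intros)
qed

lemma remainder_measurable: "sol \<phi> \<Longrightarrow> remainder \<phi> \<in> borel_measurable borel"
  using remainder_isCont by (auto intro!: borel_measurable_continuous_onI continuous_at_imp_continuous_on)

end

context wave_eq_root
begin

text \<open>Every \<open>d < al * lam\<close> is reached because solutions decay at every rate below
  \<open>lam\<close>; the rate \<open>sg\<close> is chosen between \<open>d / al\<close> and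
  \<open>lam\<close>.\<close>

lemma sol_decay_powr:
  assumes s: "sol \<phi>" and d: "0 \<le> d" "d < al * lam"
  obtains D where "D \<ge> 0" "\<And>t. \<phi> t powr al \<le> D * exp (d * t)"
proof -
  obtain X where X: "X > 0" "\<And>t. \<phi> t \<le> X" by (rule sol_bounded[OF s]) blast
  have n: "0 \<le> \<phi> t" for t by (rule sol_nonneg[OF s])
  define y where "y = d / al"
  define sg where "sg = (y + lam) / 2"
  have "y < lam" "0 \<le> y" using d al by (simp_all add: y_def field_simps)
  then have sg: "0 < sg" "sg < lam" "d / al < sg" using lam(1) by (auto simp: sg_def simp flip: y_def)
  then have dsg: "d \<le> al * sg" using al by (simp add: field_simps)
  obtain C where C: "\<And>t. \<phi> t \<le> C * exp (sg * t)" by (rule sol_decay[OF s sg(1,2)]) blast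
  have C0: "C \<ge> 0" using order_trans[OF n C[of 0]] by simp
  have "\<phi> t powr al \<le> max (C powr al) (X powr al) * exp (d * t)" for t
  proof (rule exp_le_of_le_min[OF d(1) dsg])
    have "\<phi> t powr al \<le> (C * exp (sg * t)) powr al" using n C al by (intro powr_mono2) auto
    also have "\<dots> = C powr al * exp (al * sg * t)" using C0 by (simp add: powr_mult exp_powr_real mult_ac)
    finally show "\<phi> t powr al \<le> C powr al * exp (al * sg * t)" .
    show "\<phi> t powr al \<le> X powr al" using n X al by (intro powr_mono2) auto
  qed auto
  then show ?thesis by (intro that[of "max (C powr al) (X powr al)"]) (auto simp: le_max_iff_disj)
qed

lemma nonlinear_difference:
  assumes s: "sol \<phi>1" "sol \<phi>2" and d: "0 \<le> d" "d < al * lam"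
  obtains C where "C \<ge> 0" "\<And>t. \<bar>nf (\<phi>1 t) - nf (\<phi>2 t)\<bar> \<le> C * exp (d * t) * \<bar>\<phi>1 t - \<phi>2 t\<bar>"
    "\<And>t. \<bar>ng (\<phi>1 t) - ng (\<phi>2 t)\<bar> \<le> C * exp (d * t) * \<bar>\<phi>1 t - \<phi>2 t\<bar>"
proof -
  obtain X1 where X1: "X1 > 0" "\<And>t. \<phi>1 t \<le> X1" by (rule sol_bounded[OF s(1)]) blast
  obtain X2 where X2: "X2 > 0" "\<And>t. \<phi>2 t \<le> X2" by (rule sol_bounded[OF s(2)]) blast
  have n: "0 \<le> \<phi>1 t" "0 \<le> \<phi>2 t" for t using sol_nonneg s by auto
  define X where "X = max X1 X2"
  have X: "\<phi>1 t \<in> {0..X}" "\<phi>2 t \<in> {0..X}" for t using n X1(2)[of t] X2(2)[of t] by (auto simp: X_def le_max_iff_disj)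
  obtain Cf where Cf: "Cf \<ge> 0" "\<forall>x\<in>{0..X}. \<forall>y\<in>{0..X}. \<bar>(f x - a0 * x) - (f y - a0 * y)\<bar> \<le> Cf * (max x y) powr al * \<bar>x - y\<bar>"
    using f_near[of X] by blast
  obtain Cg where Cg: "Cg \<ge> 0" "\<forall>x\<in>{0..X}. \<forall>y\<in>{0..X}. \<bar>(g x - b0 * x) - (g y - b0 * y)\<bar> \<le> Cg * (max x y) powr al * \<bar>x - y\<bar>"
    using g_near[of X] by blast
  obtain D1 where D1: "D1 \<ge> 0" "\<And>t. \<phi>1 t powr al \<le> D1 * exp (d * t)" by (rule sol_decay_powr[OF s(1) d]) blast
  obtain D2 where D2: "D2 \<ge> 0" "\<And>t. \<phi>2 t powr al \<le> D2 * exp (d * t)" by (rule sol_decay_powr[OF s(2) d]) blast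
  have mx: "max (\<phi>1 t) (\<phi>2 t) powr al \<le> max D1 D2 * exp (d * t)" for t
  proof -
    have "\<phi>1 t powr al \<le> max D1 D2 * exp (d * t)" "\<phi>2 t powr al \<le> max D1 D2 * exp (d * t)"
      by (rule order_trans[OF D1(2) mult_right_mono], simp, simp,
          rule order_trans[OF D2(2) mult_right_mono], simp, simp)
    then show ?thesis by (cases "\<phi>1 t \<le> \<phi>2 t") (auto simp: max_absorb1 max_absorb2)
  qed
  have le: "K * max (\<phi>1 t) (\<phi>2 t) powr al * \<bar>\<phi>1 t - \<phi>2 t\<bar> \<le> max Cf Cg * max D1 D2 * exp (d * t) * \<bar>\<phi>1 t - \<phi>2 t\<bar>"
    if "0 \<le> K" "K \<le> max Cf Cg" for K t
    using mult_mono[OF that(2) mx[of t]] that Cf(1) by (intro mult_right_mono) (auto simp: mult.assoc le_max_iff_disj)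
  show ?thesis
  proof (rule that[of "max Cf Cg * max D1 D2"])
    show "0 \<le> max Cf Cg * max D1 D2" using Cf D1 by (intro mult_nonneg_nonneg) (auto simp: le_max_iff_disj)
    fix t
    show "\<bar>nf (\<phi>1 t) - nf (\<phi>2 t)\<bar> \<le> max Cf Cg * max D1 D2 * exp (d * t) * \<bar>\<phi>1 t - \<phi>2 t\<bar>"
      unfolding nf_def using order_trans[OF Cf(2)[rule_format, OF X(1) X(2)] le[of Cf]] Cf(1) by auto
    show "\<bar>ng (\<phi>1 t) - ng (\<phi>2 t)\<bar> \<le> max Cf Cg * max D1 D2 * exp (d * t) * \<bar>\<phi>1 t - \<phi>2 t\<bar>"
      unfolding ng_def using order_trans[OF Cg(2)[rule_format, OF X(1) X(2)] le[of Cg]] Cg(1) by auto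
  qed
qed

text \<open>The majorant \<omega> is left free and the constant does not depend on it: a single
  exponential serves for decay rates, whereas the barrier needs a sum of three whose coefficients
  are fixed only later.\<close>

lemma remainder_difference:
  assumes s: "sol \<phi>1" "sol \<phi>2" and d: "0 \<le> d" "d < al * lam"
  obtains C where "C \<ge> 0" "\<And>\<omega> t. \<lbrakk>\<And>x. \<bar>\<phi>1 x - \<phi>2 x\<bar> \<le> \<omega> x; integrable M (\<lambda>r. exp (d * (t - r)) * \<omega> (t - r))\<rbrakk>
    \<Longrightarrow> \<bar>remainder \<phi>1 t - remainder \<phi>2 t\<bar> \<le> C * (exp (d * t) * \<omega> t + (\<integral>r. exp (d * (t - r)) * \<omega> (t - r) \<partial>M))"
proof -
  obtain C where C: "C \<ge> 0" "\<And>t. \<bar>nf (\<phi>1 t) - nf (\<phi>2 t)\<bar> \<le> C * exp (d * t) * \<bar>\<phi>1 t - \<phi>2 t\<bar>"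
    "\<And>t. \<bar>ng (\<phi>1 t) - ng (\<phi>2 t)\<bar> \<le> C * exp (d * t) * \<bar>\<phi>1 t - \<phi>2 t\<bar>"
    by (rule nonlinear_difference[OF s d]) blast
  show ?thesis
  proof (rule that[OF C(1)])
    fix \<omega> :: "real \<Rightarrow> real" and t
    assume om: "\<And>x. \<bar>\<phi>1 x - \<phi>2 x\<bar> \<le> \<omega> x" and i: "integrable M (\<lambda>r. exp (d * (t - r)) * \<omega> (t - r))"
    have le: "C * exp (d * x) * \<bar>\<phi>1 x - \<phi>2 x\<bar> \<le> C * (exp (d * x) * \<omega> x)" for x
      unfolding mult.assoc using om[of x] C(1) by (intro mult_left_mono) auto
    have i2: "integrable M (\<lambda>r. ng (\<phi>1 (t - r)) - ng (\<phi>2 (t - r)))"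
      using sol_conv_integrable(3)[OF s(1)] sol_conv_integrable(3)[OF s(2)] by simp
    have "\<bar>\<integral>r. ng (\<phi>1 (t - r)) - ng (\<phi>2 (t - r)) \<partial>M\<bar> \<le> (\<integral>r. C * (exp (d * (t - r)) * \<omega> (t - r)) \<partial>M)"
      by (rule order_trans[OF integral_norm_bound[where 'a = real, unfolded real_norm_def]], rule integral_mono)
         (use i i2 order_trans[OF C(3) le] in auto)
    moreover have "\<bar>nf (\<phi>1 t) - nf (\<phi>2 t)\<bar> \<le> C * (exp (d * t) * \<omega> t)" using order_trans[OF C(2) le] .
    moreover have "remainder \<phi>1 t - remainder \<phi>2 t = (nf (\<phi>1 t) - nf (\<phi>2 t)) - (\<integral>r. ng (\<phi>1 (t - r)) - ng (\<phi>2 (t - r)) \<partial>M)"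
      unfolding remainder_def using sol_conv_integrable(3)[OF s(1)] sol_conv_integrable(3)[OF s(2)] by simp
    ultimately show "\<bar>remainder \<phi>1 t - remainder \<phi>2 t\<bar> \<le> C * (exp (d * t) * \<omega> t + (\<integral>r. exp (d * (t - r)) * \<omega> (t - r) \<partial>M))"
      by (simp add: distrib_left)
  qed
qed

lemma sol_difference_decay:
  assumes s: "sol \<phi>1" "sol \<phi>2" and z: "0 \<le> z" "z < lam"
  obtains C where "C \<ge> 0" "\<And>t. \<bar>\<phi>1 t - \<phi>2 t\<bar> \<le> C * exp (z * t)"
    "\<And>t. \<bar>deriv \<phi>1 t - deriv \<phi>2 t\<bar> \<le> C * exp (z * t)"
    "\<And>t. \<bar>deriv (deriv \<phi>1) t - deriv (deriv \<phi>2) t\<bar> \<le> C * exp (z * t)"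
proof -
  have *: "\<exists>C\<ge>0. \<forall>t. \<bar>\<phi> t\<bar> \<le> C * exp (z * t) \<and> \<bar>deriv \<phi> t\<bar> \<le> C * exp (z * t) \<and> \<bar>deriv (deriv \<phi>) t\<bar> \<le> C * exp (z * t)"
    if s: "sol \<phi>" for \<phi>
  proof -
    have n: "0 \<le> \<phi> t" for t by (rule sol_nonneg[OF s])
    obtain C where C: "\<And>t. \<phi> t \<le> C * exp (z * t)"
    proof (cases "z = 0")
      case True
      obtain X where "X > 0" "\<And>t. \<phi> t \<le> X" by (rule sol_bounded[OF s]) blast
      then show ?thesis using that[of X] True by simp
    next
      case False
      then show ?thesis using sol_decay[OF s, of z] z that by (metis less_eq_real_def)
    qed
    obtain D where D: "D \<ge> C" "\<And>t. \<bar>deriv \<phi> t\<bar> \<le> D * exp (z * t)" "\<And>t. \<bar>deriv (deriv \<phi>) t\<bar> \<le> D * exp (z * t)"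
      by (rule sol_deriv_bound[OF s C]) (use z lam in auto)
    have "\<bar>\<phi> t\<bar> \<le> D * exp (z * t)" for t
      using n[of t] order_trans[OF C[of t] mult_right_mono[OF D(1)]] by simp
    moreover have "0 \<le> D" using order_trans[OF abs_ge_zero D(2)[of 0]] by simp
    ultimately show ?thesis using D by blast
  qed
  obtain C1 where C1: "C1 \<ge> 0" "\<And>t. \<bar>\<phi>1 t\<bar> \<le> C1 * exp (z * t)" "\<And>t. \<bar>deriv \<phi>1 t\<bar> \<le> C1 * exp (z * t)" "\<And>t. \<bar>deriv (deriv \<phi>1) t\<bar> \<le> C1 * exp (z * t)"
    using *[OF s(1)] by blast
  obtain C2 where C2: "C2 \<ge> 0" "\<And>t. \<bar>\<phi>2 t\<bar> \<le> C2 * exp (z * t)" "\<And>t. \<bar>deriv \<phi>2 t\<bar> \<le> C2 * exp (z * t)" "\<And>t. \<bar>deriv (deriv \<phi>2) t\<bar> \<le> C2 * exp (z * t)"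
    using *[OF s(2)] by blast
  show ?thesis
  proof (rule that[of "C1 + C2"])
    show "0 \<le> C1 + C2" using C1 C2 by simp
    fix t
    show "\<bar>\<phi>1 t - \<phi>2 t\<bar> \<le> (C1 + C2) * exp (z * t)"
      "\<bar>deriv \<phi>1 t - deriv \<phi>2 t\<bar> \<le> (C1 + C2) * exp (z * t)"
      "\<bar>deriv (deriv \<phi>1) t - deriv (deriv \<phi>2) t\<bar> \<le> (C1 + C2) * exp (z * t)"
      using C1(2-4)[of t] C2(2-4)[of t] by (simp_all only: distrib_right)
  qed
qed

text \<open>Superlinearity gains the exponent \<open>d\<close> over the rate of the difference
  itself.\<close>

lemma remainder_difference_exp:
  assumes s: "sol \<phi>1" "sol \<phi>2" and d: "0 \<le> d" "d < al * lam" and z: "0 \<le> z" "z + d \<le> m2"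
    and K: "\<And>t. \<bar>\<phi>1 t - \<phi>2 t\<bar> \<le> K * exp (z * t)"
  obtains C where "C \<ge> 0" "\<And>t. \<bar>remainder \<phi>1 t - remainder \<phi>2 t\<bar> \<le> C * exp ((z + d) * t)"
proof -
  obtain C where C: "C \<ge> 0" "\<And>\<omega> t. \<lbrakk>\<And>x. \<bar>\<phi>1 x - \<phi>2 x\<bar> \<le> \<omega> x; integrable M (\<lambda>r. exp (d * (t - r)) * \<omega> (t - r))\<rbrakk>
    \<Longrightarrow> \<bar>remainder \<phi>1 t - remainder \<phi>2 t\<bar> \<le> C * (exp (d * t) * \<omega> t + (\<integral>r. exp (d * (t - r)) * \<omega> (t - r) \<partial>M))"
    by (rule remainder_difference[OF s d]) blast
  have K0: "K \<ge> 0" using order_trans[OF abs_ge_zero K[of 0]] by simp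
  have eq: "exp (d * x) * (K * exp (z * x)) = K * exp ((z + d) * x)" for x
    by (simp add: algebra_simps flip: exp_add)
  show ?thesis
  proof (rule that[of "C * (K * (1 + kap (z + d)))"])
    show "0 \<le> C * (K * (1 + kap (z + d)))"
      using C K0 kap_pos[of "z + d"] z d by (intro mult_nonneg_nonneg) auto
    fix t
    have "\<bar>remainder \<phi>1 t - remainder \<phi>2 t\<bar> \<le> C * (K * exp ((z + d) * t) + (\<integral>r. K * exp ((z + d) * (t - r)) \<partial>M))"
      using C(2)[of "\<lambda>x. K * exp (z * x)" t] K integrable_exp_conv[of "z + d" t] z d
      by (simp only: eq) simp
    also have "\<dots> = C * (K * (1 + kap (z + d))) * exp ((z + d) * t)"
      by (simp add: exp_conv) (simp add: algebra_simps)
    finally show "\<bar>remainder \<phi>1 t - remainder \<phi>2 t\<bar> \<le> C * (K * (1 + kap (z + d))) * exp ((z + d) * t)" .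
  qed
qed

text \<open>The crossing of \<open>lam\<close>: the difference decays at every rate below
  \<open>lam\<close>, and starting \<open>d / 2\<close> short of it the gain \<open>d\<close> ends
  \<open>d / 2\<close> beyond. This is what makes the transform of the remainder converge at
  \<open>lam\<close>.\<close>

lemma remainder_difference_decay:
  assumes s: "sol \<phi>1" "sol \<phi>2"
  obtains C d where "0 < d" "lam + d \<le> m2" "C \<ge> 0" "\<And>t. \<bar>remainder \<phi>1 t - remainder \<phi>2 t\<bar> \<le> C * exp ((lam + d) * t)"
    "\<And>t. \<bar>remainder \<phi>1 t - remainder \<phi>2 t\<bar> \<le> C"
proof -
  \<comment> \<open>Three constraints: a gain below \<open>al * lam\<close>, a final exponent within
    the moments of the kernel, and a nonnegative starting rate \<open>lam - d / 2\<close>.\<close>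
  define d where "d = min (min (al * lam / 2) (m2 - lam)) lam"
  have "al * lam > 0" using al lam by simp
  then have d: "0 < d" "d \<le> al * lam / 2" "d < al * lam" "lam + d \<le> m2" "d \<le> lam"
    using lam(1,2) unfolding d_def by (-, linarith+)
  obtain K where K: "K \<ge> 0" "\<And>t. \<bar>\<phi>1 t - \<phi>2 t\<bar> \<le> K * exp ((lam - d / 2) * t)"
    by (rule sol_difference_decay[OF s, of "lam - d / 2"]) (use d lam in auto)
  obtain K' where K': "K' \<ge> 0" "\<And>t. \<bar>\<phi>1 t - \<phi>2 t\<bar> \<le> K' * exp (0 * t)"
    by (rule sol_difference_decay[OF s, of 0]) (use d lam in auto)
  obtain C where C: "C \<ge> 0" "\<And>t. \<bar>remainder \<phi>1 t - remainder \<phi>2 t\<bar> \<le> C * exp ((lam + d / 2) * t)"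
    by (rule remainder_difference_exp[OF s _ _ _ _ K(2), of d]) (use d lam in \<open>auto simp: algebra_simps\<close>)
  obtain C' where C': "C' \<ge> 0" "\<And>t. \<bar>remainder \<phi>1 t - remainder \<phi>2 t\<bar> \<le> C' * exp ((0 + 0) * t)"
    by (rule remainder_difference_exp[OF s _ _ _ _ K'(2), of 0]) (use al lam m2_pos in auto)
  show ?thesis
  proof (rule that[of "d / 2" "max C C'"])
    fix t
    have "C * exp ((lam + d / 2) * t) \<le> max C C' * exp ((lam + d / 2) * t)"
      by (intro mult_right_mono) auto
    then show "\<bar>remainder \<phi>1 t - remainder \<phi>2 t\<bar> \<le> max C C' * exp ((lam + d / 2) * t)"
      using C(2)[of t] by linarith
    show "\<bar>remainder \<phi>1 t - remainder \<phi>2 t\<bar> \<le> max C C'" using C'(2)[of t] by simp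
  qed (use d C in \<open>auto simp: le_max_iff_disj\<close>)
qed

lemma sol_weighted_decay:
  assumes s: "sol \<phi>" and rho: "0 < rho" "rho < lam"
  obtains C b where "b > 0" "\<And>t. \<bar>exp (- rho * t) * \<phi> t\<bar> \<le> C * exp (- b * \<bar>t\<bar>)"
    "\<And>t. \<bar>exp (- rho * t) * deriv \<phi> t\<bar> \<le> C * exp (- b * \<bar>t\<bar>)"
    "\<And>t. \<bar>exp (- rho * t) * deriv (deriv \<phi>) t\<bar> \<le> C * exp (- b * \<bar>t\<bar>)"
    "\<And>t. \<bar>exp (- rho * t) * (\<integral>r. \<phi> (t - r) \<partial>M)\<bar> \<le> C * exp (- b * \<bar>t\<bar>)"
proof -
  define sg where "sg = (rho + lam) / 2"
  have sg: "rho < sg" "sg < lam" using rho by (auto simp: sg_def)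
  obtain C where C: "C \<ge> 0" "\<And>t. \<bar>\<phi> t - 0\<bar> \<le> C * exp (sg * t)" "\<And>t. \<bar>deriv \<phi> t - deriv (\<lambda>t. 0) t\<bar> \<le> C * exp (sg * t)"
    "\<And>t. \<bar>deriv (deriv \<phi>) t - deriv (deriv (\<lambda>t. 0)) t\<bar> \<le> C * exp (sg * t)"
    by (rule sol_difference_decay[OF s sol_zero, of sg]) (use sg rho in auto)
  obtain D where D: "D \<ge> 0" "\<And>t. \<bar>\<phi> t - 0\<bar> \<le> D * exp (0 * t)" "\<And>t. \<bar>deriv \<phi> t - deriv (\<lambda>t. 0) t\<bar> \<le> D * exp (0 * t)"
    "\<And>t. \<bar>deriv (deriv \<phi>) t - deriv (deriv (\<lambda>t. 0)) t\<bar> \<le> D * exp (0 * t)"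
    by (rule sol_difference_decay[OF s sol_zero, of 0]) (use lam in auto)
  define b where "b = min rho (sg - rho)"
  have b: "b > 0" "b \<le> rho" "rho + b \<le> sg" using rho sg by (auto simp: b_def)
  have e: "\<bar>\<integral>r. \<phi> (t - r) \<partial>M\<bar> \<le> C * kap sg * exp (sg * t)" "\<bar>\<integral>r. \<phi> (t - r) \<partial>M\<bar> \<le> D" for t
    using exp_bounded_conv(2)[of sg \<phi> C t] bounded_conv(2)[of \<phi> D t] sol_measurable(1)[OF s] C D sg rho lam by auto
  define K where "K = max (max C D) (max (C * kap sg) D)"
  have w: "max C D * exp (- b * \<bar>t\<bar>) \<le> K * exp (- b * \<bar>t\<bar>)" "max (C * kap sg) D * exp (- b * \<bar>t\<bar>) \<le> K * exp (- b * \<bar>t\<bar>)" for t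
    by (intro mult_right_mono; simp add: K_def)+
  show ?thesis
  proof (rule that[OF b(1), of K])
    fix t
    show "\<bar>exp (- rho * t) * \<phi> t\<bar> \<le> K * exp (- b * \<bar>t\<bar>)"
      using order_trans[OF two_sided_exp_bound[of \<phi> t C sg D b rho] w(1)] C(2)[of t] D(2)[of t] b by simp
    show "\<bar>exp (- rho * t) * deriv \<phi> t\<bar> \<le> K * exp (- b * \<bar>t\<bar>)"
      using order_trans[OF two_sided_exp_bound[of "deriv \<phi>" t C sg D b rho] w(1)] C(3)[of t] D(3)[of t] b by simp
    show "\<bar>exp (- rho * t) * deriv (deriv \<phi>) t\<bar> \<le> K * exp (- b * \<bar>t\<bar>)"
      using order_trans[OF two_sided_exp_bound[of "deriv (deriv \<phi>)" t C sg D b rho] w(1)] C(4)[of t] D(4)[of t] b by simp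
    show "\<bar>exp (- rho * t) * (\<integral>r. \<phi> (t - r) \<partial>M)\<bar> \<le> K * exp (- b * \<bar>t\<bar>)"
      using order_trans[OF two_sided_exp_bound[of "\<lambda>t. \<integral>r. \<phi> (t - r) \<partial>M" t "C * kap sg" sg D b rho] w(2)] e[of t] b by simp
  qed
qed

text \<open>Below \<open>lam\<close> each term of the linearization has an absolutely convergent
  transform, the boundary terms vanish at both ends, and Tonelli turns the convolution into the
  factor \<open>kap rho\<close>.\<close>

lemma remainder_laplace:
  assumes s: "sol \<phi>" and rho: "0 < rho" "rho < lam"
  shows "0 \<le> (\<integral>t. exp (- rho * t) * remainder \<phi> t \<partial>lborel)"
proof -
  note d = sol_deriv[OF s]
  have n: "0 \<le> \<phi> t" for t by (rule sol_nonneg[OF s])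
  have [measurable]: "\<phi> \<in> borel_measurable borel" "deriv \<phi> \<in> borel_measurable borel" by (rule sol_measurable[OF s])+
  have cont: "isCont \<phi> t" "isCont (deriv \<phi>) t" "isCont (deriv (deriv \<phi>)) t" for t
    using sol_isCont[OF s] sol_deriv2_isCont[OF s] by auto
  have [measurable]: "deriv (deriv \<phi>) \<in> borel_measurable borel"
    using cont by (auto intro!: borel_measurable_continuous_onI continuous_at_imp_continuous_on)
  obtain C b where b: "b > 0" and C: "\<And>t. \<bar>exp (- rho * t) * \<phi> t\<bar> \<le> C * exp (- b * \<bar>t\<bar>)"
    "\<And>t. \<bar>exp (- rho * t) * deriv \<phi> t\<bar> \<le> C * exp (- b * \<bar>t\<bar>)"
    "\<And>t. \<bar>exp (- rho * t) * deriv (deriv \<phi>) t\<bar> \<le> C * exp (- b * \<bar>t\<bar>)"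
    "\<And>t. \<bar>exp (- rho * t) * (\<integral>r. \<phi> (t - r) \<partial>M)\<bar> \<le> C * exp (- b * \<bar>t\<bar>)"
    by (rule sol_weighted_decay[OF s rho]) blast
  note I = integrable_exp_bound[OF b _ C(1)] integrable_exp_bound[OF b _ C(2)] integrable_exp_bound[OF b _ C(3)] integrable_exp_bound[OF b _ C(4)]
  have I: "integrable lborel (\<lambda>t. exp (- rho * t) * \<phi> t)" "integrable lborel (\<lambda>t. exp (- rho * t) * deriv \<phi> t)"
    "integrable lborel (\<lambda>t. exp (- rho * t) * deriv (deriv \<phi>) t)" "integrable lborel (\<lambda>t. exp (- rho * t) * (\<integral>r. \<phi> (t - r) \<partial>M))"
    by (rule I; simp)+
  define P where "P t = exp (- rho * t) * deriv \<phi> t + (rho - c) * (exp (- rho * t) * \<phi> t)" for t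
  define p where "p t = exp (- rho * t) * deriv (deriv \<phi>) t - c * (exp (- rho * t) * deriv \<phi> t) - (rho\<^sup>2 - c * rho) * (exp (- rho * t) * \<phi> t)" for t
  have e0: "((\<lambda>t. C * exp (- b * \<bar>t\<bar>)) \<longlongrightarrow> 0) at_top" "((\<lambda>t. C * exp (- b * \<bar>t\<bar>)) \<longlongrightarrow> 0) at_bot"
    using b by real_asymp+
  have lim: "(u \<longlongrightarrow> 0) F" if "\<And>t. \<bar>u t\<bar> \<le> C * exp (- b * \<bar>t\<bar>)" "((\<lambda>t. C * exp (- b * \<bar>t\<bar>)) \<longlongrightarrow> 0) F" for u F
    by (rule Lim_null_comparison[OF _ that(2)]) (use that(1) in auto)
  have "(\<integral>t. p t \<partial>lborel) = 0"
  proof (rule integral_deriv_eq_0[where P = P])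
    show "(P has_real_derivative p t) (at t)" for t unfolding P_def[abs_def] p_def
      by (auto intro!: derivative_eq_intros d simp: algebra_simps power2_eq_square)
    show "isCont p t" for t unfolding p_def[abs_def] using cont by (intro continuous_intros) auto
    show "integrable lborel p" unfolding p_def[abs_def] using I by simp
    show "(P \<longlongrightarrow> 0) at_top" unfolding P_def[abs_def]
      using tendsto_add[OF lim[OF C(2) e0(1)] tendsto_mult_right_zero[OF lim[OF C(1) e0(1)], of "rho - c"]] by simp
    show "(P \<longlongrightarrow> 0) at_bot" unfolding P_def[abs_def]
      using tendsto_add[OF lim[OF C(2) e0(2)] tendsto_mult_right_zero[OF lim[OF C(1) e0(2)], of "rho - c"]] by simp
  qed
  have pI: "integrable lborel p" unfolding p_def[abs_def] using I by simp
  have nl: "(\<integral>t. exp (- rho * t) * (\<integral>r. \<phi> (t - r) \<partial>M) \<partial>lborel) = kap rho * (\<integral>t. exp (- rho * t) * \<phi> t \<partial>lborel)"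
  proof -
    have "ennreal (\<integral>t. exp (- rho * t) * (\<integral>r. \<phi> (t - r) \<partial>M) \<partial>lborel) = (\<integral>\<^sup>+t. ennreal (exp (- rho * t) * (\<integral>r. \<phi> (t - r) \<partial>M)) \<partial>lborel)"
      using I(4) n by (intro nn_integral_eq_integral[symmetric]) auto
    also have "\<dots> = (\<integral>\<^sup>+t. ennreal (exp (- rho * t)) * (\<integral>\<^sup>+r. 1 * ennreal (\<phi> (t - r)) \<partial>M) \<partial>lborel)"
    proof (rule nn_integral_cong)
      fix t
      have "(\<integral>\<^sup>+r. 1 * ennreal (\<phi> (t - r)) \<partial>M) = ennreal (\<integral>r. \<phi> (t - r) \<partial>M)"
        using sol_conv_integrable(1)[OF s, of t] n by (simp add: nn_integral_eq_integral)
      then show "ennreal (exp (- rho * t) * (\<integral>r. \<phi> (t - r) \<partial>M)) = ennreal (exp (- rho * t)) * (\<integral>\<^sup>+r. 1 * ennreal (\<phi> (t - r)) \<partial>M)"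
        using n by (simp add: ennreal_mult)
    qed
    also have "\<dots> = (\<integral>\<^sup>+x. ennreal (\<phi> x) * (\<integral>\<^sup>+r. 1 * ennreal (exp (- rho * (x + r))) \<partial>M) \<partial>lborel)"
      by (rule nn_integral_convolution_swap) (auto intro: sigma_finite_measure_axioms)
    also have "\<dots> = (\<integral>\<^sup>+x. ennreal (kap rho * (exp (- rho * x) * \<phi> x)) \<partial>lborel)"
    proof (rule nn_integral_cong)
      fix x
      have eq: "exp (- rho * (x + r)) = exp (- rho * x) * exp (- rho * r)" for r by (simp add: algebra_simps flip: exp_add)
      have "(\<integral>\<^sup>+r. 1 * ennreal (exp (- rho * (x + r))) \<partial>M) = ennreal (\<integral>r. exp (- rho * x) * exp (- rho * r) \<partial>M)"
        unfolding eq using integrable_exp[of rho] rho lam by (subst nn_integral_eq_integral[symmetric]) auto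
      also have "\<dots> = ennreal (exp (- rho * x) * kap rho)" by (simp add: kap_def)
      finally show "ennreal (\<phi> x) * (\<integral>\<^sup>+r. 1 * ennreal (exp (- rho * (x + r))) \<partial>M) = ennreal (kap rho * (exp (- rho * x) * \<phi> x))"
        using n[of x] kap_pos[of rho] rho lam by (simp add: ennreal_mult'[symmetric] mult_ac)
    qed
    also have "\<dots> = ennreal (kap rho * (\<integral>t. exp (- rho * t) * \<phi> t \<partial>lborel))"
      using I(1) n kap_pos[of rho] rho lam by (subst nn_integral_eq_integral) auto
    finally show ?thesis
      using n kap_pos[of rho] rho lam by (subst (asm) ennreal_inj) auto
  qed
  have "(\<integral>t. exp (- rho * t) * remainder \<phi> t \<partial>lborel)
     = (\<integral>t. p t + (rho\<^sup>2 - c * rho - a0) * (exp (- rho * t) * \<phi> t) + b0 * (exp (- rho * t) * (\<integral>r. \<phi> (t - r) \<partial>M)) \<partial>lborel)"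
    by (intro Bochner_Integration.integral_cong) (simp_all add: remainder_eq[OF s] p_def algebra_simps)
  also have "\<dots> = (rho\<^sup>2 - c * rho - a0) * (\<integral>t. exp (- rho * t) * \<phi> t \<partial>lborel) + b0 * (kap rho * (\<integral>t. exp (- rho * t) * \<phi> t \<partial>lborel))"
    using pI I \<open>(\<integral>t. p t \<partial>lborel) = 0\<close> by (simp add: nl[simplified])
  also have "\<dots> = chi0 rho * (\<integral>t. exp (- rho * t) * \<phi> t \<partial>lborel)" by (simp add: chf_def algebra_simps)
  also have "\<dots> \<ge> 0" using chi0_pos[of rho] rho n by (intro mult_nonneg_nonneg) auto
  finally show ?thesis .
qed

text \<open>Transform of the remainder at \<open>lam\<close> itself, an exponent at which the
  transform of the solution may diverge.\<close>

definition charge :: "(real \<Rightarrow> real) \<Rightarrow> real" where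
  "charge \<phi> = (\<integral>t. exp (- lam * t) * remainder \<phi> t \<partial>lborel)"

lemma charge_nonneg:
  assumes s: "sol \<phi>" shows "0 \<le> charge \<phi>"
proof -
  obtain C d where d: "0 < d" "lam + d \<le> m2" "C \<ge> 0" and C: "\<And>t. \<bar>remainder \<phi> t - remainder (\<lambda>t. 0) t\<bar> \<le> C * exp ((lam + d) * t)"
    "\<And>t. \<bar>remainder \<phi> t - remainder (\<lambda>t. 0) t\<bar> \<le> C"
    by (rule remainder_difference_decay[OF s sol_zero]) blast
  define b where "b = min (lam / 2) d"
  have b: "b > 0" "b \<le> lam / 2" "b \<le> d" using d lam by (auto simp: b_def)
  \<comment> \<open>All these exponents stay between \<open>lam / 2\<close> and \<open>lam\<close>,
    so one decay rate \<open>b\<close> gives a common majorant.\<close>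
  define x where "x n = lam - lam / (2 + real n)" for n
  have x: "lam / 2 \<le> x n" "0 < x n" "x n < lam" for n
    using lam(1) by (auto simp: x_def field_simps add_pos_nonneg mult_le_cancel_left1)
  have xl: "x \<longlonglongrightarrow> lam" unfolding x_def by real_asymp
  have m: "remainder \<phi> \<in> borel_measurable borel" by (rule remainder_measurable[OF s])
  have "(\<lambda>n. \<integral>t. exp (- x n * t) * remainder \<phi> t \<partial>lborel) \<longlonglongrightarrow> charge \<phi>"
    unfolding charge_def
  proof (rule integral_dominated_convergence[where w = "\<lambda>t. C * exp (- b * \<bar>t\<bar>)"])
    show "AE t in lborel. (\<lambda>n. exp (- x n * t) * remainder \<phi> t) \<longlonglongrightarrow> exp (- lam * t) * remainder \<phi> t"
      using xl by (intro AE_I2 tendsto_intros)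
    show "AE t in lborel. norm (exp (- x n * t) * remainder \<phi> t) \<le> C * exp (- b * \<bar>t\<bar>)" for n
      using two_sided_exp_bound[of "remainder \<phi>" _ C "lam + d" C b "x n"] C b x[of n] by (intro AE_I2) simp
  qed (use m integrable_exp_abs(1)[OF b(1)] in auto)
  then show ?thesis
    by (rule LIMSEQ_le_const) (use remainder_laplace[OF s x(2,3)] in auto)
qed

lemma sol_shift:
  assumes s: "sol \<phi>" shows "sol (\<lambda>t. \<phi> (t + h))" "remainder (\<lambda>t. \<phi> (t + h)) = (\<lambda>t. remainder \<phi> (t + h))"
    "charge (\<lambda>t. \<phi> (t + h)) = exp (lam * h) * charge \<phi>"
proof -
  note d = sol_deriv[OF s]
  have 1: "((\<lambda>t. \<phi> (t + h)) has_real_derivative deriv \<phi> (t + h)) (at t)" for t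
    using d(1)[of "t + h"] by (simp only: DERIV_shift)
  have 2: "((\<lambda>t. deriv \<phi> (t + h)) has_real_derivative deriv (deriv \<phi>) (t + h)) (at t)" for t
    using d(2)[of "t + h"] by (simp only: DERIV_shift)
  have e1: "deriv (\<lambda>t. \<phi> (t + h)) = (\<lambda>t. deriv \<phi> (t + h))" by (intro ext DERIV_imp_deriv 1)
  have e2: "deriv (\<lambda>t. deriv \<phi> (t + h)) = (\<lambda>t. deriv (deriv \<phi>) (t + h))" by (intro ext DERIV_imp_deriv 2)
  have "bounded (range (\<lambda>t. \<phi> (t + h)))"
    by (rule bounded_subset[of "range \<phi>"]) (use s in \<open>auto simp: sol_def\<close>)
  moreover have "((\<lambda>t. \<phi> (t + h)) \<longlongrightarrow> 0) at_bot"
    by (rule filterlim_compose[OF sol_at_bot[OF s]])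
       real_asymp
  moreover have sh: "t + h - r = t - r + h" for t r by simp
  ultimately show "sol (\<lambda>t. \<phi> (t + h))"
    unfolding sol_def e1 e2 using 1 2 sol_nonneg[OF s] sol_eq[OF s] by (simp add: sh)
  show r: "remainder (\<lambda>t. \<phi> (t + h)) = (\<lambda>t. remainder \<phi> (t + h))"
    by (auto simp: remainder_def algebra_simps)
  have "charge (\<lambda>t. \<phi> (t + h)) = (\<integral>t. exp (- lam * t) * remainder \<phi> (t + h) \<partial>lborel)"
    unfolding charge_def r ..
  also have "\<dots> = (\<integral>t. exp (- lam * (t - h)) * remainder \<phi> t \<partial>lborel)"
    by (subst lborel_integral_real_affine[where c = 1 and t = "- h"]) auto
  also have "\<dots> = (\<integral>t. exp (lam * h) * (exp (- lam * t) * remainder \<phi> t) \<partial>lborel)"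
    by (intro Bochner_Integration.integral_cong) (auto simp: algebra_simps simp flip: exp_add)
  finally show "charge (\<lambda>t. \<phi> (t + h)) = exp (lam * h) * charge \<phi>" by (simp add: charge_def)
qed

end

section \<open>Tools for the difference of two solutions: tails, a weighted Poincare inequality,
  Young's inequality\<close>

lemma tail_int_linear:
  assumes "set_integrable lborel {t<..} u" "set_integrable lborel {t<..} v"
  shows "tail_int (\<lambda>s. u s + k * v s) t = tail_int u t + k * tail_int v t"
  unfolding tail_int_def using assms by (simp add: set_integral_add)

text \<open>With total integral 0 the tail equals minus the integral over the left half-line, which
  is as small at minus infinity as \<open>u\<close> itself. Equality of charges enters the proof
  here.\<close>

lemma tail_int_two_sided_bound:
  fixes u :: "real \<Rightarrow> real"
  assumes b: "b > 0" and m: "u \<in> borel_measurable borel" and bd: "\<And>t. \<bar>u t\<bar> \<le> C * exp (- b * \<bar>t\<bar>)"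
    and z: "(\<integral>t. u t \<partial>lborel) = 0"
  shows "\<bar>tail_int u t\<bar> \<le> C / b * exp (- b * \<bar>t\<bar>)"
proof (cases "t \<ge> 0")
  case True
  have "\<bar>u s\<bar> \<le> C * exp (- b * s)" if "s > t" for s using bd[of s] that True by simp
  from set_integrable_exp_tail(2)[OF b m this] show ?thesis using True by simp
next
  case False
  have iu: "integrable lborel u" by (rule integrable_exp_bound[OF b m bd])
  have i1: "set_integrable lborel A u" if "A \<in> sets borel" for A
    unfolding set_integrable_def by (rule integrable_mult_indicator) (use that iu in auto)
  have "(\<integral>s. u s \<partial>lborel) = (LINT s:{..t} \<union> {t<..}|lborel. u s)"
    by (simp add: set_lebesgue_integral_def)
       (intro Bochner_Integration.integral_cong, auto simp: indicator_def)
  also have "\<dots> = (LINT s:{..t}|lborel. u s) + tail_int u t"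
    unfolding tail_int_def by (rule set_integral_Un) (use i1 in auto)
  finally have "tail_int u t = - (LINT s:{..t}|lborel. u s)" using z by simp
  also have "(LINT s:{..t}|lborel. u s) = (LINT s:{-t..}|lborel. u (- s))"
    unfolding set_lebesgue_integral_def
    by (subst lborel_integral_real_affine[where c = "-1" and t = 0])
       (auto intro!: Bochner_Integration.integral_cong simp: indicator_def)
  also have "\<dots> = tail_int (\<lambda>s. u (- s)) (- t)"
    unfolding tail_int_def
  proof (rule set_integral_cong_set)
    show "AE s in lborel. (s \<in> {- t<..}) = (s \<in> {- t..})"
      using AE_lborel_singleton[of "- t"] by eventually_elim auto
  qed (use m in \<open>simp_all add: set_borel_measurable_def\<close>)
  finally have eq: "\<bar>tail_int u t\<bar> = \<bar>tail_int (\<lambda>s. u (- s)) (- t)\<bar>" by simp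
  have "\<bar>u (- s)\<bar> \<le> C * exp (- b * s)" if "s > - t" for s using bd[of "- s"] that False by simp
  then have "\<bar>tail_int (\<lambda>s. u (- s)) (- t)\<bar> \<le> C / b * exp (- b * - t)"
    by (intro set_integrable_exp_tail(2)[OF b]) (use m in auto)
  then show ?thesis using False unfolding eq by simp
qed

text \<open>Fatou bounds the integral of \<open>u\<close> by every positive number, while a positive
  value of a continuous nonnegative function would contribute a fixed amount.\<close>

lemma zero_of_psi_small:
  fixes u :: "real \<Rightarrow> real"
  assumes c: "\<And>t. isCont u t" and n: "\<And>t. 0 \<le> u t"
    and small: "\<And>\<epsilon>. 0 < \<epsilon> \<Longrightarrow> \<exists>e0>0. \<forall>e. 0 < e \<and> e < e0 \<longrightarrow> integrable lborel (\<lambda>t. psi e t * u t) \<and> (\<integral>t. psi e t * u t \<partial>lborel) \<le> \<epsilon>"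
  shows "u t = 0"
proof (rule ccontr)
  assume "u t \<noteq> 0"
  then have ut: "u t > 0" using n[of t] by simp
  have m: "u \<in> borel_measurable borel"
    using c by (auto intro!: borel_measurable_continuous_onI continuous_at_imp_continuous_on)
  have I: "integrable lborel u \<and> (\<integral>t. u t \<partial>lborel) \<le> \<epsilon>" if e: "0 < \<epsilon>" for \<epsilon>
  proof -
    obtain e0 where e0: "e0 > 0" "\<And>e. 0 < e \<Longrightarrow> e < e0 \<Longrightarrow> integrable lborel (\<lambda>t. psi e t * u t) \<and> (\<integral>t. psi e t * u t \<partial>lborel) \<le> \<epsilon>"
      using small[OF e] by blast
    show ?thesis using integrable_of_psi_bound[OF m n e0(1) e0(2)] by blast
  qed
  have "\<forall>\<^sub>F x in at t. u t / 2 < u x"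
    using c[of t] ut unfolding isCont_def by (intro order_tendstoD) auto
  then obtain d where d: "d > 0" "\<And>x. x \<noteq> t \<Longrightarrow> dist x t < d \<Longrightarrow> u t / 2 < u x"
    unfolding eventually_at by auto
  define S where "S = {t..t + d / 2}"
  have "u t / 2 * (d / 2) = (\<integral>x. u t / 2 * indicator S x \<partial>lborel)"
    using d by (simp add: S_def)
  also have "\<dots> \<le> (\<integral>x. u x \<partial>lborel)"
  proof (rule integral_mono)
    show "integrable lborel (\<lambda>x. u t / 2 * indicator S x)" using d
      by (intro integrable_mult_right integrable_real_indicator) (auto simp: S_def emeasure_lborel_Icc_eq)
    show "u t / 2 * indicator S x \<le> u x" for x
      using d(2)[of x] d(1) n[of x] ut by (cases "x = t") (auto simp: S_def indicator_def dist_real_def)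
  qed (use I[of 1] in auto)
  finally have "u t / 2 * (d / 2) \<le> (\<integral>x. u x \<partial>lborel)" .
  moreover have "u t / 2 * (d / 2) > 0" using ut d by simp
  ultimately show False using I[of "u t / 2 * (d / 2) / 2"] by simp
qed

text \<open>The pointwise bound is squared and integrated against the weight, and
  \<open>psi_osc\<close> turns the oscillation back into \<open>w1\<close>. What matters is that
  \<open>K\<close> does not depend on \<open>e\<close>.\<close>

lemma poincare_psi:
  fixes w w1 j :: "real \<Rightarrow> real"
  assumes w: "\<And>t. (w has_real_derivative w1 t) (at t)" "\<And>t. isCont w1 t"
    and gr: "\<And>a. 0 < a \<Longrightarrow> \<exists>C. \<forall>t. \<bar>w t\<bar> \<le> C * exp (a * \<bar>t\<bar>) \<and> \<bar>w1 t\<bar> \<le> C * exp (a * \<bar>t\<bar>)"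
    and b: "0 < b" and j: "j \<in> borel_measurable borel" "\<And>t. \<bar>j t\<bar> \<le> J"
    and le: "\<And>t. \<bar>w t\<bar> \<le> \<alpha> * \<bar>j t\<bar> + \<alpha> * \<bar>w1 t\<bar> + \<beta> * sqrt (osc b w1 t / b)"
  obtains K where "K > 0" "\<And>e. 0 < e \<Longrightarrow> e \<le> b / 2 \<Longrightarrow> integrable lborel (\<lambda>t. psi e t * (j t)\<^sup>2) \<and>
    (\<integral>t. psi e t * (w t)\<^sup>2 \<partial>lborel) \<le> K * ((\<integral>t. psi e t * (j t)\<^sup>2 \<partial>lborel) + (\<integral>t. psi e t * (w1 t)\<^sup>2 \<partial>lborel))"
proof -
  have wc: "isCont w t" for t using w(1) DERIV_isCont by blast
  have [measurable]: "w \<in> borel_measurable borel" "w1 \<in> borel_measurable borel"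
    using wc w(2) by (auto intro!: borel_measurable_continuous_onI continuous_at_imp_continuous_on)
  note j(1)[measurable]
  \<comment> \<open>The 3 comes from the square of a sum of three terms, \<open>4 / b\<close> from
    \<open>2 / (b - e)\<close> with \<open>e \<le> b / 2\<close>.\<close>
  define K where "K = 3 * \<alpha>\<^sup>2 + 3 * \<beta>\<^sup>2 / b * (4 / b) + 1"
  have K: "K > 0" unfolding K_def using b by (intro add_nonneg_pos add_nonneg_nonneg) auto
  show ?thesis
  proof (rule that[OF K])
    fix e :: real assume e: "0 < e" "e \<le> b / 2"
    \<comment> \<open>Growth slower than every exponential is available, so a rate with
      \<open>2 * a < e\<close> makes the squares integrable against the weight.\<close>
    define a where "a = e / 4"
    obtain C where C: "\<And>t. \<bar>w t\<bar> \<le> C * exp (a * \<bar>t\<bar>)" "\<And>t. \<bar>w1 t\<bar> \<le> C * exp (a * \<bar>t\<bar>)"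
      using gr[of a] e by (auto simp: a_def)
    have a: "0 \<le> a" "2 * a < b" "2 * a < e" "e < b" using e b by (auto simp: a_def)
    have sq: "\<bar>x\<^sup>2\<bar> \<le> C\<^sup>2 * exp (2 * a * \<bar>t\<bar>)" if "\<bar>x\<bar> \<le> C * exp (a * \<bar>t\<bar>)" for x t
    proof -
      have "x\<^sup>2 \<le> (C * exp (a * \<bar>t\<bar>))\<^sup>2" using that by (metis abs_ge_zero power2_abs power_mono)
      then show ?thesis by (simp add: power_mult_distrib power2_eq_square algebra_simps flip: exp_add)
    qed
    have Iw: "integrable lborel (\<lambda>t. psi e t * (w t)\<^sup>2)"
      by (rule psi_integrable[OF _ a(3) _ sq[OF C(1)]]) (use e in auto)
    have Iw1: "integrable lborel (\<lambda>t. psi e t * (w1 t)\<^sup>2)"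
      by (rule psi_integrable[OF _ a(3) _ sq[OF C(2)]]) (use e in auto)
    have Ij: "integrable lborel (\<lambda>t. psi e t * (j t)\<^sup>2)"
    proof (rule psi_integrable[OF _ e(1)])
      show "\<bar>(j t)\<^sup>2\<bar> \<le> J\<^sup>2 * exp (0 * \<bar>t\<bar>)" for t using j(2)[of t] by (simp add: abs_le_square_iff[symmetric])
    qed (use e in auto)
    have o: "integrable lborel (\<lambda>t. psi e t * osc b w1 t)"
      "(\<integral>t. psi e t * osc b w1 t \<partial>lborel) \<le> 2 / (b - e) * (\<integral>t. psi e t * (w1 t)\<^sup>2 \<partial>lborel)"
      using psi_osc[OF w C(2) a(1,2) e(1) a(3,4)] by auto
    have on: "0 \<le> osc b w1 t" for t by (rule osc_nonneg[OF w C(2) a(1,2)])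
    have ple: "(w t)\<^sup>2 \<le> 3 * \<alpha>\<^sup>2 * (j t)\<^sup>2 + 3 * \<alpha>\<^sup>2 * (w1 t)\<^sup>2 + 3 * \<beta>\<^sup>2 / b * osc b w1 t" for t
    proof -
      have three: "(x + y + z)\<^sup>2 \<le> 3 * x\<^sup>2 + 3 * y\<^sup>2 + 3 * z\<^sup>2" for x y z :: real
        using zero_le_power2[of "x - y"] zero_le_power2[of "y - z"] zero_le_power2[of "x - z"]
        by (simp add: power2_eq_square algebra_simps)
      have "(w t)\<^sup>2 \<le> (\<alpha> * \<bar>j t\<bar> + \<alpha> * \<bar>w1 t\<bar> + \<beta> * sqrt (osc b w1 t / b))\<^sup>2"
        using le[of t] by (metis abs_ge_zero power2_abs power_mono)
      also have "\<dots> \<le> 3 * (\<alpha> * \<bar>j t\<bar>)\<^sup>2 + 3 * (\<alpha> * \<bar>w1 t\<bar>)\<^sup>2 + 3 * (\<beta> * sqrt (osc b w1 t / b))\<^sup>2"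
        by (rule three)
      also have "\<dots> = 3 * \<alpha>\<^sup>2 * (j t)\<^sup>2 + 3 * \<alpha>\<^sup>2 * (w1 t)\<^sup>2 + 3 * \<beta>\<^sup>2 / b * osc b w1 t"
        using on[of t] b by (simp add: power_mult_distrib)
      finally show ?thesis .
    qed
    have "(\<integral>t. psi e t * (w t)\<^sup>2 \<partial>lborel) \<le> (\<integral>t. 3 * \<alpha>\<^sup>2 * (psi e t * (j t)\<^sup>2) + 3 * \<alpha>\<^sup>2 * (psi e t * (w1 t)\<^sup>2) + 3 * \<beta>\<^sup>2 / b * (psi e t * osc b w1 t) \<partial>lborel)"
    proof (rule integral_mono[OF Iw])
      show "psi e t * (w t)\<^sup>2 \<le> 3 * \<alpha>\<^sup>2 * (psi e t * (j t)\<^sup>2) + 3 * \<alpha>\<^sup>2 * (psi e t * (w1 t)\<^sup>2) + 3 * \<beta>\<^sup>2 / b * (psi e t * osc b w1 t)" for t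
        using mult_left_mono[OF ple[of t] psi_nonneg[of e t]] by (simp add: algebra_simps)
    qed (use Ij Iw1 o in simp)
    also have "\<dots> = 3 * \<alpha>\<^sup>2 * (\<integral>t. psi e t * (j t)\<^sup>2 \<partial>lborel) + 3 * \<alpha>\<^sup>2 * (\<integral>t. psi e t * (w1 t)\<^sup>2 \<partial>lborel) + 3 * \<beta>\<^sup>2 / b * (\<integral>t. psi e t * osc b w1 t \<partial>lborel)"
      using Ij Iw1 o by simp
    also have "\<dots> \<le> K * (\<integral>t. psi e t * (j t)\<^sup>2 \<partial>lborel) + K * (\<integral>t. psi e t * (w1 t)\<^sup>2 \<partial>lborel)"
    proof -
      have "2 / (b - e) \<le> 4 / b" using e b by (simp add: field_simps)
      then have "2 / (b - e) * (\<integral>t. psi e t * (w1 t)\<^sup>2 \<partial>lborel) \<le> 4 / b * (\<integral>t. psi e t * (w1 t)\<^sup>2 \<partial>lborel)"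
        by (intro mult_right_mono) auto
      then have "(\<integral>t. psi e t * osc b w1 t \<partial>lborel) \<le> 4 / b * (\<integral>t. psi e t * (w1 t)\<^sup>2 \<partial>lborel)"
        using o(2) by linarith
      then have "3 * \<beta>\<^sup>2 / b * (\<integral>t. psi e t * osc b w1 t \<partial>lborel) \<le> 3 * \<beta>\<^sup>2 / b * (4 / b * (\<integral>t. psi e t * (w1 t)\<^sup>2 \<partial>lborel))"
        using b by (intro mult_left_mono) auto
      moreover have "3 * \<alpha>\<^sup>2 * (\<integral>t. psi e t * (j t)\<^sup>2 \<partial>lborel) \<le> K * (\<integral>t. psi e t * (j t)\<^sup>2 \<partial>lborel)"
        using b by (intro mult_right_mono) (auto simp: K_def)
      moreover have "0 \<le> (\<integral>t. psi e t * (w1 t)\<^sup>2 \<partial>lborel)" by simp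
      moreover have "K * (\<integral>t. psi e t * (w1 t)\<^sup>2 \<partial>lborel) = 3 * \<alpha>\<^sup>2 * (\<integral>t. psi e t * (w1 t)\<^sup>2 \<partial>lborel)
          + 3 * \<beta>\<^sup>2 / b * (4 / b * (\<integral>t. psi e t * (w1 t)\<^sup>2 \<partial>lborel)) + (\<integral>t. psi e t * (w1 t)\<^sup>2 \<partial>lborel)"
        by (simp add: K_def algebra_simps)
      ultimately show ?thesis by linarith
    qed
    finally show "integrable lborel (\<lambda>t. psi e t * (j t)\<^sup>2) \<and> (\<integral>t. psi e t * (w t)\<^sup>2 \<partial>lborel) \<le> K * ((\<integral>t. psi e t * (j t)\<^sup>2 \<partial>lborel) + (\<integral>t. psi e t * (w1 t)\<^sup>2 \<partial>lborel))"
      using Ij by (simp add: distrib_left)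
  qed
qed

context exp_moment_measure
begin

text \<open>The equation is integrated from \<open>t\<close> to plus infinity, where every term
  decays, and the convolution commutes with the tail. The result has the form of the hypothesis with
  \<open>w\<close> replaced by its tail, so the step can be repeated.\<close>

lemma tail_identity:
  fixes w w1 w2 :: "real \<Rightarrow> real"
  assumes l: "0 < l" and w: "\<And>t. (w has_real_derivative w1 t) (at t)" "\<And>t. (w1 has_real_derivative w2 t) (at t)" "\<And>t. isCont w2 t"
    and bd: "\<And>t. \<bar>w t\<bar> \<le> K * exp (- l * t)" "\<And>t. \<bar>w1 t\<bar> \<le> K * exp (- l * t)" "\<And>t. \<bar>w2 t\<bar> \<le> K * exp (- l * t)"
    and eta: "\<And>t. eta t = w2 t + d * w1 t + B * ((\<integral>r. exp (- l * r) * w (t - r) \<partial>M) - q * w t)"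
  shows "tail_int eta t = - w1 t - d * w t + B * ((\<integral>r. exp (- l * r) * tail_int w (t - r) \<partial>M) - q * tail_int w t)"
proof -
  have c: "isCont w t" "isCont w1 t" for t using w(1,2) DERIV_isCont by blast+
  have [measurable]: "w \<in> borel_measurable borel" "w1 \<in> borel_measurable borel" "w2 \<in> borel_measurable borel"
    using c w(3) by (auto intro!: borel_measurable_continuous_onI continuous_at_imp_continuous_on)
  define N where "N t = (\<integral>r. exp (- l * r) * w (t - r) \<partial>M)" for t
  have Nb: "\<bar>N s\<bar> \<le> K * exp (- l * s)" for s
  proof -
    have b2: "\<bar>exp (- l * r) * w (s - r)\<bar> \<le> K * exp (- l * s)" for r
    proof -
      have "\<bar>exp (- l * r) * w (s - r)\<bar> \<le> exp (- l * r) * (K * exp (- l * (s - r)))"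
        unfolding abs_mult using bd(1)[of "s - r"] by (auto intro: mult_left_mono)
      also have "\<dots> = K * exp (- l * s)" by (simp add: algebra_simps flip: exp_add)
      finally show ?thesis .
    qed
    have i: "integrable M (\<lambda>r. exp (- l * r) * w (s - r))"
      by (rule integrable_const_bound[where B = "K * exp (- l * s)"])
         (intro AE_I2, simp only: real_norm_def b2, measurable)
    have "\<bar>N s\<bar> \<le> (\<integral>r. K * exp (- l * s) \<partial>M)" unfolding N_def
      by (rule order_trans[OF integral_norm_bound[where 'a = real, unfolded real_norm_def]],
          rule integral_mono[OF integrable_abs[OF i]], simp, rule b2)
    then show ?thesis by simp
  qed
  have [measurable]: "N \<in> borel_measurable borel" unfolding N_def[abs_def] by simp
  have si: "set_integrable lborel {t<..} u" if "u \<in> borel_measurable borel" "\<And>s. \<bar>u s\<bar> \<le> K * exp (- l * s)" for u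
    by (rule set_integrable_exp_tail(1)[OF l that])
  have S: "set_integrable lborel {t<..} w" "set_integrable lborel {t<..} w1" "set_integrable lborel {t<..} w2" "set_integrable lborel {t<..} N"
    using si bd Nb by auto
  have e0: "((\<lambda>t. K * exp (- l * t)) \<longlongrightarrow> 0) at_top" using l by real_asymp
  have lim: "(w \<longlongrightarrow> 0) at_top" "(w1 \<longlongrightarrow> 0) at_top"
    by (rule Lim_null_comparison[OF _ e0], use bd in simp)+
  have t1: "tail_int w2 t = - w1 t" by (rule tail_int_FTC[OF w(2,3) S(3) lim(2)])
  have t2: "tail_int w1 t = - w t" by (rule tail_int_FTC[OF w(1) c(2) S(2) lim(1)])
  have t3: "tail_int N t = (\<integral>r. exp (- l * r) * tail_int w (t - r) \<partial>M)"
    unfolding N_def[abs_def] by (rule tail_int_conv[OF l _ bd(1)]) simp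
  have e: "eta = (\<lambda>s. ((w2 s + d * w1 s) + B * N s) + (- (B * q)) * w s)"
    by (auto simp: eta N_def algebra_simps)
  have S1: "set_integrable lborel {t<..} (\<lambda>s. w2 s + d * w1 s)"
    using S by (intro set_integral_add(1) set_integrable_mult_right) auto
  then have S2: "set_integrable lborel {t<..} (\<lambda>s. (w2 s + d * w1 s) + B * N s)"
    using S by (intro set_integral_add(1) set_integrable_mult_right) auto
  have "tail_int eta t = ((tail_int w2 t + d * tail_int w1 t) + B * tail_int N t) + (- (B * q)) * tail_int w t"
    unfolding e tail_int_linear[OF S2 S(1)] tail_int_linear[OF S1 S(4)] tail_int_linear[OF S(3,2)] ..
  then show ?thesis unfolding t1 t2 t3 by (simp add: algebra_simps)
qed

text \<open>Young's inequality with equal weights, pointwise in \<open>r\<close>. Nothing is lost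
  when \<open>\<bar>x\<bar>\<close> and \<open>\<bar>y r\<bar>\<close> agree, which is why the
  energy estimate retains the characteristic function exactly.\<close>

lemma conv_young:
  fixes x :: real and y :: "real \<Rightarrow> real"
  assumes rho: "0 \<le> rho" "rho \<le> m2"
    and "integrable M (\<lambda>r. exp (- rho * r) * y r)" "integrable M (\<lambda>r. exp (- rho * r) * (y r)\<^sup>2)"
  shows "\<bar>x\<bar> * (\<integral>r. exp (- rho * r) * \<bar>y r\<bar> \<partial>M) \<le> kap rho * x\<^sup>2 / 2 + (\<integral>r. exp (- rho * r) * (y r)\<^sup>2 \<partial>M) / 2"
proof -
  have "integrable M (\<lambda>r. \<bar>exp (- rho * r) * y r\<bar>)" using assms(3) by (rule integrable_abs)
  then have i: "integrable M (\<lambda>r. exp (- rho * r) * \<bar>y r\<bar>)" by (simp add: abs_mult)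
  have "\<bar>x\<bar> * (\<integral>r. exp (- rho * r) * \<bar>y r\<bar> \<partial>M) = (\<integral>r. \<bar>x\<bar> * (exp (- rho * r) * \<bar>y r\<bar>) \<partial>M)" by simp
  also have "\<dots> \<le> (\<integral>r. x\<^sup>2 / 2 * exp (- rho * r) + 1 / 2 * (exp (- rho * r) * (y r)\<^sup>2) \<partial>M)"
  proof (rule integral_mono)
    fix r
    have "0 \<le> exp (- rho * r) * (\<bar>x\<bar> - \<bar>y r\<bar>)\<^sup>2" by simp
    also have "\<dots> = exp (- rho * r) * x\<^sup>2 + exp (- rho * r) * (y r)\<^sup>2 - 2 * (\<bar>x\<bar> * (exp (- rho * r) * \<bar>y r\<bar>))"
      by (simp add: power2_diff algebra_simps)
    finally show "\<bar>x\<bar> * (exp (- rho * r) * \<bar>y r\<bar>) \<le> x\<^sup>2 / 2 * exp (- rho * r) + 1 / 2 * (exp (- rho * r) * (y r)\<^sup>2)"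
      by (simp add: algebra_simps)
  qed (use i assms(4) integrable_exp[OF rho] in auto)
  also have "\<dots> = x\<^sup>2 / 2 * kap rho + 1 / 2 * (\<integral>r. exp (- rho * r) * (y r)\<^sup>2 \<partial>M)"
    using assms(4) integrable_exp[OF rho] by (simp add: kap_def)
  finally show ?thesis by (simp add: mult.commute)
qed

text \<open>The energy estimate for growth slower than every exponential: for each \<open>e\<close>
  a rate below \<open>e / 2\<close> is picked. The second moment at \<open>e0\<close> bounds those
  at smaller \<open>e\<close>, so \<open>G\<close> does not depend on \<open>e\<close>.\<close>

lemma energy_general:
  fixes w w1 w2 eta :: "real \<Rightarrow> real"
  assumes w: "\<And>t. (w has_real_derivative w1 t) (at t)" "\<And>t. (w1 has_real_derivative w2 t) (at t)"
      "\<And>t. isCont w2 t"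
    and gr: "\<And>a. 0 < a \<Longrightarrow> \<exists>C. \<forall>t. \<bar>w t\<bar> \<le> C * exp (a * \<bar>t\<bar>) \<and> \<bar>w1 t\<bar> \<le> C * exp (a * \<bar>t\<bar>) \<and>
       \<bar>w2 t\<bar> \<le> C * exp (a * \<bar>t\<bar>) \<and> \<bar>eta t\<bar> \<le> C * exp (a * \<bar>t\<bar>)"
    and m: "eta \<in> borel_measurable borel"
    and rho: "0 < rho" "rho < m2" and B: "0 \<le> B"
    and pde: "\<And>t. 0 \<le> w t * w2 t + d * (w t * w1 t) - B / 2 * kap rho * (w t)\<^sup>2
      + B / 2 * (\<integral>r. exp (- rho * r) * (w (t - r))\<^sup>2 \<partial>M) + \<bar>w t\<bar> * eta t"
  obtains G e0 where "G \<ge> 0" "e0 > 0" "\<And>e. 0 < e \<Longrightarrow> e < e0 \<Longrightarrow>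
     integrable lborel (\<lambda>t. psi e t * (w t)\<^sup>2) \<and> integrable lborel (\<lambda>t. psi e t * (w1 t)\<^sup>2) \<and>
     integrable lborel (\<lambda>t. psi e t * (\<bar>w t\<bar> * eta t)) \<and>
     (\<integral>t. psi e t * (w1 t)\<^sup>2 \<partial>lborel)
      \<le> (e * \<bar>d - B * kap1 rho\<bar> + e\<^sup>2 * G) / 2 * (\<integral>t. psi e t * (w t)\<^sup>2 \<partial>lborel)
        + (\<integral>t. psi e t * (\<bar>w t\<bar> * eta t) \<partial>lborel)"
proof -
  define e0 where "e0 = min rho (m2 - rho) / 2"
  have e0: "e0 > 0" "0 < rho - e0" "rho + e0 < m2" using rho by (auto simp: e0_def min_def field_simps)
  define M2 where "M2 e = (\<integral>r. \<bar>r\<bar>\<^sup>2 * (exp (- rho * r) * exp (e * \<bar>r\<bar>)) \<partial>M)" for e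
  define G where "G = 1 + B / 2 * M2 e0"
  have G: "G \<ge> 0" unfolding G_def M2_def using B by (intro add_nonneg_nonneg mult_nonneg_nonneg) auto
  show ?thesis
  proof (rule that[OF G e0(1)], intro conjI)
    fix e :: real assume e: "0 < e" "e < e0"
    define a where "a = e / 4"
    have a: "0 \<le> a" "2 * a < e" "0 < rho - e" "rho + e < m2" using e e0 by (auto simp: a_def)
    obtain C where C: "\<And>t. \<bar>w t\<bar> \<le> C * exp (a * \<bar>t\<bar>)" "\<And>t. \<bar>w1 t\<bar> \<le> C * exp (a * \<bar>t\<bar>)"
       "\<And>t. \<bar>w2 t\<bar> \<le> C * exp (a * \<bar>t\<bar>)" "\<And>t. \<bar>eta t\<bar> \<le> C * exp (a * \<bar>t\<bar>)"
      using gr[of a] e by (auto simp: a_def)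
    note E = energy_estimate[OF w C m a e(1) B pde]
    show "integrable lborel (\<lambda>t. psi e t * (w t)\<^sup>2)" "integrable lborel (\<lambda>t. psi e t * (w1 t)\<^sup>2)"
      "integrable lborel (\<lambda>t. psi e t * (\<bar>w t\<bar> * eta t))" by (rule E)+
    have "M2 e \<le> M2 e0" unfolding M2_def
    proof (rule integral_mono)
      show "integrable M (\<lambda>r. \<bar>r\<bar>\<^sup>2 * (exp (- rho * r) * exp (e * \<bar>r\<bar>)))"
        by (rule integrable_power_exp) (use a e in auto)
      show "integrable M (\<lambda>r. \<bar>r\<bar>\<^sup>2 * (exp (- rho * r) * exp (e0 * \<bar>r\<bar>)))"
        by (rule integrable_power_exp) (use e0 in auto)
      show "\<bar>r\<bar>\<^sup>2 * (exp (- rho * r) * exp (e * \<bar>r\<bar>)) \<le> \<bar>r\<bar>\<^sup>2 * (exp (- rho * r) * exp (e0 * \<bar>r\<bar>))" for r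
        using e by (intro mult_left_mono) (auto intro: mult_right_mono)
    qed
    then have "1 + B / 2 * M2 e \<le> G" unfolding G_def using B by (intro add_left_mono mult_left_mono) auto
    then have "(e * \<bar>d - B * kap1 rho\<bar> + e\<^sup>2 * (1 + B / 2 * M2 e)) / 2 * (\<integral>t. psi e t * (w t)\<^sup>2 \<partial>lborel)
       \<le> (e * \<bar>d - B * kap1 rho\<bar> + e\<^sup>2 * G) / 2 * (\<integral>t. psi e t * (w t)\<^sup>2 \<partial>lborel)"
      by (intro mult_right_mono divide_right_mono add_left_mono mult_left_mono) auto
    then show "(\<integral>t. psi e t * (w1 t)\<^sup>2 \<partial>lborel)
      \<le> (e * \<bar>d - B * kap1 rho\<bar> + e\<^sup>2 * G) / 2 * (\<integral>t. psi e t * (w t)\<^sup>2 \<partial>lborel)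
        + (\<integral>t. psi e t * (\<bar>w t\<bar> * eta t) \<partial>lborel)"
      using E(4) unfolding M2_def by linarith
  qed
qed

end

lemma (in exp_moment_measure) integrable_weighted_shift:
  fixes u :: "real \<Rightarrow> real"
  assumes [measurable]: "u \<in> borel_measurable borel" and bd: "\<And>x. \<bar>u x\<bar> \<le> K * exp (- l * x)"
  shows "integrable M (\<lambda>r. exp (- l * r) * u (t - r))"
proof (rule integrable_const_bound[where B = "K * exp (- l * t)"])
  have "\<bar>exp (- l * r) * u (t - r)\<bar> \<le> K * exp (- l * t)" for r
  proof -
    have "\<bar>exp (- l * r) * u (t - r)\<bar> \<le> exp (- l * r) * (K * exp (- l * (t - r)))"
      unfolding abs_mult using bd[of "t - r"] by (auto intro: mult_left_mono)
    also have "\<dots> = K * exp (- l * t)" by (simp add: algebra_simps flip: exp_add)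
    finally show ?thesis .
  qed
  then show "AE r in M. norm (exp (- l * r) * u (t - r)) \<le> K * exp (- l * t)" by simp
qed measurable

lemma zero_of_deriv_zero:
  fixes w :: "real \<Rightarrow> real"
  assumes "\<And>t. (w has_real_derivative 0) (at t)" "(w \<longlongrightarrow> 0) at_top"
  shows "w t = 0"
proof -
  have "w = (\<lambda>_. w t)" using DERIV_isconst_all[of w] assms(1) by blast
  then have "(w \<longlongrightarrow> w t) at_top" using tendsto_const by metis
  then show ?thesis using tendsto_unique[OF trivial_limit_at_top_linorder assms(2)] by auto
qed

lemma weighted_derivs:
  fixes v v1 v2 :: "real \<Rightarrow> real"
  assumes "\<And>t. (v has_real_derivative v1 t) (at t)" "\<And>t. (v1 has_real_derivative v2 t) (at t)"
  shows "((\<lambda>t. exp (- l * t) * v t) has_real_derivative exp (- l * t) * (v1 t - l * v t)) (at t)"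
    and "((\<lambda>t. exp (- l * t) * (v1 t - l * v t)) has_real_derivative exp (- l * t) * (v2 t - 2 * l * v1 t + l\<^sup>2 * v t)) (at t)"
  by (auto intro!: derivative_eq_intros assms simp: algebra_simps power2_eq_square)

text \<open>The factor \<open>(1 + l)\<^sup>2\<close> is the sum of the coefficients 1,
  \<open>2 * l\<close> and \<open>l\<^sup>2\<close>.\<close>

lemma weighted_bounds:
  fixes l v v1 v2 B :: real
  assumes "0 \<le> l" "\<bar>exp (- l * t) * v\<bar> \<le> B" "\<bar>exp (- l * t) * v1\<bar> \<le> B" "\<bar>exp (- l * t) * v2\<bar> \<le> B"
  shows "\<bar>exp (- l * t) * v\<bar> \<le> (1 + l)\<^sup>2 * B" "\<bar>exp (- l * t) * (v1 - l * v)\<bar> \<le> (1 + l)\<^sup>2 * B"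
    "\<bar>exp (- l * t) * (v2 - 2 * l * v1 + l\<^sup>2 * v)\<bar> \<le> (1 + l)\<^sup>2 * B"
proof -
  define x y z where "x = exp (- l * t) * v" and "y = exp (- l * t) * v1" and "z = exp (- l * t) * v2"
  have B: "0 \<le> B" using assms(2) by linarith
  have lx: "\<bar>l * x\<bar> \<le> l * B" "\<bar>2 * l * y\<bar> \<le> 2 * l * B" "\<bar>l\<^sup>2 * x\<bar> \<le> l\<^sup>2 * B"
  proof -
    have "\<bar>x\<bar> \<le> B" "\<bar>y\<bar> \<le> B" using assms(2,3) unfolding x_def y_def .
    then show "\<bar>l * x\<bar> \<le> l * B" "\<bar>2 * l * y\<bar> \<le> 2 * l * B" "\<bar>l\<^sup>2 * x\<bar> \<le> l\<^sup>2 * B"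
      using assms(1) by (auto simp: abs_mult intro!: mult_left_mono)
  qed
  have e: "(1 + l)\<^sup>2 * B = B + 2 * l * B + l\<^sup>2 * B" by (simp add: power2_eq_square algebra_simps)
  have p: "0 \<le> l * B" "0 \<le> l\<^sup>2 * B" using assms(1) B by auto
  show "\<bar>exp (- l * t) * v\<bar> \<le> (1 + l)\<^sup>2 * B" using assms(2) e p by linarith
  have "exp (- l * t) * (v1 - l * v) = y - l * x" by (simp add: x_def y_def algebra_simps)
  then show "\<bar>exp (- l * t) * (v1 - l * v)\<bar> \<le> (1 + l)\<^sup>2 * B"
    using assms(3) lx e p unfolding y_def[symmetric] by linarith
  have "exp (- l * t) * (v2 - 2 * l * v1 + l\<^sup>2 * v) = z - 2 * l * y + l\<^sup>2 * x" by (simp add: x_def y_def z_def algebra_simps)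
  then show "\<bar>exp (- l * t) * (v2 - 2 * l * v1 + l\<^sup>2 * v)\<bar> \<le> (1 + l)\<^sup>2 * B"
    using assms(4) lx e p unfolding z_def[symmetric] by linarith
qed

context wave_eq
begin

lemma difference_derivs:
  assumes s: "sol \<phi>1" "sol \<phi>2"
  shows "((\<lambda>t. \<phi>1 t - \<phi>2 t) has_real_derivative deriv \<phi>1 t - deriv \<phi>2 t) (at t)"
    "((\<lambda>t. deriv \<phi>1 t - deriv \<phi>2 t) has_real_derivative deriv (deriv \<phi>1) t - deriv (deriv \<phi>2) t) (at t)"
    "isCont (\<lambda>t. deriv (deriv \<phi>1) t - deriv (deriv \<phi>2) t) t"
  using sol_deriv[OF s(1)] sol_deriv[OF s(2)] sol_deriv2_isCont[OF s(1)] sol_deriv2_isCont[OF s(2)]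
  by (auto intro!: derivative_eq_intros)

text \<open>Multiply the equation of the difference by the difference. No linearization is involved:
  difference quotients of \<open>f\<close> are at least \<open>ia\<close>, those of \<open>g\<close>
  at most \<open>L\<close> in absolute value, Young's inequality splits the convolution, and the
  sign of \<open>chf c ia L rho\<close> disposes of the zero-order terms. The summand with factor 0
  is the source term of the energy estimate.\<close>

lemma difference_pde:
  assumes s: "sol \<phi>1" "sol \<phi>2" and rho: "0 \<le> rho" "rho \<le> m2" and chi: "chf c ia L rho \<le> 0"
  defines "v \<equiv> \<lambda>t. \<phi>1 t - \<phi>2 t" and "v1 \<equiv> \<lambda>t. deriv \<phi>1 t - deriv \<phi>2 t" and "v2 \<equiv> \<lambda>t. deriv (deriv \<phi>1) t - deriv (deriv \<phi>2) t"
  defines "w \<equiv> \<lambda>t. exp (- rho * t) * v t"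
  assumes i2: "integrable M (\<lambda>r. exp (- rho * r) * (w (t - r))\<^sup>2)"
  shows "0 \<le> w t * (exp (- rho * t) * (v2 t - 2 * rho * v1 t + rho\<^sup>2 * v t)) + (2 * rho - c) * (w t * (exp (- rho * t) * (v1 t - rho * v t)))
     - L / 2 * kap rho * (w t)\<^sup>2 + L / 2 * (\<integral>r. exp (- rho * r) * (w (t - r))\<^sup>2 \<partial>M) + \<bar>w t\<bar> * 0"
proof -
  define E N2 where "E = exp (- rho * t)" and "N2 = (\<integral>r. exp (- rho * r) * (w (t - r))\<^sup>2 \<partial>M)"
  have n: "0 \<le> \<phi>1 t" "0 \<le> \<phi>2 t" for t using sol_nonneg s by auto
  have iv: "integrable M (\<lambda>r. v (t - r))" unfolding v_def
    using sol_conv_integrable(1)[OF s(1)] sol_conv_integrable(1)[OF s(2)] by simp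
  have ew: "exp (- rho * r) * w (t - r) = E * v (t - r)" for r
    by (simp add: w_def E_def algebra_simps flip: exp_add)
  then have i1: "integrable M (\<lambda>r. exp (- rho * r) * w (t - r))" using iv by simp
  have eaw: "exp (- rho * r) * \<bar>w (t - r)\<bar> = E * \<bar>v (t - r)\<bar>" for r
    using arg_cong[OF ew[of r], of abs] by (simp add: abs_mult E_def)
  define fd gd where "fd = f (\<phi>1 t) - f (\<phi>2 t)" and "gd = (\<integral>r. g (\<phi>1 (t - r)) \<partial>M) - (\<integral>r. g (\<phi>2 (t - r)) \<partial>M)"
  have fd: "ia * (v t)\<^sup>2 \<le> v t * fd"
  proof (cases "\<phi>2 t \<le> \<phi>1 t")
    case True
    then have "v t * (ia * v t) \<le> v t * fd" unfolding fd_def using f_lower[of "\<phi>2 t" "\<phi>1 t"] n by (intro mult_left_mono) (auto simp: v_def)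
    then show ?thesis by (simp add: power2_eq_square mult_ac)
  next
    case False
    then have "(- v t) * (ia * (- v t)) \<le> (- v t) * (- fd)" unfolding fd_def using f_lower[of "\<phi>1 t" "\<phi>2 t"] n by (intro mult_left_mono) (auto simp: v_def)
    then show ?thesis by (simp add: power2_eq_square mult_ac)
  qed
  have "gd = (\<integral>r. g (\<phi>1 (t - r)) - g (\<phi>2 (t - r)) \<partial>M)"
    unfolding gd_def using sol_conv_integrable(2)[OF s(1)] sol_conv_integrable(2)[OF s(2)] by simp
  then have "\<bar>gd\<bar> \<le> (\<integral>r. \<bar>g (\<phi>1 (t - r)) - g (\<phi>2 (t - r))\<bar> \<partial>M)"
    using integral_norm_bound[where 'a = real, unfolded real_norm_def] by simp
  also have "\<dots> \<le> (\<integral>r. L * \<bar>v (t - r)\<bar> \<partial>M)"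
    unfolding v_def
    by (rule integral_mono)
       (use g_lip n iv sol_conv_integrable(2)[OF s(1)] sol_conv_integrable(2)[OF s(2)] in \<open>auto simp: v_def\<close>)
  finally have "\<bar>gd\<bar> \<le> L * (\<integral>r. \<bar>v (t - r)\<bar> \<partial>M)" by simp
  then have "E * \<bar>gd\<bar> \<le> E * (L * (\<integral>r. \<bar>v (t - r)\<bar> \<partial>M))" by (rule mult_left_mono) (simp add: E_def)
  also have "\<dots> = L * (\<integral>r. exp (- rho * r) * \<bar>w (t - r)\<bar> \<partial>M)" unfolding eaw by simp
  finally have "\<bar>w t\<bar> * (E * \<bar>gd\<bar>) \<le> \<bar>w t\<bar> * (L * (\<integral>r. exp (- rho * r) * \<bar>w (t - r)\<bar> \<partial>M))"
    by (rule mult_left_mono) simp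
  also have "\<dots> = L * (\<bar>w t\<bar> * (\<integral>r. exp (- rho * r) * \<bar>w (t - r)\<bar> \<partial>M))" by simp
  also have "\<dots> \<le> L * (kap rho * (w t)\<^sup>2 / 2 + N2 / 2)"
    unfolding N2_def using L_pos by (intro mult_left_mono conv_young[OF rho i1 i2]) auto
  finally have "\<bar>w t * (E * gd)\<bar> \<le> L * (kap rho * (w t)\<^sup>2 / 2 + N2 / 2)" by (simp add: abs_mult E_def)
  then have gw: "w t * (E * gd) \<le> L * (kap rho * (w t)\<^sup>2 / 2 + N2 / 2)" by linarith
  have "v2 t - c * v1 t = fd - gd"
    unfolding v2_def v1_def fd_def gd_def using sol_eq[OF s(1), of t] sol_eq[OF s(2), of t] by (simp add: algebra_simps)
  then have v2: "v2 t = c * v1 t + fd - gd" by simp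
  have wE: "w t = E * v t" by (simp add: w_def E_def)
  have "w t * (E * (v2 t - 2 * rho * v1 t + rho\<^sup>2 * v t)) + (2 * rho - c) * (w t * (E * (v1 t - rho * v t)))
     = E\<^sup>2 * (v t * fd) - w t * (E * gd) - (rho\<^sup>2 - c * rho) * (w t)\<^sup>2"
    unfolding v2 wE by (simp add: algebra_simps power2_eq_square)
  moreover have "ia * (w t)\<^sup>2 \<le> E\<^sup>2 * (v t * fd)"
    using mult_left_mono[OF fd, of "E\<^sup>2"] by (simp add: wE power_mult_distrib mult_ac)
  moreover have "0 \<le> - chf c ia L rho * (w t)\<^sup>2" using chi by (intro mult_nonneg_nonneg) auto
  then have "0 \<le> ia * (w t)\<^sup>2 - (rho\<^sup>2 - c * rho) * (w t)\<^sup>2 - L * (kap rho * (w t)\<^sup>2)"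
    unfolding chf_def by (simp add: algebra_simps)
  moreover have "L / 2 * kap rho * (w t)\<^sup>2 = L * (kap rho * (w t)\<^sup>2) / 2" "L * (kap rho * (w t)\<^sup>2 / 2 + N2 / 2) = L * (kap rho * (w t)\<^sup>2) / 2 + L / 2 * N2"
    by (simp_all add: algebra_simps)
  ultimately show ?thesis using gw unfolding E_def[symmetric] N2_def[symmetric] by simp
qed

end

section \<open>Faster decay of differences by a barrier\<close>

context wave_eq_root
begin

text \<open>Convexity: according to the sign of the slope at \<open>z\<close>, the value there is at
  most the negative one at \<open>rho\<close> or strictly below the zero one at
  \<open>lam\<close>.\<close>

lemma chi0_negative_between:
  assumes "lam < z" "z \<le> rho" "rho < m2" "chi0 rho < 0" shows "chi0 z < 0"
proof -
  have b: "0 \<le> b0" using b0_pos by simp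
  have 1: "chi0 z + dchf c b0 z * (lam - z) + (lam - z)\<^sup>2 \<le> chi0 lam"
    by (rule chf_tangent) (use assms lam b in auto)
  have 2: "chi0 z + dchf c b0 z * (rho - z) + (rho - z)\<^sup>2 \<le> chi0 rho"
    by (rule chf_tangent) (use assms lam b in auto)
  show ?thesis
  proof (cases "dchf c b0 z \<ge> 0")
    case True
    then have "dchf c b0 z * (rho - z) \<ge> 0" using assms by simp
    then show ?thesis using 2 assms(4) zero_le_power2[of "rho - z"] by linarith
  next
    case False
    then have "dchf c b0 z * (lam - z) > 0" using assms by (simp add: mult_neg_neg)
    then show ?thesis using 1 lam(3) zero_le_power2[of "lam - z"] by linarith
  qed
qed

text \<open>Maximum principle with the supersolution
  \<open>A e\<^bsup>\<rho>t\<^esup> + K (e\<^bsup>\<lambda>t\<^esup> + e\<^bsup>(\<lambda>+\<delta>)t\<^esup>)\<close>, where \<open>\<lambda>\<close> is the first zero: the term with exponent \<open>\<lambda>\<close>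
  is only neutral for the linearization, the one with exponent \<open>\<lambda> + \<delta>\<close> absorbs the remainder.\<close>
lemma sol_difference_barrier:
  assumes s: "sol \<phi>1" "sol \<phi>2" and little: "((\<lambda>t. exp (- lam * t) * (\<phi>1 t - \<phi>2 t)) \<longlongrightarrow> 0) at_bot"
    and rho: "lam < rho" "rho < m2" "chi0 rho < 0"
  obtains A where "\<And>t. \<bar>\<phi>1 t - \<phi>2 t\<bar> \<le> A * exp (rho * t)"
proof -
  define v v1 v2 where "v t = \<phi>1 t - \<phi>2 t" and "v1 t = deriv \<phi>1 t - deriv \<phi>2 t"
    and "v2 t = deriv (deriv \<phi>1) t - deriv (deriv \<phi>2) t" for t
  have dv: "(v has_real_derivative v1 t) (at t)" "(v1 has_real_derivative v2 t) (at t)" for t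
    using difference_derivs[OF s] by (simp_all add: v_def[abs_def] v1_def[abs_def] v2_def[abs_def])
  have vc: "isCont v t" for t using dv(1) DERIV_isCont by blast
  obtain X where X0: "X \<ge> 0" "\<And>t. \<bar>\<phi>1 t - \<phi>2 t\<bar> \<le> X * exp (0 * t)"
    by (rule sol_difference_decay[OF s, of 0]) (use lam(1) in auto)
  then have X: "X \<ge> 0" "\<And>t. \<bar>v t\<bar> \<le> X" by (simp_all add: v_def)
  define d where "d = min (min (al * lam / 2) (m2 - rho)) (rho - lam)"
  \<comment> \<open>Half the gain: the remainder produced by the exponent \<open>lam\<close> decays
    at rate \<open>lam + d\<close>, which beats \<open>z2\<close> by \<open>d / 2\<close>.\<close>
  define z2 where "z2 = lam + d / 2"
  have "al * lam > 0" using al lam by simp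
  then have d0: "0 < d" "d \<le> al * lam / 2" "d \<le> m2 - rho" "d \<le> rho - lam"
    using rho unfolding d_def by (-, linarith+)
  then have d: "0 \<le> d" "d < al * lam" "rho + d \<le> m2" "lam + d \<le> m2" "z2 + d \<le> m2" "lam < z2" "z2 \<le> rho" "0 \<le> z2"
    using \<open>al * lam > 0\<close> lam(1) rho unfolding z2_def by (-, linarith+)
  obtain C where C: "C \<ge> 0" "\<And>\<omega> t. \<lbrakk>\<And>x. \<bar>\<phi>1 x - \<phi>2 x\<bar> \<le> \<omega> x; integrable M (\<lambda>r. exp (d * (t - r)) * \<omega> (t - r))\<rbrakk>
    \<Longrightarrow> \<bar>remainder \<phi>1 t - remainder \<phi>2 t\<bar> \<le> C * (exp (d * t) * \<omega> t + (\<integral>r. exp (d * (t - r)) * \<omega> (t - r) \<partial>M))"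
    by (rule remainder_difference[OF s d(1,2)]) blast
  \<comment> \<open>Strict negativity at \<open>rho\<close> and at \<open>z2\<close> is the margin
    against which the remainder terms, with constants \<open>k1\<close>, \<open>k2\<close> and
    \<open>k3\<close>, are measured; \<open>T\<close> is taken so far to the left that they stay
    below it.\<close>
  define n1 n2 where "n1 = - chi0 rho" and "n2 = - chi0 z2"
  have n12: "n1 > 0" "n2 > 0" using rho chi0_negative_between[of z2 rho] d by (auto simp: n1_def n2_def)
  define k1 k2 k3 where "k1 = C * (1 + kap (rho + d))" and "k2 = C * (1 + kap (lam + d))" and "k3 = C * (1 + kap (z2 + d))"
  have "((\<lambda>t. k1 * exp (d * t)) \<longlongrightarrow> 0) at_bot" "((\<lambda>t. k2 * exp (d / 2 * t) + k3 * exp (d * t)) \<longlongrightarrow> 0) at_bot"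
    using d0(1) by real_asymp+
  from this[THEN order_tendstoD(2), of n1] this[THEN order_tendstoD(2), of n2]
  have "\<forall>\<^sub>F t in at_bot. k1 * exp (d * t) < n1 \<and> k2 * exp (d / 2 * t) + k3 * exp (d * t) < n2"
    using n12 by (auto intro: eventually_conj)
  then obtain T where T: "\<And>t. t \<le> T \<Longrightarrow> k1 * exp (d * t) < n1" "\<And>t. t \<le> T \<Longrightarrow> k2 * exp (d / 2 * t) + k3 * exp (d * t) < n2"
    by (auto simp: eventually_at_bot_linorder)
  \<comment> \<open>With this coefficient the first term of the barrier already dominates for
    \<open>t \<ge> T\<close>, where only boundedness of the difference is used.\<close>
  define A where "A = X * exp (- rho * T)"
  have A: "A \<ge> 0" using X by (simp add: A_def)
  define om1 where "om1 t = exp (lam * t) + exp (z2 * t)" for t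
  have om1: "om1 t > 0" "exp (lam * t) \<le> om1 t" for t by (auto simp: om1_def add_pos_pos)
  \<comment> \<open>The least coefficient of the remaining part of the barrier that dominates at
    \<open>t\<close>; the claim is that it is never positive.\<close>
  define u where "u t = (\<bar>v t\<bar> - A * exp (rho * t)) / om1 t" for t
  have right: "u t \<le> 0" if "t \<ge> T" for t
  proof -
    have "X * 1 \<le> X * (exp (- rho * T) * exp (rho * t))"
      using that rho lam X by (intro mult_left_mono) (auto simp flip: exp_add)
    then have "\<bar>v t\<bar> \<le> A * exp (rho * t)" using X(2)[of t] by (simp add: A_def mult.assoc)
    then show ?thesis using om1(1)[of t] by (simp add: u_def divide_nonpos_pos)
  qed
  have left: "u t \<le> \<bar>exp (- lam * t) * v t\<bar>" for t
  proof -
    have "u t \<le> \<bar>v t\<bar> / om1 t" unfolding u_def using A om1(1)[of t] by (intro divide_right_mono) auto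
    also have "\<dots> \<le> \<bar>v t\<bar> / exp (lam * t)" using om1[of t] by (intro divide_left_mono) auto
    also have "\<dots> = \<bar>exp (- lam * t) * v t\<bar>" by (simp add: abs_mult exp_minus field_simps)
    finally show ?thesis .
  qed
  have "u ts \<le> 0" for ts
  proof (rule ccontr)
    assume "\<not> u ts \<le> 0"
    then have ts: "u ts > 0" by simp
    then have tsT: "ts < T" using right[of ts] by (cases "ts < T") auto
    have "((\<lambda>t. \<bar>exp (- lam * t) * v t\<bar>) \<longlongrightarrow> 0) at_bot"
      using tendsto_rabs_zero[OF little] by (simp add: v_def)
    then have "\<forall>\<^sub>F t in at_bot. \<bar>exp (- lam * t) * v t\<bar> < u ts"
      by (rule order_tendstoD) (use ts in simp)
    then obtain s0 where s0: "\<And>t. t \<le> s0 \<Longrightarrow> \<bar>exp (- lam * t) * v t\<bar> < u ts"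
      by (auto simp: eventually_at_bot_linorder)
    define lo where "lo = min s0 ts"
    have uc: "continuous_on {lo..T} u"
      unfolding u_def[abs_def]
    proof (intro continuous_on_divide continuous_on_diff continuous_on_rabs)
      show "continuous_on {lo..T} v" using vc by (simp add: continuous_at_imp_continuous_on)
      show "continuous_on {lo..T} om1" unfolding om1_def[abs_def] by (intro continuous_intros)
      show "continuous_on {lo..T} (\<lambda>t. A * exp (rho * t))" by (intro continuous_intros)
      show "\<forall>t\<in>{lo..T}. om1 t \<noteq> 0" using om1(1) by (metis less_irrefl)
    qed
    obtain t0 where t0: "t0 \<in> {lo..T}" "\<And>t. t \<in> {lo..T} \<Longrightarrow> u t \<le> u t0"
    proof -
      have "lo \<le> T" using tsT by (simp add: lo_def)
      then have "\<exists>x\<in>{lo..T}. \<forall>y\<in>{lo..T}. u y \<le> u x"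
        by (intro continuous_attains_sup uc) auto
      then show ?thesis using that by blast
    qed
    have gl: "u ts \<le> u t0" using t0(2)[of ts] tsT by (auto simp: lo_def)
    \<comment> \<open>To the left of \<open>lo\<close> the smallness of the weighted difference
      keeps \<open>u\<close> below \<open>u ts\<close>, and to the right of \<open>T\<close> it is
      nonpositive; so the maximum over the compact interval is global.\<close>
    have max: "u t \<le> u t0" for t
    proof -
      consider "t < lo" | "t \<in> {lo..T}" | "t > T" by fastforce
      then show ?thesis
      proof cases
        case 1
        then show ?thesis using left[of t] s0[of t] gl by (auto simp: lo_def)
      next
        case 2 then show ?thesis by (rule t0(2))
      next
        case 3 then show ?thesis using right[of t] ts gl by auto
      qed
    qed
    \<comment> \<open>With this coefficient the barrier touches the modulus of \<open>v\<close> at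
      \<open>t0\<close> from above; the sign \<open>sg\<close> selects the side, and the second
      derivative test applies there.\<close>
    define K where "K = u t0"
    have K: "K > 0" using ts gl by (simp add: K_def)
    define om where "om t = A * exp (rho * t) + K * (exp (lam * t) + exp (z2 * t))" for t
    have om': "om t = A * exp (rho * t) + K * om1 t" for t by (simp add: om_def om1_def)
    have vle: "\<bar>v t\<bar> \<le> om t" for t
    proof -
      have "(\<bar>v t\<bar> - A * exp (rho * t)) / om1 t \<le> K" using max[of t] by (simp only: K_def u_def)
      then show ?thesis unfolding om' pos_divide_le_eq[OF om1(1)] by linarith
    qed
    have veq: "\<bar>v t0\<bar> = om t0"
    proof -
      have "(\<bar>v t0\<bar> - A * exp (rho * t0)) / om1 t0 = K" by (simp only: K_def u_def)
      then have "\<bar>v t0\<bar> - A * exp (rho * t0) = K * om1 t0" using om1(1)[of t0] by (simp add: field_simps)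
      then show ?thesis unfolding om' by linarith
    qed
    define sg where "sg = (if v t0 \<ge> 0 then 1 else - 1 :: real)"
    have sgv: "sg * v t0 = om t0" using veq by (auto simp: sg_def)
    have sgle: "sg * x \<le> \<bar>x\<bar>" "\<bar>sg * x\<bar> = \<bar>x\<bar>" for x by (auto simp: sg_def)
    define U where "U t = sg * v t - om t" for t
    define o1 o2 where "o1 t = A * rho * exp (rho * t) + K * (lam * exp (lam * t) + z2 * exp (z2 * t))"
      and "o2 t = A * rho\<^sup>2 * exp (rho * t) + K * (lam\<^sup>2 * exp (lam * t) + z2\<^sup>2 * exp (z2 * t))" for t
    have U1: "(U has_real_derivative sg * v1 t - o1 t) (at t)" for t
      unfolding U_def[abs_def] om_def[abs_def] o1_def by (auto intro!: derivative_eq_intros dv simp: algebra_simps)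
    have U2: "((\<lambda>t. sg * v1 t - o1 t) has_real_derivative sg * v2 t - o2 t) (at t)" for t
      unfolding o1_def[abs_def] o2_def by (auto intro!: derivative_eq_intros dv simp: algebra_simps power2_eq_square)
    have U0: "U t0 = 0" "U t \<le> 0" for t using sgv order_trans[OF sgle(1) vle] by (auto simp: U_def)
    have test: "sg * v1 t0 - o1 t0 = 0" "sg * v2 t0 - o2 t0 \<le> 0"
      using second_derivative_test_max[OF U1 U2[of t0]] U0 by auto
    have ie: "integrable M (\<lambda>r. exp (z * (t0 - r)))" if "0 \<le> z" "z \<le> m2" for z by (rule integrable_exp_conv[OF that])
    have iv: "integrable M (\<lambda>r. v (t0 - r))" unfolding v_def
      using sol_conv_integrable(1)[OF s(1)] sol_conv_integrable(1)[OF s(2)] by simp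
    have "sg * (\<integral>r. v (t0 - r) \<partial>M) = (\<integral>r. sg * v (t0 - r) \<partial>M)" by simp
    also have "\<dots> \<le> (\<integral>r. om (t0 - r) \<partial>M)"
      by (rule integral_mono) (use iv order_trans[OF sgle(1) vle] ie[of rho] ie[of lam] ie[of z2] d lam rho in \<open>auto simp: om_def\<close>)
    also have "\<dots> = A * (exp (rho * t0) * kap rho) + K * (exp (lam * t0) * kap lam + exp (z2 * t0) * kap z2)"
      unfolding om_def using ie[of rho] ie[of lam] ie[of z2] d lam rho by (simp add: exp_conv)
    finally have cv: "b0 * (sg * (\<integral>r. v (t0 - r) \<partial>M)) \<le> b0 * \<dots>" using b0_pos by (intro mult_left_mono) auto
    have eqR: "remainder \<phi>1 t0 - remainder \<phi>2 t0 = v2 t0 - c * v1 t0 - a0 * v t0 + b0 * (\<integral>r. v (t0 - r) \<partial>M)"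
      unfolding remainder_eq[OF s(1)] remainder_eq[OF s(2)] v_def v1_def v2_def
      using sol_conv_integrable(1)[OF s(1)] sol_conv_integrable(1)[OF s(2)] by (simp add: algebra_simps)
    have "sg * (remainder \<phi>1 t0 - remainder \<phi>2 t0) = sg * v2 t0 - c * (sg * v1 t0) - a0 * (sg * v t0) + b0 * (sg * (\<integral>r. v (t0 - r) \<partial>M))"
      unfolding eqR by (simp add: algebra_simps)
    also have "\<dots> \<le> o2 t0 - c * o1 t0 - a0 * om t0 + b0 * (A * (exp (rho * t0) * kap rho) + K * (exp (lam * t0) * kap lam + exp (z2 * t0) * kap z2))"
      using cv test sgv by simp
    also have "\<dots> = A * exp (rho * t0) * chi0 rho + K * exp (lam * t0) * chi0 lam + K * exp (z2 * t0) * chi0 z2"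
      by (simp add: o1_def o2_def om_def chf_def algebra_simps)
    also have "\<dots> = - (A * exp (rho * t0) * n1 + K * exp (z2 * t0) * n2)" by (simp add: lam(3) n1_def n2_def)
    finally have lower: "A * exp (rho * t0) * n1 + K * exp (z2 * t0) * n2 \<le> \<bar>remainder \<phi>1 t0 - remainder \<phi>2 t0\<bar>"
      using sgle(2)[of "remainder \<phi>1 t0 - remainder \<phi>2 t0"] by linarith
    have eom: "exp (d * x) * om x = A * exp ((rho + d) * x) + K * (exp ((lam + d) * x) + exp ((z2 + d) * x))" for x
      by (simp add: om_def algebra_simps flip: exp_add)
    have "\<bar>remainder \<phi>1 t0 - remainder \<phi>2 t0\<bar> \<le> C * (exp (d * t0) * om t0 + (\<integral>r. exp (d * (t0 - r)) * om (t0 - r) \<partial>M))"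
    proof (rule C(2))
      show "integrable M (\<lambda>r. exp (d * (t0 - r)) * om (t0 - r))"
        unfolding eom using ie[of "rho + d"] ie[of "lam + d"] ie[of "z2 + d"] d lam rho by simp
    qed (use vle v_def in auto)
    also have "(\<integral>r. exp (d * (t0 - r)) * om (t0 - r) \<partial>M)
       = A * (exp ((rho + d) * t0) * kap (rho + d)) + K * (exp ((lam + d) * t0) * kap (lam + d) + exp ((z2 + d) * t0) * kap (z2 + d))"
      unfolding eom using ie[of "rho + d"] ie[of "lam + d"] ie[of "z2 + d"] d lam rho by (simp add: exp_conv)
    also have "C * (exp (d * t0) * om t0 + \<dots>)
       = A * exp (rho * t0) * (k1 * exp (d * t0)) + K * exp (z2 * t0) * (k2 * exp (d / 2 * t0) + k3 * exp (d * t0))"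
    proof -
      have "exp ((rho + d) * t0) = exp (rho * t0) * exp (d * t0)" "exp ((z2 + d) * t0) = exp (z2 * t0) * exp (d * t0)"
        "exp ((lam + d) * t0) = exp (z2 * t0) * exp (d / 2 * t0)"
        by (simp_all add: z2_def field_simps flip: exp_add)
      then show ?thesis unfolding eom by (simp add: k1_def k2_def k3_def algebra_simps)
    qed
    also have "\<dots> < A * exp (rho * t0) * n1 + K * exp (z2 * t0) * n2"
    proof (rule add_le_less_mono)
      show "A * exp (rho * t0) * (k1 * exp (d * t0)) \<le> A * exp (rho * t0) * n1"
        using T(1)[of t0] t0(1) A by (intro mult_left_mono) auto
      show "K * exp (z2 * t0) * (k2 * exp (d / 2 * t0) + k3 * exp (d * t0)) < K * exp (z2 * t0) * n2"
        using T(2)[of t0] t0(1) K by (intro mult_strict_left_mono) auto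
    qed
    finally show False using lower by simp
  qed
  then have "\<bar>v t\<bar> \<le> A * exp (rho * t)" for t
    using om1(1)[of t] unfolding u_def by (simp add: divide_le_0_iff) (smt (verit))
  then show ?thesis by (intro that[of A]) (simp add: v_def)
qed

end

section \<open>Energy arguments for the difference of two solutions\<close>

context wave_eq_root
begin

text \<open>Decay at a rate above \<open>mm\<close> makes \<open>exp (- mm * t) * v t\<close> square
  integrable from the outset. The energy estimate then has no source term and a fixed square norm on
  the right, so the integral of the square of \<open>w1\<close> is of order \<open>e\<close>; hence
  \<open>w\<close> is constant, and it vanishes at plus infinity.\<close>

lemma vanish_of_fast_decay:
  assumes s: "sol \<phi>1" "sol \<phi>2" and mm: "0 < mm" "mm < rho" "rho \<le> m2" and chi: "chf c ia L mm \<le> 0"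
    and A: "\<And>t. \<bar>\<phi>1 t - \<phi>2 t\<bar> \<le> A * exp (rho * t)"
  shows "\<phi>1 = \<phi>2"
proof -
  define v v1 v2 where "v = (\<lambda>t. \<phi>1 t - \<phi>2 t)" and "v1 = (\<lambda>t. deriv \<phi>1 t - deriv \<phi>2 t)"
    and "v2 = (\<lambda>t. deriv (deriv \<phi>1) t - deriv (deriv \<phi>2) t)"
  have dv: "(v has_real_derivative v1 t) (at t)" "(v1 has_real_derivative v2 t) (at t)" "isCont v2 t" for t
    unfolding v_def v1_def v2_def by (rule difference_derivs[OF s])+
  have vc: "isCont v t" for t using dv(1) DERIV_isCont by blast
  have vm: "v \<in> borel_measurable borel"
    using vc by (auto intro!: borel_measurable_continuous_onI continuous_at_imp_continuous_on)
  have vA: "\<bar>v t\<bar> \<le> A * exp (rho * t)" for t using A by (simp add: v_def)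
  have A0: "A \<ge> 0" using order_trans[OF abs_ge_zero A[of 0]] by simp
  obtain X where X: "X \<ge> 0" "\<And>t. \<bar>v t\<bar> \<le> X * exp (0 * t)" "\<And>t. \<bar>v1 t\<bar> \<le> X * exp (0 * t)" "\<And>t. \<bar>v2 t\<bar> \<le> X * exp (0 * t)"
    unfolding v_def v1_def v2_def by (rule sol_difference_decay[OF s, of 0]) (use lam(1) in auto)
  \<comment> \<open>A gain of 0 suffices: the remainder serves here to bound
    \<open>v2 - c * v1\<close> by the same exponential.\<close>
  obtain C where C: "C \<ge> 0" "\<And>t. \<bar>remainder \<phi>1 t - remainder \<phi>2 t\<bar> \<le> C * exp ((rho + 0) * t)"
    by (rule remainder_difference_exp[OF s _ _ _ _ A, of 0]) (use al lam(1) mm in auto)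
  define F where "F = C + a0 * A + b0 * (A * kap rho)"
  have F0: "F \<ge> 0" unfolding F_def using C(1) A0 coeffs b0_pos kap_pos[of rho] mm by (intro add_nonneg_nonneg mult_nonneg_nonneg) auto
  have F: "\<bar>v2 t - c * v1 t\<bar> \<le> F * exp (rho * t)" for t
  proof -
    have "v2 t - c * v1 t = (remainder \<phi>1 t - remainder \<phi>2 t) + a0 * v t - b0 * (\<integral>r. v (t - r) \<partial>M)"
      unfolding remainder_eq[OF s(1)] remainder_eq[OF s(2)] v_def v1_def v2_def
      using sol_conv_integrable(1)[OF s(1)] sol_conv_integrable(1)[OF s(2)] by (simp add: algebra_simps)
    moreover have "\<bar>a0 * v t\<bar> \<le> a0 * (A * exp (rho * t))"
      using coeffs vA[of t] by (simp add: abs_mult mult_left_mono)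
    moreover have "\<bar>b0 * (\<integral>r. v (t - r) \<partial>M)\<bar> \<le> b0 * (A * kap rho * exp (rho * t))"
      using b0_pos exp_bounded_conv(2)[OF _ mm(3) vm vA, of t] mm by (simp add: abs_mult)
    moreover have "F * exp (rho * t) = C * exp (rho * t) + a0 * (A * exp (rho * t)) + b0 * (A * kap rho * exp (rho * t))"
      by (simp add: F_def algebra_simps)
    ultimately show ?thesis using C(2)[of t] by simp
  qed
  define D1 where "D1 = ((2 + 2 * \<bar>c\<bar>) * A + F) * exp rho"
  have D1: "\<bar>v1 t\<bar> \<le> D1 * exp (rho * t)" for t
  proof -
    have e: "exp (rho * x) \<le> exp rho * exp (rho * t)" if "t \<le> x" "x \<le> t + 1" for x
    proof -
      have "rho * x \<le> rho * (t + 1)" using that mm by (intro mult_left_mono) auto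
      then show ?thesis by (simp flip: exp_add add: algebra_simps)
    qed
    have "\<bar>v1 t\<bar> \<le> (2 + 2 * \<bar>c\<bar>) * (A * (exp rho * exp (rho * t))) + F * (exp rho * exp (rho * t))"
    proof (rule interior_estimate[OF dv(1,2)])
      fix x assume x: "t \<le> x" "x \<le> t + 1"
      show "\<bar>v x\<bar> \<le> A * (exp rho * exp (rho * t))"
        using vA[of x] mult_left_mono[OF e[OF x] A0] by linarith
      show "\<bar>v2 x - c * v1 x\<bar> \<le> F * (exp rho * exp (rho * t))"
        using F[of x] mult_left_mono[OF e[OF x] F0] by linarith
    qed
    then show ?thesis by (simp add: D1_def algebra_simps)
  qed
  have D2: "\<bar>v2 t\<bar> \<le> (F + \<bar>c\<bar> * D1) * exp (rho * t)" for t
  proof -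
    have "\<bar>c * v1 t\<bar> \<le> \<bar>c\<bar> * (D1 * exp (rho * t))" unfolding abs_mult by (rule mult_left_mono[OF D1]) simp
    then show ?thesis using F[of t] by (simp only: distrib_right mult.assoc)
  qed
  define b where "b = min mm (rho - mm)"
  have b: "b > 0" "b \<le> mm" "mm + b \<le> rho" using mm by (auto simp: b_def)
  define K where "K = max (max A D1) (max (F + \<bar>c\<bar> * D1) X)"
  have K: "\<bar>exp (- mm * t) * u t\<bar> \<le> K * exp (- b * \<bar>t\<bar>)"
    if "\<bar>u t\<bar> \<le> Z * exp (rho * t)" "\<bar>u t\<bar> \<le> X * exp (0 * t)" "Z \<le> K" for u Z and t :: real
  proof -
    have "\<bar>exp (- mm * t) * u t\<bar> \<le> max Z X * exp (- b * \<bar>t\<bar>)"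
      using two_sided_exp_bound[where u = u and t = t and C = Z and z = rho and X = X, OF that(1) _ b(2,3)] that(2) by simp
    also have "\<dots> \<le> K * exp (- b * \<bar>t\<bar>)" using that(3) by (intro mult_right_mono) (auto simp: K_def)
    finally show ?thesis .
  qed
  have Kb: "\<bar>exp (- mm * t) * v t\<bar> \<le> K * exp (- b * \<bar>t\<bar>)" "\<bar>exp (- mm * t) * v1 t\<bar> \<le> K * exp (- b * \<bar>t\<bar>)"
    "\<bar>exp (- mm * t) * v2 t\<bar> \<le> K * exp (- b * \<bar>t\<bar>)" for t
    by (rule K[OF vA X(2)], simp add: K_def, rule K[OF D1 X(3)], simp add: K_def, rule K[OF D2 X(4)], simp add: K_def)
  define w w1 w2 where "w = (\<lambda>t. exp (- mm * t) * v t)" and "w1 = (\<lambda>t. exp (- mm * t) * (v1 t - mm * v t))"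
    and "w2 = (\<lambda>t. exp (- mm * t) * (v2 t - 2 * mm * v1 t + mm\<^sup>2 * v t))"
  have dw: "(w has_real_derivative w1 t) (at t)" "(w1 has_real_derivative w2 t) (at t)" for t
    unfolding w_def w1_def w2_def using weighted_derivs[OF dv(1,2)] by auto
  have wc: "isCont w t" "isCont w1 t" for t using dw DERIV_isCont by blast+
  have w2c: "isCont w2 t" for t unfolding w2_def
    using vc dv(3) DERIV_isCont[OF dv(2)] by (intro continuous_intros) auto
  have wm[measurable]: "w \<in> borel_measurable borel" and w1m[measurable]: "w1 \<in> borel_measurable borel"
    using wc by (auto intro!: borel_measurable_continuous_onI continuous_at_imp_continuous_on)
  define K' where "K' = (1 + mm)\<^sup>2 * K"
  have wb: "\<bar>w t\<bar> \<le> K' * exp (- b * \<bar>t\<bar>)" "\<bar>w1 t\<bar> \<le> K' * exp (- b * \<bar>t\<bar>)" "\<bar>w2 t\<bar> \<le> K' * exp (- b * \<bar>t\<bar>)" for t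
    using weighted_bounds[OF _ Kb] mm unfolding w_def w1_def w2_def K'_def mult.assoc by auto
  have K'0: "K' \<ge> 0" using order_trans[OF abs_ge_zero wb(1)[of 0]] by simp
  have wK: "\<bar>w t\<bar> \<le> K' * exp (a * \<bar>t\<bar>)" "\<bar>w1 t\<bar> \<le> K' * exp (a * \<bar>t\<bar>)" "\<bar>w2 t\<bar> \<le> K' * exp (a * \<bar>t\<bar>)" if "0 \<le> a" for a t
  proof -
    have "- b * \<bar>t\<bar> \<le> a * \<bar>t\<bar>" using that b by (intro mult_right_mono) auto
    then have "K' * exp (- b * \<bar>t\<bar>) \<le> K' * exp (a * \<bar>t\<bar>)" using K'0 by (intro mult_left_mono) auto
    then show "\<bar>w t\<bar> \<le> K' * exp (a * \<bar>t\<bar>)" "\<bar>w1 t\<bar> \<le> K' * exp (a * \<bar>t\<bar>)" "\<bar>w2 t\<bar> \<le> K' * exp (a * \<bar>t\<bar>)"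
      using wb[of t] by linarith+
  qed
  have wK0: "\<bar>w t\<bar> \<le> K' * exp (0 * \<bar>t\<bar>)" for t using wK(1)[of 0 t] by simp
  have i2: "integrable M (\<lambda>r. exp (- mm * r) * (w (t - r))\<^sup>2)" for t
    by (rule weighted_square_conv(1)[OF wm wK0]) (use mm in auto)
  have pde: "0 \<le> w t * w2 t + (2 * mm - c) * (w t * w1 t) - L / 2 * kap mm * (w t)\<^sup>2
      + L / 2 * (\<integral>r. exp (- mm * r) * (w (t - r))\<^sup>2 \<partial>M) + \<bar>w t\<bar> * 0" for t
    using difference_pde[OF s _ _ chi, of t] i2[of t] mm unfolding w_def w1_def w2_def v_def v1_def v2_def by auto
  obtain G e0 where G: "G \<ge> 0" "e0 > 0" and E: "\<And>e. 0 < e \<Longrightarrow> e < e0 \<Longrightarrow>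
     integrable lborel (\<lambda>t. psi e t * (w t)\<^sup>2) \<and> integrable lborel (\<lambda>t. psi e t * (w1 t)\<^sup>2) \<and>
     integrable lborel (\<lambda>t. psi e t * (\<bar>w t\<bar> * 0)) \<and>
     (\<integral>t. psi e t * (w1 t)\<^sup>2 \<partial>lborel)
      \<le> (e * \<bar>(2 * mm - c) - L * kap1 mm\<bar> + e\<^sup>2 * G) / 2 * (\<integral>t. psi e t * (w t)\<^sup>2 \<partial>lborel)
        + (\<integral>t. psi e t * (\<bar>w t\<bar> * 0) \<partial>lborel)"
  proof (rule energy_general[OF dw w2c, where eta = "\<lambda>_. 0" and rho = mm and B = L and d = "2 * mm - c"])
    fix a :: real assume "0 < a"
    then show "\<exists>C. \<forall>t. \<bar>w t\<bar> \<le> C * exp (a * \<bar>t\<bar>) \<and> \<bar>w1 t\<bar> \<le> C * exp (a * \<bar>t\<bar>) \<and> \<bar>w2 t\<bar> \<le> C * exp (a * \<bar>t\<bar>) \<and> \<bar>0\<bar> \<le> C * exp (a * \<bar>t\<bar>)"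
      using wK[of a] K'0 by (intro exI[of _ K']) auto
  qed (use pde mm L_pos in auto)
  have Iw: "integrable lborel (\<lambda>t. (w t)\<^sup>2)"
  proof (rule integrable_exp_bound[OF b(1)])
    fix t
    have "(w t)\<^sup>2 = \<bar>w t\<bar> * \<bar>w t\<bar>" by (simp add: power2_eq_square)
    also have "\<dots> \<le> K' * (K' * exp (- b * \<bar>t\<bar>))"
      using wb(1)[of t] wK0[of t] by (intro mult_mono) auto
    finally show "\<bar>(w t)\<^sup>2\<bar> \<le> (K' * K') * exp (- b * \<bar>t\<bar>)" by (simp add: mult.assoc)
  qed simp
  define Q where "Q = (\<integral>t. (w t)\<^sup>2 \<partial>lborel)"
  have Q0: "Q \<ge> 0" by (simp add: Q_def)
  define D where "D = \<bar>(2 * mm - c) - L * kap1 mm\<bar> + G"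
  have D0: "D \<ge> 0" using G by (simp add: D_def)
  have "(w1 t)\<^sup>2 = 0" for t
  proof (rule zero_of_psi_small[where u = "\<lambda>t. (w1 t)\<^sup>2"])
    show "isCont (\<lambda>t. (w1 t)\<^sup>2) t" for t using wc(2) by (intro continuous_intros)
    fix \<epsilon> :: real assume eps: "0 < \<epsilon>"
    \<comment> \<open>Small enough for \<open>e * (D * Q + 1) \<le> \<epsilon>\<close>; the summand
      1 keeps the denominator positive.\<close>
    define e1 where "e1 = min (min e0 1) (\<epsilon> / (D * Q + 1))"
    have "D * Q + 1 > 0" using D0 Q0 by (intro add_nonneg_pos mult_nonneg_nonneg) auto
    then have e1: "e1 > 0" using G(2) eps by (simp add: e1_def)
    show "\<exists>e0>0. \<forall>e. 0 < e \<and> e < e0 \<longrightarrow> integrable lborel (\<lambda>t. psi e t * (w1 t)\<^sup>2) \<and> (\<integral>t. psi e t * (w1 t)\<^sup>2 \<partial>lborel) \<le> \<epsilon>"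
    proof (intro exI[of _ e1] conjI allI impI e1)
      fix e assume e: "0 < e \<and> e < e1"
      then have e': "0 < e" "e < e0" "e < 1" "e < \<epsilon> / (D * Q + 1)" by (auto simp: e1_def)
      show "integrable lborel (\<lambda>t. psi e t * (w1 t)\<^sup>2)" using E[OF e'(1,2)] by blast
      have S: "(\<integral>t. psi e t * (w t)\<^sup>2 \<partial>lborel) \<le> Q" unfolding Q_def
        by (rule integral_mono) (use E[OF e'(1,2)] Iw psi_le_1[of e] in \<open>auto intro!: mult_left_le_one_le\<close>)
      have "e\<^sup>2 \<le> e" using e' by (simp add: power2_eq_square mult_left_le)
      then have "e\<^sup>2 * G \<le> e * G" using G(1) by (rule mult_right_mono)
      then have g0: "(e * x + e\<^sup>2 * G) / 2 \<le> e * (x + G)" if "0 \<le> x" for x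
      proof -
        have "0 \<le> e * x" "0 \<le> e * G" using that e' G(1) by auto
        have "e * x + e\<^sup>2 * G \<le> e * x + e * G" using \<open>e\<^sup>2 * G \<le> e * G\<close> by simp
        also have "\<dots> \<le> 2 * (e * x + e * G)"
        proof -
          have dbl: "y \<le> 2 * y" if "0 \<le> y" for y :: real using that by simp
          show ?thesis by (rule dbl[OF add_nonneg_nonneg]) fact+
        qed
        finally have "e * x + e\<^sup>2 * G \<le> 2 * (e * x + e * G)" .
        then show ?thesis by (simp add: distrib_left)
      qed
      have g: "(e * \<bar>(2 * mm - c) - L * kap1 mm\<bar> + e\<^sup>2 * G) / 2 \<le> e * D"
        unfolding D_def by (rule g0) simp
      have "(\<integral>t. psi e t * (w1 t)\<^sup>2 \<partial>lborel) \<le> (e * \<bar>(2 * mm - c) - L * kap1 mm\<bar> + e\<^sup>2 * G) / 2 * (\<integral>t. psi e t * (w t)\<^sup>2 \<partial>lborel)"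
        using E[OF e'(1,2)] by simp
      also have "\<dots> \<le> (e * D) * Q"
        using g S e' D0 by (intro mult_mono) auto
      also have "\<dots> \<le> e * (D * Q + 1)" using e' by (simp add: algebra_simps)
      also have "\<dots> \<le> \<epsilon>" using e'(4) \<open>D * Q + 1 > 0\<close> by (simp add: field_simps)
      finally show "(\<integral>t. psi e t * (w1 t)\<^sup>2 \<partial>lborel) \<le> \<epsilon>" .
    qed
  qed simp
  then have "(w has_real_derivative 0) (at t)" for t using dw(1)[of t] by simp
  moreover have "(w \<longlongrightarrow> 0) at_top"
  proof (rule Lim_null_comparison)
    show "\<forall>\<^sub>F t in at_top. norm (w t) \<le> K' * exp (- b * \<bar>t\<bar>)" using wb(1) by simp
    show "((\<lambda>t. K' * exp (- b * \<bar>t\<bar>)) \<longlongrightarrow> 0) at_top" using b(1) by real_asymp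
  qed
  ultimately have "w t = 0" for t by (rule zero_of_deriv_zero)
  then show ?thesis by (auto simp: w_def v_def)
qed

text \<open>Both parts start from the equation of \<open>w\<close> integrated once, in which
  \<open>w\<close> appears with minus the slope of \<open>chi0\<close> at \<open>lam\<close>. A
  nonzero slope bounds \<open>w\<close> by \<open>w1\<close>, \<open>j\<close> and the local
  oscillation, which closes the energy estimate. With slope 0 the equation is integrated again; then
  the coefficient of \<open>w\<close> is half the second derivative of \<open>chi0\<close>, which is
  positive.\<close>

lemma matched_difference:
  assumes s: "sol \<phi>1" "sol \<phi>2" and eq: "charge \<phi>1 = charge \<phi>2"
  shows "dchf c b0 lam \<noteq> 0 \<Longrightarrow> ((\<lambda>t. exp (- lam * t) * (\<phi>1 t - \<phi>2 t)) \<longlongrightarrow> 0) at_bot"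
    and "dchf c b0 lam = 0 \<Longrightarrow> chf c ia L lam \<le> 0 \<Longrightarrow> L = b0 \<Longrightarrow> \<phi>1 = \<phi>2"
proof -
  define v v1 v2 where "v = (\<lambda>t. \<phi>1 t - \<phi>2 t)" and "v1 = (\<lambda>t. deriv \<phi>1 t - deriv \<phi>2 t)"
    and "v2 = (\<lambda>t. deriv (deriv \<phi>1) t - deriv (deriv \<phi>2) t)"
  have dv: "(v has_real_derivative v1 t) (at t)" "(v1 has_real_derivative v2 t) (at t)" "isCont v2 t" for t
    unfolding v_def v1_def v2_def by (rule difference_derivs[OF s])+
  have vc: "isCont v t" for t using dv(1) DERIV_isCont by blast
  define w w1 w2 where "w = (\<lambda>t. exp (- lam * t) * v t)" and "w1 = (\<lambda>t. exp (- lam * t) * (v1 t - lam * v t))"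
    and "w2 = (\<lambda>t. exp (- lam * t) * (v2 t - 2 * lam * v1 t + lam\<^sup>2 * v t))"
  have dw: "(w has_real_derivative w1 t) (at t)" "(w1 has_real_derivative w2 t) (at t)" for t
    unfolding w_def w1_def w2_def using weighted_derivs[OF dv(1,2)] by auto
  have wc: "isCont w t" "isCont w1 t" for t using dw DERIV_isCont by blast+
  have w2c: "isCont w2 t" for t unfolding w2_def
    using vc dv(3) DERIV_isCont[OF dv(2)] by (intro continuous_intros) auto
  have wm: "w \<in> borel_measurable borel" and w1m: "w1 \<in> borel_measurable borel"
    using wc by (auto intro!: borel_measurable_continuous_onI continuous_at_imp_continuous_on)
  \<comment> \<open>Small \<open>a\<close> yields growth at minus infinity slower than every
    exponential, while \<open>a = lam\<close> yields decay at plus infinity.\<close>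
  have gr3: "\<exists>C\<ge>0. \<forall>t. \<bar>w t\<bar> \<le> C * exp (- a * t) \<and> \<bar>w1 t\<bar> \<le> C * exp (- a * t) \<and> \<bar>w2 t\<bar> \<le> C * exp (- a * t)"
    if a: "0 < a" "a \<le> lam" for a
  proof -
    obtain C where C: "C \<ge> 0" "\<And>t. \<bar>v t\<bar> \<le> C * exp ((lam - a) * t)" "\<And>t. \<bar>v1 t\<bar> \<le> C * exp ((lam - a) * t)" "\<And>t. \<bar>v2 t\<bar> \<le> C * exp ((lam - a) * t)"
      unfolding v_def v1_def v2_def by (rule sol_difference_decay[OF s, of "lam - a"]) (use a lam in auto)
    have le: "\<bar>exp (- lam * t) * x\<bar> \<le> C * exp (- a * t)" if "\<bar>x\<bar> \<le> C * exp ((lam - a) * t)" for x t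
    proof -
      have "\<bar>exp (- lam * t) * x\<bar> \<le> exp (- lam * t) * (C * exp ((lam - a) * t))"
        unfolding abs_mult using that by (auto intro: mult_left_mono)
      also have "\<dots> = C * exp (- a * t)" by (simp add: algebra_simps flip: exp_add)
      finally show ?thesis .
    qed
    show ?thesis
      using weighted_bounds[OF _ le[OF C(2)] le[OF C(3)] le[OF C(4)]] lam(1) C(1)
      unfolding w_def w1_def w2_def
      by (intro exI[of _ "(1 + lam)\<^sup>2 * C"]) (auto simp: mult.assoc)
  qed
  have gr: "\<exists>C\<ge>0. \<forall>t. \<bar>w t\<bar> \<le> C * exp (a * \<bar>t\<bar>) \<and> \<bar>w1 t\<bar> \<le> C * exp (a * \<bar>t\<bar>) \<and> \<bar>w2 t\<bar> \<le> C * exp (a * \<bar>t\<bar>)"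
    if a: "0 < a" for a
  proof -
    define a' where "a' = min a lam"
    have a': "0 < a'" "a' \<le> lam" "a' \<le> a" using a lam by (auto simp: a'_def)
    obtain C where C: "C \<ge> 0" "\<And>t. \<bar>w t\<bar> \<le> C * exp (- a' * t)" "\<And>t. \<bar>w1 t\<bar> \<le> C * exp (- a' * t)" "\<And>t. \<bar>w2 t\<bar> \<le> C * exp (- a' * t)"
      using gr3[OF a'(1,2)] by blast
    have "C * exp (- a' * t) \<le> C * exp (a * \<bar>t\<bar>)" for t
    proof -
      have "- a' * t \<le> a' * \<bar>t\<bar>" using a' by (simp add: abs_if)
      also have "\<dots> \<le> a * \<bar>t\<bar>" using a' by (intro mult_right_mono) auto
      finally show ?thesis using C(1) by (intro mult_left_mono) auto
    qed
    then show ?thesis using C by (meson order_trans)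
  qed
  obtain K where K: "K \<ge> 0" "\<And>t. \<bar>w t\<bar> \<le> K * exp (- lam * t)" "\<And>t. \<bar>w1 t\<bar> \<le> K * exp (- lam * t)" "\<And>t. \<bar>w2 t\<bar> \<le> K * exp (- lam * t)"
    using gr3[of lam] lam(1) by auto
  define eta where "eta t = exp (- lam * t) * (remainder \<phi>1 t - remainder \<phi>2 t)" for t
  have etac: "isCont eta t" for t unfolding eta_def[abs_def]
    using remainder_isCont[OF s(1)] remainder_isCont[OF s(2)] by (intro continuous_intros) auto
  have etam: "eta \<in> borel_measurable borel"
    using etac by (auto intro!: borel_measurable_continuous_onI continuous_at_imp_continuous_on)
  \<comment> \<open>The relation \<open>chi0 lam = 0\<close> eliminates \<open>a0\<close>, so that
    the right-hand side annihilates constants.\<close>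
  have eta_eq: "eta t = w2 t + (2 * lam - c) * w1 t + b0 * ((\<integral>r. exp (- lam * r) * w (t - r) \<partial>M) - kap lam * w t)" for t
  proof -
    have i: "integrable M (\<lambda>r. \<phi>1 (t - r))" "integrable M (\<lambda>r. \<phi>2 (t - r))"
      using sol_conv_integrable(1) s by auto
    have "exp (- lam * r) * w (t - r) = exp (- lam * t) * (\<phi>1 (t - r) - \<phi>2 (t - r))" for r
      by (simp add: w_def v_def algebra_simps flip: exp_add)
    then have "(\<integral>r. exp (- lam * r) * w (t - r) \<partial>M) = exp (- lam * t) * ((\<integral>r. \<phi>1 (t - r) \<partial>M) - (\<integral>r. \<phi>2 (t - r) \<partial>M))"
      using i by simp
    moreover have "lam\<^sup>2 - c * lam - a0 = - b0 * kap lam" using lam(3) by (simp add: chf_def)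
    then have "a0 = lam\<^sup>2 - c * lam + b0 * kap lam" by simp
    ultimately show ?thesis
      unfolding eta_def remainder_eq[OF s(1)] remainder_eq[OF s(2)] w_def w1_def w2_def v_def v1_def v2_def
      by (simp only:) (simp add: algebra_simps power2_eq_square)
  qed
  obtain Ce d where Ce: "0 < d" "lam + d \<le> m2" "Ce \<ge> 0" "\<And>t. \<bar>remainder \<phi>1 t - remainder \<phi>2 t\<bar> \<le> Ce * exp ((lam + d) * t)"
    "\<And>t. \<bar>remainder \<phi>1 t - remainder \<phi>2 t\<bar> \<le> Ce"
    by (rule remainder_difference_decay[OF s]) blast
  define be where "be = min lam d"
  have be: "be > 0" "be \<le> lam" "lam + be \<le> lam + d" using Ce(1) lam by (auto simp: be_def)
  have eta_b: "\<bar>eta t\<bar> \<le> Ce * exp (- be * \<bar>t\<bar>)" for t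
    using two_sided_exp_bound[where u = "\<lambda>t. remainder \<phi>1 t - remainder \<phi>2 t" and t = t, OF Ce(4,5) be(2,3)] by (simp add: eta_def)
  have charge_int: "integrable lborel (\<lambda>t. exp (- lam * t) * remainder \<phi> t)" if s': "sol \<phi>" for \<phi>
  proof -
    obtain C d where C: "0 < d" "lam + d \<le> m2" "C \<ge> 0" "\<And>t. \<bar>remainder \<phi> t - remainder (\<lambda>t. 0) t\<bar> \<le> C * exp ((lam + d) * t)"
      "\<And>t. \<bar>remainder \<phi> t - remainder (\<lambda>t. 0) t\<bar> \<le> C"
      by (rule remainder_difference_decay[OF s' sol_zero]) blast
    define b where "b = min lam d"
    have b: "b > 0" "b \<le> lam" "lam + b \<le> lam + d" using C(1) lam by (auto simp: b_def)
    show ?thesis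
      by (rule integrable_exp_bound[OF b(1)])
         (use remainder_measurable[OF s'] two_sided_exp_bound[where u = "\<lambda>t. remainder \<phi> t - remainder (\<lambda>t. 0) t", OF C(4,5) b(2,3)] in auto)
  qed
  have "(\<integral>t. eta t \<partial>lborel) = charge \<phi>1 - charge \<phi>2"
    unfolding charge_def eta_def using charge_int[OF s(1)] charge_int[OF s(2)] by (simp add: right_diff_distrib)
  \<comment> \<open>Equal charges make the source integrate to 0, whence its tail \<open>j\<close>
    decays at both ends.\<close>
  then have eta0: "(\<integral>t. eta t \<partial>lborel) = 0" using eq by simp
  define j where "j = tail_int eta"
  have j_b: "\<bar>j t\<bar> \<le> Ce / be * exp (- be * \<bar>t\<bar>)" for t
    unfolding j_def by (rule tail_int_two_sided_bound[OF be(1) etam eta_b eta0])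
  have "\<bar>eta t\<bar> \<le> Ce * exp (- be * t)" for t
  proof -
    have "- be * \<bar>t\<bar> \<le> - be * t" using be by (simp add: mult_left_mono)
    then have "Ce * exp (- be * \<bar>t\<bar>) \<le> Ce * exp (- be * t)" using Ce(3) by (intro mult_left_mono) auto
    then show ?thesis using eta_b[of t] by linarith
  qed
  from tail_int_deriv[OF be(1) etac this] have jc: "isCont j t" for t
    unfolding j_def using DERIV_isCont by blast
  have jm: "j \<in> borel_measurable borel"
    using jc by (auto intro!: borel_measurable_continuous_onI continuous_at_imp_continuous_on)
  have ji: "integrable lborel j" by (rule integrable_exp_bound[OF be(1) jm j_b])
  define W where "W = tail_int w"
  have dW: "(W has_real_derivative - w t) (at t)" for t
    unfolding W_def by (rule tail_int_deriv[OF lam(1) wc(1) K(2)])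
  have Wb: "\<bar>W t\<bar> \<le> K / lam * exp (- lam * t)" for t
    unfolding W_def by (rule set_integrable_exp_tail(2)[OF lam(1) wm K(2)])
  have Wc: "isCont W t" for t using dW DERIV_isCont by blast
  have Wm: "W \<in> borel_measurable borel"
    using Wc by (auto intro!: borel_measurable_continuous_onI continuous_at_imp_continuous_on)
  have j_eq: "j t = - w1 t - (2 * lam - c) * w t + b0 * ((\<integral>r. exp (- lam * r) * W (t - r) \<partial>M) - kap lam * W t)" for t
    unfolding j_def W_def by (rule tail_identity[OF lam(1) dw w2c K(2,3,4) eta_eq])
  \<comment> \<open>At most half the distance of \<open>lam\<close> from 0 and from
    \<open>m2\<close>, so that moments with the extra factor \<open>exp (b * \<bar>r\<bar>)\<close>
    are finite.\<close>
  define b where "b = min lam (m2 - lam) / 2"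
  have b: "b > 0" "0 < lam - b" "lam + b < m2" using lam by (auto simp: b_def min_def field_simps)
  obtain Cb where Cb: "\<And>t. \<bar>w1 t\<bar> \<le> Cb * exp (b / 4 * \<bar>t\<bar>)" using gr[of "b / 4"] b by auto
  define q where "q t = sqrt (osc b w1 t / b)" for t
  have q0: "q t \<ge> 0" for t
    unfolding q_def using osc_nonneg[OF dw(1) wc(2) Cb, of b t] b by simp
  have incr: "\<bar>w x - w t\<bar> \<le> q t * exp (b * \<bar>x - t\<bar>)" for x t
    unfolding q_def by (rule increment_le_osc[OF dw(1) wc(2) Cb]) (use b in auto)
  have incr': "\<bar>w x - w t\<bar> \<le> q t * exp (b * \<bar>r\<bar>)" if "\<bar>x - t\<bar> \<le> \<bar>r\<bar>" for x t r
  proof -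
    have "q t * exp (b * \<bar>x - t\<bar>) \<le> q t * exp (b * \<bar>r\<bar>)"
      using that q0[of t] b by (intro mult_left_mono) (auto intro: mult_left_mono)
    then show ?thesis using incr[of x t] by linarith
  qed
  have iM: "integrable M (\<lambda>r. exp (- lam * r))" "integrable M (\<lambda>r. r * exp (- lam * r))" "integrable M (\<lambda>r. r\<^sup>2 * exp (- lam * r))"
    using integrable_exp[of lam] integrable_id_exp[of lam] integrable_sq_exp[of lam] lam by auto
  have gr2: "\<exists>C. \<forall>t. \<bar>w t\<bar> \<le> C * exp (a * \<bar>t\<bar>) \<and> \<bar>w1 t\<bar> \<le> C * exp (a * \<bar>t\<bar>)" if "0 < a" for a
    using gr[OF that] by blast
  have i2: "integrable M (\<lambda>r. exp (- lam * r) * (w (t - r))\<^sup>2)" for t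
  proof -
    obtain C where C: "\<And>t. \<bar>w t\<bar> \<le> C * exp (b / 2 * \<bar>t\<bar>)" using gr[of "b / 2"] b by auto
    show ?thesis by (rule weighted_square_conv(1)[OF wm C]) (use b in auto)
  qed
  show "((\<lambda>t. exp (- lam * t) * (\<phi>1 t - \<phi>2 t)) \<longlongrightarrow> 0) at_bot" if nz: "dchf c b0 lam \<noteq> 0"
  proof -
    define D where "D = \<bar>dchf c b0 lam\<bar>"
    have D: "D > 0" using nz by (simp add: D_def)
    define K1 where "K1 = (\<integral>r. \<bar>r\<bar> ^ 1 * (exp (- lam * r) * exp (b * \<bar>r\<bar>)) \<partial>M)"
    have iK1: "integrable M (\<lambda>r. \<bar>r\<bar> ^ 1 * (exp (- lam * r) * exp (b * \<bar>r\<bar>)))"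
      by (rule integrable_power_exp) (use b in auto)
    have poin: "\<bar>w t\<bar> \<le> 1 / D * \<bar>j t\<bar> + 1 / D * \<bar>w1 t\<bar> + (b0 * K1 / D) * q t" for t
    proof -
      \<comment> \<open>First-order Taylor error of \<open>W\<close>. The derivative of
        \<open>W\<close> is \<open>- w\<close>, so the error is governed by increments of
        \<open>w\<close>, that is by \<open>q\<close>.\<close>
      define err where "err r = W (t - r) - W t - r * w t" for r
      have err: "\<bar>err r\<bar> \<le> \<bar>r\<bar> * (q t * exp (b * \<bar>r\<bar>))" for r
      proof (cases "r = 0")
        case False
        have "\<exists>z. \<bar>z - t\<bar> \<le> \<bar>r\<bar> \<and> W (t - r) - W t = r * w z"
        proof (cases "r > 0")
          case True
          obtain z where "t - r < z" "z < t" "W t - W (t - r) = (t - (t - r)) * (- w z)"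
            using MVT2[of "t - r" t W "\<lambda>x. - w x"] dW True by auto
          then show ?thesis by (intro exI[of _ z]) auto
        next
          case neg: False
          obtain z where "t < z" "z < t - r" "W (t - r) - W t = (t - r - t) * (- w z)"
            using MVT2[of t "t - r" W "\<lambda>x. - w x"] dW neg False by auto
          then show ?thesis using neg by (intro exI[of _ z]) auto
        qed
        then obtain z where z: "\<bar>z - t\<bar> \<le> \<bar>r\<bar>" "W (t - r) - W t = r * w z" by blast
        have "err r = r * (w z - w t)" using z(2) by (simp add: err_def algebra_simps)
        then show ?thesis using incr'[OF z(1)] by (simp add: abs_mult mult_left_mono)
      qed (simp add: err_def)
      have iW: "integrable M (\<lambda>r. exp (- lam * r) * W (t - r))" by (rule integrable_weighted_shift[OF Wm Wb])
      have e: "exp (- lam * r) * err r = exp (- lam * r) * W (t - r) - W t * exp (- lam * r) - w t * (r * exp (- lam * r))" for r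
        by (simp add: err_def algebra_simps)
      have ie: "integrable M (\<lambda>r. exp (- lam * r) * err r)" unfolding e using iW iM by simp
      have E: "(\<integral>r. exp (- lam * r) * err r \<partial>M) = (\<integral>r. exp (- lam * r) * W (t - r) \<partial>M) - W t * kap lam - w t * kap1 lam"
        unfolding e kap_def kap1_def using iW iM by simp
      have "\<bar>\<integral>r. exp (- lam * r) * err r \<partial>M\<bar> \<le> (\<integral>r. q t * (\<bar>r\<bar> ^ 1 * (exp (- lam * r) * exp (b * \<bar>r\<bar>))) \<partial>M)"
      proof (rule order_trans[OF integral_norm_bound[where 'a = real, unfolded real_norm_def]], rule integral_mono[OF integrable_abs[OF ie]])
        fix r
        show "\<bar>exp (- lam * r) * err r\<bar> \<le> q t * (\<bar>r\<bar> ^ 1 * (exp (- lam * r) * exp (b * \<bar>r\<bar>)))"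
          using mult_left_mono[OF err[of r], of "exp (- lam * r)"] by (simp add: abs_mult mult_ac)
      qed (use iK1 in simp)
      also have "\<dots> = q t * K1" unfolding K1_def by (rule integral_mult_right_zero)
      finally have eb: "\<bar>\<integral>r. exp (- lam * r) * err r \<partial>M\<bar> \<le> q t * K1" .
      \<comment> \<open>The constant part of the expansion cancels against
        \<open>kap lam * W t\<close>, and the linear part joins the drift to form the slope
        \<open>dchf c b0 lam\<close>.\<close>
      have "j t = - w1 t - dchf c b0 lam * w t + b0 * (\<integral>r. exp (- lam * r) * err r \<partial>M)"
        unfolding j_eq E dchf_def by (simp add: algebra_simps)
      moreover have "\<bar>b0 * (\<integral>r. exp (- lam * r) * err r \<partial>M)\<bar> \<le> b0 * (q t * K1)"
        using eb b0_pos by (simp add: abs_mult)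
      ultimately have "\<bar>dchf c b0 lam * w t\<bar> \<le> \<bar>j t\<bar> + \<bar>w1 t\<bar> + b0 * (q t * K1)" by linarith
      then have "D * \<bar>w t\<bar> \<le> \<bar>j t\<bar> + \<bar>w1 t\<bar> + b0 * (q t * K1)" by (simp add: abs_mult D_def)
      then show ?thesis using D by (simp add: field_simps)
    qed
    have j_b0: "\<bar>j t\<bar> \<le> Ce / be" for t
    proof -
      have "Ce / be * exp (- be * \<bar>t\<bar>) \<le> Ce / be * 1" using Ce(3) be(1) by (intro mult_left_mono) auto
      then show ?thesis using j_b[of t] by linarith
    qed
    obtain Kp where Kp: "Kp > 0" and P: "\<And>e. 0 < e \<Longrightarrow> e \<le> b / 2 \<Longrightarrow> integrable lborel (\<lambda>t. psi e t * (j t)\<^sup>2) \<and>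
      (\<integral>t. psi e t * (w t)\<^sup>2 \<partial>lborel) \<le> Kp * ((\<integral>t. psi e t * (j t)\<^sup>2 \<partial>lborel) + (\<integral>t. psi e t * (w1 t)\<^sup>2 \<partial>lborel))"
      by (rule poincare_psi[OF dw(1) wc(2) gr2 b(1) jm j_b0 poin[unfolded q_def]]) auto
    \<comment> \<open>The exact equation is used with \<open>B = b0\<close>, the nonlinear part
      being kept as the source \<open>eta\<close>.\<close>
    have pde: "0 \<le> w t * w2 t + (2 * lam - c) * (w t * w1 t) - b0 / 2 * kap lam * (w t)\<^sup>2
      + b0 / 2 * (\<integral>r. exp (- lam * r) * (w (t - r))\<^sup>2 \<partial>M) + \<bar>w t\<bar> * \<bar>eta t\<bar>" for t
    proof -
      define N N2 where "N = (\<integral>r. exp (- lam * r) * w (t - r) \<partial>M)" and "N2 = (\<integral>r. exp (- lam * r) * (w (t - r))\<^sup>2 \<partial>M)"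
      have i1: "integrable M (\<lambda>r. exp (- lam * r) * w (t - r))" by (rule integrable_weighted_shift[OF wm K(2)])
      have "\<bar>N\<bar> \<le> (\<integral>r. \<bar>exp (- lam * r) * w (t - r)\<bar> \<partial>M)" unfolding N_def
        by (rule integral_norm_bound[where 'a = real, unfolded real_norm_def])
      also have "\<dots> = (\<integral>r. exp (- lam * r) * \<bar>w (t - r)\<bar> \<partial>M)" by (simp add: abs_mult)
      finally have "\<bar>w t\<bar> * \<bar>N\<bar> \<le> \<bar>w t\<bar> * \<dots>" by (rule mult_left_mono) simp
      also have "\<dots> \<le> kap lam * (w t)\<^sup>2 / 2 + N2 / 2"
        unfolding N2_def by (rule conv_young[OF _ _ i1 i2]) (use lam in auto)
      finally have "w t * N \<le> kap lam * (w t)\<^sup>2 / 2 + N2 / 2"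
        using abs_ge_self[of "w t * N"] by (simp add: abs_mult)
      then have y: "b0 * (w t * N) \<le> b0 * (kap lam * (w t)\<^sup>2 / 2 + N2 / 2)" using b0_pos by (intro mult_left_mono) auto
      have "w t * eta t = w t * w2 t + (2 * lam - c) * (w t * w1 t) + b0 * (w t * N) - b0 * (kap lam * (w t)\<^sup>2)"
        unfolding eta_eq N_def[symmetric] by (simp add: algebra_simps power2_eq_square)
      moreover have "0 \<le> w t * eta t + \<bar>w t\<bar> * \<bar>eta t\<bar>" using abs_ge_minus_self[of "w t * eta t"] by (simp add: abs_mult)
      moreover have "b0 / 2 * kap lam * (w t)\<^sup>2 = b0 * (kap lam * (w t)\<^sup>2) / 2" "b0 * (kap lam * (w t)\<^sup>2 / 2 + N2 / 2) = b0 * (kap lam * (w t)\<^sup>2) / 2 + b0 / 2 * N2"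
        by (simp_all add: algebra_simps)
      ultimately show ?thesis using y unfolding N2_def[symmetric] by linarith
    qed
    obtain G e0 where G: "G \<ge> 0" "e0 > 0" and E: "\<And>e. 0 < e \<Longrightarrow> e < e0 \<Longrightarrow>
     integrable lborel (\<lambda>t. psi e t * (w t)\<^sup>2) \<and> integrable lborel (\<lambda>t. psi e t * (w1 t)\<^sup>2) \<and>
     integrable lborel (\<lambda>t. psi e t * (\<bar>w t\<bar> * \<bar>eta t\<bar>)) \<and>
     (\<integral>t. psi e t * (w1 t)\<^sup>2 \<partial>lborel)
      \<le> (e * \<bar>(2 * lam - c) - b0 * kap1 lam\<bar> + e\<^sup>2 * G) / 2 * (\<integral>t. psi e t * (w t)\<^sup>2 \<partial>lborel)
        + (\<integral>t. psi e t * (\<bar>w t\<bar> * \<bar>eta t\<bar>) \<partial>lborel)"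
    proof (rule energy_general[OF dw w2c, where eta = "\<lambda>t. \<bar>eta t\<bar>" and rho = lam and B = b0 and d = "2 * lam - c"])
      fix a :: real assume a: "0 < a"
      obtain C where C: "C \<ge> 0" "\<And>t. \<bar>w t\<bar> \<le> C * exp (a * \<bar>t\<bar>)" "\<And>t. \<bar>w1 t\<bar> \<le> C * exp (a * \<bar>t\<bar>)" "\<And>t. \<bar>w2 t\<bar> \<le> C * exp (a * \<bar>t\<bar>)"
        using gr[OF a] by blast
      have "\<bar>eta t\<bar> \<le> Ce * exp (a * \<bar>t\<bar>)" for t
      proof -
        have "- be * \<bar>t\<bar> \<le> a * \<bar>t\<bar>" using a be by (intro mult_right_mono) auto
        then have "Ce * exp (- be * \<bar>t\<bar>) \<le> Ce * exp (a * \<bar>t\<bar>)" using Ce(3) by (intro mult_left_mono) auto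
        then show ?thesis using eta_b[of t] by linarith
      qed
      moreover have "C * exp (a * \<bar>t\<bar>) \<le> (C + Ce) * exp (a * \<bar>t\<bar>)" "Ce * exp (a * \<bar>t\<bar>) \<le> (C + Ce) * exp (a * \<bar>t\<bar>)" for t
        using C(1) Ce(3) by (auto intro!: mult_right_mono)
      ultimately show "\<exists>C. \<forall>t. \<bar>w t\<bar> \<le> C * exp (a * \<bar>t\<bar>) \<and> \<bar>w1 t\<bar> \<le> C * exp (a * \<bar>t\<bar>) \<and> \<bar>w2 t\<bar> \<le> C * exp (a * \<bar>t\<bar>) \<and> \<bar>\<bar>eta t\<bar>\<bar> \<le> C * exp (a * \<bar>t\<bar>)"
        using C(2-4) unfolding abs_abs by (meson order_trans)
    qed (use pde lam etam b0_pos in auto)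
    have sq_int: "integrable lborel (\<lambda>t. (u t)\<^sup>2)" if u: "u \<in> borel_measurable borel" "\<And>t. \<bar>u t\<bar> \<le> Z * exp (- be * \<bar>t\<bar>)" for u Z
    proof (rule integrable_exp_bound[OF be(1)])
      fix t
      have Z: "Z \<ge> 0" using order_trans[OF abs_ge_zero u(2)[of 0]] by simp
      have "Z * exp (- be * \<bar>t\<bar>) \<le> Z * 1" using Z be(1) by (intro mult_left_mono) auto
      then have "\<bar>u t\<bar> \<le> Z" using u(2)[of t] by linarith
      then have "\<bar>u t\<bar> * \<bar>u t\<bar> \<le> Z * (Z * exp (- be * \<bar>t\<bar>))" using u(2)[of t] Z by (intro mult_mono) auto
      then show "\<bar>(u t)\<^sup>2\<bar> \<le> (Z * Z) * exp (- be * \<bar>t\<bar>)" by (simp add: power2_eq_square mult.assoc)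
    qed (use u in simp)
    have Ij: "integrable lborel (\<lambda>t. (j t)\<^sup>2)" and Ie: "integrable lborel (\<lambda>t. (eta t)\<^sup>2)"
      using sq_int[OF jm j_b] sq_int[OF etam eta_b] by auto
    define Q1 Q2 where "Q1 = (\<integral>t. (j t)\<^sup>2 \<partial>lborel)" and "Q2 = (\<integral>t. (eta t)\<^sup>2 \<partial>lborel)"
    \<comment> \<open>The value comes from solving \<open>T \<le> (Q1 + T) / 2 + Kp * Q2\<close> for
      \<open>T\<close>.\<close>
    define R where "R = Q1 + 2 * Kp * Q2"
    have Q0: "Q1 \<ge> 0" "Q2 \<ge> 0" "R \<ge> 0" using Kp by (auto simp: Q1_def Q2_def R_def)
    define DG where "DG = D + G + 1"
    have DG: "DG > 0" using D G by (simp add: DG_def)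
    \<comment> \<open>Below \<open>e1\<close> the energy error is at most
      \<open>S / (4 * Kp)\<close>. Young's inequality spends as much on the source, and by the
      Poincare inequality the sum costs half of \<open>T\<close>, which is absorbed on the
      left.\<close>
    define e1 where "e1 = min (min e0 (b / 2)) (min 1 (1 / (2 * Kp * DG)))"
    have e1: "e1 > 0" using G(2) b(1) Kp DG by (simp add: e1_def)
    have bnd: "integrable lborel (\<lambda>t. psi e t * (w t)\<^sup>2) \<and> integrable lborel (\<lambda>t. psi e t * (w1 t)\<^sup>2) \<and>
       (\<integral>t. psi e t * (w t)\<^sup>2 \<partial>lborel) \<le> Kp * (Q1 + R) \<and> (\<integral>t. psi e t * (w1 t)\<^sup>2 \<partial>lborel) \<le> R"
      if e: "0 < e" "e < e1" for e
    proof -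
      have e': "e < e0" "e \<le> b / 2" "e < 1" "e < 1 / (2 * Kp * DG)" using e by (auto simp: e1_def)
      define S T where "S = (\<integral>t. psi e t * (w t)\<^sup>2 \<partial>lborel)" and "T = (\<integral>t. psi e t * (w1 t)\<^sup>2 \<partial>lborel)"
      note Ee = E[OF e(1) e'(1)]
      have ST0: "S \<ge> 0" "T \<ge> 0" by (auto simp: S_def T_def)
      have pj: "(\<integral>t. psi e t * (j t)\<^sup>2 \<partial>lborel) \<le> Q1" unfolding Q1_def
        by (rule integral_mono) (use P[OF e(1) e'(2)] Ij psi_le_1[of e] in \<open>auto intro!: mult_left_le_one_le\<close>)
      have "S \<le> Kp * ((\<integral>t. psi e t * (j t)\<^sup>2 \<partial>lborel) + T)" using P[OF e(1) e'(2)] by (simp add: S_def T_def)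
      also have "\<dots> \<le> Kp * (Q1 + T)" using pj Kp by (intro mult_left_mono) auto
      finally have S: "S \<le> Kp * (Q1 + T)" .
      have "(\<integral>t. psi e t * (\<bar>w t\<bar> * \<bar>eta t\<bar>) \<partial>lborel) \<le> (\<integral>t. 1 / (4 * Kp) * (psi e t * (w t)\<^sup>2) + Kp * (eta t)\<^sup>2 \<partial>lborel)"
      proof (rule integral_mono)
        fix t
        have "0 \<le> (\<bar>w t\<bar> - 2 * Kp * \<bar>eta t\<bar>)\<^sup>2 / (4 * Kp)" using Kp by simp
        also have "\<dots> = 1 / (4 * Kp) * (w t)\<^sup>2 + Kp * (eta t)\<^sup>2 - \<bar>w t\<bar> * \<bar>eta t\<bar>"
          using Kp by (simp add: power2_diff field_simps power2_eq_square)
        finally have "psi e t * (\<bar>w t\<bar> * \<bar>eta t\<bar>) \<le> psi e t * (1 / (4 * Kp) * (w t)\<^sup>2 + Kp * (eta t)\<^sup>2)"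
          by (intro mult_left_mono) auto
        also have "\<dots> \<le> 1 / (4 * Kp) * (psi e t * (w t)\<^sup>2) + Kp * (eta t)\<^sup>2"
        proof -
          have "psi e t * (Kp * (eta t)\<^sup>2) \<le> Kp * (eta t)\<^sup>2" using Kp psi_le_1[of e t] by (intro mult_left_le_one_le) auto
          then show ?thesis by (simp add: distrib_left)
        qed
        finally show "psi e t * (\<bar>w t\<bar> * \<bar>eta t\<bar>) \<le> 1 / (4 * Kp) * (psi e t * (w t)\<^sup>2) + Kp * (eta t)\<^sup>2" .
      qed (use Ee Ie in auto)
      also have "\<dots> = 1 / (4 * Kp) * S + Kp * Q2" unfolding S_def Q2_def using Ee Ie by simp
      finally have X: "(\<integral>t. psi e t * (\<bar>w t\<bar> * \<bar>eta t\<bar>) \<partial>lborel) \<le> 1 / (4 * Kp) * S + Kp * Q2" .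
      have "e\<^sup>2 \<le> e" using e e' by (simp add: power2_eq_square mult_left_le)
      then have "e\<^sup>2 * G \<le> e * G" using G(1) by (rule mult_right_mono)
      then have "e * D + e\<^sup>2 * G \<le> e * DG" using e by (simp add: DG_def distrib_left)
      also have "\<dots> \<le> 1 / (2 * Kp)" using e'(4) Kp DG by (simp add: field_simps)
      finally have "(e * D + e\<^sup>2 * G) / 2 * S \<le> 1 / (2 * Kp) / 2 * S" using ST0 by (intro mult_right_mono divide_right_mono) auto
      moreover have "T \<le> (e * D + e\<^sup>2 * G) / 2 * S + (\<integral>t. psi e t * (\<bar>w t\<bar> * \<bar>eta t\<bar>) \<partial>lborel)"
        using Ee by (simp add: T_def S_def D_def dchf_def)
      ultimately have T1: "T \<le> 1 / (4 * Kp) * S + 1 / (4 * Kp) * S + Kp * Q2" using X by simp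
      have "1 / (4 * Kp) * S + 1 / (4 * Kp) * S = 1 / (2 * Kp) * S" using Kp by (simp add: field_simps)
      also have "\<dots> \<le> 1 / (2 * Kp) * (Kp * (Q1 + T))" using S Kp by (intro mult_left_mono) auto
      also have "\<dots> = (Q1 + T) / 2" using Kp by simp
      finally have "T \<le> (Q1 + T) / 2 + Kp * Q2" by (rule order_trans[OF T1 add_right_mono])
      then have T: "T \<le> R" by (simp add: R_def field_simps)
      have "Kp * (Q1 + T) \<le> Kp * (Q1 + R)" using T Kp by (intro mult_left_mono) auto
      then show ?thesis using Ee S T by (simp add: S_def T_def)
    qed
    have "integrable lborel (\<lambda>t. (w t)\<^sup>2)"
      by (rule integrable_of_psi_bound(1)[OF _ _ e1, where B = "Kp * (Q1 + R)"]) (use bnd wm in auto)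
    moreover have "integrable lborel (\<lambda>t. (w1 t)\<^sup>2)"
      by (rule integrable_of_psi_bound(1)[OF _ _ e1, where B = R]) (use bnd w1m in auto)
    ultimately have "(w \<longlongrightarrow> 0) at_bot"
      by (rule tendsto_0_at_bot_of_square_integrable[OF dw(1) wc(2)])
    then show ?thesis by (simp add: w_def v_def)
  qed
  show "\<phi>1 = \<phi>2" if dz: "dchf c b0 lam = 0" and chi: "chf c ia L lam \<le> 0" and Lb: "L = b0"
  proof -
    \<comment> \<open>The second derivative of \<open>W2\<close> is \<open>w\<close>, so a
      second-order expansion of \<open>W2\<close> under the convolution brings \<open>w\<close>
      itself to light.\<close>
    define W2 where "W2 = tail_int W"
    have dW2: "(W2 has_real_derivative - W t) (at t)" for t
      unfolding W2_def by (rule tail_int_deriv[OF lam(1) Wc Wb])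
    have dW': "((\<lambda>x. - W x) has_real_derivative w t) (at t)" for t using DERIV_minus[OF dW[of t]] by simp
    have W2b: "\<bar>W2 t\<bar> \<le> K / lam / lam * exp (- lam * t)" for t
      unfolding W2_def by (rule set_integrable_exp_tail(2)[OF lam(1) Wm Wb])
    have W2m: "W2 \<in> borel_measurable borel"
      using DERIV_isCont[OF dW2] by (auto intro!: borel_measurable_continuous_onI continuous_at_imp_continuous_on)
    define K' where "K' = max K (K / lam)"
    have K': "K * exp (- lam * t) \<le> K' * exp (- lam * t)" "K / lam * exp (- lam * t) \<le> K' * exp (- lam * t)" for t
        unfolding K'_def by (rule mult_right_mono[OF max.cobounded1], simp, rule mult_right_mono[OF max.cobounded2], simp)
    have dmw: "((\<lambda>t. - w t) has_real_derivative - w1 t) (at t)" for t using DERIV_minus[OF dw(1)] .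
    define p where "p = tail_int j"
    have p_eq: "p t = - (- w t) - (2 * lam - c) * W t + b0 * ((\<integral>r. exp (- lam * r) * W2 (t - r) \<partial>M) - kap lam * W2 t)" for t
      unfolding p_def W2_def
    proof (rule tail_identity[OF lam(1) dW dmw, where K = K'])
      show "isCont (\<lambda>t. - w1 t) t" for t using wc(2) by (intro continuous_intros)
      show "\<bar>W t\<bar> \<le> K' * exp (- lam * t)" for t using order_trans[OF Wb K'(2)] .
      show "\<bar>- w t\<bar> \<le> K' * exp (- lam * t)" for t using order_trans[OF K(2) K'(1)] by simp
      show "\<bar>- w1 t\<bar> \<le> K' * exp (- lam * t)" for t using order_trans[OF K(3) K'(1)] by simp
      show "j t = - w1 t + (2 * lam - c) * - w t + b0 * ((\<integral>r. exp (- lam * r) * W (t - r) \<partial>M) - kap lam * W t)" for t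
        unfolding j_eq by simp
    qed
    define J where "J = (\<integral>t. \<bar>j t\<bar> \<partial>lborel)"
    have J0: "J \<ge> 0" by (simp add: J_def)
    \<comment> \<open>The integral of \<open>j\<close> need not vanish, so \<open>p\<close> may
      approach a nonzero constant at minus infinity; boundedness is all that is claimed.\<close>
    have pb: "\<bar>p t\<bar> \<le> J" for t
    proof -
      have i: "integrable lborel (\<lambda>s. indicator {t<..} s *\<^sub>R j s)" by (rule integrable_mult_indicator[OF _ ji]) simp
      show ?thesis unfolding p_def tail_int_def set_lebesgue_integral_def J_def
        by (rule order_trans[OF integral_norm_bound[where 'a = real, unfolded real_norm_def]],
            rule integral_mono[OF integrable_abs[OF i] integrable_abs[OF ji]]) (simp add: indicator_def)
    qed
    have "\<bar>j t\<bar> \<le> Ce / be * exp (- be * t)" for t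
    proof -
      have "- be * \<bar>t\<bar> \<le> - be * t" using be by (simp add: mult_left_mono)
      then have "Ce / be * exp (- be * \<bar>t\<bar>) \<le> Ce / be * exp (- be * t)" using Ce(3) be(1) by (intro mult_left_mono) auto
      then show ?thesis using j_b[of t] by linarith
    qed
    from tail_int_deriv[OF be(1) jc this] have pc: "isCont p t" for t
      unfolding p_def using DERIV_isCont by blast
    have pm: "p \<in> borel_measurable borel"
      using pc by (auto intro!: borel_measurable_continuous_onI continuous_at_imp_continuous_on)
    define K2 k2 where "K2 = (\<integral>r. \<bar>r\<bar> ^ 2 * (exp (- lam * r) * exp (b * \<bar>r\<bar>)) \<partial>M)" and "k2 = (\<integral>r. r\<^sup>2 * exp (- lam * r) \<partial>M)"
    have k20: "k2 \<ge> 0" by (simp add: k2_def)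
    have iK2: "integrable M (\<lambda>r. \<bar>r\<bar> ^ 2 * (exp (- lam * r) * exp (b * \<bar>r\<bar>)))"
      by (rule integrable_power_exp) (use b in auto)
    have poin: "\<bar>w t\<bar> \<le> 1 * \<bar>p t\<bar> + 1 * \<bar>w1 t\<bar> + (b0 * K2 / 2) * q t" for t
    proof -
      define err where "err r = W2 (t - r) - W2 t - r * W t - r\<^sup>2 / 2 * w t" for r
      have err: "\<bar>err r\<bar> \<le> (q t * exp (b * \<bar>r\<bar>)) * r\<^sup>2 / 2" for r
      proof -
        have "\<bar>W2 (t + - r) - W2 t - (- r) * (- W t) - (- r)\<^sup>2 / 2 * w t\<bar> \<le> (q t * exp (b * \<bar>r\<bar>)) * (- r)\<^sup>2 / 2"
          by (rule second_order_bound[OF dW2 dW']) (use incr' in auto)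
        then show ?thesis by (simp add: err_def)
      qed
      have iW: "integrable M (\<lambda>r. exp (- lam * r) * W2 (t - r))" by (rule integrable_weighted_shift[OF W2m W2b])
      have e: "exp (- lam * r) * err r = exp (- lam * r) * W2 (t - r) - W2 t * exp (- lam * r) - W t * (r * exp (- lam * r)) - w t / 2 * (r\<^sup>2 * exp (- lam * r))" for r
        by (simp add: err_def algebra_simps)
      have ie: "integrable M (\<lambda>r. exp (- lam * r) * err r)" unfolding e using iW iM by simp
      have E: "(\<integral>r. exp (- lam * r) * err r \<partial>M) = (\<integral>r. exp (- lam * r) * W2 (t - r) \<partial>M) - W2 t * kap lam - W t * kap1 lam - w t / 2 * k2"
        unfolding e kap_def kap1_def k2_def using iW iM by simp
      have "\<bar>\<integral>r. exp (- lam * r) * err r \<partial>M\<bar> \<le> (\<integral>r. q t / 2 * (\<bar>r\<bar> ^ 2 * (exp (- lam * r) * exp (b * \<bar>r\<bar>))) \<partial>M)"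
      proof (rule order_trans[OF integral_norm_bound[where 'a = real, unfolded real_norm_def]], rule integral_mono[OF integrable_abs[OF ie]])
        fix r
        show "\<bar>exp (- lam * r) * err r\<bar> \<le> q t / 2 * (\<bar>r\<bar> ^ 2 * (exp (- lam * r) * exp (b * \<bar>r\<bar>)))"
          using mult_left_mono[OF err[of r], of "exp (- lam * r)"] by (simp add: abs_mult mult_ac)
      qed (use iK2 in simp)
      also have "\<dots> = q t / 2 * K2" unfolding K2_def by (rule integral_mult_right_zero)
      finally have "\<bar>b0 * (\<integral>r. exp (- lam * r) * err r \<partial>M)\<bar> \<le> b0 * (q t / 2 * K2)"
        using b0_pos by (simp add: abs_mult)
      \<comment> \<open>The coefficient of \<open>w\<close> is half the second derivative of
        \<open>chi0\<close> at \<open>lam\<close>; it is at least 1, and the slope term drops out by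
        \<open>dz\<close>.\<close>
      moreover have "p t = w t * (1 + b0 * k2 / 2) - dchf c b0 lam * W t + b0 * (\<integral>r. exp (- lam * r) * err r \<partial>M)"
        unfolding p_eq E dchf_def by (simp add: field_simps)
      ultimately have "\<bar>w t * (1 + b0 * k2 / 2)\<bar> \<le> \<bar>p t\<bar> + b0 * (q t / 2 * K2)" using dz by simp
      moreover have "\<bar>w t\<bar> * 1 \<le> \<bar>w t\<bar> * (1 + b0 * k2 / 2)" using k20 b0_pos by (intro mult_left_mono) auto
      moreover have "\<bar>w t * (1 + b0 * k2 / 2)\<bar> = \<bar>w t\<bar> * (1 + b0 * k2 / 2)" using k20 b0_pos by (simp add: abs_mult)
      ultimately show ?thesis by (simp add: mult_ac)
    qed
    obtain Kp where Kp: "Kp > 0" and P: "\<And>e. 0 < e \<Longrightarrow> e \<le> b / 2 \<Longrightarrow> integrable lborel (\<lambda>t. psi e t * (p t)\<^sup>2) \<and>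
      (\<integral>t. psi e t * (w t)\<^sup>2 \<partial>lborel) \<le> Kp * ((\<integral>t. psi e t * (p t)\<^sup>2 \<partial>lborel) + (\<integral>t. psi e t * (w1 t)\<^sup>2 \<partial>lborel))"
      by (rule poincare_psi[OF dw(1) wc(2) gr2 b(1) pm pb poin[unfolded q_def]]) auto
    have pde: "0 \<le> w t * w2 t + (2 * lam - c) * (w t * w1 t) - L / 2 * kap lam * (w t)\<^sup>2
        + L / 2 * (\<integral>r. exp (- lam * r) * (w (t - r))\<^sup>2 \<partial>M) + \<bar>w t\<bar> * 0" for t
      using difference_pde[OF s _ _ chi, of t] i2[of t] lam unfolding w_def w1_def w2_def v_def v1_def v2_def by auto
    obtain G e0 where G: "G \<ge> 0" "e0 > 0" and E: "\<And>e. 0 < e \<Longrightarrow> e < e0 \<Longrightarrow>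
       integrable lborel (\<lambda>t. psi e t * (w t)\<^sup>2) \<and> integrable lborel (\<lambda>t. psi e t * (w1 t)\<^sup>2) \<and>
       integrable lborel (\<lambda>t. psi e t * (\<bar>w t\<bar> * 0)) \<and>
       (\<integral>t. psi e t * (w1 t)\<^sup>2 \<partial>lborel)
        \<le> (e * \<bar>(2 * lam - c) - L * kap1 lam\<bar> + e\<^sup>2 * G) / 2 * (\<integral>t. psi e t * (w t)\<^sup>2 \<partial>lborel)
          + (\<integral>t. psi e t * (\<bar>w t\<bar> * 0) \<partial>lborel)"
    proof (rule energy_general[OF dw w2c, where eta = "\<lambda>_. 0" and rho = lam and B = L and d = "2 * lam - c"])
      fix a :: real assume "0 < a"
      then show "\<exists>C. \<forall>t. \<bar>w t\<bar> \<le> C * exp (a * \<bar>t\<bar>) \<and> \<bar>w1 t\<bar> \<le> C * exp (a * \<bar>t\<bar>) \<and> \<bar>w2 t\<bar> \<le> C * exp (a * \<bar>t\<bar>) \<and> \<bar>0\<bar> \<le> C * exp (a * \<bar>t\<bar>)"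
        using gr[of a] by fastforce
    qed (use pde lam L_pos in auto)
    \<comment> \<open>With \<open>L = b0\<close> the slope at the double zero is the coefficient of
      order \<open>e\<close> in the energy estimate, which therefore disappears.\<close>
    have dL: "\<bar>(2 * lam - c) - L * kap1 lam\<bar> = 0" using dz Lb by (simp add: dchf_def)
    have "(w1 t)\<^sup>2 = 0" for t
    proof (rule zero_of_psi_small[where u = "\<lambda>t. (w1 t)\<^sup>2"])
      show "isCont (\<lambda>t. (w1 t)\<^sup>2) t" for t using wc(2) by (intro continuous_intros)
      fix \<epsilon> :: real assume eps: "0 < \<epsilon>"
      define H where "H = G * Kp"
      have H: "H \<ge> 0" using G Kp by (simp add: H_def)
      have pos: "H + 1 > 0" "4 * H * J\<^sup>2 + 1 > 0" using H by (auto intro!: add_nonneg_pos mult_nonneg_nonneg)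
      \<comment> \<open>The bound by \<open>1 / (H + 1)\<close> allows the term in \<open>T\<close>
        to be absorbed; the last one makes the rest at most \<epsilon>.\<close>
      define e1 where "e1 = min (min e0 (b / 2)) (min (min 1 (1 / (H + 1))) (\<epsilon> / (4 * H * J\<^sup>2 + 1)))"
      have e1: "e1 > 0" using G(2) b(1) pos eps by (simp add: e1_def)
      show "\<exists>e0>0. \<forall>e. 0 < e \<and> e < e0 \<longrightarrow> integrable lborel (\<lambda>t. psi e t * (w1 t)\<^sup>2) \<and> (\<integral>t. psi e t * (w1 t)\<^sup>2 \<partial>lborel) \<le> \<epsilon>"
      proof (intro exI[of _ e1] conjI allI impI e1)
        fix e assume e: "0 < e \<and> e < e1"
        then have e': "0 < e" "e < e0" "e \<le> b / 2" "e < 1" "e < 1 / (H + 1)" "e < \<epsilon> / (4 * H * J\<^sup>2 + 1)" by (auto simp: e1_def)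
        note Ee = E[OF e'(1,2)]
        show "integrable lborel (\<lambda>t. psi e t * (w1 t)\<^sup>2)" using Ee by blast
        define S T where "S = (\<integral>t. psi e t * (w t)\<^sup>2 \<partial>lborel)" and "T = (\<integral>t. psi e t * (w1 t)\<^sup>2 \<partial>lborel)"
        have T0: "T \<ge> 0" by (simp add: T_def)
        have ip: "integrable lborel (\<lambda>t. psi e t)"
          using psi_integrable[of e 0 "\<lambda>_. 1" 1] e' by simp
        \<comment> \<open>A bounded function costs \<open>4 / e\<close> under the weight; multiplied
          by the energy error of order \<open>e\<^sup>2\<close> this still leaves order
          \<open>e\<close>.\<close>
        have "(\<integral>t. psi e t * (p t)\<^sup>2 \<partial>lborel) \<le> (\<integral>t. J\<^sup>2 * psi e t \<partial>lborel)"
        proof (rule integral_mono)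
          show "psi e t * (p t)\<^sup>2 \<le> J\<^sup>2 * psi e t" for t
          proof -
            have "(p t)\<^sup>2 \<le> J\<^sup>2" using pb[of t] by (metis abs_ge_zero power2_abs power_mono)
            then show ?thesis by (simp add: mult.commute mult_left_mono)
          qed
        qed (use P[OF e'(1,3)] ip in auto)
        also have "\<dots> \<le> J\<^sup>2 * (4 / e)" using mult_left_mono[OF psi_integral_le[OF e'(1)], of "J\<^sup>2"] by simp
        finally have pp: "(\<integral>t. psi e t * (p t)\<^sup>2 \<partial>lborel) \<le> J\<^sup>2 * (4 / e)" .
        have "S \<le> Kp * ((\<integral>t. psi e t * (p t)\<^sup>2 \<partial>lborel) + T)" using P[OF e'(1,3)] by (simp add: S_def T_def)
        also have "\<dots> \<le> Kp * (J\<^sup>2 * (4 / e) + T)" using pp Kp by (intro mult_left_mono) auto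
        finally have S: "S \<le> Kp * (J\<^sup>2 * (4 / e) + T)" .
        have "T \<le> e\<^sup>2 * G / 2 * S" using Ee unfolding dL by (simp add: S_def T_def)
        also have "\<dots> \<le> e\<^sup>2 * G / 2 * (Kp * (J\<^sup>2 * (4 / e) + T))" using S G(1) by (intro mult_left_mono) auto
        also have "\<dots> = 2 * e * H * J\<^sup>2 + (e * (e * H)) * T / 2"
          using e' by (simp add: H_def field_simps power2_eq_square)
        also have "(e * (e * H)) * T / 2 \<le> 1 * T / 2"
        proof -
          have "e * H \<le> e * (H + 1)" using e' by simp
          also have "\<dots> \<le> 1" using e' pos by (simp add: field_simps)
          finally have "e * (e * H) \<le> 1 * 1" using e' H by (intro mult_mono) auto
          then show ?thesis using T0 by (intro divide_right_mono mult_right_mono) auto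
        qed
        finally have "T \<le> e * (4 * H * J\<^sup>2)" by simp
        also have "\<dots> \<le> e * (4 * H * J\<^sup>2 + 1)" using e' by simp
        also have "\<dots> \<le> \<epsilon>" using e'(6) pos by (simp add: field_simps)
        finally show "(\<integral>t. psi e t * (w1 t)\<^sup>2 \<partial>lborel) \<le> \<epsilon>" by (simp add: T_def)
      qed
    qed simp
    then have "(w has_real_derivative 0) (at t)" for t using dw(1)[of t] by simp
    moreover have "(w \<longlongrightarrow> 0) at_top"
    proof (rule Lim_null_comparison)
      show "\<forall>\<^sub>F t in at_top. norm (w t) \<le> K * exp (- lam * t)" using K(2) by simp
      show "((\<lambda>t. K * exp (- lam * t)) \<longlongrightarrow> 0) at_top" using lam(1) by real_asymp
    qed
    ultimately have "w t = 0" for t by (rule zero_of_deriv_zero)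
    then show ?thesis by (auto simp: w_def v_def)
  qed
qed

section \<open>Uniqueness at a fixed speed\<close>

lemma translates_of_charge_determines:
  assumes det: "\<And>\<phi>1 \<phi>2. sol \<phi>1 \<Longrightarrow> sol \<phi>2 \<Longrightarrow> charge \<phi>1 = charge \<phi>2 \<Longrightarrow> \<phi>1 = \<phi>2"
    and s: "sol \<phi>1" "sol \<phi>2" and nz: "\<phi>1 \<noteq> (\<lambda>_. 0)" "\<phi>2 \<noteq> (\<lambda>_. 0)"
  shows "\<exists>h. \<forall>t. \<phi>1 t = \<phi>2 (t + h)"
proof -
  have "charge (\<lambda>_. 0) = 0" by (simp add: charge_def)
  then have pos: "charge \<phi>1 > 0" "charge \<phi>2 > 0"
    using charge_nonneg[OF s(1)] charge_nonneg[OF s(2)] det[OF s(1) sol_zero] det[OF s(2) sol_zero] nz by fastforce+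
  define h where "h = ln (charge \<phi>1 / charge \<phi>2) / lam"
  have "charge (\<lambda>t. \<phi>2 (t + h)) = charge \<phi>1"
    using pos lam(1) by (simp add: sol_shift(3)[OF s(2)] h_def)
  then have "\<phi>1 = (\<lambda>t. \<phi>2 (t + h))" using det[OF s(1) sol_shift(1)[OF s(2)]] by simp
  then show ?thesis by metis
qed

end

context wave_eq
begin

theorem unique_up_to_translation:
  assumes m: "0 < m" "m < m2" "chf c ia L m \<le> 0"
    and s: "sol \<phi>1" "sol \<phi>2" and nz: "\<phi>1 \<noteq> (\<lambda>_. 0)" "\<phi>2 \<noteq> (\<lambda>_. 0)"
  shows "\<exists>h. \<forall>t. \<phi>1 t = \<phi>2 (t + h)"
\<comment> \<open>Strict negativity of \<open>chi0\<close> is sought at an exponent where the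
  Lipschitz version is nonpositive, because the barrier has to reach past the exponent of the energy
  estimate. If there is none, \<open>m\<close> itself is a common zero.\<close>
proof (cases "\<exists>mm. 0 < mm \<and> mm < m2 \<and> chi0 mm < 0 \<and> chf c ia L mm \<le> 0")
  case True
  then obtain mm where mm: "0 < mm" "mm < m2" "chi0 mm < 0" "chf c ia L mm \<le> 0" by blast
  have cc: "continuous_on {0..mm} chi0" using chf_continuous by (rule continuous_on_subset) (use mm in auto)
  \<comment> \<open>The first zero \<open>lam\<close> is obtained as the least point of this compact
    set, to which \<open>mm\<close> belongs.\<close>
  define S where "S = {0..mm} \<inter> chi0 -` {..0}"
  have "closed S" unfolding S_def by (rule continuous_closed_preimage[OF cc]) auto
  moreover have "bounded S" unfolding S_def by (rule bounded_subset[of "{0..mm}"]) auto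
  ultimately have "compact S" by (simp add: compact_eq_bounded_closed)
  moreover have "mm \<in> S" using mm by (simp add: S_def)
  ultimately obtain lam where lam: "lam \<in> S" "\<And>z. z \<in> S \<Longrightarrow> lam \<le> z"
    using compact_attains_inf[of S] by blast
  have z0: "chi0 0 > 0" using coeffs by (simp add: chf_def)
  have below: "0 < chi0 z" if "0 \<le> z" "z < lam" for z
    using lam(2)[of z] lam(1) that by (auto simp: S_def not_le[symmetric])
  have lam0: "0 < lam" "lam \<le> mm" using lam(1) z0 by (auto simp: S_def less_le)
  have zero: "chi0 lam = 0"
  proof (rule ccontr)
    assume "chi0 lam \<noteq> 0"
    then have neg: "chi0 lam < 0" using lam(1) by (auto simp: S_def)
    have "\<exists>x\<ge>0. x \<le> lam \<and> chi0 x = 0"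
      by (rule IVT2'[of chi0 lam 0 0]) (use neg z0 lam0 continuous_on_subset[OF cc] in auto)
    then obtain x where x: "0 \<le> x" "x \<le> lam" "chi0 x = 0" by blast
    then have "x < lam" using neg by (cases "x = lam") auto
    then show False using below[OF x(1)] x(3) by simp
  qed
  have lmm: "lam < mm" using lam0 zero mm(3) by (cases "lam = mm") auto
  interpret R: wave_eq_root M m2 f g c a0 b0 ia L al lam
    by unfold_locales (use lam0 lmm mm zero below in auto)
  have bc: "0 \<le> b0" using b0_pos by simp
  \<comment> \<open>By strong convexity a zero with slope 0 would make \<open>chi0\<close>
    nonnegative at \<open>mm\<close>.\<close>
  have nz': "dchf c b0 lam \<noteq> 0"
    using chf_tangent[of lam mm b0 c a0] lam0 lmm mm zero bc by (auto simp: algebra_simps) (smt (verit) zero_le_power2)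
  have "continuous (at mm) chi0"
    using chf_continuous[of c a0 b0] mm by (intro continuous_on_interior[of "{0..m2}"]) auto
  then have "\<forall>\<^sub>F x in at mm. chi0 x < 0"
    unfolding isCont_def using mm(3) by (intro order_tendstoD) auto
  then obtain d where d: "d > 0" "\<And>x. x \<noteq> mm \<Longrightarrow> dist x mm < d \<Longrightarrow> chi0 x < 0"
    unfolding eventually_at by auto
  \<comment> \<open>Decay must go strictly beyond \<open>mm\<close> to make the weighted difference
    integrable at minus infinity; continuity keeps \<open>chi0\<close> negative there.\<close>
  define rho where "rho = mm + min d (m2 - mm) / 2"
  have rho: "mm < rho" "rho < m2" "chi0 rho < 0"
    using d mm by (auto simp: rho_def dist_real_def min_def field_simps)
  show ?thesis
  proof (rule R.translates_of_charge_determines[OF _ s nz])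
    fix \<phi>1 \<phi>2 assume s': "sol \<phi>1" "sol \<phi>2" and eq: "R.charge \<phi>1 = R.charge \<phi>2"
    obtain A where A: "\<And>t. \<bar>\<phi>1 t - \<phi>2 t\<bar> \<le> A * exp (rho * t)"
      by (rule R.sol_difference_barrier[OF s' R.matched_difference(1)[OF s' eq nz'], of rho]) (use rho lmm in auto)
    show "\<phi>1 = \<phi>2"
      by (rule R.vanish_of_fast_decay[OF s' mm(1) rho(1) _ mm(4) A]) (use rho in auto)
  qed
next
  case False
  \<comment> \<open>The linearization lies below the Lipschitz version, so
    \<open>chi0 m \<le> 0\<close>; the case assumption forbids a negative value. Both functions then
    vanish at \<open>m\<close>, which forces their coefficients to agree.\<close>
  have le: "chi0 m \<le> chf c ia L m"
  proof -
    have "b0 * kap m \<le> L * kap m" using coeffs kap_pos[of m] m by (intro mult_right_mono) auto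
    then show ?thesis unfolding chf_def using coeffs(4) by linarith
  qed
  then have z: "chi0 m = 0" "chf c ia L m = 0" using False m by force+
  have "(L - b0) * kap m + (a0 - ia) = 0" using z by (simp add: chf_def algebra_simps)
  moreover have "(L - b0) * kap m \<ge> 0" using coeffs kap_pos[of m] m by simp
  ultimately have "(L - b0) * kap m = 0" "a0 = ia" using coeffs by linarith+
  then have Lb: "L = b0" "ia = a0" using kap_pos[of m] m by auto
  \<comment> \<open>Otherwise \<open>chi0\<close>, now equal to the Lipschitz version, would be
    negative at some nearby exponent, against the case assumption.\<close>
  have dz: "dchf c b0 m = 0"
  proof (rule ccontr)
    assume "dchf c b0 m \<noteq> 0"
    with z(1) m b0_pos obtain y where "0 < y" "y < m2" "chi0 y < 0"
      using chf_negative_nearby[of m b0 c a0] by auto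
    then show False using False Lb by auto
  qed
  have below: "0 < chi0 y" if "0 \<le> y" "y < m" for y
    using chf_tangent[of m y b0 c a0] that m b0_pos z dz by (auto intro: less_le_trans[of 0 "(y - m)\<^sup>2"])
  interpret R: wave_eq_root M m2 f g c a0 b0 ia L al m
    by unfold_locales (use m z below in auto)
  show ?thesis
    by (rule R.translates_of_charge_determines[OF R.matched_difference(2) s nz]) (use dz m Lb in auto)
qed

end

subsection \<open>Reduction of the kernel and the nonlinearities\<close>

lemma hderiv_works:
  assumes "h differentiable (at s within {0..})"
  shows "(h has_real_derivative hderiv h s) (at s within {0..})"
  using assms unfolding hderiv_def has_real_derivative_iff_has_vector_derivative
  by (simp add: vector_derivative_works)

lemma hderiv_at_right:
  assumes "h differentiable (at s within {0..})" "0 \<le> s"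
  shows "((\<lambda>y. (h y - h s) / (y - s)) \<longlongrightarrow> hderiv h s) (at_right s)"
proof -
  have "((\<lambda>y. (h y - h s) / (y - s)) \<longlongrightarrow> hderiv h s) (at s within {0..})"
    using hderiv_works[OF assms(1)] by (simp add: has_field_derivative_iff)
  then show ?thesis by (rule tendsto_within_subset) (use assms(2) in auto)
qed

lemma hderiv_mvt:
  assumes "0 \<le> y" "y < x" "\<And>s. y \<le> s \<Longrightarrow> s \<le> x \<Longrightarrow> h differentiable (at s within {0..})"
  obtains z where "y < z" "z < x" "h x - h y = hderiv h z * (x - y)"
proof -
  have "\<exists>z\<in>{y<..<x}. h x - h y = (\<lambda>d. hderiv h z * d) (x - y)"
  proof (rule mvt_simple[OF assms(2)])
    fix s assume "y \<le> s" "s \<le> x"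
    then have "(h has_real_derivative hderiv h s) (at s within {y..x})"
      by (intro DERIV_subset[OF hderiv_works[OF assms(3)]]) (use assms(1) in auto)
    then show "(h has_derivative (\<lambda>d. hderiv h s * d)) (at s within {y..x})"
      by (simp add: has_field_derivative_def)
  qed
  then show ?thesis using that by auto
qed

text \<open>Near 0 the mean value theorem and the Hoelder condition compare
  \<open>hderiv h z\<close> with \<open>hderiv h 0\<close>. Once \<open>x \<ge> \<delta>\<close>,
  the quotient \<open>x powr \<alpha> / \<delta> powr \<alpha>\<close> is at least 1, so the
  Lipschitz bound takes the required form with a larger constant.\<close>

lemma hoelder_remainder_bound:
  assumes h: "C1_Hoelder_near_0 \<alpha> h" and al: "0 < \<alpha>"
    and B: "0 \<le> B" "\<And>x y. x \<in> {0..X} \<Longrightarrow> y \<in> {0..X} \<Longrightarrow> \<bar>h x - h y\<bar> \<le> B * \<bar>x - y\<bar>"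
  shows "\<exists>C\<ge>0. \<forall>x\<in>{0..X}. \<forall>y\<in>{0..X}.
    \<bar>(h x - hderiv h 0 * x) - (h y - hderiv h 0 * y)\<bar> \<le> C * (max x y) powr \<alpha> * \<bar>x - y\<bar>"
proof -
  obtain \<delta> C where d: "\<delta> > 0" "\<And>s. s \<in> {0..<\<delta>} \<Longrightarrow> h differentiable (at s within {0..})"
    and C: "\<And>s t. s \<in> {0..<\<delta>} \<Longrightarrow> t \<in> {0..<\<delta>} \<Longrightarrow> \<bar>hderiv h s - hderiv h t\<bar> \<le> C * \<bar>s - t\<bar> powr \<alpha>"
    using h unfolding C1_Hoelder_near_0_def by blast
  define b where "b = hderiv h 0"
  define K where "K = \<bar>C\<bar> + (B + \<bar>b\<bar>) / \<delta> powr \<alpha>"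
  have K0: "0 \<le> (B + \<bar>b\<bar>) / \<delta> powr \<alpha>" using B(1) by simp
  have half: "\<bar>(h x - b * x) - (h y - b * y)\<bar> \<le> K * x powr \<alpha> * \<bar>x - y\<bar>" if xy: "0 \<le> y" "y < x" "x \<le> X" for x y
  proof (cases "x < \<delta>")
    case True
    obtain z where z: "y < z" "z < x" "h x - h y = hderiv h z * (x - y)"
      by (rule hderiv_mvt[OF xy(1,2), of h]) (use d(2) xy True in auto)
    have "\<bar>hderiv h z - b\<bar> \<le> C * z powr \<alpha>" using C[of z 0] z xy True d(1) by (simp add: b_def)
    also have "\<dots> \<le> \<bar>C\<bar> * x powr \<alpha>" using z xy al by (intro mult_mono powr_mono2) auto
    also have "\<dots> \<le> K * x powr \<alpha>" using K0 by (intro mult_right_mono) (auto simp: K_def)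
    finally have "\<bar>hderiv h z - b\<bar> * \<bar>x - y\<bar> \<le> K * x powr \<alpha> * \<bar>x - y\<bar>" by (rule mult_right_mono) simp
    moreover have "(h x - b * x) - (h y - b * y) = (hderiv h z - b) * (x - y)" using z(3) by (simp add: algebra_simps)
    ultimately show ?thesis by (simp add: abs_mult)
  next
    case False
    have "\<bar>(h x - b * x) - (h y - b * y)\<bar> = \<bar>(h x - h y) - b * (x - y)\<bar>" by (simp add: algebra_simps)
    also have "\<dots> \<le> \<bar>h x - h y\<bar> + \<bar>b\<bar> * \<bar>x - y\<bar>" by (simp flip: abs_mult)
    also have "\<dots> \<le> B * \<bar>x - y\<bar> + \<bar>b\<bar> * \<bar>x - y\<bar>" using B(2)[of x y] xy by simp
    also have "\<dots> = (B + \<bar>b\<bar>) * 1 * \<bar>x - y\<bar>" by (simp add: algebra_simps)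
    also have "\<dots> \<le> (B + \<bar>b\<bar>) * (x powr \<alpha> / \<delta> powr \<alpha>) * \<bar>x - y\<bar>"
    proof (intro mult_right_mono mult_left_mono)
      have "\<delta> powr \<alpha> \<le> x powr \<alpha>" using False d(1) al by (intro powr_mono2) auto
      then show "1 \<le> x powr \<alpha> / \<delta> powr \<alpha>" using d(1) by simp
    qed (use B in auto)
    also have "\<dots> = (B + \<bar>b\<bar>) / \<delta> powr \<alpha> * x powr \<alpha> * \<bar>x - y\<bar>" by simp
    also have "\<dots> \<le> K * x powr \<alpha> * \<bar>x - y\<bar>" by (intro mult_right_mono) (auto simp: K_def)
    finally show ?thesis .
  qed
  show ?thesis
  proof (intro exI[of _ K] conjI ballI)
    show "0 \<le> K" using K0 by (simp add: K_def)
    fix x y assume xy: "x \<in> {0..X}" "y \<in> {0..X}"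
    consider "x = y" | "y < x" | "x < y" by linarith
    then show "\<bar>(h x - hderiv h 0 * x) - (h y - hderiv h 0 * y)\<bar> \<le> K * (max x y) powr \<alpha> * \<bar>x - y\<bar>"
    proof cases
      case 2
      then show ?thesis using half[of y x] xy by (simp add: b_def max_absorb1)
    next
      case 3
      then show ?thesis using half[of x y] xy by (simp add: b_def max_absorb2 abs_minus_commute)
    qed simp
  qed
qed

text \<open>Extension by 0 to negative \<open>s\<close>, where the values of \<open>K\<close> carry
  no meaning.\<close>

definition kernel_density :: "(real \<Rightarrow> real \<Rightarrow> real) \<Rightarrow> real \<times> real \<Rightarrow> real" where
  "kernel_density K p = indicator ({0..} \<times> UNIV) p *\<^sub>R (case p of (s, w) \<Rightarrow> K s w)"

text \<open>The law of \<open>c s + w\<close> when \<open>(s, w)\<close> has density \<open>K\<close>; its density is the function \<open>k2\<close>.\<close>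
definition kernel_law :: "(real \<Rightarrow> real \<Rightarrow> real) \<Rightarrow> real \<Rightarrow> real measure" where
  "kernel_law K c = distr (density (lborel \<Otimes>\<^sub>M lborel) (\<lambda>p. ennreal (kernel_density K p))) borel (\<lambda>(s, w). c * s + w)"

context
  fixes K :: "real \<Rightarrow> real \<Rightarrow> real"
  assumes K: "is_kernel K"
begin

lemma kernel_density_integrable: "integrable (lborel \<Otimes>\<^sub>M lborel) (kernel_density K)"
  using K unfolding is_kernel_def set_integrable_def lborel_prod kernel_density_def[abs_def] by simp

lemma kernel_density_measurable [measurable]: "kernel_density K \<in> borel_measurable (lborel \<Otimes>\<^sub>M lborel)"
  using kernel_density_integrable by simp

lemma kernel_density_nonneg: "0 \<le> kernel_density K p"
  using K unfolding is_kernel_def kernel_density_def by (auto simp: indicator_def split: prod.split)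

lemma kernel_density_eq: "kernel_density K (s, w) = indicator {0..} s * K s w"
  by (simp add: kernel_density_def indicator_def)

lemma kernel_density_integral: "integral\<^sup>L (lborel \<Otimes>\<^sub>M lborel) (kernel_density K) = 1"
proof -
  have "integral\<^sup>L (lborel \<Otimes>\<^sub>M lborel) (kernel_density K) = (\<integral>s. \<integral>w. kernel_density K (s, w) \<partial>lborel \<partial>lborel)"
    using lborel_pair.integral_fst'[OF kernel_density_integrable] by simp
  also have "\<dots> = (LINT s:{0..}|lborel. (LINT w|lborel. K s w))"
    unfolding set_lebesgue_integral_def
    by (intro Bochner_Integration.integral_cong) (auto simp: kernel_density_eq indicator_def)
  finally show ?thesis using K by (simp add: is_kernel_def)
qed

lemma sets_kernel_law [simp, measurable_cong]: "sets (kernel_law K c) = sets borel"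
  by (simp add: kernel_law_def)

lemma nn_integral_kernel_law:
  assumes [measurable]: "u \<in> borel_measurable borel"
  shows "(\<integral>\<^sup>+r. u r \<partial>kernel_law K c) = (\<integral>\<^sup>+s. \<integral>\<^sup>+w. ennreal (kernel_density K (s, w)) * u (c * s + w) \<partial>lborel \<partial>lborel)"
proof -
  have "(\<integral>\<^sup>+r. u r \<partial>kernel_law K c)
     = (\<integral>\<^sup>+p. ennreal (kernel_density K p) * u (case p of (s, w) \<Rightarrow> c * s + w) \<partial>(lborel \<Otimes>\<^sub>M lborel))"
    unfolding kernel_law_def by (simp add: nn_integral_distr nn_integral_density)
  also have "\<dots> = (\<integral>\<^sup>+s. \<integral>\<^sup>+w. ennreal (kernel_density K (s, w)) * u (c * s + w) \<partial>lborel \<partial>lborel)"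
    by (subst lborel.nn_integral_fst[symmetric]) auto
  finally show ?thesis .
qed

lemma prob_space_kernel_law: "prob_space (kernel_law K c)"
proof (rule prob_spaceI)
  have "emeasure (kernel_law K c) (space (kernel_law K c)) = (\<integral>\<^sup>+r. 1 \<partial>kernel_law K c)" by simp
  also have "\<dots> = (\<integral>\<^sup>+p. ennreal (kernel_density K p) \<partial>(lborel \<Otimes>\<^sub>M lborel))"
    by (subst nn_integral_kernel_law, simp, subst lborel.nn_integral_fst[symmetric]) auto
  also have "\<dots> = 1"
    using kernel_density_integrable kernel_density_nonneg kernel_density_integral by (subst nn_integral_eq_integral) auto
  finally show "emeasure (kernel_law K c) (space (kernel_law K c)) = 1" .
qed

lemma integral_kernel_law:
  assumes [measurable]: "u \<in> borel_measurable borel" and bd: "\<And>r. \<bar>u r\<bar> \<le> X"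
  shows "(\<integral>r. u r \<partial>kernel_law K c) = (LINT s:{0..}|lborel. (LINT w|lborel. K s w * u (c * s + w)))"
proof -
  have "(\<integral>r. u r \<partial>kernel_law K c) = (\<integral>p. kernel_density K p * u (case p of (s, w) \<Rightarrow> c * s + w) \<partial>(lborel \<Otimes>\<^sub>M lborel))"
    unfolding kernel_law_def using kernel_density_nonneg
    by (subst integral_distr, simp, simp, subst integral_density) auto
  also have "\<dots> = (\<integral>s. \<integral>w. kernel_density K (s, w) * u (c * s + w) \<partial>lborel \<partial>lborel)"
  proof (subst lborel_pair.integral_fst'[symmetric])
    show "integrable (lborel \<Otimes>\<^sub>M lborel) (\<lambda>p. kernel_density K p * u (case p of (s, w) \<Rightarrow> c * s + w))"
    proof (rule Bochner_Integration.integrable_bound[OF integrable_mult_right[OF kernel_density_integrable, of X]])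
      show "AE p in lborel \<Otimes>\<^sub>M lborel. norm (kernel_density K p * u (case p of (s, w) \<Rightarrow> c * s + w)) \<le> norm (X * kernel_density K p)"
      proof (rule AE_I2)
        fix p
        have "kernel_density K p * \<bar>u (case p of (s, w) \<Rightarrow> c * s + w)\<bar> \<le> kernel_density K p * X"
          by (rule mult_left_mono[OF bd kernel_density_nonneg])
        then show "norm (kernel_density K p * u (case p of (s, w) \<Rightarrow> c * s + w)) \<le> norm (X * kernel_density K p)"
          using kernel_density_nonneg[of p] order_trans[OF abs_ge_zero bd[of 0]] by (simp add: abs_mult mult.commute)
      qed
    qed simp
  qed simp
  also have "\<dots> = (LINT s:{0..}|lborel. (LINT w|lborel. K s w * u (c * s + w)))"
    unfolding set_lebesgue_integral_def
    by (intro Bochner_Integration.integral_cong) (auto simp: kernel_density_eq indicator_def)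
  finally show ?thesis .
qed

text \<open>The delay variable \<open>s\<close> is nonnegative under the kernel, so a larger speed
  pushes the law to the right and lowers its exponential moments.\<close>

lemma nn_integral_kernel_law_mono:
  assumes "c' \<le> c" "0 \<le> z"
  shows "(\<integral>\<^sup>+r. ennreal (exp (- z * r)) \<partial>kernel_law K c) \<le> (\<integral>\<^sup>+r. ennreal (exp (- z * r)) \<partial>kernel_law K c')"
proof -
  have le: "ennreal (kernel_density K (s, w)) * ennreal (exp (- z * (c * s + w))) \<le> ennreal (kernel_density K (s, w)) * ennreal (exp (- z * (c' * s + w)))" for s w :: real
  proof (cases "s \<ge> 0")
    case True
    then have "z * (c' * s + w) \<le> z * (c * s + w)" using assms by (intro mult_left_mono add_right_mono mult_right_mono) auto
    then show ?thesis by (intro mult_left_mono ennreal_leI) auto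
  qed (simp add: kernel_density_eq)
  have eq: "(\<integral>\<^sup>+r. ennreal (exp (- z * r)) \<partial>kernel_law K d)
      = (\<integral>\<^sup>+s. \<integral>\<^sup>+w. ennreal (kernel_density K (s, w)) * ennreal (exp (- z * (d * s + w))) \<partial>lborel \<partial>lborel)" for d
    by (rule nn_integral_kernel_law) simp
  show ?thesis unfolding eq by (intro nn_integral_mono le)
qed

text \<open>The Bochner integral in \<open>k2\<close> takes the value 0 where a slice of the density
  is not integrable. Such points form a null set, because the \<open>ennreal\<close> slices
  \<open>q\<close> have total integral 1; elsewhere \<open>k2\<close> and \<open>q\<close>
  agree.\<close>

lemma k2_nn_integral:
  assumes [measurable]: "u \<in> borel_measurable borel"
  shows "(\<integral>\<^sup>+r. ennreal (k2 K c r) * u r \<partial>lborel) = (\<integral>\<^sup>+r. u r \<partial>kernel_law K c)"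
    and "k2 K c \<in> borel_measurable borel" and "0 \<le> k2 K c r"
proof -
  define q where "q r = (\<integral>\<^sup>+s. ennreal (kernel_density K (s, r - c * s)) \<partial>lborel)" for r
  have [measurable]: "(\<lambda>(s, r). kernel_density K (s, r - c * s)) \<in> borel_measurable (lborel \<Otimes>\<^sub>M lborel)"
    by measurable
  have [measurable]: "(\<lambda>(r, s). kernel_density K (s, r - c * s)) \<in> borel_measurable (lborel \<Otimes>\<^sub>M lborel)"
    by measurable
  have [measurable]: "q \<in> borel_measurable borel"
    unfolding q_def[abs_def] by measurable
  have k2: "k2 K c r = enn2real (q r)" for r
  proof -
    have "k2 K c r = (\<integral>s. kernel_density K (s, r - c * s) \<partial>lborel)"
      unfolding k2_def set_lebesgue_integral_def
      by (intro Bochner_Integration.integral_cong) (auto simp: kernel_density_eq)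
    also have "\<dots> = enn2real (q r)"
      unfolding q_def using kernel_density_nonneg by (intro integral_eq_nn_integral) auto
    finally show ?thesis .
  qed
  show "k2 K c \<in> borel_measurable borel" unfolding k2[abs_def] by measurable
  show "0 \<le> k2 K c r" unfolding k2 by simp
  have swap: "(\<integral>\<^sup>+r. q r * u r \<partial>lborel) = (\<integral>\<^sup>+r. u r \<partial>kernel_law K c)" if [measurable]: "u \<in> borel_measurable borel" for u
  proof -
    have "(\<integral>\<^sup>+r. q r * u r \<partial>lborel) = (\<integral>\<^sup>+r. \<integral>\<^sup>+s. ennreal (kernel_density K (s, r - c * s)) * u r \<partial>lborel \<partial>lborel)"
      unfolding q_def by (intro nn_integral_cong nn_integral_multc[symmetric]) measurable
    also have "\<dots> = (\<integral>\<^sup>+s. \<integral>\<^sup>+r. ennreal (kernel_density K (s, r - c * s)) * u r \<partial>lborel \<partial>lborel)"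
      by (rule lborel_pair.Fubini') measurable
    also have "\<dots> = (\<integral>\<^sup>+s. \<integral>\<^sup>+w. ennreal (kernel_density K (s, w)) * u (c * s + w) \<partial>lborel \<partial>lborel)"
    proof (rule nn_integral_cong)
      fix s :: real
      have [measurable]: "(\<lambda>w. kernel_density K (s, w)) \<in> borel_measurable borel"
        using measurable_Pair2[OF kernel_density_measurable, of s] by simp
      show "(\<integral>\<^sup>+r. ennreal (kernel_density K (s, r - c * s)) * u r \<partial>lborel) = (\<integral>\<^sup>+w. ennreal (kernel_density K (s, w)) * u (c * s + w) \<partial>lborel)"
        by (subst nn_integral_real_affine[where c = 1 and t = "c * s"]) auto
    qed
    also have "\<dots> = (\<integral>\<^sup>+r. u r \<partial>kernel_law K c)" by (rule nn_integral_kernel_law[symmetric]) simp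
    finally show ?thesis .
  qed
  interpret L: prob_space "kernel_law K c" by (rule prob_space_kernel_law)
  have "(\<integral>\<^sup>+r. q r \<partial>lborel) = 1" using swap[of "\<lambda>_. 1"] L.emeasure_space_1 by simp
  then have "AE r in lborel. q r \<noteq> \<infinity>" by (intro nn_integral_PInf_AE) auto
  then have "AE r in lborel. ennreal (k2 K c r) * u r = q r * u r"
    by eventually_elim (simp add: k2 less_top)
  then show "(\<integral>\<^sup>+r. ennreal (k2 K c r) * u r \<partial>lborel) = (\<integral>\<^sup>+r. u r \<partial>kernel_law K c)"
    using swap[OF assms] by (simp cong: nn_integral_cong_AE)
qed

text \<open>The transform converges at a real \<open>z\<close> strictly beyond \<open>m\<close>.
  Both summands of \<open>u\<close> are nonnegative, so the convolution has a finite transform; by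
  Tonelli this is the product of the transform of \<open>k1\<close> and the exponential moment, and
  the first factor is not 0.\<close>

lemma gammaK_exp_moment:
  assumes be: "hderiv f 0 < \<beta>" "0 \<le> hderiv f 0" "0 < hderiv g 0" and m: "0 < m" "ereal m < gammaK f g K \<beta> c"
  obtains z where "m < z" "(\<integral>\<^sup>+r. ennreal (exp (- z * r)) \<partial>kernel_law K c) < \<infinity>"
proof -
  \<comment> \<open>A supremum above \<open>m\<close> is witnessed by a genuine value with the
    defining property, which also rules out the default for an empty set.\<close>
  obtain \<gamma> where g: "is_gammaK f g K \<beta> c \<gamma>" "ereal m < \<gamma>"
    using m(2) unfolding gammaK_def by (auto simp: less_Sup_iff)
  obtain z where z: "m < z" "ereal z < \<gamma>" using ereal_dense2[OF g(2)] by auto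
  define u where "u s = hderiv g 0 * conv (k1 \<beta> c) (k2 K c) s + (\<beta> - hderiv f 0) * k1 \<beta> c s" for s
  have b0: "\<beta> > 0" using be by simp
  have "c\<^sup>2 + 4 * \<beta> > 0" using b0 by (intro add_nonneg_pos) auto
  then have sg: "sigma \<beta> c > 0" by (simp add: sigma_def)
  have k1p: "k1 \<beta> c s > 0" for s using sg by (simp add: k1_def)
  have k1m[measurable]: "k1 \<beta> c \<in> borel_measurable borel" unfolding k1_def[abs_def] by measurable
  have k1b: "k1 \<beta> c s \<le> 1 / sigma \<beta> c" for s
  proof -
    have "(if s \<ge> 0 then exp (nu \<beta> c * s) else exp (mu \<beta> c * s)) \<le> 1"
      using nu_mu_roots(1,2)[OF b0, of c] by (auto simp: mult_nonpos_nonneg mult_nonneg_nonpos)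
    then show ?thesis unfolding k1_def using sg by (intro divide_right_mono) auto
  qed
  note k2m[measurable] = k2_nn_integral(2)[of "\<lambda>_. 0", simplified] and k2n = k2_nn_integral(3)[of "\<lambda>_. 0", simplified]
  have "laplace_converges u (complex_of_real z)"
    using g(1) z m(1) unfolding is_gammaK_def Let_def u_def[abs_def] by auto
  then have "integrable lborel (\<lambda>s. complex_of_real (u s * exp (- (s * z))))"
    unfolding laplace_converges_def by (simp add: exp_of_real[symmetric])
  then have iu: "integrable lborel (\<lambda>s. u s * exp (- (s * z)))"
    using integrable_Re by fastforce
  interpret L: prob_space "kernel_law K c" by (rule prob_space_kernel_law)
  \<comment> \<open>\<open>conv\<close> is a Bochner integral; since \<open>k1\<close> is bounded
    and the law has mass 1, it is finite and agrees with the \<open>ennreal\<close>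
    integral.\<close>
  have conv_eq: "ennreal (conv (k1 \<beta> c) (k2 K c) x) = (\<integral>\<^sup>+r. ennreal (k2 K c r) * ennreal (k1 \<beta> c (x - r)) \<partial>lborel)" for x
  proof -
    have "(\<integral>\<^sup>+r. ennreal (k2 K c r) * ennreal (k1 \<beta> c (x - r)) \<partial>lborel) \<le> (\<integral>\<^sup>+r. ennreal (k2 K c r) * ennreal (1 / sigma \<beta> c) \<partial>lborel)"
      by (intro nn_integral_mono mult_left_mono ennreal_leI k1b) auto
    also have "\<dots> = (\<integral>\<^sup>+r. ennreal (1 / sigma \<beta> c) \<partial>kernel_law K c)" by (rule k2_nn_integral(1)) simp
    also have "\<dots> < \<infinity>" using L.emeasure_space_1 by (simp add: ennreal_mult_less_top)
    finally have fin: "(\<integral>\<^sup>+r. ennreal (k2 K c r) * ennreal (k1 \<beta> c (x - r)) \<partial>lborel) < \<infinity>" .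
    have "conv (k1 \<beta> c) (k2 K c) x = enn2real (\<integral>\<^sup>+r. ennreal (k1 \<beta> c (x - r) * k2 K c r) \<partial>lborel)"
      unfolding conv_def using k1p k2n by (intro integral_eq_nn_integral AE_I2 mult_nonneg_nonneg less_imp_le[OF k1p] k2n) simp
    also have "(\<integral>\<^sup>+r. ennreal (k1 \<beta> c (x - r) * k2 K c r) \<partial>lborel) = (\<integral>\<^sup>+r. ennreal (k2 K c r) * ennreal (k1 \<beta> c (x - r)) \<partial>lborel)"
      using k1p k2n by (intro nn_integral_cong) (simp add: ennreal_mult less_imp_le mult.commute)
    finally show ?thesis using fin by simp
  qed
  have conv0: "0 \<le> conv (k1 \<beta> c) (k2 K c) x" for x
    unfolding conv_def by (intro integral_nonneg_AE AE_I2 mult_nonneg_nonneg less_imp_le[OF k1p] k2n)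
  define A where "A = (\<integral>\<^sup>+r. ennreal (exp (- z * r)) \<partial>kernel_law K c)"
  have A: "A = (\<integral>\<^sup>+r. ennreal (k2 K c r) * ennreal (exp (- z * r)) \<partial>lborel)"
    unfolding A_def by (rule k2_nn_integral(1)[symmetric]) simp
  have "(\<integral>\<^sup>+s. ennreal (k1 \<beta> c s) * ennreal (exp (- z * s)) \<partial>lborel) * A
      = (\<integral>\<^sup>+s. ennreal (k1 \<beta> c s) * ennreal (exp (- z * s)) * A \<partial>lborel)"
    by (rule nn_integral_multc[symmetric]) simp
  also have "\<dots> = (\<integral>\<^sup>+s. ennreal (k1 \<beta> c s) * (\<integral>\<^sup>+r. ennreal (k2 K c r) * ennreal (exp (- z * (s + r))) \<partial>lborel) \<partial>lborel)"
  proof (rule nn_integral_cong)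
    fix s
    have "(\<integral>\<^sup>+r. ennreal (k2 K c r) * ennreal (exp (- z * (s + r))) \<partial>lborel)
        = (\<integral>\<^sup>+r. ennreal (exp (- z * s)) * (ennreal (k2 K c r) * ennreal (exp (- z * r))) \<partial>lborel)"
      by (intro nn_integral_cong) (simp add: algebra_simps exp_add ennreal_mult exp_diff divide_inverse exp_minus[symmetric])
    also have "\<dots> = ennreal (exp (- z * s)) * A" unfolding A by (rule nn_integral_cmult) simp
    finally show "ennreal (k1 \<beta> c s) * ennreal (exp (- z * s)) * A = ennreal (k1 \<beta> c s) * (\<integral>\<^sup>+r. ennreal (k2 K c r) * ennreal (exp (- z * (s + r))) \<partial>lborel)"
      by (simp add: mult.assoc)
  qed
  also have "\<dots> = (\<integral>\<^sup>+t. ennreal (exp (- z * t)) * (\<integral>\<^sup>+r. ennreal (k2 K c r) * ennreal (k1 \<beta> c (t - r)) \<partial>lborel) \<partial>lborel)"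
    by (rule nn_integral_convolution_swap[symmetric]) (auto intro: sigma_finite_lborel)
  also have "\<dots> \<le> (\<integral>\<^sup>+t. ennreal (1 / hderiv g 0 * (u t * exp (- (t * z)))) \<partial>lborel)"
  proof (rule nn_integral_mono)
    fix t
    have "hderiv g 0 * conv (k1 \<beta> c) (k2 K c) t \<le> u t" unfolding u_def using be k1p[of t] by simp
    then have "conv (k1 \<beta> c) (k2 K c) t \<le> 1 / hderiv g 0 * u t" using be(3) by (simp add: field_simps)
    then have "exp (- z * t) * conv (k1 \<beta> c) (k2 K c) t \<le> exp (- z * t) * (1 / hderiv g 0 * u t)"
      by (rule mult_left_mono) simp
    then show "ennreal (exp (- z * t)) * (\<integral>\<^sup>+r. ennreal (k2 K c r) * ennreal (k1 \<beta> c (t - r)) \<partial>lborel) \<le> ennreal (1 / hderiv g 0 * (u t * exp (- (t * z))))"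
      unfolding conv_eq[symmetric] using conv0[of t] by (simp flip: ennreal_mult add: mult_ac ennreal_leI)
  qed
  also have "\<dots> < \<infinity>"
    using integrable_mult_right[OF iu, of "1 / hderiv g 0"] by (simp add: real_integrable_def less_top)
  finally have fin: "(\<integral>\<^sup>+s. ennreal (k1 \<beta> c s) * ennreal (exp (- z * s)) \<partial>lborel) * A < \<infinity>" .
  have "(\<integral>\<^sup>+s. ennreal (k1 \<beta> c s) * ennreal (exp (- z * s)) \<partial>lborel) \<noteq> 0"
  proof
    assume "(\<integral>\<^sup>+s. ennreal (k1 \<beta> c s) * ennreal (exp (- z * s)) \<partial>lborel) = 0"
    then have "AE s in lborel. ennreal (k1 \<beta> c s) * ennreal (exp (- z * s)) = 0"
      by (subst (asm) nn_integral_0_iff_AE) auto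
    moreover have "(ennreal (k1 \<beta> c s) * ennreal (exp (- z * s)) = 0) = False" for s
      using k1p[of s] by (simp add: ennreal_eq_0_iff not_le)
    ultimately show False by (simp add: ae_filter_eq_bot_iff)
  qed
  then have "A < \<infinity>" using fin by (auto simp: ennreal_mult_less_top)
  then show ?thesis using that[OF z(1)] by (simp add: A_def)
qed

end

section \<open>From the hypotheses on the kernel and the nonlinearities to uniqueness at every
  admissible speed\<close>

lemma uniqueness_at_speed:
  fixes f g :: "real \<Rightarrow> real" and K :: "real \<Rightarrow> real \<Rightarrow> real" and L \<beta> c' c m :: real
  assumes H1: "H1 g" and H2: "H2 f g" and H3: "H3 f g" and K: "is_kernel K"
    and L: "0 < L" "\<forall>s1\<ge>0. \<forall>s2\<ge>0. \<bar>g s1 - g s2\<bar> \<le> L * \<bar>s1 - s2\<bar>"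
    and be: "hderiv f 0 < \<beta>" and m: "0 < m" "ereal m < gammaK f g K \<beta> c'" and chi: "chi f K L m c' \<le> 0"
    and c: "c' \<le> c" and w: "semi_wavefront f g K c \<phi>1" "semi_wavefront f g K c \<phi>2"
  shows "\<exists>h. \<forall>t. \<phi>1 t = \<phi>2 (t + h)"
proof -
  obtain \<alpha> where al: "0 < \<alpha>" "C1_Hoelder_near_0 \<alpha> f" "C1_Hoelder_near_0 \<alpha> g"
    using H3 unfolding H3_def by blast
  define a0 b0 ia where "a0 = hderiv f 0" and "b0 = hderiv g 0" and "ia = (INF s\<in>{0..}. hderiv f s)"
  have fd: "f differentiable (at s within {0..})" if "0 \<le> s" for s using H2 that by (simp add: H2_def)
  have gd: "g differentiable (at 0 within {0..})" using H1 by (simp add: H1_def)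
  have fm: "f x \<le> f y" if "0 \<le> x" "x \<le> y" for x y
    using H2 that unfolding H2_def strict_mono_on_def by (cases "x = y") (auto intro: less_imp_le)
  \<comment> \<open>Nonnegative slopes bound the set in the infimum of \<open>chi\<close> from
    below, so that \<open>INF\<close> is a true lower bound and not an unspecified value.\<close>
  have f'0: "0 \<le> hderiv f s" if s: "0 \<le> s" for s
  proof (rule tendsto_lowerbound[OF hderiv_at_right[OF fd[OF s] s]])
    show "\<forall>\<^sub>F y in at_right s. 0 \<le> (f y - f s) / (y - s)"
      using eventually_at_right_less[of s] by eventually_elim (use fm[OF s] in auto)
  qed simp
  have ia_le: "ia \<le> hderiv f s" if "0 \<le> s" for s
    unfolding ia_def by (rule cINF_lower) (use f'0 that in \<open>auto intro!: bdd_belowI[of _ 0]\<close>)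
  have g0: "g 0 = 0" and gn: "\<And>s. 0 \<le> s \<Longrightarrow> 0 \<le> g s" using H1 by (auto simp: H1_def)
  have f0: "f 0 = 0" and fn: "\<And>s. 0 \<le> s \<Longrightarrow> 0 \<le> f s" using H2 by (auto simp: H2_def)
  have b0L: "b0 \<le> L"
    unfolding b0_def
  proof (rule tendsto_upperbound[OF hderiv_at_right[OF gd]])
    show "\<forall>\<^sub>F y in at_right 0. (g y - g 0) / (y - 0) \<le> L"
      using eventually_at_right_less[of 0]
    proof eventually_elim
      case (elim y)
      then have "g y \<le> L * y" using L(2)[rule_format, of y 0] g0 by auto
      then show ?case using elim g0 by (simp add: field_simps)
    qed
  qed auto
  have co: "0 \<le> a0" "a0 < b0" "0 < b0" "ia \<le> a0"
    using f'0[of 0] H2 H1 ia_le[of 0] by (auto simp: a0_def b0_def H1_def H2_def)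
  have f_cont: "continuous_on {0..} f"
    using fd by (auto simp: continuous_on_eq_continuous_within intro: differentiable_imp_continuous_within)
  have f_lower: "ia * (x - y) \<le> f x - f y" if xy: "0 \<le> y" "y \<le> x" for x y
  proof (cases "x = y")
    case False
    then have "y < x" using xy by simp
    then obtain z where z: "y < z" "z < x" "f x - f y = hderiv f z * (x - y)"
      by (rule hderiv_mvt[OF xy(1), of x f]) (use fd xy in auto)
    then show ?thesis using ia_le[of z] xy by (auto intro: mult_right_mono)
  qed simp
  have f_near: "\<exists>C\<ge>0. \<forall>x\<in>{0..X}. \<forall>y\<in>{0..X}. \<bar>(f x - a0 * x) - (f y - a0 * y)\<bar> \<le> C * (max x y) powr \<alpha> * \<bar>x - y\<bar>" for X
  proof -
    have "compact (hderiv f ` {0..X})"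
      by (rule compact_continuous_image) (use H2 in \<open>auto simp: H2_def intro: continuous_on_subset\<close>)
    then have "bounded (hderiv f ` {0..X})" by (rule compact_imp_bounded)
    then obtain B where "\<forall>x\<in>hderiv f ` {0..X}. norm x \<le> B" unfolding bounded_iff by (rule exE)
    then have B: "\<bar>hderiv f s\<bar> \<le> B" if "s \<in> {0..X}" for s using that by simp
    have lt: "\<bar>f x - f y\<bar> \<le> \<bar>B\<bar> * \<bar>x - y\<bar>" if xy: "0 \<le> y" "y < x" "x \<le> X" for x y
    proof -
      obtain z where z: "y < z" "z < x" "f x - f y = hderiv f z * (x - y)"
        by (rule hderiv_mvt[OF xy(1,2), of f]) (use fd xy in auto)
      have "\<bar>hderiv f z\<bar> \<le> \<bar>B\<bar>" using B[of z] z xy by auto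
      then show ?thesis unfolding z(3) abs_mult by (rule mult_right_mono) simp
    qed
    have "\<bar>f x - f y\<bar> \<le> \<bar>B\<bar> * \<bar>x - y\<bar>" if "x \<in> {0..X}" "y \<in> {0..X}" for x y
      using lt[of y x] lt[of x y] that by (cases x y rule: linorder_cases) (auto simp: abs_minus_commute)
    then show ?thesis unfolding a0_def by (intro hoelder_remainder_bound[OF al(2,1), of "\<bar>B\<bar>"]) auto
  qed
  have g_near: "\<exists>C\<ge>0. \<forall>x\<in>{0..X}. \<forall>y\<in>{0..X}. \<bar>(g x - b0 * x) - (g y - b0 * y)\<bar> \<le> C * (max x y) powr \<alpha> * \<bar>x - y\<bar>" for X
    unfolding b0_def by (rule hoelder_remainder_bound[OF al(3,1), of L]) (use L in auto)
  \<comment> \<open>This exponent, strictly above \<open>m\<close>, plays the part of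
    \<open>m2\<close> for the laws at all speeds from \<open>c'\<close> on.\<close>
  obtain z where z: "m < z" "(\<integral>\<^sup>+r. ennreal (exp (- z * r)) \<partial>kernel_law K c') < \<infinity>"
    by (rule gammaK_exp_moment[OF K be _ _ m]) (use co in \<open>auto simp: a0_def b0_def\<close>)
  have moment: "exp_moment_measure (kernel_law K d) z" if d: "c' \<le> d" for d
  proof -
    interpret prob_space "kernel_law K d" by (rule prob_space_kernel_law[OF K])
    have "(\<integral>\<^sup>+r. ennreal (exp (- z * r)) \<partial>kernel_law K d) < \<infinity>"
      using nn_integral_kernel_law_mono[OF K d, of z] z m(1) by (auto intro: le_less_trans)
    then show ?thesis
      by unfold_locales (use z m(1) in \<open>auto intro!: integrableI_nonneg simp: sets_kernel_law[OF K] measurable_cong_sets[OF sets_kernel_law[OF K] refl]\<close>)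
  qed
  interpret M': exp_moment_measure "kernel_law K c'" z by (rule moment) simp
  interpret M: exp_moment_measure "kernel_law K c" z by (rule moment[OF c])
  have kap_nn: "(\<integral>\<^sup>+r. ennreal (exp (- m * r)) \<partial>kernel_law K c') = ennreal (M'.kap m)"
    "(\<integral>\<^sup>+r. ennreal (exp (- m * r)) \<partial>kernel_law K c) = ennreal (M.kap m)"
    unfolding M'.kap_def M.kap_def using M'.integrable_exp[of m] M.integrable_exp[of m] m(1) z(1)
    by (auto intro!: nn_integral_eq_integral)
  have kap_le: "M.kap m \<le> M'.kap m"
    using nn_integral_kernel_law_mono[OF K c, of m] m(1) z(1) M'.kap_pos[of m] unfolding kap_nn by (simp add: ennreal_le_iff)
  have "(\<integral>\<^sup>+s\<in>{0..}. (\<integral>\<^sup>+w. ennreal (K s w * exp (- m * (c' * s + w))) \<partial>lborel) \<partial>lborel) = (\<integral>\<^sup>+r. ennreal (exp (- m * r)) \<partial>kernel_law K c')"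
  proof -
    have "(\<integral>\<^sup>+s\<in>{0..}. (\<integral>\<^sup>+w. ennreal (K s w * exp (- m * (c' * s + w))) \<partial>lborel) \<partial>lborel)
      = (\<integral>\<^sup>+s. \<integral>\<^sup>+w. ennreal (kernel_density K (s, w)) * ennreal (exp (- m * (c' * s + w))) \<partial>lborel \<partial>lborel)"
    proof (rule nn_integral_cong)
      fix s :: real
      have "ennreal (K s w * exp (- m * (c' * s + w))) = ennreal (kernel_density K (s, w)) * ennreal (exp (- m * (c' * s + w)))" if "0 \<le> s" for w
        using that K by (simp add: kernel_density_eq[OF K] is_kernel_def ennreal_mult)
      then show "(\<integral>\<^sup>+w. ennreal (K s w * exp (- m * (c' * s + w))) \<partial>lborel) * indicator {0..} s = (\<integral>\<^sup>+w. ennreal (kernel_density K (s, w)) * ennreal (exp (- m * (c' * s + w))) \<partial>lborel)"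
        by (cases "0 \<le> s") (auto simp: kernel_density_eq[OF K])
    qed
    then show ?thesis by (simp add: nn_integral_kernel_law[OF K, of "\<lambda>r. ennreal (exp (- m * r))", simplified])
  qed
  \<comment> \<open>The moment at \<open>m\<close> is finite, so the extended value
    \<open>chi\<close> reduces to an ordinary number.\<close>
  then have "ereal (m\<^sup>2 - c' * m - ia) + ereal L * enn2ereal (ennreal (M'.kap m)) \<le> 0"
    using chi unfolding chi_def kap_nn ia_def by simp
  then have chi': "m\<^sup>2 - c' * m - ia + L * M'.kap m \<le> 0"
    using M'.kap_pos[of m] m(1) z(1) by (simp add: enn2ereal_ennreal zero_ereal_def)
  \<comment> \<open>Both terms that depend on the speed, \<open>- c * m\<close> and
    \<open>L * kap m\<close>, are nonincreasing in it.\<close>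
  have chi_c: "M.chf c ia L m \<le> 0"
  proof -
    have "L * M.kap m \<le> L * M'.kap m" using kap_le L(1) by (intro mult_left_mono) auto
    moreover have "c' * m \<le> c * m" using c m(1) by (intro mult_right_mono) auto
    ultimately show ?thesis using chi' unfolding M.chf_def by linarith
  qed
  interpret W: wave_eq "kernel_law K c" z f g c a0 b0 ia L \<alpha>
    by unfold_locales (use f0 g0 fn gn f_cont f_lower L(2) al(1) f_near g_near co b0L in auto)
  have sol: "W.sol \<phi>" if w: "semi_wavefront f g K c \<phi>" for \<phi>
    unfolding W.sol_def
  proof (intro conjI allI)
    have E: "solves_E f g K c \<phi>" and pos: "\<And>t. \<phi> t > 0" using w by (auto simp: semi_wavefront_def)
    show d1: "(\<phi> has_real_derivative deriv \<phi> t) (at t)" for t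
      using E unfolding solves_E_def by (simp add: DERIV_deriv_iff_real_differentiable)
    show "(deriv \<phi> has_real_derivative deriv (deriv \<phi>) t) (at t)" for t
      using E unfolding solves_E_def by (simp add: DERIV_deriv_iff_real_differentiable)
    show "0 \<le> \<phi> t" for t using pos by (simp add: less_imp_le)
    show bd: "bounded (range \<phi>)" and "(\<phi> \<longlongrightarrow> 0) at_bot" using w by (auto simp: semi_wavefront_def)
    fix t
    obtain X where X: "\<And>s. \<bar>\<phi> s\<bar> \<le> X" using bd by (auto simp: bounded_iff)
    have "continuous_on UNIV (\<lambda>s. g (\<phi> s))"
      by (rule continuous_on_compose2[OF W.g_continuous])
         (use DERIV_isCont[OF d1] pos in \<open>auto intro!: continuous_at_imp_continuous_on simp: less_imp_le\<close>)
    then have gm: "(\<lambda>s. g (\<phi> s)) \<in> borel_measurable borel" by (rule borel_measurable_continuous_onI)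
    have gb: "\<bar>g (\<phi> s)\<bar> \<le> L * X" for s
    proof -
      have "\<bar>g (\<phi> s)\<bar> \<le> L * \<phi> s" using W.g_le[of "\<phi> s"] gn[of "\<phi> s"] pos[of s] by simp
      also have "\<dots> \<le> L * X" using X[of s] L(1) by (intro mult_left_mono) auto
      finally show ?thesis .
    qed
    \<comment> \<open>Boundedness of \<open>g\<close> along the wavefront lets the double integral
      of the original equation be rewritten as an integral against the law.\<close>
    have "(\<integral>r. g (\<phi> (t - r)) \<partial>kernel_law K c) = (LINT s:{0..}|lborel. (LINT w|lborel. K s w * g (\<phi> (t - (c * s + w)))))"
      by (rule integral_kernel_law[OF K, of "\<lambda>r. g (\<phi> (t - r))" "L * X"]) (use gm gb in auto)
    then show "deriv (deriv \<phi>) t = c * deriv \<phi> t + f (\<phi> t) - (\<integral>r. g (\<phi> (t - r)) \<partial>kernel_law K c)"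
      using E unfolding solves_E_def by (auto simp: algebra_simps diff_diff_eq dest!: spec[of _ t])
  qed
  have nz: "\<phi> \<noteq> (\<lambda>_. 0)" if "semi_wavefront f g K c \<phi>" for \<phi>
    using that unfolding semi_wavefront_def by (metis less_irrefl)
  show ?thesis
    by (rule W.unique_up_to_translation[OF m(1) z(1) chi_c sol[OF w(1)] sol[OF w(2)] nz[OF w(1)] nz[OF w(2)]])
qed

theorem theorem4p3:
  fixes f g :: "real \<Rightarrow> real" and K :: "real \<Rightarrow> real \<Rightarrow> real"
    and L \<beta> c' m :: real and \<phi> :: "real \<Rightarrow> real"
  assumes "H1 g" and "H2 f g" and "H3 f g"
    and "is_kernel K"
    and "L > 0"
    and "\<forall>s1\<ge>0. \<forall>s2\<ge>0. \<bar>g s1 - g s2\<bar> \<le> L * \<bar>s1 - s2\<bar>"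
    and "\<beta> > hderiv f 0"
    and "semi_wavefront f g K c' \<phi>"
    and "0 < m" and "ereal m < gammaK f g K \<beta> c'"
    and "chi f K L m c' \<le> 0"
  shows "(\<forall>\<psi>. semi_wavefront f g K c' \<psi> \<longrightarrow> (\<exists>t0. \<forall>t. \<psi> t = \<phi> (t + t0))) \<and>
         (\<forall>c>c'. unique_mod_translation f g K c)"
  unfolding unique_mod_translation_def
  by (intro conjI allI impI; rule uniqueness_at_speed[OF assms(1-7,9-11)]) (use assms(8) in auto)

end
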